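(* Assume the standing assumptions (a)–(d) below. Let $\mu,\bar\mu$ be probability measures on $\mathbb{R}^d$ with finite second moment, $N\in\mathbb{N}$, and let $T\in(0,\infty)$, $\epsilon\in[0,\infty)$ satisfy $$LT^2\le \tfrac35\min\Big(\tfrac14,\ \tfrac{3}{1280\,L\tilde R^2}\Big),\qquad \epsilon\tilde L\le \frac{5}{64}\,\frac{K}{\sqrt{7/6+3/(2KT^2)}}\exp\Big(-\frac{5\tilde R}{2T}-5\Big).$$ Then for all $m\in\mathbb{N}$, $$\boldsymbol{\mathcal W}^1_{\rho_N}(\mu^{\otimes N}\pi^m,(\bar\mu\bar\pi^m)^{\otimes N})\le e^{-cm}\boldsymbol{\mathcal W}^1_\rho(\mu,\bar\mu)+c^{-1}\mathbf B(\bar\mu)N^{-1/2},$$ $$\boldsymbol{\mathcal W}^1_{\bar\ell_1^N}(\mu^{\otimes N}\pi^m,(\bar\mu\bar\pi^m)^{\otimes N})\le \mathbf Ae^{-cm}\boldsymbol{\mathcal W}^1(\mu,\bar\mu)+\mathbf Ac^{-1}\mathbf B(\bar\mu)N^{-1/2},$$ where $c=\frac{KT^2}{156}e^{-5\tilde R/(4T)}$ and $\mathbf A=\exp(\frac54(\tilde R/T+2))$. Moreover, if $\bar\mu_*$ is a probability measure with finite second moment of the form $\bar\mu_*(\mathrm{d}x)=Z^{-1}e^{-U_{\bar\mu_*}(x)}\mathrm{d}x$ with $Z<\infty$, then $$\boldsymbol{\mathcal W}^1_{\rho_N}(\bar\mu_*^{\otimes N},\mu^{\otimes N}\pi^m)\le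 e^{-cm}\boldsymbol{\mathcal W}^1_\rho(\bar\mu_*,\mu)+c^{-1}\mathbf B(\bar\mu_* )N^{-1/2},$$ $$\boldsymbol{\mathcal W}^1_{\bar\ell_1^N}(\bar\mu_*^{\otimes N},\mu^{\otimes N}\pi^m)\le \mathbf Ae^{-cm}\boldsymbol{\mathcal W}^1(\bar\mu_*,\mu)+\mathbf Ac^{-1}\mathbf B(\bar\mu_* )N^{-1/2}.$$
   Context: Standing assumptions: $V:\mathbb{R}^d\to\mathbb{R}$, $W:\mathbb{R}^d\times\mathbb{R}^d\to\mathbb{R}$ are $C^1$, $\nabla_1W$ the gradient in the first argument, constants $L>0,K>0,\mathcal R\ge0,\tilde L\ge0$ with: (a) $V(0)=0$, $V\ge0$; (b) $|\nabla V(x)-\nabla V(y)|\le L|x-y|$; (c) $\langle x-y,\nabla V(x)-\nabla V(y)\rangle\ge K|x-y|^2+L^{-1}|\nabla V(x)-\nabla V(y)|^2$ whenever $|x-y|\ge\mathcal R$; (d) $W$ symmetric, $|\nabla_1W(x,y)-\nabla_1W(\tilde x,\tilde y)|\le\tilde L(|x-\tilde x|+|y-\tilde y|)$. $\tilde R=\sqrt{(2L+K)/(6K)}\mathcal R$ (with $1/0=\infty$), $R_1=\frac54(\tilde R+2T)$, $f(r)=\int_0^re^{-\min(R_1,s)/T}\mathrm{d}s$, $\rho(x,y)=f(|x-y|)$ on $\mathbb{R}^d$, and on $\mathbb{R}^{Nd}$ (points $x=(x^1,\dots,x^N)$, $x^i\in\mathbb{R}^d$): $\rho_N(x,y)=\frac1N\sum_if(|x^i-y^i|)$,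 $\bar\ell_1^N(x,y)=\frac1N\sum_i|x^i-y^i|$. $\boldsymbol{\mathcal W}^1_{\mathsf d}$ is the $L^1$-Wasserstein distance w.r.t. metric $\mathsf d$, $\boldsymbol{\mathcal W}^1$ for the Euclidean metric. $U_\nu(x)=V(x)+\epsilon\int W(x,u)\nu(\mathrm{d}u)$. Nonlinear dynamics $(\bar q_t,\bar p_t)(x,v,\nu)$: $\dot{\bar q}_t=\bar p_t$, $\dot{\bar p}_t=-\nabla V(\bar q_t)-\epsilon\int\nabla_1W(\bar q_t,u)\nu_t(\mathrm{d}u)$, $(\bar q_0,\bar p_0)=(x,v)$, $\nu_t=\mathrm{Law}(\bar q_t(\tilde x,\tilde v,\nu))$, $(\tilde x,\tilde v)\sim\nu\otimes\mathcal N(0,I_d)$. nHMC kernel $\bar\pi_\nu(x,A)=\mathbb{P}[\bar q_T(x,\xi,\nu)\in A]$, $\xi\sim\mathcal N(0,I_d)$; $\nu\bar\pi:=\nu\bar\pi_\nu$, $\nu\bar\pi^{m+1}:=(\nu\bar\pi^m)\bar\pi$. Particle system: $U(x)=\sum_{i=1}^N\big(V(x^i)+\frac{\epsilon}{2N}\sum_jW(x^i,x^j)\big)$; exact flow $\dot q^i_t=p^i_t$, $\dot p^i_t=-\nabla_iU(q_t)$; xHMC kernel $\pi(x,A)=\mathbb{P}[q_T(x,\xi)\in A]$, $\xi\sim\mathcal N(0,I_{Nd})$. For a probability measure $\nu$ with finite second moment: $\mathbf B_1(\nu):=\sup_{k\ge0}\sup_{0\le t\le T}\int|y|^2(\nu\bar\pi^k)_t(\mathrm{d}y)$,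 where $(\nu\bar\pi^k)_t$ is the law at time $t$ of the nonlinear dynamics started from $(\nu\bar\pi^k)\otimes\mathcal N(0,I_d)$, and $\mathbf B(\nu):=4T^2\epsilon\tilde L\,\mathbf B_1(\nu)^{1/2}$. *)

theory Defs
  imports "HOL-Probability.Probability"
begin

definition grad :: "('a::real_inner \<Rightarrow> real) \<Rightarrow> 'a \<Rightarrow> 'a" where
  "grad f x = (THE g. (f has_derivative (\<lambda>h. g \<bullet> h)) (at x))"

definition grad1 :: "('a::real_inner \<Rightarrow> 'a \<Rightarrow> real) \<Rightarrow> 'a \<Rightarrow> 'a \<Rightarrow> 'a" where
  "grad1 W x y = grad (\<lambda>x'. W x' y) x"

definition std_gauss :: "'a::euclidean_space measure" where
  "std_gauss = density lborel
     (\<lambda>x. ennreal ((2 * pi) powr (- real DIM('a) / 2) * exp (- (norm x)\<^sup>2 / 2)))"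

definition fin_second_moment :: "'a::euclidean_space measure \<Rightarrow> bool" where
  "fin_second_moment \<mu> \<longleftrightarrow> prob_space \<mu> \<and> sets \<mu> = sets borel \<and>
     integrable \<mu> (\<lambda>x. (norm x)\<^sup>2)"

definition coupling :: "'b measure \<Rightarrow> 'c measure \<Rightarrow> ('b \<times> 'c) measure \<Rightarrow> bool" where
  "coupling M M' \<gamma> \<longleftrightarrow> prob_space \<gamma> \<and> sets \<gamma> = sets (M \<Otimes>\<^sub>M M') \<and>
     distr \<gamma> M fst = M \<and> distr \<gamma> M' snd = M'"

definition W1 :: "('b \<Rightarrow> 'b \<Rightarrow> real) \<Rightarrow> 'b measure \<Rightarrow> 'b measure \<Rightarrow> ennreal" where
  "W1 d M M' = (INF \<gamma> \<in> {\<gamma>. coupling M M' \<gamma>}. \<integral>\<^sup>+ z. ennreal (d (fst z) (snd z)) \<partial>\<gamma>)"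

definition prodN :: "nat \<Rightarrow> 'b measure \<Rightarrow> (nat \<Rightarrow> 'b) measure" where
  "prodN N \<mu> = (\<Pi>\<^sub>M i\<in>{..<N}. \<mu>)"

definition Rtilde :: "real \<Rightarrow> real \<Rightarrow> real \<Rightarrow> real" where
  "Rtilde L K R = sqrt ((2 * L + K) / (6 * K)) * R"

definition R1 :: "real \<Rightarrow> real \<Rightarrow> real \<Rightarrow> real \<Rightarrow> real" where
  "R1 L K R T = 5 / 4 * (Rtilde L K R + 2 * T)"

definition fdist :: "real \<Rightarrow> real \<Rightarrow> real \<Rightarrow> real \<Rightarrow> real \<Rightarrow> real" where
  "fdist L K R T r = integral {0..r} (\<lambda>s. exp (- min (R1 L K R T) s / T))"

definition rho :: "real \<Rightarrow> real \<Rightarrow> real \<Rightarrow> real \<Rightarrow> 'a::real_normed_vector \<Rightarrow> 'a \<Rightarrow> real" where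
  "rho L K R T x y = fdist L K R T (norm (x - y))"

definition rhoN :: "real \<Rightarrow> real \<Rightarrow> real \<Rightarrow> real \<Rightarrow> nat \<Rightarrow>
    (nat \<Rightarrow> 'a::real_normed_vector) \<Rightarrow> (nat \<Rightarrow> 'a) \<Rightarrow> real" where
  "rhoN L K R T N x y = (1 / real N) * (\<Sum>i<N. fdist L K R T (norm (x i - y i)))"

definition ell1N :: "nat \<Rightarrow> (nat \<Rightarrow> 'a::real_normed_vector) \<Rightarrow> (nat \<Rightarrow> 'a) \<Rightarrow> real" where
  "ell1N N x y = (1 / real N) * (\<Sum>i<N. norm (x i - y i))"

definition euclid :: "'a::real_normed_vector \<Rightarrow> 'a \<Rightarrow> real" where
  "euclid x y = norm (x - y)"

definition nl_sol :: "('a::euclidean_space \<Rightarrow> real) \<Rightarrow> ('a \<Rightarrow> 'a \<Rightarrow> real) \<Rightarrow> real \<Rightarrow> real \<Rightarrow>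
    'a measure \<Rightarrow> (real \<Rightarrow> 'a \<Rightarrow> 'a \<Rightarrow> 'a) \<Rightarrow> (real \<Rightarrow> 'a \<Rightarrow> 'a \<Rightarrow> 'a) \<Rightarrow>
    (real \<Rightarrow> 'a measure) \<Rightarrow> bool" where
  "nl_sol V W \<epsilon> T \<nu> Q P nut \<longleftrightarrow>
     (\<forall>x v. Q 0 x v = x \<and> P 0 x v = v \<and>
        (\<forall>t\<in>{0..T}.
           ((\<lambda>s. Q s x v) has_vector_derivative P t x v) (at t within {0..T}) \<and>
           ((\<lambda>s. P s x v) has_vector_derivative
              - (grad V (Q t x v) + \<epsilon> *\<^sub>R (\<integral>u. grad1 W (Q t x v) u \<partial>(nut t))))
             (at t within {0..T}))) \<and>
     (\<forall>t\<in>{0..T}. nut t = distr (\<nu> \<Otimes>\<^sub>M std_gauss) borel (\<lambda>(x, v). Q t x v))"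

definition qbarT :: "('a::euclidean_space \<Rightarrow> real) \<Rightarrow> ('a \<Rightarrow> 'a \<Rightarrow> real) \<Rightarrow> real \<Rightarrow> real \<Rightarrow>
    'a measure \<Rightarrow> 'a \<Rightarrow> 'a \<Rightarrow> 'a" where
  "qbarT V W \<epsilon> T \<nu> x v = (THE y. \<exists>Q P nut. nl_sol V W \<epsilon> T \<nu> Q P nut \<and> y = Q T x v)"

definition nl_law :: "('a::euclidean_space \<Rightarrow> real) \<Rightarrow> ('a \<Rightarrow> 'a \<Rightarrow> real) \<Rightarrow> real \<Rightarrow> real \<Rightarrow>
    'a measure \<Rightarrow> real \<Rightarrow> 'a measure" where
  "nl_law V W \<epsilon> T \<nu> t = (THE m. \<exists>Q P nut. nl_sol V W \<epsilon> T \<nu> Q P nut \<and> m = nut t)"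

definition nl_kernel :: "('a::euclidean_space \<Rightarrow> real) \<Rightarrow> ('a \<Rightarrow> 'a \<Rightarrow> real) \<Rightarrow> real \<Rightarrow> real \<Rightarrow>
    'a measure \<Rightarrow> 'a \<Rightarrow> 'a measure" where
  "nl_kernel V W \<epsilon> T \<nu> x = distr std_gauss borel (\<lambda>v. qbarT V W \<epsilon> T \<nu> x v)"

definition nl_step :: "('a::euclidean_space \<Rightarrow> real) \<Rightarrow> ('a \<Rightarrow> 'a \<Rightarrow> real) \<Rightarrow> real \<Rightarrow> real \<Rightarrow>
    'a measure \<Rightarrow> 'a measure" where
  "nl_step V W \<epsilon> T \<nu> = \<nu> \<bind> nl_kernel V W \<epsilon> T \<nu>"

definition B1 :: "('a::euclidean_space \<Rightarrow> real) \<Rightarrow> ('a \<Rightarrow> 'a \<Rightarrow> real) \<Rightarrow> real \<Rightarrow> real \<Rightarrow>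
    'a measure \<Rightarrow> ennreal" where
  "B1 V W \<epsilon> T \<nu> = (SUP k. SUP t\<in>{0..T}.
      \<integral>\<^sup>+ y. ennreal ((norm y)\<^sup>2) \<partial>(nl_law V W \<epsilon> T ((nl_step V W \<epsilon> T ^^ k) \<nu>) t))"

definition Bconst :: "('a::euclidean_space \<Rightarrow> real) \<Rightarrow> ('a \<Rightarrow> 'a \<Rightarrow> real) \<Rightarrow> real \<Rightarrow> real \<Rightarrow>
    real \<Rightarrow> 'a measure \<Rightarrow> ennreal" where
  "Bconst V W \<epsilon> T Lt \<nu> =
     (if B1 V W \<epsilon> T \<nu> = \<top> then \<top>
      else ennreal (4 * T\<^sup>2 * \<epsilon> * Lt * sqrt (enn2real (B1 V W \<epsilon> T \<nu>))))"

definition U_nu :: "('a::euclidean_space \<Rightarrow> real) \<Rightarrow> ('a \<Rightarrow> 'a \<Rightarrow> real) \<Rightarrow> real \<Rightarrow>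
    'a measure \<Rightarrow> 'a \<Rightarrow> real" where
  "U_nu V W \<epsilon> \<nu> x = V x + \<epsilon> * (\<integral>u. W x u \<partial>\<nu>)"

definition Upart :: "('a::euclidean_space \<Rightarrow> real) \<Rightarrow> ('a \<Rightarrow> 'a \<Rightarrow> real) \<Rightarrow> real \<Rightarrow> nat \<Rightarrow>
    (nat \<Rightarrow> 'a) \<Rightarrow> real" where
  "Upart V W \<epsilon> N x = (\<Sum>i<N. V (x i) + \<epsilon> / (2 * real N) * (\<Sum>j<N. W (x i) (x j)))"

definition gradU :: "('a::euclidean_space \<Rightarrow> real) \<Rightarrow> ('a \<Rightarrow> 'a \<Rightarrow> real) \<Rightarrow> real \<Rightarrow> nat \<Rightarrow>
    (nat \<Rightarrow> 'a) \<Rightarrow> nat \<Rightarrow> 'a" where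
  "gradU V W \<epsilon> N x i = grad (\<lambda>y. Upart V W \<epsilon> N (x(i := y))) (x i)"

definition part_sol :: "('a::euclidean_space \<Rightarrow> real) \<Rightarrow> ('a \<Rightarrow> 'a \<Rightarrow> real) \<Rightarrow> real \<Rightarrow> real \<Rightarrow> nat \<Rightarrow>
    (nat \<Rightarrow> 'a) \<Rightarrow> (nat \<Rightarrow> 'a) \<Rightarrow> (real \<Rightarrow> nat \<Rightarrow> 'a) \<Rightarrow> (real \<Rightarrow> nat \<Rightarrow> 'a) \<Rightarrow> bool" where
  "part_sol V W \<epsilon> T N x \<xi> q p \<longleftrightarrow>
     (\<forall>i<N. q 0 i = x i \<and> p 0 i = \<xi> i \<and>
        (\<forall>t\<in>{0..T}.
           ((\<lambda>s. q s i) has_vector_derivative p t i) (at t within {0..T}) \<and>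
           ((\<lambda>s. p s i) has_vector_derivative - gradU V W \<epsilon> N (q t) i) (at t within {0..T})))"

definition qT :: "('a::euclidean_space \<Rightarrow> real) \<Rightarrow> ('a \<Rightarrow> 'a \<Rightarrow> real) \<Rightarrow> real \<Rightarrow> real \<Rightarrow> nat \<Rightarrow>
    (nat \<Rightarrow> 'a) \<Rightarrow> (nat \<Rightarrow> 'a) \<Rightarrow> (nat \<Rightarrow> 'a)" where
  "qT V W \<epsilon> T N x \<xi> =
     (THE y. \<exists>q p. part_sol V W \<epsilon> T N x \<xi> q p \<and> y = restrict (q T) {..<N})"

definition part_kernel :: "('a::euclidean_space \<Rightarrow> real) \<Rightarrow> ('a \<Rightarrow> 'a \<Rightarrow> real) \<Rightarrow> real \<Rightarrow> real \<Rightarrow>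
    nat \<Rightarrow> (nat \<Rightarrow> 'a) \<Rightarrow> (nat \<Rightarrow> 'a) measure" where
  "part_kernel V W \<epsilon> T N x = distr (prodN N std_gauss) (prodN N borel) (\<lambda>\<xi>. qT V W \<epsilon> T N x \<xi>)"

definition part_step :: "('a::euclidean_space \<Rightarrow> real) \<Rightarrow> ('a \<Rightarrow> 'a \<Rightarrow> real) \<Rightarrow> real \<Rightarrow> real \<Rightarrow>
    nat \<Rightarrow> (nat \<Rightarrow> 'a) measure \<Rightarrow> (nat \<Rightarrow> 'a) measure" where
  "part_step V W \<epsilon> T N M = M \<bind> part_kernel V W \<epsilon> T N"

end

theory Submission
  imports Defs
begin

text \<open>
  One step contracts a concave distance under the following coupling of the velocities. Particles
  at distance at least \<open>Rtilde\<close> get the same velocity, and the convexity of \<open>V\<close> at infinity makes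
  their positions approach each other. For closer particles the second velocity is the first one
  minus \<open>\<gamma> (x - y)\<close>, with the maximal probability which the Gaussian law allows; otherwise it is
  reflected in the direction of \<open>x - y\<close>. In the first event the distance shrinks; the second one
  has a probability of order \<open>|x - y|\<close>, and there the concave distance, which saturates
  exponentially, gains essentially at most \<open>T exp (- |x - y| / T)\<close>.

  The particles are compared with independent copies of the nonlinear dynamics. Their forces differ
  by a Lipschitz term, which the contraction absorbs because \<open>\<epsilon>\<close> is small, and by the fluctuation
  of an empirical mean of independent variables, which is of order \<open>1 / sqrt N\<close>. Iterating the resulting
  one-step bound gives a geometric series with sum \<open>1 / c\<close>.

  The equilibrium is a fixed point of the nonlinear step: started from it, the dynamics is a
  Hamiltonian flow that preserves the phase space density. It is a limit of symplectic Euler steps,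
  compositions of shears, which preserve Lebesgue measure; Fatou's lemma on open sets and outer
  regularity transfer this to the limit.
\<close>

section \<open>Gradients\<close>

text \<open>The kernels are definite descriptions over all solutions of a self-consistent equation,
  and such a solution comes with no measurability or moment bound. Both are recovered from the
  equation: while the curve of laws is frozen, trajectories are Lipschitz in their initial data.
  Only then can two solutions be compared in a weighted norm.

  The interaction forces differ by a term linear in the distance of whole trajectories, whereas the
  concave distance dominates only \<open>exp (- cut / T)\<close> times the Euclidean one. Hence the
  one-particle estimate carries an extra term \<open>kap * amp\<close>, and
  \<open>\<epsilon>\<close> is exponentially small twice over: one factor matches the rate, the
  other pays for comparing the two distances.

  In \<open>cut\<close>, the part \<open>5/4 * Rt\<close> leaves room for the growth of a near pair
  within one step, and the part \<open>5/2 * T\<close> makes the slope beyond the cut at most a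
  twelfth of the slope at a near pair. Near pairs gain \<open>1/36 - 13/1000\<close> of
  \<open>rate\<close>, far pairs \<open>2/75 - 1/250\<close>; both exceed the \<open>1/156\<close>
  in \<open>c\<close>.\<close>

lemma grad_eqI:
  fixes f :: "'a::euclidean_space \<Rightarrow> real"
  assumes "(f has_derivative (\<lambda>h. g \<bullet> h)) (at x)"
  shows "grad f x = g"
  unfolding grad_def
proof (rule the_equality)
  fix g' assume "(f has_derivative (\<lambda>h. g' \<bullet> h)) (at x)"
  then have "(\<lambda>h. g' \<bullet> h) = (\<lambda>h. g \<bullet> h)" using assms has_derivative_unique by blast
  then show "g' = g" by (metis vector_eq_rdot)
qed (fact assms)

lemma grad_has_derivative:
  fixes f :: "'a::euclidean_space \<Rightarrow> real"
  assumes "f differentiable (at x)"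
  shows "(f has_derivative (\<lambda>h. grad f x \<bullet> h)) (at x)"
proof -
  obtain D where D: "(f has_derivative D) (at x)" using assms unfolding differentiable_def by blast
  have lin: "linear D" using D by (rule has_derivative_linear)
  define g where "g = (\<Sum>b\<in>Basis. D b *\<^sub>R b)"
  have "D = (\<lambda>h. g \<bullet> h)"
  proof
    fix h
    have "D h = D (\<Sum>b\<in>Basis. (h \<bullet> b) *\<^sub>R b)" by (simp add: euclidean_representation)
    also have "\<dots> = (\<Sum>b\<in>Basis. (h \<bullet> b) * D b)"
      using lin by (simp add: linear_sum linear_cmul)
    also have "\<dots> = g \<bullet> h"
      by (simp add: g_def inner_sum_left inner_sum_right mult.commute inner_commute)
    finally show "D h = g \<bullet> h" .
  qed
  then show ?thesis using D grad_eqI by metis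
qed

text \<open>Symmetry turns the derivative in the second argument into \<open>grad1\<close> with
  swapped arguments, so the gradient in the first argument determines the full derivative.\<close>

lemma grad1_joint_derivative:
  fixes W :: "'a::euclidean_space \<Rightarrow> 'a \<Rightarrow> real"
  assumes diff: "(\<lambda>z. W (fst z) (snd z)) differentiable (at (a, c))"
    and sym: "\<And>x y. W x y = W y x"
  shows "((\<lambda>z. W (fst z) (snd z)) has_derivative
           (\<lambda>h. grad1 W a c \<bullet> fst h + grad1 W c a \<bullet> snd h)) (at (a, c))"
proof -
  obtain D where D: "((\<lambda>z. W (fst z) (snd z)) has_derivative D) (at (a, c))"
    using diff unfolding differentiable_def by blast
  have lin: "linear D" using D by (rule has_derivative_linear)
  have "((\<lambda>x. (x, c)) has_derivative (\<lambda>h. (h, 0))) (at a)"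
    by (auto intro!: derivative_eq_intros)
  from has_derivative_compose[OF this, of "\<lambda>z. W (fst z) (snd z)" D] D
  have 1: "((\<lambda>x. W x c) has_derivative (\<lambda>h. D (h, 0))) (at a)" by simp
  have "((\<lambda>x. (a, x)) has_derivative (\<lambda>h. (0, h))) (at c)"
    by (auto intro!: derivative_eq_intros)
  from has_derivative_compose[OF this, of "\<lambda>z. W (fst z) (snd z)" D] D
  have 2: "((\<lambda>x. W x a) has_derivative (\<lambda>h. D (0, h))) (at c)"
    using sym by (simp add: sym[of a])
  have e1: "D (h, 0) = grad1 W a c \<bullet> h" for h
    using has_derivative_unique[OF 1 grad_has_derivative[of "\<lambda>x. W x c" a]] 1
    unfolding grad1_def differentiable_def by metis
  have e2: "D (0, h) = grad1 W c a \<bullet> h" for h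
    using has_derivative_unique[OF 2 grad_has_derivative[of "\<lambda>x. W x a" c]] 2
    unfolding grad1_def differentiable_def by metis
  have "D h = grad1 W a c \<bullet> fst h + grad1 W c a \<bullet> snd h" for h
    using linear_add[OF lin, of "(fst h, 0)" "(0, snd h)"] e1 e2 by simp
  then have "D = (\<lambda>h. grad1 W a c \<bullet> fst h + grad1 W c a \<bullet> snd h)" by auto
  then show ?thesis using D by simp
qed

lemma grad1_derivative:
  fixes W :: "'a::euclidean_space \<Rightarrow> 'a \<Rightarrow> real"
  assumes "(\<lambda>z. W (fst z) (snd z)) differentiable (at (a, c))"
    and "\<And>x y. W x y = W y x"
  shows "((\<lambda>x. W x c) has_derivative (\<lambda>h. grad1 W a c \<bullet> h)) (at a)"
proof -
  have "((\<lambda>x. (x, c)) has_derivative (\<lambda>h. (h, 0))) (at a)"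
    by (auto intro!: derivative_eq_intros)
  from has_derivative_compose[OF this grad1_joint_derivative[OF assms]] show ?thesis by simp
qed

text \<open>Particle \<open>i\<close> enters the double sum in either slot. By symmetry the two
  slots contribute equally, which cancels the factor 1/2; the diagonal term fits the same count,
  since both of its arguments move.\<close>

lemma gradU_eq:
  fixes W :: "'a::euclidean_space \<Rightarrow> 'a \<Rightarrow> real"
  assumes V: "\<And>x. V differentiable (at x)"
    and W: "\<And>z. (\<lambda>z. W (fst z) (snd z)) differentiable (at z)"
    and sym: "\<And>x y. W x y = W y x" and i: "i < N"
  shows "gradU V W \<epsilon> N x i = grad V (x i) + (\<epsilon> / real N) *\<^sub>R (\<Sum>j<N. grad1 W (x i) (x j))"
  unfolding gradU_def
proof (rule grad_eqI)
  let ?d = "\<lambda>k h. (if k = i then h else 0 :: 'a)"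
  have pr: "((\<lambda>y. (x(i := y)) k) has_derivative ?d k) (at (x i))" for k
    by (cases "k = i") auto
  have dV: "((\<lambda>y. V ((x(i := y)) k)) has_derivative (\<lambda>h. grad V (x k) \<bullet> ?d k h)) (at (x i))" for k
    using has_derivative_compose[OF pr[of k], of V "\<lambda>h. grad V (x k) \<bullet> h"] grad_has_derivative[OF V, of "x k"]
    by simp
  have dW: "((\<lambda>y. W ((x(i := y)) k) ((x(i := y)) j)) has_derivative
      (\<lambda>h. grad1 W (x k) (x j) \<bullet> ?d k h + grad1 W (x j) (x k) \<bullet> ?d j h)) (at (x i))" for k j
    using has_derivative_compose[OF has_derivative_Pair[OF pr[of k] pr[of j]],
        of "\<lambda>z. W (fst z) (snd z)" "\<lambda>h. grad1 W (x k) (x j) \<bullet> fst h + grad1 W (x j) (x k) \<bullet> snd h"]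
      grad1_joint_derivative[OF W sym, of "x k" "x j"]
    by simp
  have eq: "(\<Sum>k<N. grad V (x k) \<bullet> ?d k h
        + \<epsilon> / (2 * real N) * (\<Sum>j<N. grad1 W (x k) (x j) \<bullet> ?d k h + grad1 W (x j) (x k) \<bullet> ?d j h))
      = (grad V (x i) + (\<epsilon> / real N) *\<^sub>R (\<Sum>j<N. grad1 W (x i) (x j))) \<bullet> h" for h
  proof -
    have s1: "(\<Sum>k<N. grad V (x k) \<bullet> ?d k h) = grad V (x i) \<bullet> h"
      using i by (simp add: if_distrib sum.delta cong: if_cong)
    have s2: "(\<Sum>k<N. \<Sum>j<N. grad1 W (x k) (x j) \<bullet> ?d k h) = (\<Sum>j<N. grad1 W (x i) (x j) \<bullet> h)"
      by (subst sum.swap, rule sum.cong) (use i in \<open>simp_all add: if_distrib sum.delta cong: if_cong\<close>)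
    have s3: "(\<Sum>k<N. \<Sum>j<N. grad1 W (x j) (x k) \<bullet> ?d j h) = (\<Sum>j<N. grad1 W (x i) (x j) \<bullet> h)"
      by (rule sum.cong) (use i in \<open>simp_all add: if_distrib sum.delta cong: if_cong\<close>)
    show ?thesis
      by (simp only: sum.distrib sum_distrib_left[symmetric] s1 s2 s3 inner_add_left inner_scaleR_left inner_sum_left)
        (simp add: field_simps)
  qed
  show "((\<lambda>y. Upart V W \<epsilon> N (x(i := y))) has_derivative
      (\<lambda>h. (grad V (x i) + (\<epsilon> / real N) *\<^sub>R (\<Sum>j<N. grad1 W (x i) (x j))) \<bullet> h)) (at (x i))"
    unfolding Upart_def eq[symmetric]
    by (intro has_derivative_sum has_derivative_add dV has_derivative_mult_right dW)
qed

section \<open>Second-order ordinary differential equations\<close>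

text \<open>The velocity terms cancel in the derivative of
  \<open>z s + (t - s) *\<^sub>R p s\<close>. All later estimates start from this form, which
  involves the force and the initial velocity only.\<close>

lemma taylor_second_order:
  fixes z :: "real \<Rightarrow> 'a::euclidean_space"
  assumes z: "\<And>s. s \<in> {0..T} \<Longrightarrow> (z has_vector_derivative p s) (at s within {0..T})"
    and p: "\<And>s. s \<in> {0..T} \<Longrightarrow> (p has_vector_derivative a s) (at s within {0..T})"
    and t: "t \<in> {0..T}"
  shows "((\<lambda>s. (t - s) *\<^sub>R a s) has_integral (z t - z 0 - t *\<^sub>R p 0)) {0..t}"
proof -
  have "((\<lambda>s. (t - s) *\<^sub>R a s) has_integral
      ((z t + (t - t) *\<^sub>R p t) - (z 0 + (t - 0) *\<^sub>R p 0))) {0..t}"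
  proof (rule fundamental_theorem_of_calculus)
    fix s assume s: "s \<in> {0..t}"
    then have s': "s \<in> {0..T}" and sub: "{0..t} \<subseteq> {0..T}" using t by auto
    show "((\<lambda>s. z s + (t - s) *\<^sub>R p s) has_vector_derivative (t - s) *\<^sub>R a s) (at s within {0..t})"
      by (rule has_vector_derivative_eq_rhs)
        (auto intro!: derivative_eq_intros has_vector_derivative_within_subset[OF z[OF s'] sub]
          has_vector_derivative_within_subset[OF p[OF s'] sub])
  qed (use t in auto)
  then show ?thesis by (simp add: algebra_simps)
qed

lemma second_order_bound:
  fixes z :: "real \<Rightarrow> 'a::euclidean_space"
  assumes z: "\<And>s. s \<in> {0..T} \<Longrightarrow> (z has_vector_derivative p s) (at s within {0..T})"
    and p: "\<And>s. s \<in> {0..T} \<Longrightarrow> (p has_vector_derivative a s) (at s within {0..T})"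
    and t: "t \<in> {0..T}"
    and A: "\<And>s. s \<in> {0..T} \<Longrightarrow> norm (a s) \<le> A" and A0: "0 \<le> A"
  shows "norm (z t - z 0 - t *\<^sub>R p 0) \<le> A * T\<^sup>2"
proof -
  have h: "((\<lambda>s. (t - s) *\<^sub>R a s) has_integral (z t - z 0 - t *\<^sub>R p 0)) (cbox 0 t)"
    using taylor_second_order[OF z p t] by simp
  have "norm (z t - z 0 - t *\<^sub>R p 0) \<le> (T * A) * measure lborel (cbox 0 t)"
  proof (rule has_integral_bound[OF _ h])
    show "0 \<le> T * A" using t A0 by auto
    fix s assume "s \<in> cbox 0 t"
    then show "norm ((t - s) *\<^sub>R a s) \<le> T * A"
      using t A[of s] A0 by (auto intro!: mult_mono)
  qed
  also have "\<dots> \<le> (T * A) * T" using t A0 by (intro mult_left_mono) auto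
  finally show ?thesis by (simp add: power2_eq_square mult_ac)
qed

lemma continuous_on_trajectory:
  assumes "\<And>s. s \<in> {0..T} \<Longrightarrow> (z has_vector_derivative p s) (at s within {0..T::real})"
  shows "continuous_on {0..T} z"
  using assms has_vector_derivative_continuous continuous_on_eq_continuous_within by blast

text \<open>At a time where the norm is maximal, the force term is at most half of that maximum and
  is absorbed. The short horizon replaces the usual exponential.\<close>

lemma second_order_gronwall:
  fixes z :: "real \<Rightarrow> 'a::euclidean_space"
  assumes z: "\<And>s. s \<in> {0..T} \<Longrightarrow> (z has_vector_derivative p s) (at s within {0..T})"
    and p: "\<And>s. s \<in> {0..T} \<Longrightarrow> (p has_vector_derivative a s) (at s within {0..T})"
    and t: "t \<in> {0..T}"
    and A: "\<And>s. s \<in> {0..T} \<Longrightarrow> norm (a s) \<le> C * norm (z s)" and C0: "0 \<le> C" and CT: "C * T\<^sup>2 \<le> 1/2"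
  shows "norm (z t) \<le> 2 * (norm (z 0) + T * norm (p 0))"
proof -
  have T0: "0 \<le> T" using t by auto
  have "continuous_on {0..T} (\<lambda>s. norm (z s))"
    using continuous_on_trajectory[OF z] by (intro continuous_intros) auto
  then obtain s0 where s0: "s0 \<in> {0..T}" and mx: "\<And>s. s \<in> {0..T} \<Longrightarrow> norm (z s) \<le> norm (z s0)"
    using continuous_attains_sup[of "{0..T}" "\<lambda>s. norm (z s)"] T0 by auto
  have "norm (z s0 - z 0 - s0 *\<^sub>R p 0) \<le> (C * norm (z s0)) * T\<^sup>2"
  proof (rule second_order_bound[OF z p s0])
    fix s assume "s \<in> {0..T}"
    then show "norm (a s) \<le> C * norm (z s0)"
      using A[of s] mx[of s] C0 by (meson mult_left_mono order_trans)
  qed (use C0 in auto)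
  also have "\<dots> = (C * T\<^sup>2) * norm (z s0)" by simp
  also have "\<dots> \<le> 1/2 * norm (z s0)" by (intro mult_right_mono CT) auto
  finally have 1: "norm (z s0 - z 0 - s0 *\<^sub>R p 0) \<le> 1/2 * norm (z s0)" .
  have 2: "norm (z s0) \<le> norm (z s0 - z 0 - s0 *\<^sub>R p 0) + norm (z 0) + norm (s0 *\<^sub>R p 0)"
    by (smt (verit) norm_triangle_ineq diff_add_cancel)
  have "norm (z s0) \<le> 2 * (norm (z 0) + norm (s0 *\<^sub>R p 0))" using 1 2 by argo
  also have "\<dots> \<le> 2 * (norm (z 0) + T * norm (p 0))"
    using s0 by (intro mult_left_mono add_left_mono) (auto intro!: mult_right_mono)
  finally have "norm (z s0) \<le> 2 * (norm (z 0) + T * norm (p 0))" .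
  then show ?thesis using mx[OF t] by linarith
qed

text \<open>Meant for the law in a candidate solution, whose flow is not yet known to be measurable.
  Default values of \<open>emeasure\<close> can only lower the mass of \<open>distr\<close>.\<close>

lemma emeasure_distr_space_le: "emeasure (distr M N f) (space N) \<le> emeasure M (space M)"
  unfolding distr_def emeasure_measure_of_conv
  by (auto intro: emeasure_space)

section \<open>Mean-field dynamics\<close>

text \<open>Drift, interaction and initial law on phase space are left general because the notion
  serves three times: for the nonlinear dynamics, for the particle system with an empirical initial
  law, and with zero interaction for the flow at equilibrium.\<close>

definition mf_sol :: "('a::euclidean_space \<Rightarrow> 'a) \<Rightarrow> ('a \<Rightarrow> 'a \<Rightarrow> 'a) \<Rightarrow> real \<Rightarrow> ('a \<times> 'a) measure \<Rightarrow>
    (real \<Rightarrow> 'a \<Rightarrow> 'a \<Rightarrow> 'a) \<Rightarrow> (real \<Rightarrow> 'a \<Rightarrow> 'a \<Rightarrow> 'a) \<Rightarrow> (real \<Rightarrow> 'a measure) \<Rightarrow> bool" where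
  "mf_sol b g T P Q p m \<longleftrightarrow>
     (\<forall>x v. Q 0 x v = x \<and> p 0 x v = v \<and>
        (\<forall>t\<in>{0..T}.
           ((\<lambda>s. Q s x v) has_vector_derivative p t x v) (at t within {0..T}) \<and>
           ((\<lambda>s. p s x v) has_vector_derivative - (b (Q t x v) + (\<integral>u. g (Q t x v) u \<partial>(m t))))
             (at t within {0..T}))) \<and>
     (\<forall>t\<in>{0..T}. m t = distr P borel (\<lambda>(x, v). Q t x v))"

text \<open>In the smallness condition \<open>3 * l\<close> is one \<open>l\<close> for the moving
  particle and two for the averaged one, whose weight integrates to at most twice the weight of any
  given point.\<close>

locale mean_field =
  fixes b :: "'a::euclidean_space \<Rightarrow> 'a" and g :: "'a \<Rightarrow> 'a \<Rightarrow> 'a" and L l T :: real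
  assumes b_lip: "norm (b x - b y) \<le> L * norm (x - y)"
    and g_lip: "norm (g x u - g x' u') \<le> l * (norm (x - x') + norm (u - u'))"
    and L0: "0 \<le> L" and l0: "0 \<le> l" and T0: "0 < T" and small: "(L + 3 * l) * T\<^sup>2 \<le> 1/2"
begin

lemma b_cont: "continuous_on S b"
proof (rule lipschitz_on_continuous_on)
  show "L-lipschitz_on S b"
    using b_lip L0 by (auto simp: lipschitz_on_def dist_norm)
qed

lemma g_cont: "continuous_on S (\<lambda>z. g (fst z) (snd z))"
proof (rule lipschitz_on_continuous_on)
  have *: "norm (x - x') + norm (u - u') \<le> 2 * norm ((x, u) - (x', u'))" for x x' u u' :: 'a
    using norm_fst_le[of "x - x'" "u - u'"] norm_snd_le[of "u - u'" "x - x'"] by simp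
  show "(2 * l)-lipschitz_on S (\<lambda>z. g (fst z) (snd z))"
    unfolding lipschitz_on_def dist_norm
  proof (intro conjI ballI)
    fix y z :: "'a \<times> 'a"
    have "norm (g (fst y) (snd y) - g (fst z) (snd z)) \<le> l * (2 * norm (y - z))"
      using g_lip[of "fst y" "snd y" "fst z" "snd z"] *[of "fst y" "fst z" "snd y" "snd z"] l0
      by (smt (verit) mult_left_mono prod.collapse)
    then show "norm (g (fst y) (snd y) - g (fst z) (snd z)) \<le> 2 * l * norm (y - z)" by simp
  qed (use l0 in simp)
qed

lemma b_measurable[measurable]: "b \<in> borel_measurable borel"
  by (rule borel_measurable_continuous_onI[OF b_cont])

lemma g_measurable[measurable]: "(\<lambda>z. g (fst z) (snd z)) \<in> borel_measurable (borel \<Otimes>\<^sub>M borel)"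
  using borel_measurable_continuous_onI[OF g_cont] by (simp add: borel_prod)

lemma g_measurable'[measurable (raw)]:
  assumes "f \<in> borel_measurable M" "h \<in> borel_measurable M"
  shows "(\<lambda>x. g (f x) (h x)) \<in> borel_measurable M"
  using measurable_compose[OF measurable_Pair[OF assms] g_measurable] by simp

lemma g_bound: "norm (g x u) \<le> norm (g 0 0) + l * (norm x + norm u)"
  using g_lip[of x u 0 0] norm_triangle_sub[of "g x u" "g 0 0"] by simp

lemma b_bound: "norm (b x) \<le> norm (b 0) + L * norm x"
  using b_lip[of x 0] norm_triangle_sub[of "b x" "b 0"] by simp

text \<open>The difference of \<open>g q\<close> and \<open>g q'\<close> is bounded, so either both
  are integrable or neither is; in the second case both integrals have the default value 0. Thus the
  bound is available before a candidate law is known to have a first moment.\<close>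

lemma g_integral_lip:
  assumes m: "emeasure m (space m) \<le> 1" and s: "sets m = sets borel"
  shows "norm ((\<integral>u. g q u \<partial>m) - (\<integral>u. g q' u \<partial>m)) \<le> l * norm (q - q')"
proof -
  interpret finite_measure m
    by (rule finite_measureI) (use m in \<open>auto simp: top_unique\<close>)
  have meas[measurable]: "g q \<in> borel_measurable m" for q
    by (subst measurable_cong_sets[OF s refl]) measurable
  have bd: "norm (g q u - g q' u) \<le> l * norm (q - q')" for q q' u
    using g_lip[of q u q' u] by simp
  have int_d: "integrable m (\<lambda>u. g q u - g q' u)" for q q'
    by (rule integrable_const_bound[where B="l * norm (q - q')"]) (use bd in auto)
  show ?thesis
  proof (cases "integrable m (g q)")
    case True
    then have T': "integrable m (g q')"
      using Bochner_Integration.integrable_diff[OF True int_d[of q q']] by simp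
    have "norm ((\<integral>u. g q u \<partial>m) - (\<integral>u. g q' u \<partial>m)) = norm (\<integral>u. g q u - g q' u \<partial>m)"
      using True T' by simp
    also have "\<dots> \<le> (\<integral>u. norm (g q u - g q' u) \<partial>m)" by (rule integral_norm_bound)
    also have "\<dots> \<le> (\<integral>u. l * norm (q - q') \<partial>m)"
      by (rule integral_mono) (use int_d[of q q'] bd in auto)
    also have "\<dots> = l * norm (q - q') * measure m (space m)" by simp
    also have "\<dots> \<le> l * norm (q - q') * 1"
    proof (rule mult_left_mono)
      show "measure m (space m) \<le> 1" using m by (simp add: measure_def enn2real_leI)
    qed (use l0 in auto)
    finally show ?thesis by simp
  next
    case False
    have "\<not> integrable m (g q')"
    proof
      assume "integrable m (g q')"
      from Bochner_Integration.integrable_add[OF this int_d[of q q']] False show False by simp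
    qed
    then show ?thesis using False l0 by (simp add: not_integrable_integral_eq)
  qed
qed

text \<open>Both trajectories see the same curve \<open>m\<close> of laws, so the mean field is
  merely a time-dependent Lipschitz force. Applied to two initial data of one solution, this yields
  the continuity of its flow.\<close>

lemma trajectory_lipschitz:
  assumes z1: "\<And>s. s \<in> {0..T} \<Longrightarrow> (z1 has_vector_derivative p1 s) (at s within {0..T})"
    and p1: "\<And>s. s \<in> {0..T} \<Longrightarrow>
      (p1 has_vector_derivative - (b (z1 s) + (\<integral>u. g (z1 s) u \<partial>(m s)))) (at s within {0..T})"
    and z2: "\<And>s. s \<in> {0..T} \<Longrightarrow> (z2 has_vector_derivative p2 s) (at s within {0..T})"
    and p2: "\<And>s. s \<in> {0..T} \<Longrightarrow>
      (p2 has_vector_derivative - (b (z2 s) + (\<integral>u. g (z2 s) u \<partial>(m s)))) (at s within {0..T})"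
    and m: "\<And>s. s \<in> {0..T} \<Longrightarrow> emeasure (m s) (space (m s)) \<le> 1"
      "\<And>s. s \<in> {0..T} \<Longrightarrow> sets (m s) = sets borel"
    and t: "t \<in> {0..T}"
  shows "norm (z1 t - z2 t) \<le> 2 * (norm (z1 0 - z2 0) + T * norm (p1 0 - p2 0))"
proof (rule second_order_gronwall[where z="\<lambda>t. z1 t - z2 t" and p="\<lambda>t. p1 t - p2 t" and C="L + l", OF _ _ t])
  fix s assume s: "s \<in> {0..T}"
  show "((\<lambda>t. z1 t - z2 t) has_vector_derivative p1 s - p2 s) (at s within {0..T})"
    by (intro derivative_intros z1 z2 s)
  show "((\<lambda>t. p1 t - p2 t) has_vector_derivative
     - (b (z1 s) + (\<integral>u. g (z1 s) u \<partial>(m s))) - - (b (z2 s) + (\<integral>u. g (z2 s) u \<partial>(m s)))) (at s within {0..T})"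
    by (intro derivative_intros p1 p2 s)
  show "norm (- (b (z1 s) + (\<integral>u. g (z1 s) u \<partial>(m s))) - - (b (z2 s) + (\<integral>u. g (z2 s) u \<partial>(m s))))
    \<le> (L + l) * norm (z1 s - z2 s)"
  proof -
    have "norm (- (b (z1 s) + (\<integral>u. g (z1 s) u \<partial>(m s))) - - (b (z2 s) + (\<integral>u. g (z2 s) u \<partial>(m s))))
      = norm ((b (z1 s) - b (z2 s)) + ((\<integral>u. g (z1 s) u \<partial>(m s)) - (\<integral>u. g (z2 s) u \<partial>(m s))))"
      by (subst norm_minus_cancel[symmetric]) (simp add: algebra_simps)
    also have "\<dots> \<le> L * norm (z1 s - z2 s) + l * norm (z1 s - z2 s)"
      by (intro norm_triangle_mono b_lip g_integral_lip m s)
    finally show ?thesis by (simp add: algebra_simps)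
  qed
next
  show "0 \<le> L + l" using L0 l0 by simp
  have "(L + l) * T\<^sup>2 \<le> (L + 3 * l) * T\<^sup>2" using l0 by (intro mult_right_mono) auto
  then show "(L + l) * T\<^sup>2 \<le> 1/2" using small by linarith
qed

end

locale mean_field_init = mean_field b g L l T
  for b :: "'a::euclidean_space \<Rightarrow> 'a" and g :: "'a \<Rightarrow> 'a \<Rightarrow> 'a" and L l T :: real +
  fixes P :: "('a \<times> 'a) measure"
  assumes P_prob: "prob_space P" and P_sets[measurable_cong]: "sets P = sets borel"
    and P_int: "integrable P norm"
begin

sublocale P: prob_space P by (rule P_prob)

lemma P_int_fst: "integrable P (\<lambda>w. norm (fst w))" and P_int_snd: "integrable P (\<lambda>w. norm (snd w))"
proof -
  have [measurable]: "fst \<in> borel_measurable P" "snd \<in> borel_measurable P"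
    by (subst measurable_cong_sets[OF P_sets refl],
        intro borel_measurable_continuous_onI continuous_on_fst continuous_on_snd continuous_on_id)+
  have 1: "norm (fst w) \<le> norm w" "norm (snd w) \<le> norm w" for w :: "'a \<times> 'a"
    using norm_fst_le[of "fst w" "snd w"] norm_snd_le[of "snd w" "fst w"] by simp_all
  show "integrable P (\<lambda>w. norm (fst w))"
    by (rule Bochner_Integration.integrable_bound[OF P_int]) (simp_all add: 1)
  show "integrable P (\<lambda>w. norm (snd w))"
    by (rule Bochner_Integration.integrable_bound[OF P_int]) (simp_all add: 1)
qed

definition mass :: real where "mass = 1 + (\<integral>w. norm (fst w) + norm (snd w) \<partial>P)"

text \<open>The weight integrates to at most \<open>2 * wt x v\<close> for every \<open>x\<close> and \<open>v\<close>, so the mean-field term does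
  not destroy the contractivity of the Picard map in the weighted sup norm.\<close>

definition wt :: "'a \<Rightarrow> 'a \<Rightarrow> real" where "wt x v = mass + norm x + norm v"

lemma mass_ge1: "1 \<le> mass"
  unfolding mass_def by (simp add: integral_nonneg_AE)

lemma wt_ge1: "1 \<le> wt x v" and wt_pos: "0 < wt x v" and mass_le_wt: "mass \<le> wt x v"
  and norm_le_wt: "norm x + norm v \<le> wt x v"
  using mass_ge1 norm_ge_zero[of x] norm_ge_zero[of v] unfolding wt_def by linarith+

lemma wt_int: "integrable P (\<lambda>w. wt (fst w) (snd w))"
  unfolding wt_def using P_int_fst P_int_snd by auto

lemma integral_wt_le: "(\<integral>w. wt (fst w) (snd w) \<partial>P) \<le> 2 * wt x v"
proof -
  have "(\<integral>w. wt (fst w) (snd w) \<partial>P) = mass + (\<integral>w. norm (fst w) + norm (snd w) \<partial>P)"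
    unfolding wt_def add.assoc using P_int_fst P_int_snd by (simp add: P.prob_space)
  also have "\<dots> \<le> 2 * mass" unfolding mass_def by simp
  finally show ?thesis using mass_le_wt[of x v] by linarith
qed

lemma integrable_linear_growth:
  fixes f :: "'a \<times> 'a \<Rightarrow> 'a"
  assumes f[measurable]: "f \<in> borel_measurable P" and bd: "\<And>w. norm (f w) \<le> C * wt (fst w) (snd w)"
  shows "integrable P f"
proof (rule Bochner_Integration.integrable_bound)
  show "integrable P (\<lambda>w. C * wt (fst w) (snd w))" using wt_int by simp
  show "AE w in P. norm (f w) \<le> norm (C * wt (fst w) (snd w))"
    using order_trans[OF bd abs_ge_self] by simp
qed measurable

lemma g_comp_integrable:
  assumes f[measurable]: "f \<in> borel_measurable P" and bd: "\<And>w. norm (f w) \<le> C * wt (fst w) (snd w)"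
  shows "integrable P (\<lambda>w. g q (f w))"
proof (rule integrable_linear_growth[where C="norm (g 0 0) + l * (norm q + C)"])
  fix w
  let ?w = "wt (fst w) (snd w)"
  have "norm (g q (f w)) \<le> norm (g 0 0) + l * (norm q + norm (f w))" by (rule g_bound)
  also have "\<dots> \<le> norm (g 0 0) * ?w + l * (norm q * ?w + C * ?w)"
  proof (intro add_mono mult_left_mono l0 bd)
    show "norm (g 0 0) \<le> norm (g 0 0) * ?w" "norm q \<le> norm q * ?w"
      using mult_left_mono[OF wt_ge1 norm_ge_zero] by force+
  qed
  finally show "norm (g q (f w)) \<le> (norm (g 0 0) + l * (norm q + C)) * ?w"
    by (simp add: algebra_simps)
qed measurable

lemma prob_distr_le1: "emeasure (distr P borel f) (space (distr P borel f :: 'a measure)) \<le> 1"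
  using emeasure_distr_space_le[of P borel f] by (simp add: P.emeasure_space_1)

section \<open>A priori regularity and uniqueness of mean-field solutions\<close>

lemma
  assumes S: "mf_sol b g T P Q p m"
  shows mf_sol_init: "Q 0 x v = x" "p 0 x v = v"
    and mf_sol_deriv: "t \<in> {0..T} \<Longrightarrow> ((\<lambda>s. Q s x v) has_vector_derivative p t x v) (at t within {0..T})"
    and mf_sol_deriv2: "t \<in> {0..T} \<Longrightarrow> ((\<lambda>s. p s x v) has_vector_derivative
         - (b (Q t x v) + (\<integral>u. g (Q t x v) u \<partial>(m t)))) (at t within {0..T})"
    and mf_sol_law: "t \<in> {0..T} \<Longrightarrow> m t = distr P borel (\<lambda>(x, v). Q t x v)"
  using S unfolding mf_sol_def by blast+

lemma mf_sol_mass: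
  assumes S: "mf_sol b g T P Q p m" and t: "t \<in> {0..T}"
  shows "emeasure (m t) (space (m t)) \<le> 1" "sets (m t) = sets borel"
  using mf_sol_law[OF S t] prob_distr_le1 by auto

lemma mf_sol_lipschitz:
  assumes S: "mf_sol b g T P Q p m" and t: "t \<in> {0..T}"
  shows "norm (Q t x v - Q t x' v') \<le> 2 * (norm (x - x') + T * norm (v - v'))"
  using trajectory_lipschitz[OF mf_sol_deriv[OF S] mf_sol_deriv2[OF S] mf_sol_deriv[OF S] mf_sol_deriv2[OF S]
      mf_sol_mass[OF S] t, of x v x' v']
  by (simp add: mf_sol_init[OF S])

lemma mf_sol_continuous:
  assumes S: "mf_sol b g T P Q p m" and t: "t \<in> {0..T}"
  shows "continuous_on UNIV (\<lambda>w. Q t (fst w) (snd w))"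
proof (rule lipschitz_on_continuous_on)
  show "(2 * (1 + T))-lipschitz_on UNIV (\<lambda>w. Q t (fst w) (snd w))"
    unfolding lipschitz_on_def dist_norm
  proof (intro conjI ballI)
    fix y z :: "'a \<times> 'a"
    have "norm (Q t (fst y) (snd y) - Q t (fst z) (snd z)) \<le> 2 * (norm (fst y - fst z) + T * norm (snd y - snd z))"
      by (rule mf_sol_lipschitz[OF S t])
    also have "\<dots> \<le> 2 * (norm (y - z) + T * norm (y - z))"
    proof (intro mult_left_mono add_mono)
      show "norm (fst y - fst z) \<le> norm (y - z)" by (metis norm_fst_le fst_diff prod.collapse)
      show "norm (snd y - snd z) \<le> norm (y - z)" by (metis norm_snd_le snd_diff prod.collapse)
    qed (use T0 in simp_all)
    finally show "norm (Q t (fst y) (snd y) - Q t (fst z) (snd z)) \<le> 2 * (1 + T) * norm (y - z)"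
      by (simp add: algebra_simps)
  qed (use T0 in simp)
qed

lemma mf_sol_measurable:
  assumes S: "mf_sol b g T P Q p m" and t: "t \<in> {0..T}"
  shows "(\<lambda>w. Q t (fst w) (snd w)) \<in> borel_measurable P"
  by (subst measurable_cong_sets[OF P_sets refl])
    (intro borel_measurable_continuous_onI mf_sol_continuous[OF S t])

text \<open>Compactness bounds the trajectory that starts at the origin at rest, and the Lipschitz
  bound handles all others. So any two solutions are at finite distance in the weighted
  norm.\<close>

lemma mf_sol_growth:
  assumes S: "mf_sol b g T P Q p m"
  obtains C where "0 \<le> C" "\<And>t x v. t \<in> {0..T} \<Longrightarrow> norm (Q t x v) \<le> C * wt x v"
proof -
  have "continuous_on {0..T} (\<lambda>t. norm (Q t 0 0))"
    using continuous_on_trajectory[OF mf_sol_deriv[OF S]] by (intro continuous_intros) auto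
  then obtain t0 where t0: "t0 \<in> {0..T}" and mx: "\<And>t. t \<in> {0..T} \<Longrightarrow> norm (Q t 0 0) \<le> norm (Q t0 0 0)"
    using continuous_attains_sup[of "{0..T}" "\<lambda>t. norm (Q t 0 0)"] T0 by auto
  let ?C = "norm (Q t0 0 0) + 2 * (1 + T)"
  show thesis
  proof
    show "0 \<le> ?C" using T0 by (simp add: add_nonneg_nonneg)
    fix t x v assume t: "t \<in> {0..T}"
    have "norm (Q t x v) \<le> norm (Q t 0 0) + norm (Q t x v - Q t 0 0)"
      by (metis norm_triangle_sub add.commute)
    also have "\<dots> \<le> norm (Q t0 0 0) + 2 * (norm x + T * norm v)"
      using mx[OF t] mf_sol_lipschitz[OF S t, of x v 0 0] by simp
    also have "\<dots> \<le> norm (Q t0 0 0) * wt x v + 2 * (wt x v + T * wt x v)"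
    proof (intro add_mono mult_left_mono)
      show "norm (Q t0 0 0) \<le> norm (Q t0 0 0) * wt x v"
        using mult_left_mono[OF wt_ge1 norm_ge_zero] by force
      show "norm x \<le> wt x v" "norm v \<le> wt x v"
        using norm_le_wt[of x v] norm_ge_zero[of x] norm_ge_zero[of v] by linarith+
    qed (use T0 in auto)
    finally show "norm (Q t x v) \<le> ?C * wt x v" by (simp add: algebra_simps)
  qed
qed

lemma mf_sol_integral:
  assumes S: "mf_sol b g T P Q p m" and t: "t \<in> {0..T}"
  shows "(\<integral>u. g q u \<partial>(m t)) = (\<integral>w. g q (Q t (fst w) (snd w)) \<partial>P)"
  unfolding mf_sol_law[OF S t]
  by (subst integral_distr) (use mf_sol_measurable[OF S t] in \<open>simp_all add: case_prod_beta'\<close>)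

text \<open>The halving comes from \<open>(L + 3 * l) * T\<^sup>2 \<le> 1/2\<close>. Expressing the
  law through the flow makes the interaction an integral over \<open>P\<close>, to which the
  weighted bound \<open>D\<close> applies pointwise.\<close>

lemma mf_sol_contraction:
  assumes S: "mf_sol b g T P Q p m" and S': "mf_sol b g T P Q' p' m'"
    and D: "\<And>t x v. t \<in> {0..T} \<Longrightarrow> norm (Q t x v - Q' t x v) \<le> D * wt x v" and D0: "0 \<le> D"
    and t: "t \<in> {0..T}"
  shows "norm (Q t x v - Q' t x v) \<le> (D / 2) * wt x v"
proof -
  obtain C where C: "\<And>t x v. t \<in> {0..T} \<Longrightarrow> norm (Q t x v) \<le> C * wt x v" using mf_sol_growth[OF S] by metis
  obtain C' where C': "\<And>t x v. t \<in> {0..T} \<Longrightarrow> norm (Q' t x v) \<le> C' * wt x v" using mf_sol_growth[OF S'] by metis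
  have "norm ((Q t x v - Q' t x v) - (Q 0 x v - Q' 0 x v) - t *\<^sub>R (p 0 x v - p' 0 x v))
      \<le> ((L + 3 * l) * D * wt x v) * T\<^sup>2"
  proof (rule second_order_bound[where z="\<lambda>t. Q t x v - Q' t x v" and p="\<lambda>t. p t x v - p' t x v", OF _ _ t])
    fix s assume s: "s \<in> {0..T}"
    let ?I = "\<integral>w. g (Q s x v) (Q s (fst w) (snd w)) \<partial>P"
    let ?I' = "\<integral>w. g (Q' s x v) (Q' s (fst w) (snd w)) \<partial>P"
    show "((\<lambda>t. Q t x v - Q' t x v) has_vector_derivative p s x v - p' s x v) (at s within {0..T})"
      by (intro derivative_intros mf_sol_deriv[OF S] mf_sol_deriv[OF S'] s)
    show "((\<lambda>t. p t x v - p' t x v) has_vector_derivative - (b (Q s x v) + ?I) - - (b (Q' s x v) + ?I'))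
       (at s within {0..T})"
      using mf_sol_deriv2[OF S s] mf_sol_deriv2[OF S' s]
      by (intro derivative_intros) (auto simp: mf_sol_integral[OF S s] mf_sol_integral[OF S' s])
    have mQ[measurable]: "(\<lambda>w. Q s (fst w) (snd w)) \<in> borel_measurable P"
      "(\<lambda>w. Q' s (fst w) (snd w)) \<in> borel_measurable P"
      using mf_sol_measurable[OF S s] mf_sol_measurable[OF S' s] by auto
    have int: "integrable P (\<lambda>w. g (Q s x v) (Q s (fst w) (snd w)))"
      "integrable P (\<lambda>w. g (Q' s x v) (Q' s (fst w) (snd w)))"
      by (rule g_comp_integrable[where C=C], use C[OF s] in simp_all,
          rule g_comp_integrable[where C=C'], use C'[OF s] in simp_all)
    have "norm (?I - ?I') = norm (\<integral>w. g (Q s x v) (Q s (fst w) (snd w)) - g (Q' s x v) (Q' s (fst w) (snd w)) \<partial>P)"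
      using int by simp
    also have "\<dots> \<le> (\<integral>w. norm (g (Q s x v) (Q s (fst w) (snd w)) - g (Q' s x v) (Q' s (fst w) (snd w))) \<partial>P)"
      by (rule integral_norm_bound)
    also have "\<dots> \<le> (\<integral>w. l * (D * wt x v + D * wt (fst w) (snd w)) \<partial>P)"
    proof (rule integral_mono)
      show "integrable P (\<lambda>w. norm (g (Q s x v) (Q s (fst w) (snd w)) - g (Q' s x v) (Q' s (fst w) (snd w))))"
        using int by simp
      show "integrable P (\<lambda>w. l * (D * wt x v + D * wt (fst w) (snd w)))"
        using wt_int by simp
      show "norm (g (Q s x v) (Q s (fst w) (snd w)) - g (Q' s x v) (Q' s (fst w) (snd w)))
          \<le> l * (D * wt x v + D * wt (fst w) (snd w))" for w
        by (rule order_trans[OF g_lip mult_left_mono[OF add_mono[OF D[OF s] D[OF s]] l0]])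
    qed
    also have "\<dots> = l * (D * wt x v + D * (\<integral>w. wt (fst w) (snd w) \<partial>P))"
      using wt_int by (simp add: P.prob_space)
    also have "\<dots> \<le> l * (D * wt x v + D * (2 * wt x v))"
      by (intro mult_left_mono add_left_mono integral_wt_le D0 l0)
    finally have I: "norm (?I - ?I') \<le> 3 * l * D * wt x v" by (simp add: algebra_simps)
    have B: "norm (b (Q s x v) - b (Q' s x v)) \<le> L * (D * wt x v)"
      by (rule order_trans[OF b_lip mult_left_mono[OF D[OF s] L0]])
    have "norm (- (b (Q s x v) + ?I) - - (b (Q' s x v) + ?I')) = norm ((b (Q s x v) - b (Q' s x v)) + (?I - ?I'))"
      by (subst norm_minus_cancel[symmetric]) (simp add: algebra_simps)
    also have "\<dots> \<le> L * (D * wt x v) + 3 * l * D * wt x v" by (intro norm_triangle_mono I B)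
    finally show "norm (- (b (Q s x v) + ?I) - - (b (Q' s x v) + ?I')) \<le> (L + 3 * l) * D * wt x v"
      by (simp add: algebra_simps)
  next
    show "0 \<le> (L + 3 * l) * D * wt x v" using L0 l0 D0 wt_pos[of x v] by simp
  qed
  then have "norm (Q t x v - Q' t x v) \<le> ((L + 3 * l) * T\<^sup>2) * (D * wt x v)"
    by (simp add: mf_sol_init[OF S] mf_sol_init[OF S'] mult_ac)
  also have "\<dots> \<le> 1/2 * (D * wt x v)"
    using D0 wt_pos[of x v] by (intro mult_right_mono small) auto
  finally show ?thesis by simp
qed

lemma mf_sol_unique:
  assumes S: "mf_sol b g T P Q p m" and S': "mf_sol b g T P Q' p' m'" and t: "t \<in> {0..T}"
  shows "Q t x v = Q' t x v"
proof -
  obtain C where C: "0 \<le> C" "\<And>t x v. t \<in> {0..T} \<Longrightarrow> norm (Q t x v) \<le> C * wt x v" using mf_sol_growth[OF S] by metis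
  obtain C' where C': "0 \<le> C'" "\<And>t x v. t \<in> {0..T} \<Longrightarrow> norm (Q' t x v) \<le> C' * wt x v" using mf_sol_growth[OF S'] by metis
  \<comment> \<open>A finite starting value for the weighted distance; halving it indefinitely
    leaves 0.\<close>
  define D where "D = C + C'"
  have "norm (Q t x v - Q' t x v) \<le> (D * (1/2)^n) * wt x v" if "t \<in> {0..T}" for n t x v
    using that
  proof (induction n arbitrary: t x v)
    case 0
    have "norm (Q t x v - Q' t x v) \<le> norm (Q t x v) + norm (Q' t x v)" by (rule norm_triangle_ineq4)
    also have "\<dots> \<le> D * wt x v" using C(2)[OF 0, of x v] C'(2)[OF 0, of x v] by (simp add: D_def algebra_simps)
    finally show ?case by simp
  next
    case (Suc n)
    from mf_sol_contraction[OF S S' Suc.IH _ Suc.prems] C(1) C'(1) show ?case by (simp add: D_def)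
  qed
  then have "norm (Q t x v - Q' t x v) \<le> (D * wt x v) * (1/2)^n" for n using t by (simp add: mult_ac)
  moreover have "(\<lambda>n. (D * wt x v) * (1/2)^n) \<longlonglongrightarrow> (D * wt x v) * 0"
    by (intro tendsto_intros) (simp add: LIMSEQ_realpow_zero)
  ultimately have "norm (Q t x v - Q' t x v) \<le> 0"
    by (metis (no_types, lifting) LIMSEQ_le_const mult_zero_right)
  then show ?thesis by simp
qed

lemma mf_sol_law_unique:
  assumes S: "mf_sol b g T P Q p m" and S': "mf_sol b g T P Q' p' m'" and t: "t \<in> {0..T}"
  shows "m t = m' t"
  unfolding mf_sol_law[OF S t] mf_sol_law[OF S' t] mf_sol_unique[OF S S' t] ..

section \<open>Existence by Picard iteration in a weighted space\<close>

type_synonym 'x path = "(real \<times> 'x \<times> 'x) \<Rightarrow>\<^sub>C 'x"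

text \<open>Bounded continuous functions live on a whole type, so time is continued beyond the
  interval by its end values.\<close>

definition clampT :: "real \<Rightarrow> real" where "clampT t = max 0 (min T t)"

text \<open>The unknown \<open>h\<close> is the deviation from free flight divided by the weight.
  This makes it bounded, which gives access to the Banach space of bounded continuous
  functions.\<close>

definition pos :: "'a path \<Rightarrow> real \<Rightarrow> 'a \<Rightarrow> 'a \<Rightarrow> 'a" where
  "pos h t x v = x + clampT t *\<^sub>R v + wt x v *\<^sub>R h (t, x, v)"

definition frc :: "'a path \<Rightarrow> real \<Rightarrow> 'a \<Rightarrow> 'a \<Rightarrow> 'a" where
  "frc h t x v = b (pos h t x v) + (\<integral>w. g (pos h t x v) (pos h t (fst w) (snd w)) \<partial>P)"

text \<open>The second-order Taylor formula for the deviation. Since the kernel vanishes after time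
  \<open>t\<close>, the domain of integration can be fixed to the whole interval and continuity in
  \<open>t\<close> is that of a parameter integral.\<close>

definition pic :: "'a path \<Rightarrow> real \<times> 'a \<times> 'a \<Rightarrow> 'a" where
  "pic h = (\<lambda>(t, x, v). - ((1 / wt x v) *\<^sub>R
      integral (cbox 0 T) (\<lambda>s. max 0 (clampT t - s) *\<^sub>R frc h s x v)))"

lemma clampT_bounds: "0 \<le> clampT t" "clampT t \<le> T" and clampT_id: "t \<in> {0..T} \<Longrightarrow> clampT t = t"
  using T0 by (auto simp: clampT_def)

lemma wt_cont[continuous_intros]:
  "continuous_on S f \<Longrightarrow> continuous_on S h \<Longrightarrow> continuous_on S (\<lambda>z. wt (f z) (h z))"
  unfolding wt_def by (intro continuous_intros)

lemma clampT_cont[continuous_intros]: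
  "continuous_on S f \<Longrightarrow> continuous_on S (\<lambda>z. clampT (f z))"
  unfolding clampT_def by (intro continuous_intros)

lemma pos_cont:
  assumes "continuous_on S f" "continuous_on S a" "continuous_on S c"
  shows "continuous_on S (\<lambda>z. pos h (f z) (a z) (c z))"
  unfolding pos_def
  by (intro continuous_intros assms continuous_on_compose2[OF continuous_on_apply_bcontfun[of UNIV]]) auto

lemma pos_growth: "norm (pos h t x v) \<le> (1 + T + norm h) * wt x v"
proof -
  have "norm (pos h t x v) \<le> norm x + norm (clampT t *\<^sub>R v) + norm (wt x v *\<^sub>R h (t, x, v))"
    unfolding pos_def by (intro order_trans[OF norm_triangle_ineq] add_mono norm_triangle_ineq order_refl)
  also have "\<dots> \<le> wt x v + T * wt x v + wt x v * norm h"
  proof (intro add_mono)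
    show "norm x \<le> wt x v" using norm_le_wt[of x v] norm_ge_zero[of v] by linarith
    have "norm v \<le> wt x v" using norm_le_wt[of x v] norm_ge_zero[of x] by linarith
    then show "norm (clampT t *\<^sub>R v) \<le> T * wt x v"
      using clampT_bounds[of t] T0 by (auto intro!: mult_mono)
    show "norm (wt x v *\<^sub>R h (t, x, v)) \<le> wt x v * norm h"
      using wt_pos[of x v] norm_bounded[of h "(t,x,v)"] by (simp add: mult_left_mono)
  qed
  finally show ?thesis by (simp add: algebra_simps)
qed

lemma pos_measurable[measurable]: "(\<lambda>w. pos h t (fst w) (snd w)) \<in> borel_measurable P"
  by (subst measurable_cong_sets[OF P_sets refl])
    (intro borel_measurable_continuous_onI pos_cont continuous_intros)

lemma g_pos_integrable: "integrable P (\<lambda>w. g q (pos h t (fst w) (snd w)))"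
  by (rule g_comp_integrable[OF pos_measurable pos_growth])

text \<open>Dominated convergence: along a convergent sequence the first argument stays bounded, and
  the second grows at most like the integrable weight.\<close>

lemma g_pos_continuous: "continuous_on UNIV (\<lambda>z. \<integral>w. g (fst z) (pos h (snd z) (fst w) (snd w)) \<partial>P)"
  unfolding continuous_on_sequentially
proof (intro ballI allI impI)
  fix y :: "'a \<times> real" and u assume u: "(\<forall>n. u n \<in> UNIV) \<and> u \<longlonglongrightarrow> y"
  have u1: "(\<lambda>n. fst (u n)) \<longlonglongrightarrow> fst y"
    using u by (auto intro: tendsto_fst)
  obtain B where B: "\<And>n. norm (fst (u n)) \<le> B"
    using convergent_imp_Bseq[OF convergentI[OF u1]] unfolding Bseq_def by blast
  have "(\<lambda>n. \<integral>w. g (fst (u n)) (pos h (snd (u n)) (fst w) (snd w)) \<partial>P)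
      \<longlonglongrightarrow> (\<integral>w. g (fst y) (pos h (snd y) (fst w) (snd w)) \<partial>P)"
  proof (rule integral_dominated_convergence[where
        w="\<lambda>w. norm (g 0 0) + l * (B + (1 + T + norm h) * wt (fst w) (snd w))"])
    show "integrable P (\<lambda>w. norm (g 0 0) + l * (B + (1 + T + norm h) * wt (fst w) (snd w)))"
      using wt_int by simp
    show "AE w in P. (\<lambda>n. g (fst (u n)) (pos h (snd (u n)) (fst w) (snd w)))
        \<longlonglongrightarrow> g (fst y) (pos h (snd y) (fst w) (snd w))"
    proof (rule AE_I2)
      fix w
      have "continuous_on UNIV (\<lambda>z. g (fst z) (pos h (snd z) (fst w) (snd w)))"
        using continuous_on_compose2[OF g_cont[of UNIV], of UNIV "\<lambda>z. (fst z, pos h (snd z) (fst w) (snd w))"]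
        by (simp add: pos_cont continuous_intros)
      then show "(\<lambda>n. g (fst (u n)) (pos h (snd (u n)) (fst w) (snd w)))
        \<longlonglongrightarrow> g (fst y) (pos h (snd y) (fst w) (snd w))"
        using u unfolding continuous_on_sequentially comp_def by auto
    qed
    show "AE w in P. norm (g (fst (u n)) (pos h (snd (u n)) (fst w) (snd w)))
        \<le> norm (g 0 0) + l * (B + (1 + T + norm h) * wt (fst w) (snd w))" for n
      by (intro AE_I2 order_trans[OF g_bound] add_left_mono mult_left_mono add_mono B pos_growth l0)
  qed measurable
  then show "((\<lambda>z. \<integral>w. g (fst z) (pos h (snd z) (fst w) (snd w)) \<partial>P) \<circ> u)
    \<longlonglongrightarrow> (\<integral>w. g (fst y) (pos h (snd y) (fst w) (snd w)) \<partial>P)" by (simp add: comp_def)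
qed

lemma frc_cont:
  assumes "continuous_on S f" "continuous_on S a" "continuous_on S c"
  shows "continuous_on S (\<lambda>z. frc h (f z) (a z) (c z))"
  unfolding frc_def
proof (intro continuous_on_add)
  show "continuous_on S (\<lambda>z. b (pos h (f z) (a z) (c z)))"
    by (rule continuous_on_compose2[OF b_cont[of UNIV]]) (intro pos_cont assms, simp)
  show "continuous_on S (\<lambda>z. \<integral>w. g (pos h (f z) (a z) (c z)) (pos h (f z) (fst w) (snd w)) \<partial>P)"
    using continuous_on_compose2[OF g_pos_continuous[of h], of S "\<lambda>z. (pos h (f z) (a z) (c z), f z)"]
    by (simp add: pos_cont continuous_on_Pair assms)
qed

lemma integral_growth:
  assumes "f \<in> borel_measurable P" "\<And>w. norm (f w) \<le> l * (D * wt x v + D * wt (fst w) (snd w))" "0 \<le> D"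
  shows "(\<integral>w. norm (f w :: 'a) \<partial>P) \<le> 3 * l * D * wt x v"
proof -
  have "(\<integral>w. norm (f w) \<partial>P) \<le> (\<integral>w. l * (D * wt x v + D * wt (fst w) (snd w)) \<partial>P)"
    by (rule integral_mono') (use wt_int assms order_trans[OF norm_ge_zero assms(2)] in auto)
  also have "\<dots> = l * (D * wt x v + D * (\<integral>w. wt (fst w) (snd w) \<partial>P))"
    using wt_int by (simp add: P.prob_space)
  also have "\<dots> \<le> l * (D * wt x v + D * (2 * wt x v))"
    by (intro mult_left_mono add_left_mono integral_wt_le assms l0)
  finally show ?thesis by (simp add: algebra_simps)
qed

lemma frc_lip: "norm (frc h t x v - frc k t x v) \<le> (L + 3 * l) * dist h k * wt x v"
proof -
  have D: "norm (pos h t x v - pos k t x v) \<le> dist h k * wt x v" for x v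
  proof -
    have "norm (pos h t x v - pos k t x v) = wt x v * dist (h (t, x, v)) (k (t, x, v))"
      using wt_pos[of x v] by (simp add: pos_def dist_norm scaleR_diff_right[symmetric])
    also have "\<dots> \<le> wt x v * dist h k"
      using wt_pos[of x v] by (intro mult_left_mono dist_bounded) auto
    finally show ?thesis by (simp add: mult.commute)
  qed
  let ?I = "\<lambda>h. \<integral>w. g (pos h t x v) (pos h t (fst w) (snd w)) \<partial>P"
  have "norm (?I h - ?I k) = norm (\<integral>w. g (pos h t x v) (pos h t (fst w) (snd w)) - g (pos k t x v) (pos k t (fst w) (snd w)) \<partial>P)"
    using g_pos_integrable by simp
  also have "\<dots> \<le> (\<integral>w. norm (g (pos h t x v) (pos h t (fst w) (snd w)) - g (pos k t x v) (pos k t (fst w) (snd w))) \<partial>P)"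
    by (rule integral_norm_bound)
  also have "\<dots> \<le> 3 * l * dist h k * wt x v"
    by (rule integral_growth) (measurable, rule order_trans[OF g_lip mult_left_mono[OF add_mono[OF D D] l0]], simp)
  finally have I: "norm (?I h - ?I k) \<le> 3 * l * dist h k * wt x v" .
  have "norm (b (pos h t x v) - b (pos k t x v)) \<le> L * (dist h k * wt x v)"
    by (rule order_trans[OF b_lip mult_left_mono[OF D L0]])
  from norm_triangle_mono[OF this I] show ?thesis
    by (simp add: frc_def algebra_simps)
qed

lemma frc_growth: obtains C where "0 \<le> C" "\<And>t x v. norm (frc h t x v) \<le> C * wt x v"
proof -
  define A where "A = norm (b 0) + norm (g 0 0)"
  define D where "D = 1 + T + norm h"
  have D0: "0 \<le> D" using T0 by (simp add: D_def)
  have "norm (frc h t x v) \<le> (A + (L + 3 * l) * D) * wt x v" for t x v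
  proof -
    have "norm (\<integral>w. g (pos h t x v) (pos h t (fst w) (snd w)) \<partial>P)
        \<le> (\<integral>w. norm (g (pos h t x v) (pos h t (fst w) (snd w))) \<partial>P)" by (rule integral_norm_bound)
    also have "\<dots> \<le> (\<integral>w. norm (g 0 0) + l * (D * wt x v + D * wt (fst w) (snd w)) \<partial>P)"
    proof (rule integral_mono)
      show "integrable P (\<lambda>w. norm (g (pos h t x v) (pos h t (fst w) (snd w))))"
        using g_pos_integrable by simp
    qed (use wt_int in \<open>auto simp: D_def intro!: order_trans[OF g_bound] mult_left_mono add_mono pos_growth l0\<close>)
    also have "\<dots> = norm (g 0 0) + l * (D * wt x v + D * (\<integral>w. wt (fst w) (snd w) \<partial>P))"
      using wt_int by (simp add: P.prob_space)
    also have "\<dots> \<le> norm (g 0 0) * wt x v + l * (D * wt x v + D * (2 * wt x v))"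
      using mult_left_mono[OF wt_ge1[of x v] norm_ge_zero[of "g 0 0"]]
      by (intro add_mono mult_left_mono add_left_mono integral_wt_le D0 l0) auto
    finally have 1: "norm (\<integral>w. g (pos h t x v) (pos h t (fst w) (snd w)) \<partial>P)
        \<le> (norm (g 0 0) + 3 * l * D) * wt x v" by (simp add: algebra_simps)
    have "norm (b (pos h t x v)) \<le> norm (b 0) + L * norm (pos h t x v)" by (rule b_bound)
    also have "\<dots> \<le> norm (b 0) * wt x v + L * (D * wt x v)"
      using mult_left_mono[OF wt_ge1[of x v] norm_ge_zero[of "b 0"]]
      by (intro add_mono mult_left_mono pos_growth[of h t x v, folded D_def] L0) auto
    finally have "norm (b (pos h t x v)) \<le> (norm (b 0) + L * D) * wt x v" by (simp add: algebra_simps)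
    from norm_triangle_mono[OF this 1] show ?thesis by (simp add: frc_def A_def algebra_simps)
  qed
  moreover have "0 \<le> A + (L + 3 * l) * D" using D0 L0 l0 by (simp add: A_def)
  ultimately show thesis using that by blast
qed

lemma kernel_integral_bound:
  assumes f: "continuous_on UNIV f" and bd: "\<And>s. norm (f s :: 'a) \<le> C"
  shows "norm (integral (cbox 0 T) (\<lambda>s. max 0 (clampT t - s) *\<^sub>R f s)) \<le> T\<^sup>2 * C"
proof -
  have C0: "0 \<le> C" using order_trans[OF norm_ge_zero bd] .
  have "norm (integral (cbox 0 T) (\<lambda>s. max 0 (clampT t - s) *\<^sub>R f s)) \<le> (T * C) * measure lborel (cbox 0 T)"
  proof (rule has_integral_bound)
    show "((\<lambda>s. max 0 (clampT t - s) *\<^sub>R f s) has_integral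
        integral (cbox 0 T) (\<lambda>s. max 0 (clampT t - s) *\<^sub>R f s)) (cbox 0 T)"
      by (intro integrable_integral integrable_continuous continuous_intros continuous_on_subset[OF f]) auto
    fix s assume "s \<in> cbox 0 T"
    then show "norm (max 0 (clampT t - s) *\<^sub>R f s) \<le> T * C"
      using bd[of s] clampT_bounds[of t] T0 by (auto intro!: mult_mono)
  qed (use C0 T0 in auto)
  then show ?thesis using T0 by (simp add: power2_eq_square mult_ac)
qed

text \<open>The force grows linearly like the weight, and the division by the weight in
  \<open>pic\<close> removes exactly this growth.\<close>

lemma pic_bcontfun: "pic h \<in> bcontfun"
proof -
  obtain C where C: "0 \<le> C" "\<And>t x v. norm (frc h t x v) \<le> C * wt x v" by (rule frc_growth[of h]) blast
  show ?thesis
  proof (rule bcontfun_normI)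
    have "continuous_on UNIV (\<lambda>z::real \<times> 'a \<times> 'a. integral (cbox 0 T)
        (\<lambda>s. max 0 (clampT (fst z) - s) *\<^sub>R frc h s (fst (snd z)) (snd (snd z))))"
      by (rule integral_continuous_on_param)
        (auto simp: case_prod_beta' intro!: continuous_intros frc_cont)
    then show "continuous_on UNIV (pic h)"
      unfolding pic_def case_prod_beta'
      by (intro continuous_intros) (use wt_pos in \<open>auto simp: less_imp_neq[symmetric] order_less_imp_not_eq2\<close>)
    fix z :: "real \<times> 'a \<times> 'a"
    obtain t x v where z: "z = (t, x, v)" by (cases z)
    have "norm (integral (cbox 0 T) (\<lambda>s. max 0 (clampT t - s) *\<^sub>R frc h s x v)) \<le> T\<^sup>2 * (C * wt x v)"
      by (rule kernel_integral_bound) (intro frc_cont continuous_intros, rule C)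
    then show "norm (pic h z) \<le> T\<^sup>2 * C"
      using wt_pos[of x v] by (simp add: z pic_def divide_simps mult_ac)
  qed
qed

lemma pic_fixpoint: "\<exists>h. pic h = apply_bcontfun h"
proof -
  define \<Phi> where "\<Phi> h = Bcontfun (pic h)" for h
  have app: "apply_bcontfun (\<Phi> h) = pic h" for h
    unfolding \<Phi>_def by (rule Bcontfun_inverse[OF pic_bcontfun])
  have "dist (\<Phi> h) (\<Phi> k) \<le> (1/2) * dist h k" for h k
  proof (rule dist_bound)
    fix z :: "real \<times> 'a \<times> 'a"
    obtain t x v where z: "z = (t, x, v)" by (cases z)
    let ?J = "\<lambda>h. integral (cbox 0 T) (\<lambda>s. max 0 (clampT t - s) *\<^sub>R frc h s x v)"
    have int: "(\<lambda>s. max 0 (clampT t - s) *\<^sub>R frc h s x v) integrable_on cbox 0 T" for h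
      by (intro integrable_continuous continuous_intros frc_cont)
    have "?J h - ?J k = integral (cbox 0 T) (\<lambda>s. max 0 (clampT t - s) *\<^sub>R (frc h s x v - frc k s x v))"
      using int by (simp add: integral_diff scaleR_diff_right)
    moreover have "norm (integral (cbox 0 T) (\<lambda>s. max 0 (clampT t - s) *\<^sub>R (frc h s x v - frc k s x v)))
        \<le> T\<^sup>2 * ((L + 3 * l) * dist h k * wt x v)"
      by (rule kernel_integral_bound) (intro frc_cont continuous_intros, rule frc_lip)
    ultimately have "norm (?J h - ?J k) \<le> ((L + 3 * l) * T\<^sup>2) * (dist h k * wt x v)" by (simp add: mult_ac)
    also have "\<dots> \<le> 1/2 * (dist h k * wt x v)"
      using wt_pos[of x v] by (intro mult_right_mono small) auto
    finally have "norm (?J h - ?J k) \<le> 1/2 * dist h k * wt x v" by simp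
    moreover have "dist (pic h z) (pic k z) = (1 / wt x v) * norm (?J h - ?J k)"
    proof -
      have "dist (pic h z) (pic k z) = norm (- ((1 / wt x v) *\<^sub>R (?J h - ?J k)))"
        by (simp add: z pic_def dist_norm scaleR_diff_right)
      also have "\<dots> = (1 / wt x v) * norm (?J h - ?J k)" 
        using wt_pos[of x v] by simp
      finally show ?thesis .
    qed
    ultimately have "dist (pic h z) (pic k z) \<le> 1/2 * dist h k"
      using wt_pos[of x v] by (simp only: times_divide_eq_left mult_1 pos_divide_le_eq)
    then show "dist (\<Phi> h z) (\<Phi> k z) \<le> 1/2 * dist h k"
      using wt_pos[of x v] by (simp add: app)
  qed
  then have "\<exists>!h. \<Phi> h = h" by (intro banach_fix_type[of "1/2"]) auto
  then show ?thesis using app by metis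
qed

text \<open>Joint continuity in time and initial data is recorded because time integrals and
  expectations of the flow are exchanged later, which calls for joint measurability.\<close>

lemma mf_sol_exists:
  "\<exists>Q p m. mf_sol b g T P Q p m \<and> continuous_on UNIV (\<lambda>z. Q (fst z) (fst (snd z)) (snd (snd z)))"
proof -
  obtain h where h: "pic h = apply_bcontfun h" using pic_fixpoint by blast
  define Q where "Q = pos h"
  define p where "p t x v = v - integral {0..t} (\<lambda>s. frc h s x v)" for t x v
  define m where "m t = distr P borel (\<lambda>(x, v). Q t x v)" for t
  have fc: "continuous_on S (\<lambda>s. frc h s x v)" for S x v by (intro frc_cont continuous_intros)
  \<comment> \<open>Splitting the kernel \<open>t - s\<close> into two integrals with upper limit
    \<open>t\<close> and integrands free of \<open>t\<close> allows differentiation by the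
    fundamental theorem.\<close>
  have Qt: "Q t x v = x + t *\<^sub>R v - (t *\<^sub>R integral {0..t} (\<lambda>s. frc h s x v) - integral {0..t} (\<lambda>s. s *\<^sub>R frc h s x v))"
    if t: "t \<in> {0..T}" for t x v
  proof -
    let ?k = "\<lambda>s. max 0 (t - s) *\<^sub>R frc h s x v"
    have int: "?k integrable_on S" if "S = {c..d}" for S c d
      unfolding that by (intro integrable_continuous_interval continuous_intros frc_cont)
    have i1: "integral {0..T} ?k = integral {0..t} ?k + integral {t..T} ?k"
      using t by (intro Henstock_Kurzweil_Integration.integral_combine[symmetric] int) auto
    have i2: "integral {t..T} ?k = 0"
      by (subst integral_cong[where g="\<lambda>_. 0"]) auto
    have "integral {0..t} ?k = integral {0..t} (\<lambda>s. t *\<^sub>R frc h s x v - s *\<^sub>R frc h s x v)"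
      by (intro integral_cong) (auto simp: scaleR_diff_left)
    also have "\<dots> = t *\<^sub>R integral {0..t} (\<lambda>s. frc h s x v) - integral {0..t} (\<lambda>s. s *\<^sub>R frc h s x v)"
      by (subst integral_diff) (auto intro!: integrable_continuous_interval continuous_intros frc_cont)
    finally have "integral {0..T} ?k = t *\<^sub>R integral {0..t} (\<lambda>s. frc h s x v) - integral {0..t} (\<lambda>s. s *\<^sub>R frc h s x v)"
      using i1 i2 by simp
    then show ?thesis
      using wt_pos[of x v] by (simp add: Q_def pos_def clampT_id[OF t] h[symmetric] pic_def)
  qed
  have "mf_sol b g T P Q p m"
    unfolding mf_sol_def
  proof (intro conjI allI ballI)
    fix x v
    show "Q 0 x v = x" using Qt[of 0 x v] T0 by simp
    show "p 0 x v = v" by (simp add: p_def)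
    fix t assume t: "t \<in> {0..T}"
    have d1: "((\<lambda>t. integral {0..t} (\<lambda>s. frc h s x v)) has_vector_derivative frc h t x v) (at t within {0..T})"
      by (rule integral_has_vector_derivative[OF fc t])
    have d2: "((\<lambda>t. integral {0..t} (\<lambda>s. s *\<^sub>R frc h s x v)) has_vector_derivative t *\<^sub>R frc h t x v) (at t within {0..T})"
      by (rule integral_has_vector_derivative[OF _ t]) (intro continuous_intros fc)
    have "((\<lambda>t. x + t *\<^sub>R v - (t *\<^sub>R integral {0..t} (\<lambda>s. frc h s x v) - integral {0..t} (\<lambda>s. s *\<^sub>R frc h s x v)))
        has_vector_derivative p t x v) (at t within {0..T})"
      by (rule has_vector_derivative_eq_rhs)
        (auto intro!: derivative_eq_intros d1 d2 simp: p_def algebra_simps)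
    then show "((\<lambda>s. Q s x v) has_vector_derivative p t x v) (at t within {0..T})"
      by (rule has_vector_derivative_transform[OF t, rotated]) (simp add: Qt)
    have e: "frc h t x v = b (Q t x v) + (\<integral>u. g (Q t x v) u \<partial>(m t))"
      unfolding m_def by (subst integral_distr) (simp_all add: frc_def Q_def case_prod_beta')
    show "((\<lambda>s. p s x v) has_vector_derivative - (b (Q t x v) + (\<integral>u. g (Q t x v) u \<partial>(m t)))) (at t within {0..T})"
      unfolding p_def e[symmetric] by (rule has_vector_derivative_eq_rhs) (auto intro!: derivative_eq_intros d1)
  qed (simp add: m_def)
  moreover have "continuous_on UNIV (\<lambda>z. Q (fst z) (fst (snd z)) (snd (snd z)))"
    unfolding Q_def by (intro pos_cont continuous_intros)
  ultimately show ?thesis by blast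
qed

end

section \<open>The standard Gaussian measure\<close>

lemma nn_integral_lborel_translate:
  fixes f :: "'a::euclidean_space \<Rightarrow> ennreal"
  assumes [measurable]: "f \<in> borel_measurable borel"
  shows "(\<integral>\<^sup>+x. f (c + x) \<partial>lborel) = (\<integral>\<^sup>+x. f x \<partial>lborel)"
  by (subst (2) lborel_distr_plus[of c, symmetric], subst nn_integral_distr) auto

text \<open>Integrate \<open>f x * g (x - F y)\<close> in two ways, where \<open>g\<close> is
  unchanged by \<open>F\<close>. Translation invariance and Tonelli give the same product with
  \<open>f\<close> and with \<open>f\<close> composed with \<open>F\<close>, and the common factor
  \<open>\<integral> g\<close> cancels. No determinant enters.\<close>

lemma nn_integral_lborel_isometry:
  fixes F :: "'a::euclidean_space \<Rightarrow> 'a" and f :: "'a \<Rightarrow> ennreal"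
  assumes lin: "linear F" and iso: "\<And>x. norm (F x) = norm x" and inv: "\<And>x. F (F x) = x"
    and f[measurable]: "f \<in> borel_measurable borel"
  shows "(\<integral>\<^sup>+x. f (F x) \<partial>lborel) = (\<integral>\<^sup>+x. f x \<partial>lborel)"
proof -
  have [measurable]: "F \<in> borel_measurable borel"
    using lin by (intro borel_measurable_continuous_onI linear_continuous_on linear_linear[THEN iffD2])
  \<comment> \<open>The unit ball is invariant under every isometry fixing 0 and symmetric, with
    positive finite volume.\<close>
  define g :: "'a \<Rightarrow> ennreal" where "g = indicator (ball 0 1)"
  have [measurable]: "g \<in> borel_measurable borel"
    unfolding g_def by (intro borel_measurable_indicator borel_open open_ball)
  have gF: "g (F x) = g x" for x by (simp add: g_def indicator_def iso)
  have gm: "g (- x) = g x" for x by (simp add: g_def indicator_def)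
  have tr: "(\<integral>\<^sup>+y. h (c + F y) \<partial>lborel) = (\<integral>\<^sup>+y. h (F y) \<partial>lborel)"
    if [measurable]: "h \<in> borel_measurable borel" for h :: "'a \<Rightarrow> ennreal" and c
  proof -
    have "(\<integral>\<^sup>+y. h (c + F y) \<partial>lborel) = (\<integral>\<^sup>+y. h (F (F c + y)) \<partial>lborel)"
      by (simp add: linear_add[OF lin] inv)
    then show ?thesis using nn_integral_lborel_translate[of "\<lambda>y. h (F y)" "F c"] by simp
  qed
  have "(\<integral>\<^sup>+x. f x \<partial>lborel) * (\<integral>\<^sup>+x. g x \<partial>lborel) = (\<integral>\<^sup>+x. f x * (\<integral>\<^sup>+y. g (F y) \<partial>lborel) \<partial>lborel)"
    by (simp add: gF nn_integral_multc)
  also have "\<dots> = (\<integral>\<^sup>+x. f x * (\<integral>\<^sup>+y. g (- x + F y) \<partial>lborel) \<partial>lborel)"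
    by (subst tr) auto
  also have "\<dots> = (\<integral>\<^sup>+x. (\<integral>\<^sup>+y. f x * g (x - F y) \<partial>lborel) \<partial>lborel)"
  proof -
    have "g (- x + F y) = g (x - F y)" for x y using gm[of "x - F y"] by simp
    then show ?thesis by (simp add: nn_integral_cmult)
  qed
  also have "\<dots> = (\<integral>\<^sup>+y. (\<integral>\<^sup>+x. f x * g (x - F y) \<partial>lborel) \<partial>lborel)"
    by (rule lborel_pair.Fubini') measurable
  also have "\<dots> = (\<integral>\<^sup>+y. (\<integral>\<^sup>+x. f (F y + x) * g x \<partial>lborel) \<partial>lborel)"
  proof (rule nn_integral_cong)
    fix y
    show "(\<integral>\<^sup>+x. f x * g (x - F y) \<partial>lborel) = (\<integral>\<^sup>+x. f (F y + x) * g x \<partial>lborel)"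
      using nn_integral_lborel_translate[of "\<lambda>x. f x * g (x - F y)" "F y"] by simp
  qed
  also have "\<dots> = (\<integral>\<^sup>+x. (\<integral>\<^sup>+y. f (F y + x) * g x \<partial>lborel) \<partial>lborel)"
    by (rule lborel_pair.Fubini') measurable
  also have "\<dots> = (\<integral>\<^sup>+x. (\<integral>\<^sup>+y. f (F y) \<partial>lborel) * g x \<partial>lborel)"
    by (simp add: nn_integral_multc tr[of f, unfolded add.commute[of _ "F _"]])
  also have "\<dots> = (\<integral>\<^sup>+y. f (F y) \<partial>lborel) * (\<integral>\<^sup>+x. g x \<partial>lborel)"
    by (simp add: nn_integral_cmult)
  finally have eq: "(\<integral>\<^sup>+x. f x \<partial>lborel) * (\<integral>\<^sup>+x. g x \<partial>lborel) = (\<integral>\<^sup>+y. f (F y) \<partial>lborel) * (\<integral>\<^sup>+x. g x \<partial>lborel)" .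
  have v: "(\<integral>\<^sup>+x. g x \<partial>lborel) = emeasure lborel (ball (0::'a) 1)" unfolding g_def by simp
  have "(\<integral>\<^sup>+x. g x \<partial>lborel) \<noteq> 0"
    unfolding v using content_ball_pos[of 1 "0::'a"] by (auto simp: measure_def)
  moreover have "(\<integral>\<^sup>+x. g x \<partial>lborel) \<noteq> \<top>"
    unfolding v using emeasure_bounded_finite[OF bounded_ball] by (simp add: less_top)
  ultimately show ?thesis using eq by (simp add: mult.commute[of _ "\<integral>\<^sup>+x. g x \<partial>lborel"] ennreal_mult_cancel_left)
qed

text \<open>The Householder reflection for a unit vector \<open>e\<close>, and the identity for
  \<open>e = 0\<close>; the latter case occurs through \<open>sgn 0 = 0\<close> when two particles
  coincide.\<close>

definition reflect :: "'a::real_inner \<Rightarrow> 'a \<Rightarrow> 'a" where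
  "reflect e x = x - (2 * (e \<bullet> x)) *\<^sub>R e"

lemma reflect_linear: "linear (reflect e)"
  by (auto simp: reflect_def linear_iff algebra_simps inner_add_right)

lemma reflect_norm:
  assumes "norm e = 1 \<or> e = 0" shows "norm (reflect e x) = norm x"
proof -
  have "(norm (reflect e x))\<^sup>2 = (norm x)\<^sup>2"
    using assms unfolding reflect_def power2_norm_eq_inner
    by (auto simp: inner_diff_left inner_diff_right inner_commute norm_eq_1 algebra_simps)
  then show ?thesis by simp
qed

lemma reflect_reflect: "norm e = 1 \<or> e = 0 \<Longrightarrow> reflect e (reflect e x) = x"
  by (auto simp: reflect_def inner_diff_right norm_eq_1 scaleR_add_left[symmetric])

lemma reflect_measurable[measurable]:
  assumes "f \<in> borel_measurable M" "h \<in> borel_measurable M"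
  shows "(\<lambda>x. reflect (f x) (h x :: 'a::euclidean_space)) \<in> borel_measurable M"
  unfolding reflect_def using assms by measurable

section \<open>Density and moments of the standard Gaussian\<close>

definition gauss_dens :: "'a::euclidean_space \<Rightarrow> real" where
  "gauss_dens x = (2 * pi) powr (- real DIM('a) / 2) * exp (- (norm x)\<^sup>2 / 2)"

lemma gauss_dens_nonneg: "0 \<le> gauss_dens x" and gauss_dens_pos: "0 < gauss_dens x"
  by (simp_all add: gauss_dens_def)

lemma gauss_dens_measurable[measurable]: "gauss_dens \<in> borel_measurable borel"
  unfolding gauss_dens_def by measurable

lemma std_gauss_density: "std_gauss = density lborel (\<lambda>x. ennreal (gauss_dens x))"
  unfolding std_gauss_def gauss_dens_def ..

lemma sets_std_gauss[simp, measurable_cong]: "sets std_gauss = sets borel"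
  and space_std_gauss[simp]: "space std_gauss = UNIV"
  by (simp_all add: std_gauss_def)

lemma nn_integral_std_gauss:
  "f \<in> borel_measurable borel \<Longrightarrow> (\<integral>\<^sup>+x. f x \<partial>std_gauss) = (\<integral>\<^sup>+x. ennreal (gauss_dens x) * f x \<partial>lborel)"
  unfolding std_gauss_density by (subst nn_integral_density) auto

lemma gauss_dens_prod: "gauss_dens (x :: 'a::euclidean_space) = (\<Prod>b\<in>Basis. std_normal_density (x \<bullet> b))"
proof -
  have "(\<Prod>b\<in>Basis. std_normal_density (x \<bullet> b))
      = (1 / sqrt (2 * pi)) ^ DIM('a) * exp (\<Sum>b\<in>Basis. - (x \<bullet> b)\<^sup>2 / 2)"
    by (simp add: normal_density_def prod.distrib exp_sum prod_dividef power_divide)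
  also have "(\<Sum>b\<in>Basis. - (x \<bullet> b)\<^sup>2 / 2) = - (norm x)\<^sup>2 / 2"
    unfolding power2_norm_eq_inner euclidean_inner[of x x]
    by (simp add: sum_negf sum_divide_distrib power2_eq_square)
  also have "(1 / sqrt (2 * pi)) ^ DIM('a) = (2 * pi) powr (- real DIM('a) / 2)"
  proof -
    have "(1 / sqrt (2 * pi)) = (2 * pi) powr (- (1/2))"
      by (subst powr_minus_divide) (simp add: powr_half_sqrt)
    then have "(1 / sqrt (2 * pi)) ^ DIM('a) = ((2 * pi) powr (- (1/2))) powr real DIM('a)"
      by (subst powr_realpow) auto
    then show ?thesis by (simp add: powr_powr)
  qed
  finally show ?thesis by (simp add: gauss_dens_def)
qed

lemma nn_integral_std_normal: "(\<integral>\<^sup>+y. ennreal (std_normal_density y) \<partial>lborel) = 1"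
  using prob_space.emeasure_space_1[OF prob_space_normal_density[of 1 0]]
  by (simp add: emeasure_density)

lemma prob_space_std_gauss: "prob_space (std_gauss :: 'a::euclidean_space measure)"
proof (rule prob_spaceI)
  have "emeasure (std_gauss :: 'a measure) (space std_gauss) = (\<integral>\<^sup>+x. (\<Prod>b\<in>Basis. ennreal (std_normal_density ((x::'a) \<bullet> b))) \<partial>lborel)"
    unfolding std_gauss_density by (simp add: emeasure_density gauss_dens_prod prod_ennreal)
  also have "\<dots> = 1"
    by (subst nn_integral_lborel_prod) (simp_all add: nn_integral_std_normal)
  finally show "emeasure (std_gauss :: 'a measure) (space std_gauss) = 1" .
qed

interpretation std_gauss: prob_space "std_gauss :: 'a::euclidean_space measure"
  by (rule prob_space_std_gauss)

lemma std_gauss_reflect: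
  fixes f :: "'a::euclidean_space \<Rightarrow> ennreal"
  assumes e: "norm e = 1 \<or> e = 0" and [measurable]: "f \<in> borel_measurable borel"
  shows "(\<integral>\<^sup>+x. f (reflect e x) \<partial>std_gauss) = (\<integral>\<^sup>+x. f x \<partial>std_gauss)"
proof -
  have "gauss_dens (reflect e x) = gauss_dens x" for x
    by (simp add: gauss_dens_def reflect_norm[OF e])
  then have "(\<integral>\<^sup>+x. f (reflect e x) \<partial>std_gauss)
      = (\<integral>\<^sup>+x. (\<lambda>x. ennreal (gauss_dens x) * f x) (reflect e x) \<partial>lborel)"
    by (simp add: nn_integral_std_gauss)
  also have "\<dots> = (\<integral>\<^sup>+x. ennreal (gauss_dens x) * f x \<partial>lborel)"
    by (rule nn_integral_lborel_isometry) (use reflect_linear reflect_norm[OF e] reflect_reflect[OF e] in auto)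
  finally show ?thesis by (simp add: nn_integral_std_gauss)
qed

lemma std_gauss_basis_moment:
  assumes b: "b \<in> Basis"
  shows "(\<integral>\<^sup>+x. ennreal ((b \<bullet> (x::'a::euclidean_space))\<^sup>2) \<partial>std_gauss) = 1"
proof -
  \<comment> \<open>The integrand factorizes over the coordinates; only the factor of
    \<open>b\<close> carries the square.\<close>
  define f where "f c y = (if c = b then ennreal (std_normal_density y * y\<^sup>2) else ennreal (std_normal_density y))"
    for c :: 'a and y :: real
  have "(\<Prod>c\<in>Basis. f c (x \<bullet> c)) = ennreal (gauss_dens x) * ennreal ((b \<bullet> x)\<^sup>2)" for x
  proof -
    have "(\<Prod>c\<in>Basis. f c (x \<bullet> c)) = f b (x \<bullet> b) * (\<Prod>c\<in>Basis - {b}. f c (x \<bullet> c))"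
      by (rule prod.remove) (use b in auto)
    also have "(\<Prod>c\<in>Basis - {b}. f c (x \<bullet> c)) = (\<Prod>c\<in>Basis - {b}. ennreal (std_normal_density (x \<bullet> c)))"
      by (rule prod.cong) (auto simp: f_def)
    also have "f b (x \<bullet> b) = ennreal ((b \<bullet> x)\<^sup>2) * ennreal (std_normal_density (x \<bullet> b))"
      by (simp add: f_def ennreal_mult mult.commute inner_commute)
    also have "\<dots> * (\<Prod>c\<in>Basis - {b}. ennreal (std_normal_density (x \<bullet> c)))
      = ennreal ((b \<bullet> x)\<^sup>2) * (\<Prod>c\<in>Basis. ennreal (std_normal_density (x \<bullet> c)))"
      by (subst prod.remove[OF _ b]) (simp_all add: mult.assoc)
    finally show ?thesis by (simp add: gauss_dens_prod prod_ennreal mult.commute)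
  qed
  then have "(\<integral>\<^sup>+x. ennreal ((b \<bullet> x)\<^sup>2) \<partial>std_gauss) = (\<integral>\<^sup>+x. (\<Prod>c\<in>Basis. f c (x \<bullet> c)) \<partial>lborel)"
    by (simp add: nn_integral_std_gauss)
  also have "\<dots> = (\<Prod>c\<in>Basis. \<integral>\<^sup>+y. f c y \<partial>lborel)"
    by (rule nn_integral_lborel_prod) (auto simp: f_def)
  also have "\<dots> = 1"
  proof (rule prod.neutral, rule ballI)
    fix c :: 'a
    have "has_bochner_integral lborel (\<lambda>x. std_normal_density x * x ^ (2 * 1)) (fact (2 * 1) / (2 ^ 1 * fact 1))"
      by (rule std_normal_moment_even)
    then have "has_bochner_integral lborel (\<lambda>x. std_normal_density x * x\<^sup>2) 1" by simp
    then have "(\<integral>\<^sup>+x. ennreal (std_normal_density x * x\<^sup>2) \<partial>lborel) = ennreal 1"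
      by (subst nn_integral_eq_integral) (auto simp: has_bochner_integral_iff)
    then show "(\<integral>\<^sup>+y. f c y \<partial>lborel) = 1"
      unfolding f_def by (cases "c = b") (simp_all add: nn_integral_std_normal)
  qed
  finally show ?thesis .
qed

lemma std_gauss_second_moment:
  fixes e :: "'a::euclidean_space"
  assumes e: "norm e = 1"
  shows "(\<integral>\<^sup>+x. ennreal ((e \<bullet> x)\<^sup>2) \<partial>std_gauss) = 1"
proof -
  obtain b :: 'a where b: "b \<in> Basis" using nonempty_Basis by blast
  \<comment> \<open>Unit vectors \<open>e\<close> and \<open>b\<close> are exchanged by the
    reflection along their difference, so the moment in a general direction reduces to that of a
    basis vector. For \<open>e = b\<close> this is the identity.\<close>
  define d where "d = sgn (e - b)"
  have d: "norm d = 1 \<or> d = 0" by (auto simp: d_def norm_sgn)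
  have re: "reflect d e = b"
  proof (cases "e = b")
    case False
    define k where "k = norm (e - b)"
    have k0: "k \<noteq> 0" using False by (simp add: k_def)
    have dk: "d = (1 / k) *\<^sub>R (e - b)" by (simp add: d_def k_def sgn_div_norm divide_inverse)
    have bb: "b \<bullet> b = 1" "e \<bullet> e = 1" using b e by (auto simp: norm_eq_1 inner_Basis)
    have kk: "k\<^sup>2 = 2 * ((e - b) \<bullet> e)"
      unfolding k_def power2_norm_eq_inner by (simp add: algebra_simps inner_commute bb)
    have "(2 * (d \<bullet> e)) *\<^sub>R d = ((2 * ((e - b) \<bullet> e)) / k\<^sup>2) *\<^sub>R (e - b)"
      by (simp add: dk power2_eq_square)
    also have "\<dots> = e - b" using k0 by (simp flip: kk)
    finally show ?thesis by (simp add: reflect_def)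
  qed (simp add: reflect_def d_def)
  have sw: "e \<bullet> reflect d x = b \<bullet> x" for x
  proof -
    have "e \<bullet> reflect d x = reflect d e \<bullet> x"
      by (simp add: reflect_def inner_diff_left inner_diff_right inner_commute)
    then show ?thesis by (simp add: re)
  qed
  have "(\<integral>\<^sup>+x. ennreal ((e \<bullet> x)\<^sup>2) \<partial>std_gauss) = (\<integral>\<^sup>+x. ennreal ((e \<bullet> reflect d x)\<^sup>2) \<partial>std_gauss)"
    by (subst std_gauss_reflect[OF d, of "\<lambda>x. ennreal ((e \<bullet> x)\<^sup>2)"]) auto
  then show ?thesis using std_gauss_basis_moment[OF b] by (simp add: sw)
qed

lemma std_gauss_inner_integrable:
  fixes e :: "'a::euclidean_space"
  assumes e: "norm e = 1"
  shows "integrable std_gauss (\<lambda>x. (e \<bullet> x)\<^sup>2)" "(\<integral>x. (e \<bullet> x)\<^sup>2 \<partial>std_gauss) = 1"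
    "integrable std_gauss (\<lambda>x. e \<bullet> x)" "(\<integral>x. e \<bullet> x \<partial>std_gauss) = 0"
proof -
  have "has_bochner_integral std_gauss (\<lambda>x. (e \<bullet> x)\<^sup>2) 1"
    by (rule has_bochner_integral_nn_integral) (use std_gauss_second_moment[OF e] in auto)
  then show i2: "integrable std_gauss (\<lambda>x. (e \<bullet> x)\<^sup>2)" and "(\<integral>x. (e \<bullet> x)\<^sup>2 \<partial>std_gauss) = 1"
    by (auto simp: has_bochner_integral_iff)
  show i1: "integrable std_gauss (\<lambda>x. e \<bullet> x)"
  proof (rule Bochner_Integration.integrable_bound)
    show "integrable std_gauss (\<lambda>x. 1 + (e \<bullet> x)\<^sup>2)" using i2 by simp
    show "AE x in std_gauss. norm (e \<bullet> x) \<le> norm (1 + (e \<bullet> x)\<^sup>2)"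
    proof (rule AE_I2)
      fix x
      have "0 \<le> (\<bar>e \<bullet> x\<bar> - 1/2)\<^sup>2" by simp
      then have "\<bar>e \<bullet> x\<bar> \<le> 1 + (e \<bullet> x)\<^sup>2" by (simp add: power2_eq_square algebra_simps)
      then show "norm (e \<bullet> x) \<le> norm (1 + (e \<bullet> x)\<^sup>2)" by simp
    qed
  qed measurable
  \<comment> \<open>Reflection along \<open>e\<close> preserves the Gaussian and changes the sign of
    \<open>e \<bullet> x\<close>, so the mean equals its own negative.\<close>
  have d: "distr std_gauss borel (reflect e) = std_gauss"
  proof (rule measure_eqI)
    fix A assume "A \<in> sets (distr std_gauss borel (reflect e))"
    then have [measurable]: "A \<in> sets borel" by simp
    have "emeasure (distr std_gauss borel (reflect e)) A = (\<integral>\<^sup>+x. indicator A (reflect e x) \<partial>std_gauss)"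
      by (subst nn_integral_indicator[symmetric], simp, subst nn_integral_distr) auto
    also have "\<dots> = (\<integral>\<^sup>+x. indicator A x \<partial>std_gauss)" by (rule std_gauss_reflect) (use e in auto)
    finally show "emeasure (distr std_gauss borel (reflect e)) A = emeasure std_gauss A" by simp
  qed simp
  have "(\<integral>x. e \<bullet> x \<partial>std_gauss) = (\<integral>x. e \<bullet> reflect e x \<partial>std_gauss)"
    by (subst (1) d[symmetric], subst integral_distr) auto
  also have "\<dots> = - (\<integral>x. e \<bullet> x \<partial>std_gauss)"
    using e by (simp add: reflect_def inner_diff_right norm_eq_1)
  finally show "(\<integral>x. e \<bullet> x \<partial>std_gauss) = 0" by simp
qed

lemma std_gauss_norm_square: "integrable std_gauss (\<lambda>x::'a::euclidean_space. (norm x)\<^sup>2)"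
proof -
  have "(norm x)\<^sup>2 = (\<Sum>b\<in>Basis. (b \<bullet> x)\<^sup>2)" for x :: 'a
    unfolding power2_norm_eq_inner euclidean_inner[of x x] by (simp add: power2_eq_square inner_commute)
  then show ?thesis by (auto intro!: Bochner_Integration.integrable_sum std_gauss_inner_integrable)
qed

lemma std_gauss_norm: "integrable std_gauss (\<lambda>x::'a::euclidean_space. norm x)"
proof (rule Bochner_Integration.integrable_bound)
  show "integrable std_gauss (\<lambda>x::'a. 1 + (norm x)\<^sup>2)" by (simp add: std_gauss_norm_square)
  show "AE x::'a in std_gauss. norm (norm x) \<le> norm (1 + (norm x)\<^sup>2)"
  proof (rule AE_I2)
    fix x :: 'a
    have "0 \<le> (norm x - 1/2)\<^sup>2" by simp
    then have "norm x \<le> 1 + (norm x)\<^sup>2" by (simp add: power2_eq_square algebra_simps)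
    then show "norm (norm x) \<le> norm (1 + (norm x)\<^sup>2)" by simp
  qed
qed measurable

section \<open>Maximal coupling of a Gaussian with its translate\<close>

definition unif :: "real measure" where "unif = uniform_measure lborel {0..1}"

lemma sets_unif[simp, measurable_cong]: "sets unif = sets borel" and space_unif[simp]: "space unif = UNIV"
  by (simp_all add: unif_def)

interpretation unif: prob_space unif
  unfolding unif_def by (rule prob_space_uniform_measure) auto

interpretation gauss_unif: pair_prob_space "std_gauss :: 'a::euclidean_space measure" unif ..

lemma emeasure_unif_less:
  assumes "0 \<le> c" shows "emeasure unif {..<c} = ennreal (min 1 c)"
proof -
  have "{0..1} \<inter> {..<c} = (if c \<le> 1 then {0..<c} else {0..1::real})" by auto
  then have "emeasure lborel ({0..1} \<inter> {..<c}) = ennreal (min 1 c)"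
    using assms by (auto simp: min_def)
  then show ?thesis unfolding unif_def by (subst emeasure_uniform_measure) (auto simp: divide_ennreal_def)
qed

lemma nn_integral_unif_if:
  assumes "0 \<le> c"
  shows "(\<integral>\<^sup>+u. (if u < c then A else B) \<partial>unif) = ennreal (min 1 c) * A + ennreal (1 - min 1 c) * B"
proof -
  have "emeasure unif (- {..<c}) = 1 - ennreal (min 1 c)"
    using emeasure_compl[of "{..<c}" unif] unif.emeasure_space_1
    by (simp add: emeasure_unif_less[OF assms] Compl_eq_Diff_UNIV)
  also have "\<dots> = ennreal (1 - min 1 c)"
    using assms by (metis ennreal_1 ennreal_minus le_cases min.bounded_iff min_def zero_le_one)
  finally have c: "emeasure unif (- {..<c}) = ennreal (1 - min 1 c)" .
  have "(\<integral>\<^sup>+u. (if u < c then A else B) \<partial>unif) = (\<integral>\<^sup>+u. A * indicator {..<c} u + B * indicator (- {..<c}) u \<partial>unif)"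
    by (rule nn_integral_cong) (simp add: indicator_def)
  also have "\<dots> = A * emeasure unif {..<c} + B * emeasure unif (- {..<c})"
    by (subst nn_integral_add) (simp_all add: nn_integral_cmult_indicator Compl_eq_Diff_UNIV)
  finally show ?thesis by (simp add: emeasure_unif_less[OF assms] c[simplified] mult.commute)
qed

text \<open>The threshold is the density ratio
  \<open>gauss_dens (\<eta> - a) / gauss_dens \<eta>\<close>. Comparing it with an independent
  uniform variable accepts the shift with probability the minimum of 1 and this ratio, as in a
  Metropolis test.\<close>

definition shift_or_reflect :: "'a::euclidean_space \<Rightarrow> 'a \<times> real \<Rightarrow> 'a" where
  "shift_or_reflect a = (\<lambda>(\<eta>, u). if u < exp (a \<bullet> \<eta> - (norm a)\<^sup>2 / 2) then \<eta> - a else reflect (sgn a) \<eta>)"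

lemma nn_integral_shift_or_reflect:
  fixes h :: "'a::euclidean_space \<Rightarrow> 'a \<Rightarrow> ennreal"
  assumes h[measurable]: "case_prod h \<in> borel_measurable (borel \<Otimes>\<^sub>M borel)"
  shows "(\<integral>\<^sup>+w. h (fst w) (shift_or_reflect a w) \<partial>(std_gauss \<Otimes>\<^sub>M unif))
    = (\<integral>\<^sup>+\<eta>. ennreal (min 1 (exp (a \<bullet> \<eta> - (norm a)\<^sup>2 / 2))) * h \<eta> (\<eta> - a)
        + ennreal (1 - min 1 (exp (a \<bullet> \<eta> - (norm a)\<^sup>2 / 2))) * h \<eta> (reflect (sgn a) \<eta>) \<partial>std_gauss)"
proof -
  have "(\<lambda>w. h (fst w) (shift_or_reflect a w)) \<in> borel_measurable (std_gauss \<Otimes>\<^sub>M unif)"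
    unfolding shift_or_reflect_def case_prod_beta' by measurable
  then have "(\<integral>\<^sup>+w. h (fst w) (shift_or_reflect a w) \<partial>(std_gauss \<Otimes>\<^sub>M unif))
    = (\<integral>\<^sup>+\<eta>. \<integral>\<^sup>+u. h \<eta> (shift_or_reflect a (\<eta>, u)) \<partial>unif \<partial>std_gauss)"
    by (subst unif.nn_integral_fst[symmetric]) auto
  also have "\<dots> = (\<integral>\<^sup>+\<eta>. \<integral>\<^sup>+u. (if u < exp (a \<bullet> \<eta> - (norm a)\<^sup>2 / 2) then h \<eta> (\<eta> - a)
        else h \<eta> (reflect (sgn a) \<eta>)) \<partial>unif \<partial>std_gauss)"
    by (intro nn_integral_cong) (simp add: shift_or_reflect_def)
  finally show ?thesis by (simp add: nn_integral_unif_if)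
qed

lemma shift_or_reflect_measurable:
  "shift_or_reflect (a :: 'a::euclidean_space) \<in> borel_measurable (std_gauss \<Otimes>\<^sub>M unif)"
  unfolding shift_or_reflect_def case_prod_beta' by measurable

text \<open>The accepted part, moved by \<open>- a\<close>, has density the minimum of
  \<open>gauss_dens \<eta>\<close> and \<open>gauss_dens (\<eta> + a)\<close>. The reflection maps
  \<open>a\<close> to \<open>- a\<close>, so the rejected part is carried exactly to the remainder
  of \<open>gauss_dens \<eta>\<close> above this minimum.\<close>

lemma distr_shift_or_reflect:
  "distr (std_gauss \<Otimes>\<^sub>M unif) borel (shift_or_reflect (a :: 'a::euclidean_space)) = std_gauss"
proof (rule measure_eqI)
  fix A assume "A \<in> sets (distr (std_gauss \<Otimes>\<^sub>M unif) borel (shift_or_reflect a))"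
  then have A[measurable]: "A \<in> sets borel" by simp
  define R where "R = reflect (sgn a)"
  have e: "norm (sgn a) = 1 \<or> sgn a = 0" by (auto simp: norm_sgn)
  have [measurable]: "R \<in> borel_measurable borel" unfolding R_def by measurable
  note Rn = reflect_norm[OF e, folded R_def] and RR = reflect_reflect[OF e, folded R_def]
  have Ra: "R a = - a"
  proof (cases "a = 0")
    case False
    have "(2 * (sgn a \<bullet> a)) *\<^sub>R sgn a = 2 *\<^sub>R a"
      using False by (simp add: sgn_div_norm power2_norm_eq_inner[symmetric] power2_eq_square)
    then show ?thesis by (simp add: R_def reflect_def scaleR_2)
  qed (simp add: R_def reflect_def)
  \<comment> \<open>The overlap of the Gaussian density with its translate, which is the density of
    accepted proposals.\<close>
  define m where "m \<eta> = min (gauss_dens \<eta>) (gauss_dens (\<eta> - a))" for \<eta>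
  have [measurable]: "m \<in> borel_measurable borel" unfolding m_def by measurable
  have m0: "0 \<le> m \<eta>" "m \<eta> \<le> gauss_dens \<eta>" for \<eta> by (auto simp: m_def gauss_dens_nonneg)
  have mult: "gauss_dens \<eta> * min 1 (exp (a \<bullet> \<eta> - (norm a)\<^sup>2 / 2)) = m \<eta>" for \<eta>
  proof -
    have "gauss_dens \<eta> * exp (a \<bullet> \<eta> - (norm a)\<^sup>2 / 2) = gauss_dens (\<eta> - a)"
      unfolding gauss_dens_def power2_norm_eq_inner mult.assoc exp_add[symmetric]
      by (intro arg_cong2[where f="(*)"] refl arg_cong[where f=exp])
         (simp add: inner_diff_left inner_diff_right inner_commute algebra_simps field_simps)
    then show ?thesis
      unfolding m_def using gauss_dens_pos[of \<eta>] by (simp add: min_mult_distrib_left)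
  qed
  have mR: "m (R \<eta>) = min (gauss_dens \<eta>) (gauss_dens (\<eta> + a))" for \<eta>
  proof -
    have "R (R \<eta> - a) = \<eta> + a"
      using linear_diff[OF reflect_linear, of "sgn a"] by (simp add: R_def[symmetric] RR Ra)
    then have 1: "norm (R \<eta> - a) = norm (\<eta> + a)" using Rn[of "R \<eta> - a"] by simp
    have "gauss_dens (R \<eta>) = gauss_dens \<eta>" "gauss_dens (R \<eta> - a) = gauss_dens (\<eta> + a)"
      unfolding gauss_dens_def 1 Rn by (rule refl)+
    then show ?thesis by (simp add: m_def)
  qed
  have [measurable]: "shift_or_reflect a \<in> borel_measurable (std_gauss \<Otimes>\<^sub>M unif)"
    by (rule shift_or_reflect_measurable)
  have "emeasure (distr (std_gauss \<Otimes>\<^sub>M unif) borel (shift_or_reflect a)) A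
    = (\<integral>\<^sup>+w. indicator A (shift_or_reflect a w) \<partial>(std_gauss \<Otimes>\<^sub>M unif))"
    by (subst nn_integral_indicator[symmetric], simp, subst nn_integral_distr) auto
  also have "\<dots> = (\<integral>\<^sup>+\<eta>. ennreal (min 1 (exp (a \<bullet> \<eta> - (norm a)\<^sup>2 / 2))) * indicator A (\<eta> - a)
        + ennreal (1 - min 1 (exp (a \<bullet> \<eta> - (norm a)\<^sup>2 / 2))) * indicator A (R \<eta>) \<partial>std_gauss)"
    using nn_integral_shift_or_reflect[of "\<lambda>_ x. indicator A x" a] by (simp add: R_def)
  also have "\<dots> = (\<integral>\<^sup>+\<eta>. ennreal (m \<eta>) * indicator A (\<eta> - a) + ennreal (gauss_dens \<eta> - m \<eta>) * indicator A (R \<eta>) \<partial>lborel)"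
  proof (subst nn_integral_std_gauss)
    have "ennreal (gauss_dens \<eta>) * (ennreal (min 1 (exp (a \<bullet> \<eta> - (norm a)\<^sup>2 / 2))) * indicator A (\<eta> - a)
        + ennreal (1 - min 1 (exp (a \<bullet> \<eta> - (norm a)\<^sup>2 / 2))) * indicator A (R \<eta>))
      = ennreal (m \<eta>) * indicator A (\<eta> - a) + ennreal (gauss_dens \<eta> - m \<eta>) * indicator A (R \<eta>)" for \<eta>
      unfolding distrib_left mult.assoc[symmetric]
      by (subst (1 2) ennreal_mult[symmetric]) (auto simp: gauss_dens_nonneg mult right_diff_distrib)
    then show "(\<integral>\<^sup>+\<eta>. ennreal (gauss_dens \<eta>) * (ennreal (min 1 (exp (a \<bullet> \<eta> - (norm a)\<^sup>2 / 2))) * indicator A (\<eta> - a)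
        + ennreal (1 - min 1 (exp (a \<bullet> \<eta> - (norm a)\<^sup>2 / 2))) * indicator A (R \<eta>)) \<partial>lborel)
      = (\<integral>\<^sup>+\<eta>. ennreal (m \<eta>) * indicator A (\<eta> - a) + ennreal (gauss_dens \<eta> - m \<eta>) * indicator A (R \<eta>) \<partial>lborel)"
      by simp
  qed measurable
  also have "\<dots> = (\<integral>\<^sup>+\<eta>. ennreal (m \<eta>) * indicator A (\<eta> - a) \<partial>lborel)
      + (\<integral>\<^sup>+\<eta>. ennreal (gauss_dens \<eta> - m \<eta>) * indicator A (R \<eta>) \<partial>lborel)"
    by (rule nn_integral_add) auto
  also have "(\<integral>\<^sup>+\<eta>. ennreal (m \<eta>) * indicator A (\<eta> - a) \<partial>lborel) = (\<integral>\<^sup>+\<eta>. ennreal (m (a + \<eta>)) * indicator A \<eta> \<partial>lborel)"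
    using nn_integral_lborel_translate[of "\<lambda>\<eta>. ennreal (m \<eta>) * indicator A (\<eta> - a)" a] by simp
  also have "(\<integral>\<^sup>+\<eta>. ennreal (gauss_dens \<eta> - m \<eta>) * indicator A (R \<eta>) \<partial>lborel)
      = (\<integral>\<^sup>+\<eta>. ennreal (gauss_dens \<eta> - m (R \<eta>)) * indicator A \<eta> \<partial>lborel)"
  proof -
    have "gauss_dens (R \<eta>) = gauss_dens \<eta>" for \<eta> by (simp add: gauss_dens_def Rn)
    then show ?thesis
      using nn_integral_lborel_isometry[of R "\<lambda>\<eta>. ennreal (gauss_dens \<eta> - m \<eta>) * indicator A (R \<eta>)"]
      by (simp add: Rn RR reflect_linear[of "sgn a", folded R_def])
  qed
  also have "(\<integral>\<^sup>+\<eta>. ennreal (m (a + \<eta>)) * indicator A \<eta> \<partial>lborel)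
      + (\<integral>\<^sup>+\<eta>. ennreal (gauss_dens \<eta> - m (R \<eta>)) * indicator A \<eta> \<partial>lborel)
    = (\<integral>\<^sup>+\<eta>. ennreal (m (a + \<eta>)) * indicator A \<eta> + ennreal (gauss_dens \<eta> - m (R \<eta>)) * indicator A \<eta> \<partial>lborel)"
    by (rule nn_integral_add[symmetric]) auto
  also have "\<dots> = (\<integral>\<^sup>+\<eta>. ennreal (gauss_dens \<eta>) * indicator A \<eta> \<partial>lborel)"
  proof (rule nn_integral_cong)
    fix \<eta>
    have "m (a + \<eta>) = m (R \<eta>)"
      unfolding mR by (simp add: m_def add.commute min.commute)
    then have "m (a + \<eta>) + (gauss_dens \<eta> - m (R \<eta>)) = gauss_dens \<eta>" by simp
    then have "ennreal (m (a + \<eta>)) + ennreal (gauss_dens \<eta> - m (R \<eta>)) = ennreal (gauss_dens \<eta>)"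
      by (subst ennreal_plus[symmetric]) (auto simp: m0 mR gauss_dens_nonneg)
    then show "ennreal (m (a + \<eta>)) * indicator A \<eta> + ennreal (gauss_dens \<eta> - m (R \<eta>)) * indicator A \<eta>
      = ennreal (gauss_dens \<eta>) * indicator A \<eta>" by (simp add: distrib_right[symmetric])
  qed
  also have "\<dots> = emeasure std_gauss A"
    unfolding std_gauss_density by (simp add: emeasure_density)
  finally show "emeasure (distr (std_gauss \<Otimes>\<^sub>M unif) borel (shift_or_reflect a)) A = emeasure std_gauss A" .
qed simp

section \<open>The concave distance function\<close>

text \<open>The number enters through \<open>cut / T\<close>, which exceeds
  \<open>5 * Rt / (4 * T)\<close> by 5/2. Squaring reduces both bounds to fifth powers of rational
  bounds for \<open>exp 1\<close>.\<close>

lemma exp_five_halves: "12 \<le> exp (5/2 :: real)" "exp (5/2 :: real) \<le> 25/2"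
proof -
  have e: "271/100 \<le> exp (1::real)" "exp (1::real) \<le> 272/100"
    using e_approx_32 e_less_272 by (simp_all add: abs_if split: if_splits)
  have p: "(exp (5/2 :: real))\<^sup>2 = (exp 1) ^ 5"
    by (simp add: exp_of_nat_mult[symmetric] power2_eq_square exp_add[symmetric])
  have "12\<^sup>2 \<le> (271/100 :: real) ^ 5" "(272/100 :: real) ^ 5 \<le> (25/2)\<^sup>2" by (simp_all add: eval_nat_numeral)
  moreover have "(271/100 :: real) ^ 5 \<le> exp 1 ^ 5" "exp 1 ^ 5 \<le> (272/100 :: real) ^ 5"
    using e by (auto intro!: power_mono)
  ultimately have "12\<^sup>2 \<le> (exp (5/2 :: real))\<^sup>2" "(exp (5/2 :: real))\<^sup>2 \<le> (25/2)\<^sup>2"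
    unfolding p by linarith+
  then show "12 \<le> exp (5/2 :: real)" "exp (5/2 :: real) \<le> 25/2"
    by (auto intro: power2_le_imp_le)
qed

locale concave_dist =
  fixes a T :: real
  assumes a0: "0 \<le> a" and T0: "0 < T"
begin

text \<open>The decay of the slope makes \<open>cf\<close> saturate; freezing it from
  \<open>a\<close> on keeps \<open>cf\<close> comparable to the Euclidean distance.\<close>

definition slope :: "real \<Rightarrow> real" where "slope s = exp (- min a s / T)"

definition cf :: "real \<Rightarrow> real" where "cf r = integral {0..r} slope"

lemma slope_antimono: "r \<le> s \<Longrightarrow> slope s \<le> slope r"
  unfolding slope_def using T0 by (simp add: divide_right_mono min_le_iff_disj)

lemma slope_bounds: "exp (- a / T) \<le> slope s" "0 \<le> s \<Longrightarrow> slope s \<le> 1" "0 < slope s"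
  unfolding slope_def using T0 a0 by (simp_all add: divide_right_mono)

lemma slope_integrable: "slope integrable_on {r..s}"
  unfolding slope_def using T0 by (intro integrable_continuous_interval continuous_intros) auto

lemma cf_diff: "0 \<le> r \<Longrightarrow> r \<le> s \<Longrightarrow> cf s = cf r + integral {r..s} slope"
  unfolding cf_def by (rule Henstock_Kurzweil_Integration.integral_combine[symmetric]) (auto intro: slope_integrable)

lemma cf_diff_le:
  assumes "0 \<le> r" "r \<le> s" "\<And>u. u \<in> {r..s} \<Longrightarrow> slope u \<le> C" shows "cf s \<le> cf r + C * (s - r)"
proof -
  have "integral {r..s} slope \<le> integral {r..s} (\<lambda>_. C)"
    by (intro integral_le slope_integrable assms(3)) auto
  also have "\<dots> = C * (s - r)" using assms(2) by simp
  finally show ?thesis unfolding cf_diff[OF assms(1,2)] by simp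
qed

lemma cf_diff_ge:
  assumes "0 \<le> r" "r \<le> s" "\<And>u. u \<in> {r..s} \<Longrightarrow> C \<le> slope u" shows "cf r + C * (s - r) \<le> cf s"
proof -
  have "C * (s - r) = integral {r..s} (\<lambda>_. C)" using assms(2) by simp
  also have "\<dots> \<le> integral {r..s} slope"
    by (intro integral_le slope_integrable assms(3)) auto
  finally show ?thesis unfolding cf_diff[OF assms(1,2)] by simp
qed

lemma cf_0[simp]: "cf 0 = 0" by (simp add: cf_def)

lemma cf_concave: assumes "0 \<le> r" "0 \<le> s" shows "cf s \<le> cf r + slope r * (s - r)"
proof (cases "r \<le> s")
  case True then show ?thesis using assms by (intro cf_diff_le) (auto intro: slope_antimono)
next
  case False
  then have "cf s + slope r * (r - s) \<le> cf r" using assms by (intro cf_diff_ge) (auto intro: slope_antimono)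
  then show ?thesis by (simp add: algebra_simps)
qed

lemma cf_mono: "0 \<le> r \<Longrightarrow> r \<le> s \<Longrightarrow> cf r \<le> cf s"
  using cf_diff_ge[of r s 0] slope_bounds(3) by (simp add: less_imp_le)

lemma cf_nonneg: "0 \<le> r \<Longrightarrow> 0 \<le> cf r"
  using cf_mono[of 0 r] by simp

lemma cf_measurable[measurable]: "cf \<in> borel_measurable borel"
proof (rule borel_measurable_mono, rule monoI)
  fix r s :: real assume "r \<le> s"
  \<comment> \<open>For a negative argument the interval of integration is empty and
    \<open>cf\<close> is 0, so monotonicity extends to the whole line.\<close>
  then show "cf r \<le> cf s"
    using cf_mono[of r s] cf_nonneg[of s] by (cases "0 \<le> r"; cases "0 \<le> s") (auto simp: cf_def)
qed

lemma cf_le: "0 \<le> r \<Longrightarrow> cf r \<le> r"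
  using cf_diff_le[of 0 r 1] slope_bounds(2) by simp

lemma cf_ge: "0 \<le> r \<Longrightarrow> exp (- a / T) * r \<le> cf r"
  using cf_diff_ge[of 0 r "exp (- a / T)"] slope_bounds(1) by simp

lemma cf_add_le: assumes "0 \<le> r" "0 \<le> d" shows "cf (r + d) \<le> cf r + d"
  using cf_diff_le[of r "r + d" 1] slope_bounds(2) assms by simp

lemma cf_exp: assumes "0 \<le> r" "r \<le> s" "s \<le> a" shows "cf s = cf r + T * (exp (- r / T) - exp (- s / T))"
proof -
  have "((\<lambda>u. exp (- u / T)) has_integral (- T * exp (- s / T) - (- T * exp (- r / T)))) {r..s}"
  proof (rule fundamental_theorem_of_calculus)
    fix u
    show "((\<lambda>u. - T * exp (- u / T)) has_vector_derivative exp (- u / T)) (at u within {r..s})"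
      unfolding has_real_derivative_iff_has_vector_derivative[symmetric]
      using T0 by (auto intro!: derivative_eq_intros)
  qed (use assms in auto)
  then have "integral {r..s} (\<lambda>u. exp (- u / T)) = T * (exp (- r / T) - exp (- s / T))"
    by (simp add: integral_unique algebra_simps)
  moreover have "integral {r..s} slope = integral {r..s} (\<lambda>u. exp (- u / T))"
    by (rule integral_cong) (use assms in \<open>auto simp: slope_def min_def\<close>)
  ultimately show ?thesis using cf_diff[OF assms(1,2)] by simp
qed

text \<open>All that can be gained between \<open>r\<close> and \<open>a\<close> is the tail
  \<open>T * exp (- r / T)\<close> of the exponential slope, however large \<open>s\<close> is.
  Beyond \<open>a\<close> the growth is linear, with the smallest slope.\<close>

lemma cf_saturation:
  assumes "0 \<le> r" "r \<le> a" "0 \<le> s"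
  shows "cf s \<le> cf r + T * exp (- r / T) + exp (- a / T) * max 0 (s - a)"
proof -
  have 1: "cf u \<le> cf r + T * exp (- r / T)" if "0 \<le> u" "u \<le> a" for u
  proof (cases "r \<le> u")
    case True
    have "cf u = cf r + T * exp (- r / T) - T * exp (- u / T)"
      using cf_exp[of r u] True assms that by (simp add: right_diff_distrib)
    moreover have "0 \<le> T * exp (- u / T)" using T0 by simp
    ultimately show ?thesis by linarith
  next
    case False
    then have "cf u \<le> cf r" using that by (intro cf_mono) auto
    moreover have "0 \<le> T * exp (- r / T)" using T0 by simp
    ultimately show ?thesis by linarith
  qed
  show ?thesis
  proof (cases "s \<le> a")
    case True then show ?thesis using 1[of s] assms by simp
  next
    case False
    then have "cf s \<le> cf a + exp (- a / T) * (s - a)"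
      using cf_concave[of a s] a0 by (simp add: slope_def)
    then show ?thesis using 1[of a] a0 False by simp
  qed
qed

end

section \<open>One-particle contraction in expectation\<close>

text \<open>The smallness assumption of the statement, split into its two terms: 3/20 is 3/5 times
  1/4, and the second term, which is quadratic in \<open>L * T * Rt\<close>, becomes linear by a
  square root, with \<open>(3/80)\<^sup>2 = 9/6400\<close>. The bound on \<open>K\<close> follows
  from the convexity condition.\<close>

locale hmc_params =
  fixes L K Rt T :: real
  assumes L0: "0 < L" and K0: "0 < K" and Rt0: "0 \<le> Rt" and Tpos: "0 < T"
    and KL: "K \<le> L / 4" and LT: "L * T\<^sup>2 \<le> 3/20" and LTR: "L * T * Rt \<le> 3/80"
begin

definition cut :: real where "cut = 5 / 4 * (Rt + 2 * T)"

sublocale concave_dist cut T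
  by unfold_locales (use Rt0 Tpos in \<open>auto simp: cut_def\<close>)

text \<open>For \<open>Rt = 0\<close> the junk value of \<open>1 / (4 * Rt)\<close> makes \<open>gam = 0\<close>; then no pair is closer than \<open>Rt\<close>.\<close>

definition gam :: real where "gam = min (1 / T) (1 / (4 * Rt))"

definition rate :: real where "rate = K * T\<^sup>2 * exp (- 5 * Rt / (4 * T))"

lemma rate_pos: "0 < rate" using K0 Tpos by (simp add: rate_def)

lemma KT: "K * T\<^sup>2 \<le> 3/80"
proof -
  have "K * T\<^sup>2 \<le> (L / 4) * T\<^sup>2" using KL by (intro mult_right_mono) auto
  then show ?thesis using LT by simp
qed

lemma rate_le: "rate \<le> 3/80"
proof -
  have "rate \<le> K * T\<^sup>2 * 1" unfolding rate_def
    using K0 Rt0 Tpos by (intro mult_left_mono) auto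
  then show ?thesis using KT by simp
qed

lemma exp_cut: "exp (- cut / T) = exp (- 5 * Rt / (4 * T)) * exp (- (5/2))"
proof -
  have "- cut / T = - 5 * Rt / (4 * T) + - (5/2)" using Tpos by (simp add: cut_def field_simps)
  then show ?thesis by (simp only: exp_add)
qed

lemma rate_exp_cut: "K * T\<^sup>2 * exp (- cut / T) = rate * exp (- (5/2))"
  unfolding rate_def exp_cut by (simp only: mult.assoc)

text \<open>The two terms in the minimum defining \<open>gam\<close> correspond to the two bounds on
  \<open>L\<close>. The last claim says that the force displaces a pair by at most a fixed fraction
  of what the velocity shift removes.\<close>

lemma gam_facts:
  assumes "0 < Rt"
  shows "0 < gam" "gam * T \<le> 1" "gam * Rt \<le> 1/4" "L * T\<^sup>2 \<le> 3/20 * (gam * T)"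
proof -
  show "0 < gam" using assms Tpos by (simp add: gam_def)
  show "gam * T \<le> 1" using Tpos by (simp add: gam_def min_def field_simps split: if_splits)
  show "gam * Rt \<le> 1/4" using assms by (simp add: gam_def min_def field_simps split: if_splits)
  have "gam * T = min 1 (T / (4 * Rt))" using Tpos assms by (auto simp: gam_def min_def field_simps)
  moreover have "L * T\<^sup>2 \<le> 3/20 * (T / (4 * Rt))"
  proof -
    have "L * T\<^sup>2 * Rt \<le> 3/80 * T" using mult_right_mono[OF LTR, of T] Tpos by (simp add: power2_eq_square mult_ac)
    then show ?thesis using assms by (simp add: field_simps)
  qed
  ultimately show "L * T\<^sup>2 \<le> 3/20 * (gam * T)" using LT by (simp add: min_def)
qed

text \<open>Near pairs contract with \<open>gam * T\<close>, which decays only like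
  \<open>T / Rt\<close>, times a slope of at least \<open>exp (- Rt / T)\<close>. The exponent in
  \<open>rate\<close> is larger by a quarter of \<open>Rt / T\<close>, and this surplus pays for the
  algebraic factor. The threshold 1/16 is \<open>5/3 * (3/80)\<close>.\<close>

lemma gam_rate:
  assumes "0 < Rt" "r \<le> Rt"
  shows "5/3 * rate \<le> gam * T * exp (- r / T)"
proof -
  define S where "S = Rt / T"
  have S0: "0 < S" using assms Tpos by (simp add: S_def)
  have gT: "gam * T = min 1 (1 / (4 * S))" using Tpos assms by (auto simp: gam_def min_def field_simps S_def)
  have e: "1 + S / 4 \<le> exp (S / 4)" by (rule exp_ge_add_one_self)
  have "1/16 \<le> (1 / (4 * S)) * (1 + S / 4)" using S0 by (simp add: field_simps)
  also have "\<dots> \<le> (1 / (4 * S)) * exp (S / 4)" using S0 by (intro mult_left_mono e) auto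
  finally have "1/16 \<le> (1 / (4 * S)) * exp (S / 4)" .
  moreover have "1/16 \<le> 1 * exp (S / 4)" using e S0 by linarith
  ultimately have "1/16 \<le> gam * T * exp (S / 4)" unfolding gT by (simp add: min_def)
  then have "1/16 * exp (- (5 * S / 4)) \<le> gam * T * exp (S / 4) * exp (- (5 * S / 4))"
    by (intro mult_right_mono) auto
  also have "\<dots> = gam * T * exp (- S)" by (simp add: mult.assoc exp_add[symmetric])
  also have "\<dots> \<le> gam * T * exp (- r / T)"
    using assms Tpos gam_facts(1)[OF assms(1)] by (intro mult_left_mono) (auto simp: S_def divide_right_mono)
  finally have 1: "1/16 * exp (- (5 * S / 4)) \<le> gam * T * exp (- r / T)" .
  have "rate = K * T\<^sup>2 * exp (- (5 * S / 4))" by (simp add: rate_def S_def)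
  also have "\<dots> \<le> 3/80 * exp (- (5 * S / 4))" by (intro mult_right_mono KT) auto
  finally show ?thesis using 1 by linarith
qed

section \<open>Coupled velocities and the bound for one particle\<close>

definition vel :: "'a::euclidean_space \<Rightarrow> 'a \<Rightarrow> 'a \<times> real \<Rightarrow> 'a" where
  "vel x y w = (if norm (x - y) < Rt then shift_or_reflect (gam *\<^sub>R (x - y)) w else fst w)"

text \<open>The maximal distance during free flight: the norm is convex in time, so its maximum is
  attained at an endpoint.\<close>

definition amp :: "'a::euclidean_space \<Rightarrow> 'a \<Rightarrow> 'a \<Rightarrow> real" where
  "amp x y w = max (norm (x - y)) (norm (x - y + T *\<^sub>R w))"

text \<open>\<open>w\<close> is the difference of the initial velocities. The constant is
  \<open>20/37 = (1/2) / (1 - 3/40)\<close>: bounding the trajectory by its own maximum costs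
  \<open>L * T\<^sup>2 / 2 \<le> 3/40\<close> of that maximum.\<close>

definition goal :: "'a::euclidean_space \<Rightarrow> 'a \<Rightarrow> 'a \<Rightarrow> real" where
  "goal x y w = (if norm (x - y) < Rt then cf (norm (x - y + T *\<^sub>R w) + 20/37 * (L * T\<^sup>2) * amp x y w)
     else cf ((1 - K * T\<^sup>2 / 3) * norm (x - y)))"

lemma amp_nonneg: "0 \<le> amp x y w" by (simp add: amp_def le_max_iff_disj)

lemma goal_nonneg: "0 \<le> goal x y w"
  unfolding goal_def using amp_nonneg[of x y w] L0 KT by (auto intro!: cf_nonneg add_nonneg_nonneg)

lemma one_minus_min_exp: "1 - min 1 (exp (- x)) \<le> max 0 (x :: real)"
  using exp_ge_add_one_self[of "- x"] by (auto simp: min_def max_def)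

text \<open>The positive part of \<open>x\<close> lies below the parabola
  \<open>(x + 1)\<^sup>2 / 4\<close>, which touches it at 1. This trades a truncated expectation for
  second moments, which suffices for the constants below.\<close>

lemma one_minus_min_exp_le_square:
  fixes x c :: real
  assumes "0 \<le> c"
  shows "1 - min 1 (exp (- x * c)) \<le> c * ((x + 1)\<^sup>2 / 4)"
proof -
  note that = assms
  have "max 0 x \<le> (x + 1)\<^sup>2 / 4"
  proof -
    have "0 \<le> (x - 1)\<^sup>2" by simp
    then have "x \<le> (x + 1)\<^sup>2 / 4" by (simp add: power2_eq_square algebra_simps)
    then show ?thesis by (auto simp: max_def)
  qed
  then have "c * max 0 x \<le> c * ((x + 1)\<^sup>2 / 4)" by (rule mult_left_mono[OF _ that])
  moreover have "max 0 (x * c) = c * max 0 x" using that by (auto simp: max_def mult.commute zero_le_mult_iff mult_le_0_iff)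
  ultimately show ?thesis using one_minus_min_exp[of "x * c"] by simp
qed

text \<open>Here the rejection probability is already multiplied by the size of the jump, so its
  linear bound gives a quadratic expression at once;
  \<open>2 * \<bar>n\<bar> \<le> 1 + n\<^sup>2\<close> removes the remaining absolute value.\<close>

lemma one_minus_min_exp_abs_le:
  fixes n :: real
  assumes "0 \<le> c" "0 \<le> A"
  shows "(1 - min 1 (exp (- (A - n) * c))) * \<bar>n\<bar> \<le> c * (n\<^sup>2 + A * (1 + n\<^sup>2) / 2)"
proof -
  have "(1 - min 1 (exp (- (A - n) * c))) * \<bar>n\<bar> \<le> max 0 ((A - n) * c) * \<bar>n\<bar>"
    using one_minus_min_exp[of "(A - n) * c"] unfolding mult_minus_left by (intro mult_right_mono) auto
  also have "\<dots> \<le> (c * (A + \<bar>n\<bar>)) * \<bar>n\<bar>"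
    using assms by (intro mult_right_mono) (auto simp: max_def mult.commute intro!: mult_left_mono)
  also have "\<dots> = c * (n\<^sup>2 + A * \<bar>n\<bar>)" by (simp add: algebra_simps power2_eq_square)
  also have "\<dots> \<le> c * (n\<^sup>2 + A * (1 + n\<^sup>2) / 2)"
  proof -
    have "0 \<le> (\<bar>n\<bar> - 1)\<^sup>2" by simp
    then have "2 * \<bar>n\<bar> \<le> 1 + n\<^sup>2" by (simp add: power2_eq_square algebra_simps)
    from mult_left_mono[OF this assms(2)] show ?thesis using assms by (intro mult_left_mono add_left_mono) auto
  qed
  finally show ?thesis .
qed

text \<open>A quadratic majorant in \<open>n = e \<bullet> \<eta>\<close>, whose Gaussian mean is explicit, of the conditional
  expectation given \<open>\<eta>\<close>: the first term is the outcome of the shift, the others bound the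
  contribution of the reflection, which has probability \<open>1 - min 1 q\<close>.\<close>

definition small_poly :: "real \<Rightarrow> real \<Rightarrow> real \<Rightarrow> real" where
  "small_poly \<kappa> r n = cf r + \<kappa> * r - 34/37 * (gam * T) * r * exp (- r / T)
     + gam * r * ((gam * r / 2 - n + 1)\<^sup>2 / 4) * ((34/37 * (gam * T) * r + T) * exp (- r / T))
     + gam * r * (n\<^sup>2 + (gam * r / 2) * (1 + n\<^sup>2) / 2) * (20/111 * T * exp (- r / T) + 2 * \<kappa> * T)"

lemma small_pointwise:
  fixes x y e a \<eta> :: "'a::euclidean_space"
  assumes Rt: "0 < Rt" and r: "r = norm (x - y)" "0 < r" "r < Rt" and k: "0 \<le> \<kappa>"
    and e: "e = sgn (x - y)" and a_def: "a = gam *\<^sub>R (x - y)"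
    and q_def: "q = exp (a \<bullet> \<eta> - (norm a)\<^sup>2 / 2)"
  shows "min 1 q * (goal x y (\<eta> - a - \<eta>) + \<kappa> * amp x y (\<eta> - a - \<eta>))
     + (1 - min 1 q) * (goal x y (reflect (sgn a) \<eta> - \<eta>) + \<kappa> * amp x y (reflect (sgn a) \<eta> - \<eta>))
     \<le> small_poly \<kappa> r (e \<bullet> \<eta>)"
proof -
  note g = gam_facts[OF Rt]
  define n where "n = e \<bullet> \<eta>"
  define A where "A = gam * r / 2"
  \<comment> \<open>Net contraction after a shift: the shift removes the fraction
    \<open>gam * T\<close>, and the force returns at most \<open>20/37 * (3/20) = 3/37\<close> of
    that.\<close>
  define \<delta> where "\<delta> = 34/37 * (gam * T)"
  define fp where "fp = exp (- r / T)"
  define p where "p = 1 - min 1 q"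
  have ne: "norm e = 1" using r by (simp add: e norm_sgn)
  have z: "x - y = r *\<^sub>R e" using r by (simp add: e sgn_div_norm)
  have sa: "sgn a = e" using g(1) by (simp add: a_def e sgn_scaleR)
  have fp0: "0 < fp" by (simp add: fp_def)
  have rc: "r \<le> cut" using r(2,3) Tpos unfolding cut_def by argo
  then have "min cut r = r" by simp
  then have fp_slope: "slope r = fp" by (simp add: slope_def fp_def)
  have A0: "0 \<le> A" using g(1) r by (simp add: A_def)
  have gr: "0 \<le> gam * r" using g(1) r by simp
  have q: "q = exp (- (A - n) * (gam * r))"
    unfolding q_def a_def z n_def A_def using ne r g(1)
    by (simp add: power_mult_distrib algebra_simps power2_eq_square)
  have p0: "0 \<le> p" by (simp add: p_def)
  have pb: "p \<le> gam * r * ((A - n + 1)\<^sup>2 / 4)"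
    unfolding p_def q by (rule one_minus_min_exp_le_square[OF gr])
  have pn: "p * \<bar>n\<bar> \<le> gam * r * (n\<^sup>2 + A * (1 + n\<^sup>2) / 2)"
    unfolding p_def q by (rule one_minus_min_exp_abs_le[OF gr A0])
  have d1: "\<delta> \<le> 1" "0 \<le> \<delta>" using g(1,2) Tpos by (auto simp: \<delta>_def)
  have LTg: "20/37 * (L * T\<^sup>2) \<le> 3/37 * (gam * T)" using g(4) by simp
  have "x - y + T *\<^sub>R (\<eta> - a - \<eta>) = ((1 - gam * T) * r) *\<^sub>R e" by (simp add: a_def z algebra_simps)
  then have nrm1: "norm (x - y + T *\<^sub>R (\<eta> - a - \<eta>)) = (1 - gam * T) * r" using g(2) r ne by (simp add: abs_mult)
  have amp1: "amp x y (\<eta> - a - \<eta>) = r"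
  proof -
    have "0 \<le> gam * T * r" using g(1) Tpos r by simp
    then have "(1 - gam * T) * r \<le> r" by (simp add: left_diff_distrib)
    then show ?thesis unfolding amp_def nrm1 r(1)[symmetric] by simp
  qed
  have goal1: "goal x y (\<eta> - a - \<eta>) \<le> cf r - \<delta> * r * fp"
  proof -
    have "20/37 * (L * T\<^sup>2) * r \<le> 3/37 * (gam * T) * r" using LTg r by (intro mult_right_mono) auto
    then have "(1 - gam * T) * r + 20/37 * (L * T\<^sup>2) * r \<le> (1 - \<delta>) * r" by (simp add: \<delta>_def algebra_simps)
    moreover have "0 \<le> (1 - gam * T) * r + 20/37 * (L * T\<^sup>2) * r" using g(2) r L0 by simp
    ultimately have "goal x y (\<eta> - a - \<eta>) \<le> cf ((1 - \<delta>) * r)"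
      unfolding goal_def nrm1 amp1 using r by (simp add: cf_mono)
    also have "\<dots> \<le> cf r + slope r * ((1 - \<delta>) * r - r)"
      using r d1 by (intro cf_concave) auto
    finally show ?thesis unfolding fp_slope by (simp add: algebra_simps)
  qed
  have rf: "reflect (sgn a) \<eta> - \<eta> = (- 2 * n) *\<^sub>R e" by (simp add: reflect_def sa n_def)
  have "x - y + T *\<^sub>R (reflect (sgn a) \<eta> - \<eta>) = (r - 2 * T * n) *\<^sub>R e"
    unfolding rf z by (simp add: algebra_simps)
  then have "norm (x - y + T *\<^sub>R (reflect (sgn a) \<eta> - \<eta>)) = \<bar>r - 2 * T * n\<bar>"
    using ne by (simp only: norm_scaleR mult_1_right)
  also have "\<dots> \<le> \<bar>r\<bar> + \<bar>2 * T * n\<bar>" by (rule abs_triangle_ineq4)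
  finally have nrm2: "norm (x - y + T *\<^sub>R (reflect (sgn a) \<eta> - \<eta>)) \<le> r + 2 * T * \<bar>n\<bar>"
    using r(2) Tpos by (simp add: abs_mult)
  have amp2: "amp x y (reflect (sgn a) \<eta> - \<eta>) \<le> r + 2 * T * \<bar>n\<bar>"
    unfolding amp_def using nrm2 r Tpos by simp
  have goal2: "goal x y (reflect (sgn a) \<eta> - \<eta>) \<le> cf r + T * fp + 20/111 * T * fp * \<bar>n\<bar>"
  proof -
    \<comment> \<open>A reflected pair ends within \<open>r + 2 * T * \<bar>n\<bar>\<close>,
      enlarged by the force contribution 3/37 of \<open>amp\<close>.\<close>
    let ?s = "40/37 * (r + 2 * T * \<bar>n\<bar>)"
    have "20/37 * (L * T\<^sup>2) * amp x y (reflect (sgn a) \<eta> - \<eta>) \<le> 3/37 * (r + 2 * T * \<bar>n\<bar>)"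
    proof -
      have "20/37 * (L * T\<^sup>2) * amp x y (reflect (sgn a) \<eta> - \<eta>) \<le> 3/37 * amp x y (reflect (sgn a) \<eta> - \<eta>)"
        using LT by (intro mult_right_mono amp_nonneg) auto
      then show ?thesis using amp2 by simp
    qed
    with nrm2 have le: "norm (x - y + T *\<^sub>R (reflect (sgn a) \<eta> - \<eta>))
        + 20/37 * (L * T\<^sup>2) * amp x y (reflect (sgn a) \<eta> - \<eta>) \<le> ?s" by argo
    have "goal x y (reflect (sgn a) \<eta> - \<eta>)
        = cf (norm (x - y + T *\<^sub>R (reflect (sgn a) \<eta> - \<eta>)) + 20/37 * (L * T\<^sup>2) * amp x y (reflect (sgn a) \<eta> - \<eta>))"
      unfolding goal_def using r by simp
    also have "\<dots> \<le> cf ?s"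
      using L0 by (intro cf_mono le add_nonneg_nonneg mult_nonneg_nonneg amp_nonneg) auto
    finally have "goal x y (reflect (sgn a) \<eta> - \<eta>) \<le> cf ?s" .
    also have "\<dots> \<le> cf r + T * exp (- r / T) + exp (- cut / T) * max 0 (?s - cut)"
      by (rule cf_saturation) (use r(2) rc Tpos in auto)
    also have "max 0 (?s - cut) \<le> 80/37 * T * \<bar>n\<bar>"
    proof -
      have "?s = 40/37 * r + 80/37 * T * \<bar>n\<bar>" by (simp add: algebra_simps)
      \<comment> \<open>The deterministic part stays below the cut because 40/37 is less than the
        factor 5/4 in \<open>cut\<close>; only the random jump can overshoot.\<close>
      moreover have "40/37 * r \<le> cut" using r(2,3) Tpos unfolding cut_def by argo
      moreover have "0 \<le> 80/37 * T * \<bar>n\<bar>" using Tpos by simp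
      ultimately show ?thesis by linarith
    qed
    also have "exp (- cut / T) * (80/37 * T * \<bar>n\<bar>) \<le> (fp / 12) * (80/37 * T * \<bar>n\<bar>)"
    proof (rule mult_right_mono)
      \<comment> \<open>The slope beyond the cut is at most a twelfth of the slope at
        \<open>r\<close>, so the overshoot costs little.\<close>
      have "exp (- (5/2)) \<le> 1/(12::real)" using exp_five_halves(1)
        by (simp add: exp_minus field_simps)
      moreover have "exp (- 5 * Rt / (4 * T)) \<le> fp" unfolding fp_def
        using r(2,3) Tpos by (simp add: field_simps)
      ultimately show "exp (- cut / T) \<le> fp / 12"
        unfolding exp_cut using mult_mono[of "exp (- 5 * Rt / (4 * T))" fp "exp (- (5/2))" "1/12"] fp0 by simp
    qed (use Tpos in auto)
    finally show ?thesis by (simp add: fp_def mult_ac)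
  qed
  have "min 1 q * (goal x y (\<eta> - a - \<eta>) + \<kappa> * amp x y (\<eta> - a - \<eta>))
     + (1 - min 1 q) * (goal x y (reflect (sgn a) \<eta> - \<eta>) + \<kappa> * amp x y (reflect (sgn a) \<eta> - \<eta>))
    \<le> (1 - p) * (cf r - \<delta> * r * fp + \<kappa> * r)
      + p * (cf r + T * fp + 20/111 * T * fp * \<bar>n\<bar> + \<kappa> * (r + 2 * T * \<bar>n\<bar>))"
  proof (rule add_mono)
    show "min 1 q * (goal x y (\<eta> - a - \<eta>) + \<kappa> * amp x y (\<eta> - a - \<eta>)) \<le> (1 - p) * (cf r - \<delta> * r * fp + \<kappa> * r)"
      unfolding p_def amp1 using goal1 by (auto intro!: mult_left_mono simp: q)
    show "(1 - min 1 q) * (goal x y (reflect (sgn a) \<eta> - \<eta>) + \<kappa> * amp x y (reflect (sgn a) \<eta> - \<eta>))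
      \<le> p * (cf r + T * fp + 20/111 * T * fp * \<bar>n\<bar> + \<kappa> * (r + 2 * T * \<bar>n\<bar>))"
      unfolding p_def[symmetric] by (intro mult_left_mono add_mono goal2 amp2 p0 k)
  qed
  also have "\<dots> = cf r + \<kappa> * r - \<delta> * r * fp + p * ((\<delta> * r + T) * fp) + (p * \<bar>n\<bar>) * (20/111 * T * fp + 2 * \<kappa> * T)"
    by (simp add: algebra_simps)
  also have "\<dots> \<le> cf r + \<kappa> * r - \<delta> * r * fp + gam * r * ((A - n + 1)\<^sup>2 / 4) * ((\<delta> * r + T) * fp)
      + gam * r * (n\<^sup>2 + A * (1 + n\<^sup>2) / 2) * (20/111 * T * fp + 2 * \<kappa> * T)"
    by (intro add_mono mult_right_mono pb pn order_refl) (use d1 r Tpos fp0 k in auto)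
  finally show ?thesis by (simp add: small_poly_def \<delta>_def fp_def A_def n_def)
qed

lemma small_poly_nonneg_integral:
  fixes e :: "'a::euclidean_space"
  assumes e: "norm e = 1"
  shows "integrable std_gauss (\<lambda>\<eta>. small_poly \<kappa> r (e \<bullet> \<eta>))"
    "(\<integral>\<eta>. small_poly \<kappa> r (e \<bullet> \<eta>) \<partial>std_gauss) =
      cf r + \<kappa> * r - 34/37 * (gam * T) * r * exp (- r / T)
     + gam * r * (((gam * r / 2 + 1)\<^sup>2 + 1) / 4) * ((34/37 * (gam * T) * r + T) * exp (- r / T))
     + gam * r * (1 + gam * r / 2) * (20/111 * T * exp (- r / T) + 2 * \<kappa> * T)"
proof -
  note G = std_gauss_inner_integrable[OF e]
  define c1 where "c1 = (34/37 * (gam * T) * r + T) * exp (- r / T)"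
  define c2 where "c2 = 20/111 * T * exp (- r / T) + 2 * \<kappa> * T"
  define A where "A = gam * r / 2"
  define k0 where "k0 = cf r + \<kappa> * r - 34/37 * (gam * T) * r * exp (- r / T)
    + gam * r * ((A + 1)\<^sup>2 / 4) * c1 + gam * r * (A / 2) * c2"
  define k1 where "k1 = - gam * r * ((A + 1) / 2) * c1"
  define k2 where "k2 = gam * r / 4 * c1 + gam * r * (1 + A / 2) * c2"
  have eq: "small_poly \<kappa> r n = k0 + k1 * n + k2 * n\<^sup>2" for n
    unfolding small_poly_def c1_def[symmetric] c2_def[symmetric] A_def[symmetric] k0_def k1_def k2_def
    by (simp add: field_simps power2_eq_square)
  have "integrable std_gauss (\<lambda>\<eta>. k0 + k1 * (e \<bullet> \<eta>) + k2 * (e \<bullet> \<eta>)\<^sup>2)"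
    using G(1,3) by simp
  then show "integrable std_gauss (\<lambda>\<eta>. small_poly \<kappa> r (e \<bullet> \<eta>))" by (simp add: eq)
  \<comment> \<open>The projection on a unit vector has mean 0 and second moment 1: the linear
    coefficient drops out and the quadratic one is added to the constant.\<close>
  have "(\<integral>\<eta>. k0 + k1 * (e \<bullet> \<eta>) + k2 * (e \<bullet> \<eta>)\<^sup>2 \<partial>std_gauss) = k0 + k2"
    using G std_gauss.prob_space[where 'a='a] by simp
  then show "(\<integral>\<eta>. small_poly \<kappa> r (e \<bullet> \<eta>) \<partial>std_gauss) =
      cf r + \<kappa> * r - 34/37 * (gam * T) * r * exp (- r / T)
     + gam * r * (((gam * r / 2 + 1)\<^sup>2 + 1) / 4) * ((34/37 * (gam * T) * r + T) * exp (- r / T))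
     + gam * r * (1 + gam * r / 2) * (20/111 * T * exp (- r / T) + 2 * \<kappa> * T)"
    unfolding eq c1_def[symmetric] c2_def[symmetric] A_def[symmetric] k0_def k2_def
    by (simp add: field_simps power2_eq_square)
qed

text \<open>All terms except those with \<open>\<kappa>\<close> are compared in the unit
  \<open>X = gam * T * r * exp (- r / T)\<close>. The gain of the shift exceeds the cost of the
  reflection by a narrow margin, and the margin is converted to \<open>rate * cf r\<close>.\<close>

lemma small_poly_integral_le:
  fixes e :: "'a::euclidean_space"
  assumes Rt: "0 < Rt" and r: "0 < r" "r < Rt" and e: "norm e = 1"
    and k: "0 \<le> \<kappa>" "\<kappa> \<le> 1/250 * rate * exp (- cut / T)"
  shows "(\<integral>\<eta>. small_poly \<kappa> r (e \<bullet> \<eta>) \<partial>std_gauss) \<le> (1 - rate / 156) * cf r"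
proof -
  note g = gam_facts[OF Rt]
  define fp where "fp = exp (- r / T)"
  define X where "X = gam * T * r * fp"
  have fp0: "0 < fp" by (simp add: fp_def)
  have X0: "0 \<le> X" using g(1) Tpos r fp0 by (simp add: X_def)
  have gr: "gam * r \<le> 1/4" "0 \<le> gam * r"
    using g(1,3) r mult_left_mono[of r Rt gam] by (linarith, simp)
  define A where "A = gam * r / 2"
  have A: "0 \<le> A" "A \<le> 1/8" using gr unfolding A_def by linarith+
  have A1: "((A + 1)\<^sup>2 + 1) / 4 \<le> 145/256"
  proof -
    have "(A + 1)\<^sup>2 \<le> (9/8)\<^sup>2" using A by (intro power_mono) auto
    then show ?thesis by (simp add: power2_eq_square)
  qed
  have gT: "0 \<le> gam * T" "gam * T \<le> 1" using g(1,2) Tpos by auto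
  \<comment> \<open>The numbers are the values at the largest possible \<open>gam * r = 1/4\<close>:
    there \<open>A = 1/8\<close> gives \<open>((9/8)\<^sup>2 + 1) / 4 = 145/256\<close>, and
    \<open>1 + (34/37) / 4 = 91/74\<close>.\<close>
  have t1: "gam * r * (((A + 1)\<^sup>2 + 1) / 4) * ((34/37 * (gam * T) * r + T) * fp)
      \<le> (145/256 * (91/74)) * X"
  proof -
    have "gam * r * (((A + 1)\<^sup>2 + 1) / 4) * ((34/37 * (gam * T) * r + T) * fp)
      = (((A + 1)\<^sup>2 + 1) / 4 * (34/37 * (gam * r) + 1)) * X"
      by (simp add: X_def field_simps)
    also have "\<dots> \<le> (145/256 * (91/74)) * X"
    proof (intro mult_right_mono mult_mono A1 X0)
      show "34/37 * (gam * r) + 1 \<le> 91/74" "0 \<le> 34/37 * (gam * r) + 1" using gr by linarith+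
    qed simp
    finally show ?thesis .
  qed
  have t2: "gam * r * (1 + A) * (20/111 * T * fp + 2 * \<kappa> * T) \<le> 20/111 * (9/8) * X + 9/4 * \<kappa> * r"
  proof -
    have "gam * r * (1 + A) * (20/111 * T * fp + 2 * \<kappa> * T)
      = (1 + A) * (20/111 * X) + (1 + A) * (2 * (gam * T) * (\<kappa> * r))"
      by (simp add: X_def field_simps)
    also have "\<dots> \<le> (9/8) * (20/111 * X) + (9/8) * (2 * 1 * (\<kappa> * r))"
      using A X0 gT k r by (intro add_mono mult_mono) auto
    finally show ?thesis by simp
  qed
  have eqX: "34/37 * (gam * T) * r * fp = 34/37 * X" by (simp add: X_def)
  have "(\<integral>\<eta>. small_poly \<kappa> r (e \<bullet> \<eta>) \<partial>std_gauss) \<le>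
      cf r + \<kappa> * r - 34/37 * X + (145/256 * (91/74)) * X + (20/111 * (9/8) * X + 9/4 * \<kappa> * r)"
    unfolding small_poly_nonneg_integral(2)[OF e] fp_def[symmetric] A_def[symmetric]
    using t1 t2 eqX by linarith
  \<comment> \<open>The balance of the three coefficients of \<open>X\<close> is about -0.0197,
    which is below -1/60; and 13/4 is \<open>1 + 9/4\<close>.\<close>
  also have "\<dots> \<le> cf r + 13/4 * \<kappa> * r - 1/60 * X"
    using X0 by (simp add: field_simps)
  finally have bound: "(\<integral>\<eta>. small_poly \<kappa> r (e \<bullet> \<eta>) \<partial>std_gauss) \<le> cf r + 13/4 * \<kappa> * r - 1/60 * X" .
  have kr: "13/4 * \<kappa> * r \<le> 13/1000 * rate * cf r"
  proof -
    have "\<kappa> * r \<le> (1/250 * rate * exp (- cut / T)) * r" using k r by (intro mult_right_mono) auto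
    also have "\<dots> \<le> 1/250 * rate * cf r"
      using mult_left_mono[OF cf_ge[of r], of "1/250 * rate"] r rate_pos by (simp add: mult_ac)
    finally show ?thesis by simp
  qed
  \<comment> \<open>The factor 5/3 from \<open>gam_rate\<close> turns 1/60 into 1/36.\<close>
  have X1: "1/36 * rate * cf r \<le> 1/60 * X"
  proof -
    have "5/3 * rate * cf r \<le> gam * T * fp * r"
    proof (rule mult_mono)
      show "5/3 * rate \<le> gam * T * fp" using gam_rate[OF Rt, of r] r by (simp add: fp_def)
    qed (use cf_le[of r] cf_nonneg[of r] r fp0 gT in simp_all)
    then show ?thesis by (simp add: X_def mult_ac)
  qed
  from bound kr X1 have "(\<integral>\<eta>. small_poly \<kappa> r (e \<bullet> \<eta>) \<partial>std_gauss)
      \<le> cf r + 13/1000 * rate * cf r - 1/36 * rate * cf r" by linarith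
  also have "\<dots> \<le> (1 - rate / 156) * cf r"
  proof -
    have "0 \<le> rate * cf r" using rate_pos cf_nonneg[of r] r by simp
    then show ?thesis by (simp add: field_simps)
  qed
  finally show ?thesis .
qed

text \<open>The term with \<open>\<kappa>\<close> reserves room for the interaction: it is linear in
  the distance, while \<open>cf\<close> controls only \<open>exp (- cut / T)\<close> times the
  distance, and this factor reappears in the bound on \<open>\<kappa>\<close>.\<close>

theorem one_particle_contraction:
  fixes x y :: "'a::euclidean_space"
  assumes k: "0 \<le> \<kappa>" "\<kappa> \<le> 1/250 * rate * exp (- cut / T)"
  shows "(\<integral>\<^sup>+w. ennreal (goal x y (vel x y w - fst w) + \<kappa> * amp x y (vel x y w - fst w)) \<partial>(std_gauss \<Otimes>\<^sub>M unif))
    \<le> ennreal ((1 - rate / 156) * cf (norm (x - y)))"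
proof -
  define r where "r = norm (x - y)"
  have r0: "0 \<le> r" by (simp add: r_def)
  have pp: "prob_space (std_gauss \<Otimes>\<^sub>M unif :: ('a \<times> real) measure)"
    by (intro prob_space_pair prob_space_std_gauss unif.prob_space_axioms)
  consider "r < Rt" "0 < r" | "r < Rt" "r = 0" | "Rt \<le> r" using r0 by linarith
  then show ?thesis
  proof cases
    case 1
    then have Rt: "0 < Rt" by simp
    define e where "e = sgn (x - y)"
    have e: "norm e = 1" using 1 by (simp add: e_def norm_sgn r_def)
    define a where "a = gam *\<^sub>R (x - y)"
    have v: "vel x y w = shift_or_reflect a w" for w using 1 by (simp add: vel_def r_def a_def)
    have "(\<integral>\<^sup>+w. ennreal (goal x y (vel x y w - fst w) + \<kappa> * amp x y (vel x y w - fst w)) \<partial>(std_gauss \<Otimes>\<^sub>M unif))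
      = (\<integral>\<^sup>+w. (\<lambda>\<eta> v. ennreal (goal x y (v - \<eta>) + \<kappa> * amp x y (v - \<eta>))) (fst w) (shift_or_reflect a w) \<partial>(std_gauss \<Otimes>\<^sub>M unif))"
      by (simp add: v)
    also have "\<dots> = (\<integral>\<^sup>+\<eta>. ennreal (min 1 (exp (a \<bullet> \<eta> - (norm a)\<^sup>2 / 2))) * 
          ennreal (goal x y (\<eta> - a - \<eta>) + \<kappa> * amp x y (\<eta> - a - \<eta>))
        + ennreal (1 - min 1 (exp (a \<bullet> \<eta> - (norm a)\<^sup>2 / 2))) * 
          ennreal (goal x y (reflect (sgn a) \<eta> - \<eta>) + \<kappa> * amp x y (reflect (sgn a) \<eta> - \<eta>)) \<partial>std_gauss)"
      by (rule nn_integral_shift_or_reflect) (unfold goal_def amp_def, measurable)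
    also have "\<dots> \<le> (\<integral>\<^sup>+\<eta>. ennreal (small_poly \<kappa> r (e \<bullet> \<eta>)) \<partial>std_gauss)"
    proof (rule nn_integral_mono)
      fix \<eta>
      let ?q = "exp (a \<bullet> \<eta> - (norm a)\<^sup>2 / 2)"
      have "ennreal (min 1 ?q) * ennreal (goal x y (\<eta> - a - \<eta>) + \<kappa> * amp x y (\<eta> - a - \<eta>))
        + ennreal (1 - min 1 ?q) * ennreal (goal x y (reflect (sgn a) \<eta> - \<eta>) + \<kappa> * amp x y (reflect (sgn a) \<eta> - \<eta>))
        = ennreal (min 1 ?q * (goal x y (\<eta> - a - \<eta>) + \<kappa> * amp x y (\<eta> - a - \<eta>))
          + (1 - min 1 ?q) * (goal x y (reflect (sgn a) \<eta> - \<eta>) + \<kappa> * amp x y (reflect (sgn a) \<eta> - \<eta>)))"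
        by (simp add: ennreal_mult ennreal_plus goal_nonneg amp_nonneg k)
      also have "\<dots> \<le> ennreal (small_poly \<kappa> r (e \<bullet> \<eta>))"
        by (rule ennreal_leI, rule small_pointwise[OF Rt r_def 1(2,1) k(1) e_def a_def refl])
      finally show "ennreal (min 1 ?q) * ennreal (goal x y (\<eta> - a - \<eta>) + \<kappa> * amp x y (\<eta> - a - \<eta>))
        + ennreal (1 - min 1 ?q) * ennreal (goal x y (reflect (sgn a) \<eta> - \<eta>) + \<kappa> * amp x y (reflect (sgn a) \<eta> - \<eta>))
        \<le> ennreal (small_poly \<kappa> r (e \<bullet> \<eta>))" .
    qed
    also have "\<dots> = ennreal (\<integral>\<eta>. small_poly \<kappa> r (e \<bullet> \<eta>) \<partial>std_gauss)"
    proof (rule nn_integral_eq_integral[OF small_poly_nonneg_integral(1)[OF e]], rule AE_I2)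
      fix \<eta>
      have "0 \<le> min 1 (exp (a \<bullet> \<eta> - (norm a)\<^sup>2 / 2)) * (goal x y (\<eta> - a - \<eta>) + \<kappa> * amp x y (\<eta> - a - \<eta>))
     + (1 - min 1 (exp (a \<bullet> \<eta> - (norm a)\<^sup>2 / 2))) * (goal x y (reflect (sgn a) \<eta> - \<eta>) + \<kappa> * amp x y (reflect (sgn a) \<eta> - \<eta>))"
        by (intro add_nonneg_nonneg mult_nonneg_nonneg goal_nonneg amp_nonneg k) auto
      also have "\<dots> \<le> small_poly \<kappa> r (e \<bullet> \<eta>)"
        by (rule small_pointwise[OF Rt r_def 1(2,1) k(1) e_def a_def refl])
      finally show "0 \<le> small_poly \<kappa> r (e \<bullet> \<eta>)" .
    qed
    also have "\<dots> \<le> ennreal ((1 - rate / 156) * cf r)"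
      by (intro ennreal_leI small_poly_integral_le Rt e k) (use 1 in auto)
    finally show ?thesis by (simp add: r_def)
  next
    case 2
    then have xy: "x = y" and Rt: "0 < Rt" by (auto simp: r_def)
    have "(\<integral>\<^sup>+w. ennreal (goal x y (vel x y w - fst w) + \<kappa> * amp x y (vel x y w - fst w)) \<partial>(std_gauss \<Otimes>\<^sub>M unif))
      = (\<integral>\<^sup>+w. 0 \<partial>(std_gauss \<Otimes>\<^sub>M unif :: ('a \<times> real) measure))"
    proof (rule nn_integral_cong)
      fix w :: "'a \<times> real"
      \<comment> \<open>For coinciding particles the shift is zero and the reflection is the
        identity, so the coupling is sticky.\<close>
      have "vel x y w = fst w"
        using Rt by (simp add: vel_def xy shift_or_reflect_def reflect_def case_prod_beta')
      then show "ennreal (goal x y (vel x y w - fst w) + \<kappa> * amp x y (vel x y w - fst w)) = 0"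
        using Rt by (simp add: goal_def amp_def xy)
    qed
    then show ?thesis by simp
  next
    case 3
    have v: "vel x y w - fst w = 0" for w using 3 by (simp add: vel_def r_def)
    \<comment> \<open>Far pairs may lie where the slope is smallest, so the gain is
      \<open>rate * exp (- (5/2)) * r / 3\<close>, at least 2/75 of \<open>rate * cf r\<close>; the
      interaction takes away at most 1/250.\<close>
    have "cf ((1 - K * T\<^sup>2 / 3) * r) + \<kappa> * r \<le> (1 - rate / 156) * cf r"
    proof -
      have "cf ((1 - K * T\<^sup>2 / 3) * r) \<le> cf r + slope r * ((1 - K * T\<^sup>2 / 3) * r - r)"
        using KT r0 by (intro cf_concave) auto
      also have "\<dots> = cf r - slope r * (K * T\<^sup>2 / 3 * r)" by (simp add: algebra_simps)
      finally have "cf ((1 - K * T\<^sup>2 / 3) * r) \<le> cf r - slope r * (K * T\<^sup>2 / 3 * r)" .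
      moreover have "exp (- cut / T) * (K * T\<^sup>2 / 3 * r) \<le> slope r * (K * T\<^sup>2 / 3 * r)"
        using K0 r0 by (intro mult_right_mono slope_bounds) auto
      moreover have "exp (- cut / T) * (K * T\<^sup>2 / 3 * r) = rate * exp (- (5/2)) * r / 3"
        unfolding rate_exp_cut[symmetric] by simp
      ultimately have 1: "cf ((1 - K * T\<^sup>2 / 3) * r) \<le> cf r - rate * exp (- (5/2)) * r / 3" by linarith
      have e: "2/25 \<le> exp (- (5/2) :: real)" using exp_five_halves(2) by (simp add: exp_minus field_simps)
      have "rate * (2/25) * cf r \<le> rate * exp (- (5/2)) * r"
        using rate_pos e cf_le[OF r0] cf_nonneg[OF r0] by (intro mult_mono) auto
      with 1 have 2: "cf ((1 - K * T\<^sup>2 / 3) * r) \<le> cf r - 2/75 * rate * cf r" by simp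
      have "\<kappa> * r \<le> (1/250 * rate * exp (- cut / T)) * r" using k r0 by (intro mult_right_mono) auto
      also have "\<dots> \<le> 1/250 * rate * cf r"
        using mult_left_mono[OF cf_ge[OF r0], of "1/250 * rate"] rate_pos by (simp add: mult_ac)
      finally have 3: "\<kappa> * r \<le> 1/250 * rate * cf r" .
      have "0 \<le> rate * cf r" using rate_pos cf_nonneg[OF r0] by simp
      then have "cf r - 2/75 * rate * cf r + 1/250 * rate * cf r \<le> (1 - rate / 156) * cf r"
        by (simp add: field_simps)
      with 2 3 show ?thesis by linarith
    qed
    then show ?thesis using 3
      by (simp add: v goal_def amp_def r_def[symmetric] prob_space.emeasure_space_1[OF pp] ennreal_leI)
  qed
qed

end

section \<open>Deterministic comparison of trajectories\<close>

lemma integral_linear_kernel: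
  assumes "0 \<le> (t::real)" shows "((\<lambda>s. t - s) has_integral t\<^sup>2 / 2) {0..t}"
proof -
  have "((\<lambda>s. t - s) has_integral ((t * t - t\<^sup>2 / 2) - (t * 0 - 0\<^sup>2 / 2))) {0..t}"
    by (rule fundamental_theorem_of_calculus[OF assms])
      (auto intro!: derivative_eq_intros simp: has_real_derivative_iff_has_vector_derivative[symmetric])
  then show ?thesis by (simp add: power2_eq_square)
qed

text \<open>The part \<open>\<beta>\<close> stays under the time integral: the fluctuation of the
  mean field is controlled in expectation at each fixed time, which gives no bound on its supremum
  in time.\<close>

lemma second_order_weighted_bound:
  fixes z :: "real \<Rightarrow> 'a::euclidean_space"
  assumes z: "\<And>s. s \<in> {0..T} \<Longrightarrow> (z has_vector_derivative p s) (at s within {0..T})"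
    and p: "\<And>s. s \<in> {0..T} \<Longrightarrow> (p has_vector_derivative a s) (at s within {0..T})"
    and t: "t \<in> {0..T}"
    and a: "\<And>s. s \<in> {0..T} \<Longrightarrow> norm (a s) \<le> C + \<beta> s"
    and C: "0 \<le> C" and \<beta>: "continuous_on {0..T} \<beta>" "\<And>s. s \<in> {0..T} \<Longrightarrow> 0 \<le> \<beta> s"
  shows "norm (z t - z 0 - t *\<^sub>R p 0) \<le> C * T\<^sup>2 / 2 + integral {0..T} (\<lambda>s. (T - s) * \<beta> s)"
proof -
  have h: "((\<lambda>s. (t - s) *\<^sub>R a s) has_integral (z t - z 0 - t *\<^sub>R p 0)) {0..t}"
    by (rule taylor_second_order[OF z p t])
  have \<beta>t: "continuous_on {0..t} \<beta>" using \<beta>(1) t by (auto intro: continuous_on_subset)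
  have h2: "((\<lambda>s. (t - s) * C + (t - s) * \<beta> s) has_integral (t\<^sup>2 / 2 * C + integral {0..t} (\<lambda>s. (t - s) * \<beta> s))) {0..t}"
    by (intro has_integral_add has_integral_mult_left integral_linear_kernel integrable_integral
        integrable_continuous_interval continuous_intros \<beta>t) (use t in auto)
  have "norm (z t - z 0 - t *\<^sub>R p 0) \<le> t\<^sup>2 / 2 * C + integral {0..t} (\<lambda>s. (t - s) * \<beta> s)"
    unfolding integral_unique[OF h, symmetric] integral_unique[OF h2, symmetric]
  proof (rule integral_norm_bound_integral)
    fix s assume s: "s \<in> {0..t}"
    then have "(t - s) * norm (a s) \<le> (t - s) * (C + \<beta> s)" using a[of s] t by (intro mult_left_mono) auto
    then show "norm ((t - s) *\<^sub>R a s) \<le> (t - s) * C + (t - s) * \<beta> s" using s by (simp add: distrib_left)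
  qed (use h h2 in auto)
  also have "t\<^sup>2 / 2 * C \<le> C * T\<^sup>2 / 2"
  proof -
    have "t\<^sup>2 \<le> T\<^sup>2" using t by (intro power_mono) auto
    then have "C * t\<^sup>2 \<le> C * T\<^sup>2" using C by (rule mult_left_mono)
    then show ?thesis by (simp add: mult_ac)
  qed
  also have "integral {0..t} (\<lambda>s. (t - s) * \<beta> s) \<le> integral {0..t} (\<lambda>s. (T - s) * \<beta> s)"
    using t \<beta>(2) by (intro integral_le integrable_continuous_interval continuous_intros \<beta>t mult_right_mono) auto
  also have "\<dots> \<le> integral {0..T} (\<lambda>s. (T - s) * \<beta> s)"
    using t \<beta> by (intro integral_subset_le integrable_continuous_interval continuous_intros \<beta>t) auto
  finally show ?thesis by simp
qed

text \<open>The gap between \<open>R\<close> and \<open>Rt\<close> ensures that a pair starting at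
  distance \<open>Rt\<close> does not come closer than \<open>R\<close> within one step, so the
  convexity condition applies throughout.\<close>

locale hmc_drift = hmc_params L K Rt T for L K Rt T :: real +
  fixes b :: "'a::euclidean_space \<Rightarrow> 'a" and R :: real
  assumes b_lip: "norm (b x - b y) \<le> L * norm (x - y)"
    and b_conv: "R \<le> norm (x - y) \<Longrightarrow> K * (norm (x - y))\<^sup>2 + (1 / L) * (norm (b x - b y))\<^sup>2 \<le> (x - y) \<bullet> (b x - b y)"
    and R0: "0 \<le> R" and RRt: "3/2 * R\<^sup>2 \<le> Rt\<^sup>2"
begin

lemma b_cont: "continuous_on S b"
proof (rule lipschitz_on_continuous_on)
  show "L-lipschitz_on S b"
    using b_lip L0 by (auto simp: lipschitz_on_def dist_norm)
qed

text \<open>Here \<open>c\<close> and \<open>cb\<close> are arbitrary time-dependent forces; later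
  they are the empirical and the nonlinear mean field along the trajectories. Everything about them
  enters through the single number \<open>E\<close>.\<close>

context
  fixes q qb p pb c cb :: "real \<Rightarrow> 'a" and \<beta> :: "real \<Rightarrow> real" and M E :: real
  assumes q: "\<And>s. s \<in> {0..T} \<Longrightarrow> (q has_vector_derivative p s) (at s within {0..T})"
    and p: "\<And>s. s \<in> {0..T} \<Longrightarrow> (p has_vector_derivative - (b (q s) + c s)) (at s within {0..T})"
    and qb: "\<And>s. s \<in> {0..T} \<Longrightarrow> (qb has_vector_derivative pb s) (at s within {0..T})"
    and pb: "\<And>s. s \<in> {0..T} \<Longrightarrow> (pb has_vector_derivative - (b (qb s) + cb s)) (at s within {0..T})"
    and c: "\<And>s. s \<in> {0..T} \<Longrightarrow> norm (c s - cb s) \<le> \<beta> s"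
    and \<beta>: "continuous_on {0..T} \<beta>"
    and M: "M = amp (q 0) (qb 0) (p 0 - pb 0)"
    and E: "E = integral {0..T} (\<lambda>s. (T - s) * \<beta> s)"
begin

lemma \<beta>0: "s \<in> {0..T} \<Longrightarrow> 0 \<le> \<beta> s"
  using c order_trans[OF norm_ge_zero] by blast

lemma z_deriv: "s \<in> {0..T} \<Longrightarrow> ((\<lambda>s. q s - qb s) has_vector_derivative p s - pb s) (at s within {0..T})"
  by (intro derivative_intros q qb)

lemma v_deriv: "s \<in> {0..T} \<Longrightarrow> ((\<lambda>s. p s - pb s) has_vector_derivative
    - ((b (q s) - b (qb s)) + (c s - cb s))) (at s within {0..T})"
  by (rule has_vector_derivative_eq_rhs, rule has_vector_derivative_diff[OF p pb]) auto

lemma z_cont: "continuous_on {0..T} (\<lambda>s. q s - qb s)"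
  by (rule continuous_on_trajectory[OF z_deriv])

lemma E_nonneg: "0 \<le> E"
  unfolding E using \<beta>0 by (intro integral_nonneg integrable_continuous_interval continuous_intros \<beta>) auto

lemma free_flight_le_amp:
  assumes t: "t \<in> {0..T}" shows "norm (q 0 - qb 0 + t *\<^sub>R (p 0 - pb 0)) \<le> M"
proof -
  let ?z = "q 0 - qb 0" and ?w = "p 0 - pb 0"
  define u where "u = t / T"
  have u: "0 \<le> u" "u \<le> 1" and tu: "t = u * T" using t Tpos by (auto simp: u_def)
  have "?z + t *\<^sub>R ?w = (1 - u) *\<^sub>R ?z + u *\<^sub>R (?z + T *\<^sub>R ?w)"
    unfolding tu by (simp add: algebra_simps)
  also have "norm \<dots> \<le> (1 - u) * norm ?z + u * norm (?z + T *\<^sub>R ?w)"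
    using u by (intro norm_triangle_le) simp
  also have "\<dots> \<le> (1 - u) * M + u * M"
    using u by (intro add_mono mult_left_mono) (auto simp: M amp_def)
  finally show ?thesis by (simp add: algebra_simps)
qed

lemma deviation:
  assumes t: "t \<in> {0..T}" and S: "\<And>s. s \<in> {0..T} \<Longrightarrow> norm (q s - qb s) \<le> S"
  shows "norm ((q t - qb t) - (q 0 - qb 0) - t *\<^sub>R (p 0 - pb 0)) \<le> (L * T\<^sup>2) * S / 2 + E"
proof -
  have S0: "0 \<le> S" using S[OF t] order_trans[OF norm_ge_zero] by blast
  have "norm ((q t - qb t) - (q 0 - qb 0) - t *\<^sub>R (p 0 - pb 0)) \<le> (L * S) * T\<^sup>2 / 2 + integral {0..T} (\<lambda>s. (T - s) * \<beta> s)"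
  proof (rule second_order_weighted_bound[OF z_deriv v_deriv t _ _ \<beta> \<beta>0])
    fix s assume s: "s \<in> {0..T}"
    have "norm (- ((b (q s) - b (qb s)) + (c s - cb s))) \<le> norm (b (q s) - b (qb s)) + norm (c s - cb s)"
      unfolding norm_minus_cancel by (rule norm_triangle_ineq)
    also have "\<dots> \<le> L * S + \<beta> s"
      by (intro add_mono c s order_trans[OF b_lip] mult_left_mono S) (use L0 in auto)
    finally show "norm (- ((b (q s) - b (qb s)) + (c s - cb s))) \<le> L * S + \<beta> s" .
  qed (use L0 S0 in auto)
  then show ?thesis by (simp add: E mult_ac)
qed

text \<open>The maximal distance appears on both sides; its coefficient
  \<open>L * T\<^sup>2 / 2 \<le> 3/40\<close> is absorbed, and 40/37 is the inverse of
  \<open>1 - 3/40\<close>.\<close>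

lemma sup_bound:
  assumes t: "t \<in> {0..T}" shows "norm (q t - qb t) \<le> 40/37 * (M + E)"
proof -
  have "continuous_on {0..T} (\<lambda>s. norm (q s - qb s))" by (intro continuous_intros z_cont)
  then obtain s0 where s0: "s0 \<in> {0..T}" and mx: "\<And>s. s \<in> {0..T} \<Longrightarrow> norm (q s - qb s) \<le> norm (q s0 - qb s0)"
    using continuous_attains_sup[of "{0..T}" "\<lambda>s. norm (q s - qb s)"] Tpos by auto
  let ?S = "norm (q s0 - qb s0)"
  have "?S \<le> norm ((q s0 - qb s0) - (q 0 - qb 0) - s0 *\<^sub>R (p 0 - pb 0)) + norm (q 0 - qb 0 + s0 *\<^sub>R (p 0 - pb 0))"
    using norm_triangle_ineq[of "(q s0 - qb s0) - (q 0 - qb 0) - s0 *\<^sub>R (p 0 - pb 0)" "q 0 - qb 0 + s0 *\<^sub>R (p 0 - pb 0)"]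
    by simp
  also have "\<dots> \<le> ((L * T\<^sup>2) * ?S / 2 + E) + M"
    by (intro add_mono deviation[OF s0 mx] free_flight_le_amp s0)
  also have "(L * T\<^sup>2) * ?S \<le> 3/20 * ?S" by (intro mult_right_mono LT) auto
  finally have "?S \<le> 40/37 * (M + E)" by (simp add: field_simps)
  then show ?thesis using mx[OF t] by linarith
qed

lemma deviation':
  assumes t: "t \<in> {0..T}"
  shows "norm ((q t - qb t) - (q 0 - qb 0) - t *\<^sub>R (p 0 - pb 0)) \<le> 20/37 * (L * T\<^sup>2) * M + 40/37 * E"
proof -
  have "norm ((q t - qb t) - (q 0 - qb 0) - t *\<^sub>R (p 0 - pb 0)) \<le> (L * T\<^sup>2) * (40/37 * (M + E)) / 2 + E"
    by (rule deviation[OF t sup_bound])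
  also have "\<dots> = 20/37 * (L * T\<^sup>2) * M + (20/37 * (L * T\<^sup>2)) * E + E" by (simp add: field_simps)
  also have "(20/37 * (L * T\<^sup>2)) * E \<le> 3/37 * E" using LT by (intro mult_right_mono E_nonneg) auto
  finally show ?thesis by simp
qed

lemma endpoint_bound:
  "norm (q T - qb T) \<le> norm (q 0 - qb 0 + T *\<^sub>R (p 0 - pb 0)) + 20/37 * (L * T\<^sup>2) * M + 40/37 * E"
  using deviation'[of T] Tpos norm_triangle_ineq[of "(q T - qb T) - (q 0 - qb 0) - T *\<^sub>R (p 0 - pb 0)" "q 0 - qb 0 + T *\<^sub>R (p 0 - pb 0)"]
  by simp

text \<open>The endpoint difference is, up to \<open>E\<close>, the initial difference minus
  \<open>D\<close>, the kernel-weighted integral of the drift difference \<open>B\<close>. Expanding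
  the square, the co-coercive term \<open>(1/L) * J\<close> dominates both the square of
  \<open>D\<close> and the error made by pairing \<open>B\<close> with the initial instead of the
  current difference. What remains is the gain from \<open>K\<close>.\<close>

lemma synchronous_endpoint_bound:
  assumes v: "p 0 = pb 0" and far: "Rt \<le> norm (q 0 - qb 0)"
  shows "norm (q T - qb T) \<le> (1 - K * T\<^sup>2 / 3) * norm (q 0 - qb 0) + 5/2 * E"
proof -
  define r where "r = norm (q 0 - qb 0)"
  have r0: "0 \<le> r" by (simp add: r_def)
  have Mr: "M = r" by (simp add: M amp_def v r_def)
  have dev: "norm ((q t - qb t) - (q 0 - qb 0)) \<le> 3/37 * r + 40/37 * E" if t: "t \<in> {0..T}" for t
  proof -
    have "norm ((q t - qb t) - (q 0 - qb 0)) \<le> 20/37 * (L * T\<^sup>2) * r + 40/37 * E"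
      using deviation'[OF t] by (simp add: v Mr)
    also have "20/37 * (L * T\<^sup>2) * r \<le> 3/37 * r" using LT r0 by (intro mult_right_mono) auto
    finally show ?thesis by simp
  qed
  have KTr: "K * T\<^sup>2 * r \<le> 3/80 * r" by (intro mult_right_mono KT r0)
  show ?thesis
  \<comment> \<open>If the perturbation is a sizeable part of the distance, the surplus in
    \<open>5/2 * E\<close> covers even the crude bound. Otherwise it is small enough to keep the
    pair apart.\<close>
  proof (cases "9/100 * r \<le> E")
    case True
    have "norm (q T - qb T) \<le> norm ((q T - qb T) - (q 0 - qb 0)) + r"
      unfolding r_def using norm_triangle_ineq[of "(q T - qb T) - (q 0 - qb 0)" "q 0 - qb 0"] by simp
    also have "\<dots> \<le> 3/37 * r + 40/37 * E + r" using dev[of T] Tpos by simp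
    finally have "norm (q T - qb T) \<le> 3/37 * r + 40/37 * E + r" .
    moreover have "(1 - K * T\<^sup>2 / 3) * r = r - K * T\<^sup>2 * r / 3" by (simp add: left_diff_distrib)
    ultimately show ?thesis unfolding r_def[symmetric] using KTr True E_nonneg by linarith
  next
    case False
    define B where "B s = b (q s) - b (qb s)" for s
    have qc: "continuous_on {0..T} q" "continuous_on {0..T} qb"
      by (rule continuous_on_trajectory[OF q], simp, rule continuous_on_trajectory[OF qb], simp)
    have Bc: "continuous_on {0..T} B" unfolding B_def
      by (intro continuous_intros continuous_on_compose2[OF b_cont[of UNIV]] qc) auto
    define I where "I = integral {0..T} (\<lambda>s. (T - s) * norm (B s))"
    define J where "J = integral {0..T} (\<lambda>s. (T - s) * (norm (B s))\<^sup>2)"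
    have iI: "((\<lambda>s. (T - s) * norm (B s)) has_integral I) {0..T}"
      and iJ: "((\<lambda>s. (T - s) * (norm (B s))\<^sup>2) has_integral J) {0..T}"
      unfolding I_def J_def
      by (intro integrable_integral integrable_continuous_interval continuous_intros Bc)+
    have i1: "((\<lambda>s. T - s) has_integral T\<^sup>2 / 2) {0..T}" by (rule integral_linear_kernel) (use Tpos in simp)
    \<comment> \<open>Cauchy-Schwarz for the weight \<open>T - s\<close>, whose total mass is
      \<open>T\<^sup>2 / 2\<close>; \<open>k\<close> is the weighted mean of the norm of
      \<open>B\<close>.\<close>
    have CS: "2 * I\<^sup>2 \<le> T\<^sup>2 * J"
    proof -
      define k where "k = 2 * I / T\<^sup>2"
      have "((\<lambda>s. (T - s) * (norm (B s))\<^sup>2 - 2 * k * ((T - s) * norm (B s)) + k\<^sup>2 * (T - s)) has_integral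
          (J - 2 * k * I + k\<^sup>2 * (T\<^sup>2 / 2))) {0..T}"
        by (intro has_integral_add has_integral_diff has_integral_mult_right iI iJ i1)
      then have "0 \<le> J - 2 * k * I + k\<^sup>2 * (T\<^sup>2 / 2)"
      proof (rule has_integral_nonneg)
        fix s assume "s \<in> {0..T}"
        then have "0 \<le> (T - s) * (norm (B s) - k)\<^sup>2" by simp
        then show "0 \<le> (T - s) * (norm (B s))\<^sup>2 - 2 * k * ((T - s) * norm (B s)) + k\<^sup>2 * (T - s)"
          by (simp add: power2_eq_square algebra_simps)
      qed
      also have "J - 2 * k * I + k\<^sup>2 * (T\<^sup>2 / 2) = J - 2 * I\<^sup>2 / T\<^sup>2"
        using Tpos by (simp add: k_def power2_eq_square field_simps)
      finally show ?thesis using Tpos by (simp add: field_simps)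
    qed
    have disp: "norm ((q 0 - qb 0) - (q t - qb t)) \<le> I + E" if t: "t \<in> {0..T}" for t
    proof -
      have "norm ((q t - qb t) - (q 0 - qb 0) - t *\<^sub>R (p 0 - pb 0))
          \<le> 0 * T\<^sup>2 / 2 + integral {0..T} (\<lambda>s. (T - s) * (norm (B s) + \<beta> s))"
      proof (rule second_order_weighted_bound[OF z_deriv v_deriv t])
        fix s assume s: "s \<in> {0..T}"
        show "norm (- ((b (q s) - b (qb s)) + (c s - cb s))) \<le> 0 + (norm (B s) + \<beta> s)"
          unfolding norm_minus_cancel B_def using c[OF s]
          by (auto intro: order_trans[OF norm_triangle_ineq])
        show "0 \<le> norm (B s) + \<beta> s" using \<beta>0[OF s] by simp
      qed (auto intro!: continuous_intros Bc \<beta>)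
      also have "integral {0..T} (\<lambda>s. (T - s) * (norm (B s) + \<beta> s)) = I + E"
        unfolding I_def E distrib_left
        by (intro integral_add integrable_continuous_interval continuous_intros Bc \<beta>)
      finally show ?thesis by (simp add: v norm_minus_commute)
    qed
    \<comment> \<open>Convexity is used at the current positions; replacing their difference by the
      initial one costs the displacement bound \<open>I + E\<close>. The factor 27/40 lies just
      below \<open>(304/370)\<^sup>2\<close>.\<close>
    have coer: "27/40 * K * r\<^sup>2 + (1/L) * (norm (B s))\<^sup>2 - (I + E) * norm (B s) \<le> (q 0 - qb 0) \<bullet> B s"
      if s: "s \<in> {0..T}" for s
    proof -
      have "r \<le> norm (q s - qb s) + norm ((q s - qb s) - (q 0 - qb 0))"
        unfolding r_def by (metis norm_triangle_sub norm_minus_commute)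
      \<comment> \<open>The remaining fraction of the distance:
        \<open>1 - 3/37 - (40/37) * (9/100)\<close>.\<close>
      then have low: "304/370 * r \<le> norm (q s - qb s)" using dev[OF s] False by simp
      have "R \<le> 304/370 * r"
      proof (rule power2_le_imp_le)
        have "Rt\<^sup>2 \<le> r\<^sup>2" using far Rt0 by (intro power_mono) (auto simp: r_def)
        then have "R\<^sup>2 \<le> 2/3 * r\<^sup>2" using RRt by linarith
        also have "\<dots> \<le> (304/370)\<^sup>2 * r\<^sup>2" by (intro mult_right_mono) (simp_all add: power2_eq_square)
        finally show "R\<^sup>2 \<le> (304/370 * r)\<^sup>2" by (simp only: power_mult_distrib)
      qed (use r0 in simp)
      then have "K * (norm (q s - qb s))\<^sup>2 + (1 / L) * (norm (B s))\<^sup>2 \<le> (q s - qb s) \<bullet> B s"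
        unfolding B_def using low by (intro b_conv) simp
      moreover have "27/40 * r\<^sup>2 \<le> (norm (q s - qb s))\<^sup>2"
      proof -
        have "27/40 * r\<^sup>2 \<le> (304/370 * r)\<^sup>2" by (simp add: power_mult_distrib power2_eq_square)
        also have "\<dots> \<le> (norm (q s - qb s))\<^sup>2" using low r0 by (intro power_mono) auto
        finally show ?thesis .
      qed
      then have "K * (27/40 * r\<^sup>2) \<le> K * (norm (q s - qb s))\<^sup>2" using K0 by (intro mult_left_mono) auto
      moreover have "- ((I + E) * norm (B s)) \<le> ((q 0 - qb 0) - (q s - qb s)) \<bullet> B s"
      proof -
        have "\<bar>((q 0 - qb 0) - (q s - qb s)) \<bullet> B s\<bar> \<le> norm ((q 0 - qb 0) - (q s - qb s)) * norm (B s)"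
          by (rule Cauchy_Schwarz_ineq2)
        also have "\<dots> \<le> (I + E) * norm (B s)" by (intro mult_right_mono disp s) auto
        finally show ?thesis by linarith
      qed
      ultimately show ?thesis by (simp add: inner_diff_left)
    qed
    define D where "D = integral {0..T} (\<lambda>s. (T - s) *\<^sub>R B s)"
    have iD: "((\<lambda>s. (T - s) *\<^sub>R B s) has_integral D) {0..T}"
      unfolding D_def by (intro integrable_integral integrable_continuous_interval continuous_intros Bc)
    have DI: "norm D \<le> I"
      unfolding D_def I_def
      by (intro integral_norm_bound_integral integrable_continuous_interval continuous_intros Bc) auto
    have zD: "27/40 * K * r\<^sup>2 * (T\<^sup>2 / 2) + (1/L) * J - (I + E) * I \<le> (q 0 - qb 0) \<bullet> D"
    proof (rule has_integral_le)
      show "((\<lambda>s. 27/40 * K * r\<^sup>2 * (T - s) + (1/L) * ((T - s) * (norm (B s))\<^sup>2) - (I + E) * ((T - s) * norm (B s)))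
        has_integral (27/40 * K * r\<^sup>2 * (T\<^sup>2 / 2) + (1/L) * J - (I + E) * I)) {0..T}"
        by (intro has_integral_add has_integral_diff has_integral_mult_right iI iJ i1)
      show "((\<lambda>s. (q 0 - qb 0) \<bullet> ((T - s) *\<^sub>R B s)) has_integral (q 0 - qb 0) \<bullet> D) {0..T}"
        using has_integral_linear[OF iD bounded_linear_inner_right[of "q 0 - qb 0"]] by (simp add: comp_def)
      fix s assume s: "s \<in> {0..T}"
      then have "(T - s) * (27/40 * K * r\<^sup>2 + (1/L) * (norm (B s))\<^sup>2 - (I + E) * norm (B s)) \<le> (T - s) * ((q 0 - qb 0) \<bullet> B s)"
        by (intro mult_left_mono coer) auto
      then show "27/40 * K * r\<^sup>2 * (T - s) + (1/L) * ((T - s) * (norm (B s))\<^sup>2) - (I + E) * ((T - s) * norm (B s))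
        \<le> (q 0 - qb 0) \<bullet> ((T - s) *\<^sub>R B s)"
      proof -
        have "u * (A + k * n - X * w) = A * u + k * (u * n) - X * (u * w)" for A k n X u w :: real
          by (simp add: algebra_simps)
        with \<open>(T - s) * _ \<le> _\<close> show ?thesis by (simp only: inner_scaleR_right)
      qed
    qed
    \<comment> \<open>The factor is 2 divided by the bound 3/20 on
      \<open>L * T\<^sup>2\<close>.\<close>
    have JL: "40/3 * I\<^sup>2 \<le> (1/L) * J"
    proof -
      have "40/3 * (L * T\<^sup>2) * I\<^sup>2 \<le> 2 * I\<^sup>2" using LT by (intro mult_right_mono) auto
      also have "\<dots> \<le> T\<^sup>2 * J" by (rule CS)
      finally have "T\<^sup>2 * (40/3 * L * I\<^sup>2) \<le> T\<^sup>2 * J" by (simp add: mult_ac)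
      then have "40/3 * L * I\<^sup>2 \<le> J" using Tpos by simp
      then show ?thesis using L0 by (simp add: field_simps)
    qed
    \<comment> \<open>The endpoint difference without the contribution of \<open>c - cb\<close>. In
      its squared norm the coefficient of \<open>I\<^sup>2\<close> is
      \<open>- 2 * (40/3) + 2 + 1 = - 71/3\<close>, which leaves room to complete the square with
      the mixed term in \<open>E\<close>.\<close>
    define m where "m = (q 0 - qb 0) - D"
    have "(norm m)\<^sup>2 \<le> ((1 - K * T\<^sup>2 / 3) * r + E / 4)\<^sup>2"
    proof -
      have "(norm m)\<^sup>2 = r\<^sup>2 - 2 * ((q 0 - qb 0) \<bullet> D) + (norm D)\<^sup>2"
        unfolding m_def r_def power2_norm_eq_inner by (simp add: algebra_simps inner_commute)
      also have "(norm D)\<^sup>2 \<le> I\<^sup>2" using DI by (intro power_mono) auto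
      finally have "(norm m)\<^sup>2 \<le> r\<^sup>2 - 27/40 * K * r\<^sup>2 * T\<^sup>2 - 71/3 * I\<^sup>2 + 2 * E * I"
        using zD JL by (simp add: power2_eq_square algebra_simps)
      also have "- (71/3) * I\<^sup>2 + 2 * E * I \<le> (E / 4)\<^sup>2"
      proof -
        have "0 \<le> (4 * I - E / 4)\<^sup>2" by simp
        then have "2 * E * I \<le> 16 * I\<^sup>2 + (E / 4)\<^sup>2" by (simp add: power2_eq_square algebra_simps)
        moreover have "16 * I\<^sup>2 \<le> 71/3 * I\<^sup>2" by (intro mult_right_mono) auto
        ultimately show ?thesis by linarith
      qed
      then have "r\<^sup>2 - 27/40 * K * r\<^sup>2 * T\<^sup>2 - 71/3 * I\<^sup>2 + 2 * E * I \<le> r\<^sup>2 - 27/40 * K * r\<^sup>2 * T\<^sup>2 + (E / 4)\<^sup>2"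
        by simp
      also have "r\<^sup>2 - 27/40 * K * r\<^sup>2 * T\<^sup>2 \<le> ((1 - K * T\<^sup>2 / 3) * r)\<^sup>2"
      proof -
        \<comment> \<open>This holds because 27/40 exceeds 2/3, and it is the origin of the
          contraction constant 1/3.\<close>
        have "1 - 27/40 * (K * T\<^sup>2) \<le> (1 - K * T\<^sup>2 / 3)\<^sup>2"
        proof -
          have "0 \<le> K * T\<^sup>2" using K0 by simp
          moreover have "(1 - K * T\<^sup>2 / 3)\<^sup>2 = 1 - 2/3 * (K * T\<^sup>2) + (K * T\<^sup>2 / 3)\<^sup>2" by (simp add: power2_diff)
          moreover have "0 \<le> (K * T\<^sup>2 / 3)\<^sup>2" by simp
          ultimately show ?thesis by linarith
        qed
        then have "(1 - 27/40 * (K * T\<^sup>2)) * r\<^sup>2 \<le> (1 - K * T\<^sup>2 / 3)\<^sup>2 * r\<^sup>2" by (rule mult_right_mono) simp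
        moreover have "(1 - 27/40 * (K * T\<^sup>2)) * r\<^sup>2 = r\<^sup>2 - 27/40 * K * r\<^sup>2 * T\<^sup>2" by (simp add: algebra_simps)
        ultimately show ?thesis by (simp only: power_mult_distrib)
      qed
      also have "((1 - K * T\<^sup>2 / 3) * r)\<^sup>2 + (E / 4)\<^sup>2 \<le> ((1 - K * T\<^sup>2 / 3) * r + E / 4)\<^sup>2"
      proof -
        have "x\<^sup>2 + y\<^sup>2 \<le> (x + y)\<^sup>2" if "0 \<le> x" "0 \<le> y" for x y :: real
          using that by (simp add: power2_sum)
        then show ?thesis using KT r0 E_nonneg by (auto intro!: mult_nonneg_nonneg)
      qed
      finally show ?thesis by simp
    qed
    then have m: "norm m \<le> (1 - K * T\<^sup>2 / 3) * r + E / 4"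
      by (rule power2_le_imp_le) (use KT r0 E_nonneg in auto)
    have "((\<lambda>s. (T - s) *\<^sub>R (- (B s + (c s - cb s)))) has_integral ((q T - qb T) - (q 0 - qb 0))) {0..T}"
      using taylor_second_order[OF z_deriv v_deriv, of T] Tpos by (simp add: v B_def)
    from has_integral_add[OF this iD]
    have iC: "((\<lambda>s. - ((T - s) *\<^sub>R (c s - cb s))) has_integral ((q T - qb T) - m)) {0..T}"
      by (simp add: m_def algebra_simps)
    have "norm ((q T - qb T) - m) \<le> E"
      unfolding E integral_unique[OF iC, symmetric]
    proof (rule integral_norm_bound_integral)
      fix s assume s: "s \<in> {0..T}"
      show "norm (- ((T - s) *\<^sub>R (c s - cb s))) \<le> (T - s) * \<beta> s"
        using c[OF s] s by (simp add: mult_left_mono)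
    next
      show "(\<lambda>s. - ((T - s) *\<^sub>R (c s - cb s))) integrable_on {0..T}" by (rule has_integral_integrable[OF iC])
      show "(\<lambda>s. (T - s) * \<beta> s) integrable_on {0..T}"
        by (intro integrable_continuous_interval continuous_intros \<beta>)
    qed
    then have "norm (q T - qb T) \<le> norm m + E"
      by (metis add.commute add_left_mono norm_triangle_sub order_trans)
    then show ?thesis using m E_nonneg unfolding r_def by simp
  qed
qed

text \<open>The slope of \<open>cf\<close> is at most 1, so the perturbation passes through the
  concave function without a factor. The larger of the two constants 40/37 and 5/2 serves both
  regimes.\<close>

lemma endpoint_cf_bound:
  assumes v: "Rt \<le> norm (q 0 - qb 0) \<Longrightarrow> p 0 = pb 0"
  shows "cf (norm (q T - qb T)) \<le> goal (q 0) (qb 0) (p 0 - pb 0) + 5/2 * E"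
proof (cases "norm (q 0 - qb 0) < Rt")
  case True
  let ?u = "norm (q 0 - qb 0 + T *\<^sub>R (p 0 - pb 0)) + 20/37 * (L * T\<^sup>2) * M"
  have u0: "0 \<le> ?u" using L0 unfolding M by (intro add_nonneg_nonneg mult_nonneg_nonneg amp_nonneg) auto
  have "cf (norm (q T - qb T)) \<le> cf (?u + 40/37 * E)" by (intro cf_mono endpoint_bound) auto
  also have "\<dots> \<le> cf ?u + 40/37 * E" using u0 E_nonneg by (intro cf_add_le) auto
  also have "cf ?u = goal (q 0) (qb 0) (p 0 - pb 0)" using True by (simp add: goal_def M)
  finally show ?thesis using E_nonneg by simp
next
  case False
  let ?u = "(1 - K * T\<^sup>2 / 3) * norm (q 0 - qb 0)"
  have u0: "0 \<le> ?u" using KT by (intro mult_nonneg_nonneg) auto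
  have "cf (norm (q T - qb T)) \<le> cf (?u + 5/2 * E)"
    using False v by (intro cf_mono synchronous_endpoint_bound) auto
  also have "\<dots> \<le> cf ?u + 5/2 * E" using u0 E_nonneg by (intro cf_add_le) auto
  also have "cf ?u = goal (q 0) (qb 0) (p 0 - pb 0)" using False by (simp add: goal_def)
  finally show ?thesis .
qed

end

end

section \<open>Product measures\<close>

text \<open>The maps may differ between the factors: the coupled velocity of a particle depends on
  its current pair of positions, yet each has the same law.\<close>

lemma distr_PiM_componentwise:
  fixes \<mu> :: "'b measure" and F :: "'i \<Rightarrow> 'b \<Rightarrow> 'c"
  assumes I: "finite I" and \<mu>: "prob_space \<mu>" and F: "\<And>i. i \<in> I \<Longrightarrow> F i \<in> measurable \<mu> N"
    and d: "\<And>i. i \<in> I \<Longrightarrow> distr \<mu> N (F i) = \<nu>" and \<nu>: "prob_space \<nu>" "sets \<nu> = sets N"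
  shows "distr (\<Pi>\<^sub>M i\<in>I. \<mu>) (\<Pi>\<^sub>M i\<in>I. N) (\<lambda>\<omega>. \<lambda>i\<in>I. F i (\<omega> i)) = (\<Pi>\<^sub>M i\<in>I. \<nu>)"
proof -
  interpret \<mu>: product_prob_space "\<lambda>_. \<mu>" I
    by (auto simp: product_prob_space_def product_prob_space_axioms_def product_sigma_finite_def \<mu>
        prob_space_imp_sigma_finite)
  interpret \<nu>: product_sigma_finite "\<lambda>_::'i. \<nu>"
    by (auto simp: product_sigma_finite_def \<nu> prob_space_imp_sigma_finite)
  have [measurable]: "(\<lambda>\<omega>. \<lambda>i\<in>I. F i (\<omega> i)) \<in> measurable (\<Pi>\<^sub>M i\<in>I. \<mu>) (\<Pi>\<^sub>M i\<in>I. N)"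
    by (intro measurable_restrict measurable_compose[OF measurable_component_singleton] F)
  show ?thesis
  proof (rule \<nu>.PiM_eqI[OF I])
    show "sets (distr (\<Pi>\<^sub>M i\<in>I. \<mu>) (\<Pi>\<^sub>M i\<in>I. N) (\<lambda>\<omega>. \<lambda>i\<in>I. F i (\<omega> i))) = sets (\<Pi>\<^sub>M i\<in>I. \<nu>)"
      using \<nu> by (simp cong: sets_PiM_cong)
    fix A assume A: "\<And>i. i \<in> I \<Longrightarrow> A i \<in> sets \<nu>"
    then have AN: "A i \<in> sets N" if "i \<in> I" for i using \<nu> that by simp
    have "emeasure (distr (\<Pi>\<^sub>M i\<in>I. \<mu>) (\<Pi>\<^sub>M i\<in>I. N) (\<lambda>\<omega>. \<lambda>i\<in>I. F i (\<omega> i))) (Pi\<^sub>E I A)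
      = emeasure (\<Pi>\<^sub>M i\<in>I. \<mu>) ((\<lambda>\<omega>. \<lambda>i\<in>I. F i (\<omega> i)) -` Pi\<^sub>E I A \<inter> space (\<Pi>\<^sub>M i\<in>I. \<mu>))"
      by (rule emeasure_distr) (auto intro!: sets_PiM_I_finite I AN)
    also have "(\<lambda>\<omega>. \<lambda>i\<in>I. F i (\<omega> i)) -` Pi\<^sub>E I A \<inter> space (\<Pi>\<^sub>M i\<in>I. \<mu>) = Pi\<^sub>E I (\<lambda>i. F i -` A i \<inter> space \<mu>)"
      by (auto simp: space_PiM PiE_iff extensional_def)
    also have "emeasure (\<Pi>\<^sub>M i\<in>I. \<mu>) \<dots> = (\<Prod>i\<in>I. emeasure \<mu> (F i -` A i \<inter> space \<mu>))"
      by (rule \<mu>.emeasure_PiM[OF I]) (auto intro: measurable_sets[OF F AN])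
    also have "\<dots> = (\<Prod>i\<in>I. emeasure \<nu> (A i))"
      by (rule prod.cong) (auto simp: d[symmetric] emeasure_distr F AN)
    finally show "emeasure (distr (\<Pi>\<^sub>M i\<in>I. \<mu>) (\<Pi>\<^sub>M i\<in>I. N) (\<lambda>\<omega>. \<lambda>i\<in>I. F i (\<omega> i))) (Pi\<^sub>E I A) = (\<Prod>i\<in>I. emeasure \<nu> (A i))" .
  qed
qed

text \<open>A pair of independent families is a family of independent pairs. Hence the nonlinear
  flow, applied particle by particle to independent positions and velocities, produces a product
  law.\<close>

lemma distr_PiM_pair:
  fixes \<mu> :: "'b measure" and \<rho> :: "'c measure" and f :: "'b \<times> 'c \<Rightarrow> 'd"
  assumes I: "finite (I :: 'i set)" and \<mu>: "prob_space \<mu>" and \<rho>: "prob_space \<rho>"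
    and f[measurable]: "f \<in> measurable (\<mu> \<Otimes>\<^sub>M \<rho>) N"
  shows "distr ((\<Pi>\<^sub>M i\<in>I. \<mu>) \<Otimes>\<^sub>M (\<Pi>\<^sub>M i\<in>I. \<rho>)) (\<Pi>\<^sub>M i\<in>I. N) (\<lambda>z. \<lambda>i\<in>I. f (fst z i, snd z i))
    = (\<Pi>\<^sub>M i\<in>I. distr (\<mu> \<Otimes>\<^sub>M \<rho>) N f)"
proof -
  interpret m: prob_space \<mu> by fact
  interpret r: prob_space \<rho> by fact
  interpret mr: pair_prob_space \<mu> \<rho> ..
  interpret pm: product_sigma_finite "\<lambda>_::'i. \<mu>"
    by (auto simp: product_sigma_finite_def \<mu> prob_space_imp_sigma_finite)
  interpret pr: product_sigma_finite "\<lambda>_::'i. \<rho>"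
    by (auto simp: product_sigma_finite_def \<rho> prob_space_imp_sigma_finite)
  interpret d: prob_space "distr (\<mu> \<Otimes>\<^sub>M \<rho>) N f"
    by (rule mr.P.prob_space_distr) measurable
  interpret pd: product_sigma_finite "\<lambda>_::'i. distr (\<mu> \<Otimes>\<^sub>M \<rho>) N f" ..
  interpret PR: sigma_finite_measure "\<Pi>\<^sub>M i\<in>I. \<rho>" by (rule pr.sigma_finite[OF I])
  have m1[measurable]: "(\<lambda>z. f (fst z i, snd z i)) \<in> measurable ((\<Pi>\<^sub>M i\<in>I. \<mu>) \<Otimes>\<^sub>M (\<Pi>\<^sub>M i\<in>I. \<rho>)) N" if "i \<in> I" for i
    by (rule measurable_compose[OF _ f], rule measurable_Pair)
      (auto intro!: measurable_compose[OF measurable_fst measurable_component_singleton] 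
        measurable_compose[OF measurable_snd measurable_component_singleton] that)
  have m2: "(\<lambda>z. \<lambda>i\<in>I. f (fst z i, snd z i)) \<in> measurable ((\<Pi>\<^sub>M i\<in>I. \<mu>) \<Otimes>\<^sub>M (\<Pi>\<^sub>M i\<in>I. \<rho>)) (\<Pi>\<^sub>M i\<in>I. N)"
    by (intro measurable_restrict m1)
  show ?thesis
  proof (rule pd.PiM_eqI[OF I])
    show "sets (distr ((\<Pi>\<^sub>M i\<in>I. \<mu>) \<Otimes>\<^sub>M (\<Pi>\<^sub>M i\<in>I. \<rho>)) (\<Pi>\<^sub>M i\<in>I. N) (\<lambda>z. \<lambda>i\<in>I. f (fst z i, snd z i)))
      = sets (\<Pi>\<^sub>M i\<in>I. distr (\<mu> \<Otimes>\<^sub>M \<rho>) N f)"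
      by (simp cong: sets_PiM_cong)
    fix A assume "\<And>i. i \<in> I \<Longrightarrow> A i \<in> sets (distr (\<mu> \<Otimes>\<^sub>M \<rho>) N f)"
    then have A: "A i \<in> sets N" if "i \<in> I" for i using that by simp
    have AP: "Pi\<^sub>E I A \<in> sets (\<Pi>\<^sub>M i\<in>I. N)" by (intro sets_PiM_I_finite I A)
    have ind: "(\<lambda>x. indicator (A i) (f x) :: ennreal) \<in> borel_measurable (\<mu> \<Otimes>\<^sub>M \<rho>)" if "i \<in> I" for i
      using A[OF that] by measurable
    have ind2: "(\<lambda>z. indicator (Pi\<^sub>E I A) (\<lambda>i\<in>I. f (fst z i, snd z i)) :: ennreal)
        \<in> borel_measurable ((\<Pi>\<^sub>M i\<in>I. \<mu>) \<Otimes>\<^sub>M (\<Pi>\<^sub>M i\<in>I. \<rho>))"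
      using m2 AP by measurable
    have "emeasure (distr ((\<Pi>\<^sub>M i\<in>I. \<mu>) \<Otimes>\<^sub>M (\<Pi>\<^sub>M i\<in>I. \<rho>)) (\<Pi>\<^sub>M i\<in>I. N) (\<lambda>z. \<lambda>i\<in>I. f (fst z i, snd z i))) (Pi\<^sub>E I A)
      = (\<integral>\<^sup>+z. indicator (Pi\<^sub>E I A) (\<lambda>i\<in>I. f (fst z i, snd z i)) \<partial>((\<Pi>\<^sub>M i\<in>I. \<mu>) \<Otimes>\<^sub>M (\<Pi>\<^sub>M i\<in>I. \<rho>)))"
      using AP by (subst nn_integral_indicator[symmetric], simp, subst nn_integral_distr[OF m2]) auto
    also have "\<dots> = (\<integral>\<^sup>+Y. \<integral>\<^sup>+w. indicator (Pi\<^sub>E I A) (\<lambda>i\<in>I. f (Y i, w i)) \<partial>(\<Pi>\<^sub>M i\<in>I. \<rho>) \<partial>(\<Pi>\<^sub>M i\<in>I. \<mu>))"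
      by (subst PR.nn_integral_fst[symmetric, OF ind2]) simp
    also have "\<dots> = (\<integral>\<^sup>+Y. \<integral>\<^sup>+w. (\<Prod>i\<in>I. indicator (A i) (f (Y i, w i))) \<partial>(\<Pi>\<^sub>M i\<in>I. \<rho>) \<partial>(\<Pi>\<^sub>M i\<in>I. \<mu>))"
    proof (intro nn_integral_cong)
      fix Y w
      show "indicator (Pi\<^sub>E I A) (\<lambda>i\<in>I. f (Y i, w i)) = (\<Prod>i\<in>I. indicator (A i) (f (Y i, w i)) :: ennreal)"
      proof (cases "\<forall>i\<in>I. f (Y i, w i) \<in> A i")
        case False
        then have "(\<Prod>i\<in>I. indicator (A i) (f (Y i, w i)) :: ennreal) = 0"
          by (intro prod_zero[OF I]) (auto simp: indicator_def)
        then show ?thesis using False by (auto simp: indicator_def PiE_iff)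
      qed (auto simp: indicator_def PiE_iff)
    qed
    also have "\<dots> = (\<integral>\<^sup>+Y. (\<Prod>i\<in>I. \<integral>\<^sup>+w. indicator (A i) (f (Y i, w)) \<partial>\<rho>) \<partial>(\<Pi>\<^sub>M i\<in>I. \<mu>))"
    proof (intro nn_integral_cong pr.product_nn_integral_prod I)
      fix Y i assume Y: "Y \<in> space (\<Pi>\<^sub>M i\<in>I. \<mu>)" and i: "i \<in> I"
      then have "Y i \<in> space \<mu>" by (auto simp: space_PiM)
      then show "(\<lambda>w. indicator (A i) (f (Y i, w)) :: ennreal) \<in> borel_measurable \<rho>"
        using measurable_compose[OF measurable_Pair1' ind[OF i]] by simp
    qed
    also have "\<dots> = (\<Prod>i\<in>I. \<integral>\<^sup>+y. \<integral>\<^sup>+w. indicator (A i) (f (y, w)) \<partial>\<rho> \<partial>\<mu>)"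
      by (intro pm.product_nn_integral_prod I r.borel_measurable_nn_integral_fst ind)
    also have "\<dots> = (\<Prod>i\<in>I. emeasure (distr (\<mu> \<Otimes>\<^sub>M \<rho>) N f) (A i))"
    proof (rule prod.cong[OF refl])
      fix i assume i: "i \<in> I"
      have "(\<integral>\<^sup>+y. \<integral>\<^sup>+w. indicator (A i) (f (y, w)) \<partial>\<rho> \<partial>\<mu>) = (\<integral>\<^sup>+z. indicator (A i) (f z) \<partial>(\<mu> \<Otimes>\<^sub>M \<rho>))"
        by (rule r.nn_integral_fst[OF ind[OF i]])
      also have "\<dots> = emeasure (distr (\<mu> \<Otimes>\<^sub>M \<rho>) N f) (A i)"
        using A[OF i] by (subst nn_integral_indicator[symmetric], simp, subst nn_integral_distr[OF f]) auto
      finally show "(\<integral>\<^sup>+y. \<integral>\<^sup>+w. indicator (A i) (f (y, w)) \<partial>\<rho> \<partial>\<mu>) = emeasure (distr (\<mu> \<Otimes>\<^sub>M \<rho>) N f) (A i)" .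
    qed
    finally show "emeasure (distr ((\<Pi>\<^sub>M i\<in>I. \<mu>) \<Otimes>\<^sub>M (\<Pi>\<^sub>M i\<in>I. \<rho>)) (\<Pi>\<^sub>M i\<in>I. N) (\<lambda>z. \<lambda>i\<in>I. f (fst z i, snd z i))) (Pi\<^sub>E I A)
      = (\<Prod>i\<in>I. emeasure (distr (\<mu> \<Otimes>\<^sub>M \<rho>) N f) (A i))" .
  qed
qed

lemma integral_prodN_component:
  fixes f :: "'b \<Rightarrow> real"
  assumes \<nu>: "prob_space \<nu>" and j: "j < N" and f: "f \<in> borel_measurable \<nu>"
  shows "integrable \<nu> f \<Longrightarrow> integrable (prodN N \<nu>) (\<lambda>u. f (u j))"
    "(\<integral>u. f (u j) \<partial>prodN N \<nu>) = (\<integral>x. f x \<partial>\<nu>)"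
proof -
  have d: "distr (prodN N \<nu>) \<nu> (\<lambda>u. u j) = \<nu>"
    unfolding prodN_def by (rule distr_PiM_component) (use \<nu> j in auto)
  have m: "(\<lambda>u. u j) \<in> measurable (prodN N \<nu>) \<nu>"
    unfolding prodN_def using j by (intro measurable_component_singleton) simp
  show "integrable (prodN N \<nu>) (\<lambda>u. f (u j))" if "integrable \<nu> f"
    using integrable_distr[OF m, of f] that by (simp add: d)
  show "(\<integral>u. f (u j) \<partial>prodN N \<nu>) = (\<integral>x. f x \<partial>\<nu>)"
    using integral_distr[OF m, of f] f by (simp add: d)
qed

lemma prob_space_prodN: "prob_space \<nu> \<Longrightarrow> prob_space (prodN N \<nu>)"
  unfolding prodN_def by (rule prob_space_PiM)

section \<open>Fluctuation of the mean field\<close>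

text \<open>A second-moment computation: the summands are orthogonal in L2, so the variance of their
  average is of order \<open>1 / N\<close>. The index \<open>i\<close> itself occurs in the
  sum.\<close>

lemma mean_field_fluctuation:
  fixes h :: "'a::euclidean_space \<Rightarrow> 'a \<Rightarrow> 'a"
  assumes \<nu>: "prob_space \<nu>" and sets_\<nu>[measurable_cong]: "sets \<nu> = sets borel"
    and m2: "integrable \<nu> (\<lambda>x. (norm x)\<^sup>2)"
    and lip: "\<And>q u u'. norm (h q u - h q u') \<le> l * norm (u - u')" and l0: "0 \<le> l"
    and h_meas: "(\<lambda>z. h (fst z) (snd z)) \<in> borel_measurable (borel \<Otimes>\<^sub>M borel)"
    and i: "i < N"
  shows "(\<integral>\<^sup>+u. ennreal (norm ((1 / real N) *\<^sub>R (\<Sum>j<N. h (u i) (u j)) - (\<integral>w. h (u i) w \<partial>\<nu>))) \<partial>prodN N \<nu>)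
    \<le> ennreal (2 * l * sqrt (\<integral>x. (norm x)\<^sup>2 \<partial>\<nu>) / sqrt (real N))"
proof -
  interpret \<nu>: prob_space \<nu> by fact
  interpret P: prob_space "prodN N \<nu>" by (rule prob_space_prodN) fact
  interpret ps: product_sigma_finite "\<lambda>_::nat. \<nu>"
    by (auto simp: product_sigma_finite_def \<nu> prob_space_imp_sigma_finite)
  define \<sigma> where "\<sigma> = (\<integral>x. (norm x)\<^sup>2 \<partial>\<nu>)"
  define \<sigma>1 where "\<sigma>1 = (\<integral>x. norm x \<partial>\<nu>)"
  have N0: "0 < real N" using i by simp
  have int1: "integrable \<nu> (\<lambda>x. norm x)"
  proof (rule Bochner_Integration.integrable_bound)
    show "integrable \<nu> (\<lambda>x. 1 + (norm x)\<^sup>2)" using m2 by simp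
    show "AE x in \<nu>. norm (norm x) \<le> norm (1 + (norm x)\<^sup>2)"
    proof (rule AE_I2)
      fix x :: 'a
      have "0 \<le> (norm x - 1/2)\<^sup>2" by simp
      then have "norm x \<le> 1 + (norm x)\<^sup>2" by (simp add: power2_eq_square algebra_simps)
      then show "norm (norm x) \<le> norm (1 + (norm x)\<^sup>2)" by simp
    qed
  qed measurable
  have s1: "\<sigma>1\<^sup>2 \<le> \<sigma>" "0 \<le> \<sigma>1"
    using \<nu>.variance_positive[of norm] \<nu>.variance_eq[OF int1 m2] by (auto simp: \<sigma>_def \<sigma>1_def integral_nonneg_AE)
  have hm[measurable (raw)]: "(\<lambda>x. h (f x) (k x)) \<in> borel_measurable M"
    if "f \<in> borel_measurable M" "k \<in> borel_measurable M" for f k and M :: "'m measure"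
    using measurable_compose[OF measurable_Pair[OF that] h_meas] by simp
  have hint: "integrable \<nu> (h q)" for q
  proof (rule Bochner_Integration.integrable_bound)
    show "integrable \<nu> (\<lambda>u. norm (h q 0) + l * norm u)" using int1 by simp
    show "AE u in \<nu>. norm (h q u) \<le> norm (norm (h q 0) + l * norm u)"
    proof (rule AE_I2)
      fix u
      have "norm (h q u) \<le> norm (h q 0) + norm (h q u - h q 0)" by (metis norm_triangle_sub)
      also have "\<dots> \<le> norm (h q 0) + l * norm u" using lip[of q u 0] by simp
      finally show "norm (h q u) \<le> norm (norm (h q 0) + l * norm u)" by simp
    qed
  qed measurable
  define hb where "hb q = (\<integral>w. h q w \<partial>\<nu>)" for q
  have [measurable]: "hb \<in> borel_measurable borel" unfolding hb_def by measurable
  define D where "D j u = h (u i) (u j) - hb (u i)" for j and u :: "nat \<Rightarrow> 'a"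
  have [measurable]: "(\<lambda>u. u j) \<in> borel_measurable (prodN N \<nu>)" if "j < N" for j
    using measurable_component_singleton[of j "{..<N}" "\<lambda>_. \<nu>"] that
    by (simp add: prodN_def measurable_cong_sets[OF refl sets_\<nu>])
  have Dm[measurable]: "D j \<in> borel_measurable (prodN N \<nu>)" if "j < N" for j
    unfolding D_def using that i by measurable
  \<comment> \<open>Writing the mean field as an integral over a fresh variable \<open>w\<close>
    bounds the summand without reference to the common argument \<open>u i\<close>, for the
    self-interaction as well.\<close>
  have DB: "(norm (D j u))\<^sup>2 \<le> l\<^sup>2 * (2 * (norm (u j))\<^sup>2 + 2 * \<sigma>)" for j u
  proof -
    have "D j u = (\<integral>w. h (u i) (u j) - h (u i) w \<partial>\<nu>)"
      unfolding D_def hb_def using hint by (simp add: \<nu>.prob_space)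
    also have "norm \<dots> \<le> (\<integral>w. norm (h (u i) (u j) - h (u i) w) \<partial>\<nu>)" by (rule integral_norm_bound)
    also have "\<dots> \<le> (\<integral>w. l * (norm (u j) + norm w) \<partial>\<nu>)"
      by (rule integral_mono) (use hint int1 l0 in \<open>auto intro!: order_trans[OF lip] mult_left_mono norm_triangle_ineq4\<close>)
    also have "\<dots> = l * (norm (u j) + \<sigma>1)" using int1 by (simp add: \<nu>.prob_space \<sigma>1_def)
    finally have "(norm (D j u))\<^sup>2 \<le> (l * (norm (u j) + \<sigma>1))\<^sup>2" by (intro power_mono) auto
    also have "\<dots> = l\<^sup>2 * (norm (u j) + \<sigma>1)\<^sup>2" by (simp add: power_mult_distrib)
    also have "\<dots> \<le> l\<^sup>2 * (2 * (norm (u j))\<^sup>2 + 2 * \<sigma>)"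
    proof (rule mult_left_mono)
      have "0 \<le> (norm (u j) - \<sigma>1)\<^sup>2" by simp
      then show "(norm (u j) + \<sigma>1)\<^sup>2 \<le> 2 * (norm (u j))\<^sup>2 + 2 * \<sigma>"
        using s1 by (simp add: power2_eq_square algebra_simps)
    qed simp
    finally show ?thesis .
  qed
  have Bint: "integrable (prodN N \<nu>) (\<lambda>u. l\<^sup>2 * (2 * (norm (u j))\<^sup>2 + 2 * \<sigma>))"
    and Bval: "(\<integral>u. l\<^sup>2 * (2 * (norm (u j))\<^sup>2 + 2 * \<sigma>) \<partial>prodN N \<nu>) = 4 * l\<^sup>2 * \<sigma>" if "j < N" for j
    using integral_prodN_component[OF \<nu> that, of "\<lambda>x. (norm x)\<^sup>2"] m2
    by (simp_all add: P.prob_space \<sigma>_def algebra_simps)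
  have DDint: "integrable (prodN N \<nu>) (\<lambda>u. D j u \<bullet> D k u)" if "j < N" "k < N" for j k
  proof (rule Bochner_Integration.integrable_bound)
    show "integrable (prodN N \<nu>) (\<lambda>u. l\<^sup>2 * (2 * (norm (u j))\<^sup>2 + 2 * \<sigma>) + l\<^sup>2 * (2 * (norm (u k))\<^sup>2 + 2 * \<sigma>))"
      using Bint that by (intro Bochner_Integration.integrable_add) auto
    show "AE u in prodN N \<nu>. norm (D j u \<bullet> D k u)
      \<le> norm (l\<^sup>2 * (2 * (norm (u j))\<^sup>2 + 2 * \<sigma>) + l\<^sup>2 * (2 * (norm (u k))\<^sup>2 + 2 * \<sigma>))"
    proof (rule AE_I2)
      fix u
      have "\<bar>D j u \<bullet> D k u\<bar> \<le> norm (D j u) * norm (D k u)" by (rule Cauchy_Schwarz_ineq2)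
      also have "\<dots> \<le> (norm (D j u))\<^sup>2 + (norm (D k u))\<^sup>2"
      proof -
        have "0 \<le> (norm (D j u) - norm (D k u))\<^sup>2" by simp
        then have "2 * (norm (D j u) * norm (D k u)) \<le> (norm (D j u))\<^sup>2 + (norm (D k u))\<^sup>2"
          by (simp add: power2_eq_square algebra_simps)
        moreover have "0 \<le> norm (D j u) * norm (D k u)" by simp
        ultimately show ?thesis by linarith
      qed
      also have "\<dots> \<le> l\<^sup>2 * (2 * (norm (u j))\<^sup>2 + 2 * \<sigma>) + l\<^sup>2 * (2 * (norm (u k))\<^sup>2 + 2 * \<sigma>)"
        by (intro add_mono DB)
      finally show "norm (D j u \<bullet> D k u)
        \<le> norm (l\<^sup>2 * (2 * (norm (u j))\<^sup>2 + 2 * \<sigma>) + l\<^sup>2 * (2 * (norm (u k))\<^sup>2 + 2 * \<sigma>))" by simp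
    qed
  qed (use that in measurable)
  \<comment> \<open>Given all other coordinates, the summand with index \<open>k \<noteq> i\<close>
    is centred in \<open>u k\<close>. The self-interaction term is not centred, but of two distinct
    indices at least one differs from \<open>i\<close>, and integrating out that coordinate is
    enough.\<close>
  have off0: "(\<integral>u. D j u \<bullet> D k u \<partial>prodN N \<nu>) = 0" if "j < N" "k < N" "j \<noteq> k" "k \<noteq> i" for j k
  proof -
    have ins: "{..<N} = insert k ({..<N} - {k})" using that by auto
    have DD': "integrable (\<Pi>\<^sub>M i\<in>insert k ({..<N} - {k}). \<nu>) (\<lambda>u. D j u \<bullet> D k u)"
      using DDint[OF that(1,2)] by (subst ins[symmetric]) (simp add: prodN_def)
    have "(\<integral>u. D j u \<bullet> D k u \<partial>prodN N \<nu>)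
        = (\<integral>x. (\<integral>y. D j (x(k := y)) \<bullet> D k (x(k := y)) \<partial>\<nu>) \<partial>(\<Pi>\<^sub>M i\<in>{..<N} - {k}. \<nu>))"
      unfolding prodN_def
      by (subst ins, rule ps.product_integral_insert[OF _ _ DD']) auto
    also have "\<dots> = (\<integral>x. 0 \<partial>(\<Pi>\<^sub>M i\<in>{..<N} - {k}. \<nu>))"
    proof (rule Bochner_Integration.integral_cong[OF refl])
      fix x
      have "(\<integral>y. D j (x(k := y)) \<bullet> D k (x(k := y)) \<partial>\<nu>) = (\<integral>y. D j x \<bullet> (h (x i) y - hb (x i)) \<partial>\<nu>)"
        using that by (simp add: D_def)
      also have "\<dots> = D j x \<bullet> (\<integral>y. h (x i) y - hb (x i) \<partial>\<nu>)"
        using hint by (intro integral_inner_right) auto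
      also have "(\<integral>y. h (x i) y - hb (x i) \<partial>\<nu>) = 0"
        using hint by (simp add: \<nu>.prob_space hb_def)
      finally show "(\<integral>y. D j (x(k := y)) \<bullet> D k (x(k := y)) \<partial>\<nu>) = 0" by (simp only: inner_zero_right)
    qed
    finally show ?thesis by simp
  qed
  have off: "(\<integral>u. D j u \<bullet> D k u \<partial>prodN N \<nu>) = 0" if "j < N" "k < N" "j \<noteq> k" for j k
    using off0[of j k] off0[of k j] that by (cases "k = i") (auto simp: inner_commute)
  define X where "X u = (1 / real N) *\<^sub>R (\<Sum>j<N. D j u)" for u
  have X_eq: "X u = (1 / real N) *\<^sub>R (\<Sum>j<N. h (u i) (u j)) - hb (u i)" for u
    using N0 by (simp add: X_def D_def sum_subtractf scaleR_diff_right sum_constant_scaleR)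
  have [measurable]: "X \<in> borel_measurable (prodN N \<nu>)" unfolding X_def by measurable
  have X2: "(norm (X u))\<^sup>2 = (1 / (real N)\<^sup>2) * (\<Sum>j<N. \<Sum>k<N. D j u \<bullet> D k u)" for u
  proof -
    have "(\<Sum>j<N. D j u) \<bullet> (\<Sum>j<N. D j u) = (\<Sum>j<N. \<Sum>k<N. D j u \<bullet> D k u)"
      unfolding inner_sum_left by (subst inner_sum_right) (rule refl)
    then show ?thesis unfolding power2_norm_eq_inner X_def by (simp add: power2_eq_square)
  qed
  have X2int: "integrable (prodN N \<nu>) (\<lambda>u. (norm (X u))\<^sup>2)"
    unfolding X2 by (intro integrable_mult_right Bochner_Integration.integrable_sum DDint) auto
  have "(\<integral>u. (norm (X u))\<^sup>2 \<partial>prodN N \<nu>) = (1 / (real N)\<^sup>2) * (\<Sum>j<N. \<Sum>k<N. \<integral>u. D j u \<bullet> D k u \<partial>prodN N \<nu>)"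
  proof -
    have "(\<integral>u. (\<Sum>j<N. \<Sum>k<N. D j u \<bullet> D k u) \<partial>prodN N \<nu>) = (\<Sum>j<N. \<integral>u. (\<Sum>k<N. D j u \<bullet> D k u) \<partial>prodN N \<nu>)"
      by (rule Bochner_Integration.integral_sum, rule Bochner_Integration.integrable_sum) (auto intro: DDint)
    also have "\<dots> = (\<Sum>j<N. \<Sum>k<N. \<integral>u. D j u \<bullet> D k u \<partial>prodN N \<nu>)"
      by (intro sum.cong refl Bochner_Integration.integral_sum) (auto intro: DDint)
    finally show ?thesis unfolding X2 by simp
  qed
  also have "(\<Sum>j<N. \<Sum>k<N. \<integral>u. D j u \<bullet> D k u \<partial>prodN N \<nu>) = (\<Sum>j<N. \<integral>u. D j u \<bullet> D j u \<partial>prodN N \<nu>)"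
  proof (rule sum.cong[OF refl])
    fix j assume j: "j \<in> {..<N}"
    have "(\<Sum>k<N. \<integral>u. D j u \<bullet> D k u \<partial>prodN N \<nu>) = (\<Sum>k\<in>{j}. \<integral>u. D j u \<bullet> D k u \<partial>prodN N \<nu>)"
      by (rule sum.mono_neutral_right) (use j off in auto)
    then show "(\<Sum>k<N. \<integral>u. D j u \<bullet> D k u \<partial>prodN N \<nu>) = (\<integral>u. D j u \<bullet> D j u \<partial>prodN N \<nu>)" by simp
  qed
  also have "\<dots> \<le> (\<Sum>j<N. 4 * l\<^sup>2 * \<sigma>)"
  proof (rule sum_mono)
    fix j assume "j \<in> {..<N}"
    then have j: "j < N" by simp
    have "(\<integral>u. D j u \<bullet> D j u \<partial>prodN N \<nu>) \<le> (\<integral>u. l\<^sup>2 * (2 * (norm (u j))\<^sup>2 + 2 * \<sigma>) \<partial>prodN N \<nu>)"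
      by (rule integral_mono) (use DDint[OF j j] Bint[OF j] DB[of j] in \<open>auto simp: power2_norm_eq_inner\<close>)
    then show "(\<integral>u. D j u \<bullet> D j u \<partial>prodN N \<nu>) \<le> 4 * l\<^sup>2 * \<sigma>" unfolding Bval[OF j] .
  qed
  finally have V: "(\<integral>u. (norm (X u))\<^sup>2 \<partial>prodN N \<nu>) \<le> 4 * l\<^sup>2 * \<sigma> / real N"
    using N0 by (simp add: power2_eq_square field_simps)
  have Xint: "integrable (prodN N \<nu>) (\<lambda>u. norm (X u))"
  proof (rule Bochner_Integration.integrable_bound)
    show "integrable (prodN N \<nu>) (\<lambda>u. 1 + (norm (X u))\<^sup>2)" using X2int by simp
    show "AE u in prodN N \<nu>. norm (norm (X u)) \<le> norm (1 + (norm (X u))\<^sup>2)"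
    proof (rule AE_I2)
      fix u
      have "0 \<le> (norm (X u) - 1/2)\<^sup>2" by simp
      then have "norm (X u) \<le> 1 + (norm (X u))\<^sup>2" by (simp add: power2_eq_square algebra_simps)
      then show "norm (norm (X u)) \<le> norm (1 + (norm (X u))\<^sup>2)" by simp
    qed
  qed measurable
  have "(\<integral>u. norm (X u) \<partial>prodN N \<nu>)\<^sup>2 \<le> (\<integral>u. (norm (X u))\<^sup>2 \<partial>prodN N \<nu>)"
    using P.variance_positive[of "\<lambda>u. norm (X u)"] P.variance_eq[OF Xint X2int] by simp
  also note V
  finally have "(\<integral>u. norm (X u) \<partial>prodN N \<nu>) \<le> sqrt (4 * l\<^sup>2 * \<sigma> / real N)" by (rule real_le_rsqrt)
  also have "\<dots> = 2 * l * sqrt \<sigma> / sqrt (real N)"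
    using l0 by (simp add: real_sqrt_mult real_sqrt_divide)
  finally have "ennreal (\<integral>u. norm (X u) \<partial>prodN N \<nu>) \<le> ennreal (2 * l * sqrt \<sigma> / sqrt (real N))"
    by (rule ennreal_leI)
  moreover have "(\<integral>\<^sup>+u. ennreal (norm (X u)) \<partial>prodN N \<nu>) = ennreal (\<integral>u. norm (X u) \<partial>prodN N \<nu>)"
    by (rule nn_integral_eq_integral[OF Xint]) simp
  ultimately show ?thesis by (simp add: X_eq hb_def \<sigma>_def)
qed

section \<open>Transition kernels as push-forwards\<close>

text \<open>With kernels written as images of a product of state and noise, a coupling of two steps
  can be built by coupling the noises.\<close>

lemma bind_distr_eq_distr_pair:
  assumes M: "prob_space M" and G: "prob_space G"
    and f[measurable]: "case_prod f \<in> measurable (M \<Otimes>\<^sub>M G) N"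
  shows "M \<bind> (\<lambda>x. distr G N (f x)) = distr (M \<Otimes>\<^sub>M G) N (case_prod f)"
proof -
  interpret M: prob_space M by fact
  interpret G: prob_space G by fact
  have Gs: "(\<lambda>x. G) \<in> measurable M (subprob_algebra G)"
    by (rule measurable_const) (use G in \<open>simp add: space_subprob_algebra prob_space_imp_subprob_space\<close>)
  have K: "(\<lambda>x. distr G N (f x)) \<in> measurable M (subprob_algebra N)"
    by (rule measurable_distr2[OF f Gs])
  show ?thesis
  proof (rule measure_eqI)
    show "sets (M \<bind> (\<lambda>x. distr G N (f x))) = sets (distr (M \<Otimes>\<^sub>M G) N (case_prod f))"
      using sets_bind[OF sets_kernel[OF K] M.not_empty] by simp
    fix A assume "A \<in> sets (M \<bind> (\<lambda>x. distr G N (f x)))"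
    then have A[measurable]: "A \<in> sets N" using sets_bind[OF sets_kernel[OF K] M.not_empty] by simp
    have "emeasure (M \<bind> (\<lambda>x. distr G N (f x))) A = (\<integral>\<^sup>+x. emeasure (distr G N (f x)) A \<partial>M)"
      by (rule emeasure_bind[OF M.not_empty K A])
    also have "\<dots> = (\<integral>\<^sup>+x. \<integral>\<^sup>+y. indicator A (f x y) \<partial>G \<partial>M)"
    proof (rule nn_integral_cong)
      fix x assume x: "x \<in> space M"
      then have [measurable]: "f x \<in> measurable G N"
        using measurable_compose[OF measurable_Pair1' f] by simp
      show "emeasure (distr G N (f x)) A = (\<integral>\<^sup>+y. indicator A (f x y) \<partial>G)"
        by (subst nn_integral_indicator[symmetric], simp, subst nn_integral_distr) auto
    qed
    also have "\<dots> = (\<integral>\<^sup>+z. indicator A (case_prod f z) \<partial>(M \<Otimes>\<^sub>M G))"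
      by (subst G.nn_integral_fst[symmetric]) auto
    also have "\<dots> = emeasure (distr (M \<Otimes>\<^sub>M G) N (case_prod f)) A"
      by (subst nn_integral_indicator[symmetric], simp, subst nn_integral_distr) auto
    finally show "emeasure (M \<bind> (\<lambda>x. distr G N (f x))) A = emeasure (distr (M \<Otimes>\<^sub>M G) N (case_prod f)) A" .
  qed
qed

lemma distr_pair_snd:
  assumes M: "prob_space M" and G: "prob_space G"
  shows "distr (M \<Otimes>\<^sub>M G) G snd = G"
proof (rule measure_eqI)
  interpret M: prob_space M by fact
  interpret G: prob_space G by fact
  fix A assume "A \<in> sets (distr (M \<Otimes>\<^sub>M G) G snd)"
  then have A: "A \<in> sets G" by simp
  have "snd -` A \<inter> space (M \<Otimes>\<^sub>M G) = space M \<times> A"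
    using sets.sets_into_space[OF A] by (auto simp: space_pair_measure)
  then show "emeasure (distr (M \<Otimes>\<^sub>M G) G snd) A = emeasure G A"
    using A by (simp add: emeasure_distr G.emeasure_pair_measure_Times M.emeasure_space_1)
qed simp

section \<open>The standing assumptions and derived bounds on the constants\<close>

locale hmc_setting =
  fixes V :: "'a::euclidean_space \<Rightarrow> real" and W :: "'a \<Rightarrow> 'a \<Rightarrow> real"
    and L K R Lt T \<epsilon> :: real and N :: nat
  assumes V_diff: "\<And>x. V differentiable (at x)"
    and W_diff: "\<And>z. (\<lambda>z. W (fst z) (snd z)) differentiable (at z)"
    and L_pos: "L > 0" and K_pos: "K > 0" and R_nn: "R \<ge> 0" and Lt_nn: "Lt \<ge> 0"
    and V_Lip: "\<And>x y. norm (grad V x - grad V y) \<le> L * norm (x - y)"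
    and V_conv: "\<And>x y. norm (x - y) \<ge> R \<Longrightarrow>
        (x - y) \<bullet> (grad V x - grad V y) \<ge> K * (norm (x - y))\<^sup>2 + (1 / L) * (norm (grad V x - grad V y))\<^sup>2"
    and W_sym: "\<And>x y. W x y = W y x"
    and W_Lip: "\<And>x y x' y'. norm (grad1 W x y - grad1 W x' y') \<le> Lt * (norm (x - x') + norm (y - y'))"
    and T_pos: "T > 0" and eps_nn: "\<epsilon> \<ge> 0" and N_pos: "N \<ge> 1"
    and LT1: "L * T\<^sup>2 \<le> 3 / 5 * (1 / 4)"
    and LT2: "Rtilde L K R > 0 \<Longrightarrow> L * T\<^sup>2 \<le> 3 / 5 * (3 / (1280 * L * (Rtilde L K R)\<^sup>2))"
    and eps_small: "\<epsilon> * Lt \<le> 5 / 64 * (K / sqrt (7 / 6 + 3 / (2 * K * T\<^sup>2)))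
                                  * exp (- 5 * Rtilde L K R / (2 * T) - 5)"
begin

text \<open>Tested on one pair at distance \<open>R + 1\<close>, the convexity condition and
  Cauchy-Schwarz give a quadratic inequality in the gradient difference; completing the square
  bounds \<open>K\<close>.\<close>

lemma K_le: "K \<le> L / 4"
proof -
  obtain e :: 'a where e: "e \<in> Basis" using nonempty_Basis by blast
  define x where "x = (R + 1) *\<^sub>R e"
  define r where "r = R + 1"
  have r: "norm (x - 0) = r" "0 < r" "R \<le> r" using e R_nn by (auto simp: x_def r_def)
  define n where "n = norm (grad V x - grad V 0)"
  have "K * r\<^sup>2 + (1 / L) * n\<^sup>2 \<le> (x - 0) \<bullet> (grad V x - grad V 0)"
    unfolding n_def r(1)[symmetric] by (rule V_conv) (use r in simp)
  also have "\<dots> \<le> r * n" unfolding n_def r(1)[symmetric] by (rule norm_cauchy_schwarz)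
  finally have "L * (K * r\<^sup>2 + (1 / L) * n\<^sup>2) \<le> L * (r * n)" using L_pos by (intro mult_left_mono) auto
  then have 1: "L * K * r\<^sup>2 + n\<^sup>2 \<le> L * r * n" using L_pos by (simp add: distrib_left mult.assoc)
  have "0 \<le> (n - L * r / 2)\<^sup>2" by simp
  then have "L * r * n \<le> n\<^sup>2 + L * (L / 4) * r\<^sup>2" by (simp add: power2_eq_square algebra_simps)
  with 1 have "L * r\<^sup>2 * K \<le> L * r\<^sup>2 * (L / 4)" by (simp add: mult_ac)
  then show ?thesis using L_pos r by simp
qed

definition Rt :: real where "Rt = Rtilde L K R"

lemma Rt_nonneg: "0 \<le> Rt" using L_pos K_pos R_nn by (simp add: Rt_def Rtilde_def)

text \<open>With \<open>K \<le> L / 4\<close> the ratio \<open>(2 * L + K) / (6 * K)\<close> is at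
  least 3/2.\<close>

lemma Rt_square: "3/2 * R\<^sup>2 \<le> Rt\<^sup>2"
proof -
  have "3/2 \<le> (2 * L + K) / (6 * K)" using K_le K_pos by (simp add: field_simps)
  then have "3/2 * R\<^sup>2 \<le> (2 * L + K) / (6 * K) * R\<^sup>2" by (rule mult_right_mono) simp
  also have "\<dots> = Rt\<^sup>2" using L_pos K_pos by (simp add: Rt_def Rtilde_def power_mult_distrib)
  finally show ?thesis .
qed

text \<open>For positive \<open>Rt\<close> the second smallness condition is the square of the
  claim. For \<open>Rt = 0\<close> that condition is void and the claim is trivial.\<close>

lemma LTRt: "L * T * Rt \<le> 3/80"
proof (cases "0 < Rt")
  case True
  then have "L * T\<^sup>2 \<le> 9 / (6400 * L * Rt\<^sup>2)" using LT2 by (simp add: Rt_def)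
  then have "L * T\<^sup>2 * (L * Rt\<^sup>2) \<le> 9/6400"
    using True L_pos by (simp add: field_simps)
  then have "(L * T * Rt)\<^sup>2 \<le> (3/80)\<^sup>2" by (simp add: power2_eq_square mult_ac)
  then show ?thesis by (rule power2_le_imp_le) simp
next
  case False then show ?thesis using Rt_nonneg by simp
qed

definition l :: real where "l = \<epsilon> * Lt"
definition b :: "'a \<Rightarrow> 'a" where "b = grad V"
definition g :: "'a \<Rightarrow> 'a \<Rightarrow> 'a" where "g x u = \<epsilon> *\<^sub>R grad1 W x u"

sublocale drift: hmc_drift L K Rt T b R
  by unfold_locales
    (use L_pos K_pos Rt_nonneg T_pos K_le LT1 LTRt V_Lip V_conv R_nn Rt_square in \<open>auto simp: b_def\<close>)

lemma l_nonneg: "0 \<le> l" using eps_nn Lt_nn by (simp add: l_def)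

lemma l_bound: "3 * (l * T\<^sup>2) \<le> 1/250 * drift.rate * exp (- drift.cut / T)"
proof -
  have KT: "0 < K * T\<^sup>2" "K * T\<^sup>2 \<le> 3/80" using K_pos T_pos drift.KT by auto
  \<comment> \<open>The bound \<open>K * T\<^sup>2 \<le> 3/80\<close> makes the square root in the
    assumption on \<open>\<epsilon>\<close> at least 6, which gives the numerical room needed
    here.\<close>
  have "40 \<le> 3 / (2 * K * T\<^sup>2)" using KT by (simp add: field_simps)
  then have "6\<^sup>2 \<le> 7/6 + 3 / (2 * K * T\<^sup>2)" by simp
  then have sq: "6 \<le> sqrt (7/6 + 3 / (2 * K * T\<^sup>2))" by (rule real_le_rsqrt)
  have "l \<le> 5/64 * (K / sqrt (7/6 + 3 / (2 * K * T\<^sup>2))) * exp (- 5 * Rt / (2 * T) - 5)"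
    using eps_small by (simp add: l_def Rt_def)
  also have "\<dots> \<le> 5/64 * (K / 6) * exp (- 5 * Rt / (2 * T) - 5)"
  proof (intro mult_right_mono mult_left_mono divide_left_mono)
    show "0 < sqrt (7/6 + 3 / (2 * K * T\<^sup>2)) * 6" using sq by linarith
  qed (use sq K_pos in auto)
  finally have "l * T\<^sup>2 \<le> 5/64 * (K / 6) * exp (- 5 * Rt / (2 * T) - 5) * T\<^sup>2" by (rule mult_right_mono) simp
  \<comment> \<open>The exponent is \<open>- 2 * cut / T\<close>. One half, short of 5/2, becomes
    the exponential in \<open>rate\<close>, the other half stays, and the surplus
    \<open>exp (- (5/2))\<close> is at most 1/12.\<close>
  also have "exp (- 5 * Rt / (2 * T) - 5) = exp (- 5 * Rt / (4 * T)) * exp (- drift.cut / T) * exp (- (5/2))"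
    unfolding drift.exp_cut exp_add[symmetric] by (rule arg_cong[where f=exp]) (use T_pos in \<open>simp add: field_simps\<close>)
  also have "5/64 * (K / 6) * (exp (- 5 * Rt / (4 * T)) * exp (- drift.cut / T) * exp (- (5/2))) * T\<^sup>2
    = 5/384 * (drift.rate * exp (- drift.cut / T)) * exp (- (5/2))"
    by (simp add: drift.rate_def)
  also have "\<dots> \<le> 5/384 * (drift.rate * exp (- drift.cut / T)) * (1/12)"
    using drift.rate_pos exp_five_halves(1) by (intro mult_left_mono) (auto simp: exp_minus field_simps)
  finally have "l * T\<^sup>2 \<le> 5/384 * (drift.rate * exp (- drift.cut / T)) * (1/12)" .
  moreover have "0 \<le> drift.rate * exp (- drift.cut / T)" using drift.rate_pos by simp
  ultimately show ?thesis by linarith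
qed

lemma l_small: "l * T\<^sup>2 \<le> 1/1000"
proof -
  have "drift.rate * exp (- drift.cut / T) \<le> 3/80 * 1"
    using drift.rate_le drift.rate_pos drift.a0 T_pos by (intro mult_mono) auto
  then show ?thesis using l_bound by linarith
qed

lemma g_Lip: "norm (g x u - g x' u') \<le> l * (norm (x - x') + norm (u - u'))"
  using mult_left_mono[OF W_Lip[of x u x' u'] eps_nn] eps_nn
  by (simp add: g_def l_def scaleR_diff_right[symmetric] mult.assoc)

sublocale mf: mean_field b g L l T
proof
  show "(L + 3 * l) * T\<^sup>2 \<le> 1/2" using LT1 l_small by (simp add: algebra_simps)
qed (use drift.b_lip g_Lip L_pos l_nonneg T_pos in auto)

section \<open>The nonlinear dynamics as a mean-field flow\<close>

lemma nl_sol_eq: "nl_sol V W \<epsilon> T \<nu> Q P nut = mf_sol b g T (\<nu> \<Otimes>\<^sub>M std_gauss) Q P nut"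
  unfolding nl_sol_def mf_sol_def b_def g_def integral_scaleR_right ..

lemma mean_field_init_pair:
  assumes \<nu>: "fin_second_moment \<nu>"
  shows "mean_field_init b g L l T (\<nu> \<Otimes>\<^sub>M std_gauss)"
proof -
  interpret \<nu>: prob_space \<nu> using \<nu> by (simp add: fin_second_moment_def)
  interpret pp: pair_prob_space \<nu> "std_gauss :: 'a measure" ..
  have s[measurable_cong]: "sets \<nu> = sets borel" using \<nu> by (simp add: fin_second_moment_def)
  have i1: "integrable \<nu> norm"
  proof (rule Bochner_Integration.integrable_bound)
    show "integrable \<nu> (\<lambda>x. 1 + (norm x)\<^sup>2)" using \<nu> by (simp add: fin_second_moment_def)
    show "AE x in \<nu>. norm (norm x) \<le> norm (1 + (norm x)\<^sup>2)"
    proof (rule AE_I2)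
      fix x :: 'a
      have "0 \<le> (norm x - 1/2)\<^sup>2" by simp
      then have "norm x \<le> 1 + (norm x)\<^sup>2" by (simp add: power2_eq_square algebra_simps)
      then show "norm (norm x) \<le> norm (1 + (norm x)\<^sup>2)" by simp
    qed
  qed measurable
  have d1: "distr (\<nu> \<Otimes>\<^sub>M std_gauss) \<nu> fst = \<nu>"
    by (rule prob_space.distr_pair_fst[OF prob_space_std_gauss])
  have d2: "distr (\<nu> \<Otimes>\<^sub>M std_gauss) (std_gauss :: 'a measure) snd = std_gauss"
    using \<nu>.prob_space_axioms prob_space_std_gauss by (rule distr_pair_snd)
  have j1: "integrable (\<nu> \<Otimes>\<^sub>M (std_gauss :: 'a measure)) (\<lambda>w. norm (fst w))"
    using integrable_distr[of fst "\<nu> \<Otimes>\<^sub>M std_gauss" \<nu> norm] i1 by (simp add: d1)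
  have j2: "integrable (\<nu> \<Otimes>\<^sub>M (std_gauss :: 'a measure)) (\<lambda>w. norm (snd w))"
    using integrable_distr[of snd "\<nu> \<Otimes>\<^sub>M std_gauss" "std_gauss :: 'a measure" norm] std_gauss_norm by (simp add: d2)
  have sP: "sets (\<nu> \<Otimes>\<^sub>M std_gauss) = sets (borel :: ('a \<times> 'a) measure)"
    unfolding borel_prod[symmetric] by (rule sets_pair_measure_cong) (auto simp: s)
  have nm: "norm \<in> borel_measurable (\<nu> \<Otimes>\<^sub>M (std_gauss :: 'a measure))"
    by (subst measurable_cong_sets[OF sP refl]) simp
  show ?thesis
  proof (intro mean_field_init.intro mean_field_init_axioms.intro mf.mean_field_axioms)
    show "prob_space (\<nu> \<Otimes>\<^sub>M (std_gauss :: 'a measure))" by (rule pp.P.prob_space_axioms)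
    show "integrable (\<nu> \<Otimes>\<^sub>M (std_gauss :: 'a measure)) norm"
    proof (rule Bochner_Integration.integrable_bound[OF Bochner_Integration.integrable_add[OF j1 j2] nm])
      show "AE w in \<nu> \<Otimes>\<^sub>M std_gauss. norm (norm w) \<le> norm (norm (fst w) + norm (snd (w :: 'a \<times> 'a)))"
        by (rule AE_I2) (simp add: norm_Pair norm_prod_def sqrt_sum_squares_le_sum)
    qed
  qed (rule sP)
qed

text \<open>Uniqueness reaches only the times in \<open>{0..T}\<close>, so one jointly continuous
  solution is chosen; its extension to all times makes it measurable in time and initial data
  together.\<close>

definition nlQ :: "'a measure \<Rightarrow> real \<Rightarrow> 'a \<Rightarrow> 'a \<Rightarrow> 'a" where
  "nlQ \<nu> = (SOME Q. \<exists>p m. mf_sol b g T (\<nu> \<Otimes>\<^sub>M std_gauss) Q p m \<and>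
     continuous_on UNIV (\<lambda>z. Q (fst z) (fst (snd z)) (snd (snd z))))"

lemma
  assumes \<nu>: "fin_second_moment \<nu>"
  shows nlQ_sol: "\<exists>p m. mf_sol b g T (\<nu> \<Otimes>\<^sub>M std_gauss) (nlQ \<nu>) p m"
    and nlQ_cont: "continuous_on UNIV (\<lambda>z. nlQ \<nu> (fst z) (fst (snd z)) (snd (snd z)))"
proof -
  interpret mean_field_init b g L l T "\<nu> \<Otimes>\<^sub>M std_gauss" by (rule mean_field_init_pair[OF \<nu>])
  show "\<exists>p m. mf_sol b g T (\<nu> \<Otimes>\<^sub>M std_gauss) (nlQ \<nu>) p m"
    "continuous_on UNIV (\<lambda>z. nlQ \<nu> (fst z) (fst (snd z)) (snd (snd z)))"
    using someI_ex[OF mf_sol_exists] unfolding nlQ_def by auto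
qed

lemma qbarT_eq:
  assumes \<nu>: "fin_second_moment \<nu>"
  shows "qbarT V W \<epsilon> T \<nu> x v = nlQ \<nu> T x v"
proof -
  interpret mean_field_init b g L l T "\<nu> \<Otimes>\<^sub>M std_gauss" by (rule mean_field_init_pair[OF \<nu>])
  obtain p m where S: "mf_sol b g T (\<nu> \<Otimes>\<^sub>M std_gauss) (nlQ \<nu>) p m" using nlQ_sol[OF \<nu>] by blast
  have T: "T \<in> {0..T}" using T_pos by simp
  show ?thesis unfolding qbarT_def nl_sol_eq
  proof (rule the_equality)
    show "\<exists>Q P nut. mf_sol b g T (\<nu> \<Otimes>\<^sub>M std_gauss) Q P nut \<and> nlQ \<nu> T x v = Q T x v" using S by blast
    fix y assume "\<exists>Q P nut. mf_sol b g T (\<nu> \<Otimes>\<^sub>M std_gauss) Q P nut \<and> y = Q T x v"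
    then show "y = nlQ \<nu> T x v" using mf_sol_unique[OF _ S T] by metis
  qed
qed

definition nlaw :: "'a measure \<Rightarrow> real \<Rightarrow> 'a measure" where
  "nlaw \<nu> t = distr (\<nu> \<Otimes>\<^sub>M std_gauss) borel (\<lambda>(x, v). nlQ \<nu> t x v)"

lemma nl_law_eq:
  assumes \<nu>: "fin_second_moment \<nu>" and t: "t \<in> {0..T}"
  shows "nl_law V W \<epsilon> T \<nu> t = nlaw \<nu> t"
proof -
  interpret mean_field_init b g L l T "\<nu> \<Otimes>\<^sub>M std_gauss" by (rule mean_field_init_pair[OF \<nu>])
  obtain p m where S: "mf_sol b g T (\<nu> \<Otimes>\<^sub>M std_gauss) (nlQ \<nu>) p m" using nlQ_sol[OF \<nu>] by blast
  have "m t = nlaw \<nu> t" unfolding nlaw_def by (rule mf_sol_law[OF S t])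
  show ?thesis unfolding nl_law_def nl_sol_eq
  proof (rule the_equality)
    show "\<exists>Q P nut. mf_sol b g T (\<nu> \<Otimes>\<^sub>M std_gauss) Q P nut \<and> nlaw \<nu> t = nut t"
      using S \<open>m t = nlaw \<nu> t\<close> by metis
    fix y assume "\<exists>Q P nut. mf_sol b g T (\<nu> \<Otimes>\<^sub>M std_gauss) Q P nut \<and> y = nut t"
    then show "y = nlaw \<nu> t" using mf_sol_law_unique[OF _ S t] \<open>m t = nlaw \<nu> t\<close> by metis
  qed
qed

lemma nlQ_measurable:
  assumes \<nu>: "fin_second_moment \<nu>"
  shows "(\<lambda>z. nlQ \<nu> (fst z) (fst (snd z)) (snd (snd z))) \<in> borel_measurable (borel \<Otimes>\<^sub>M (borel \<Otimes>\<^sub>M borel))"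
  using borel_measurable_continuous_onI[OF nlQ_cont[OF \<nu>]] by (simp add: borel_prod)

lemma nlQ_measurable'[measurable (raw)]:
  assumes "fin_second_moment \<nu>" "f \<in> borel_measurable M" "h \<in> borel_measurable M" "k \<in> borel_measurable M"
  shows "(\<lambda>x. nlQ \<nu> (f x) (h x) (k x)) \<in> borel_measurable M"
  using measurable_compose[OF measurable_Pair[OF assms(2) measurable_Pair[OF assms(3,4)]] nlQ_measurable[OF assms(1)]]
  by simp

lemma nl_step_eq:
  assumes \<nu>: "fin_second_moment \<nu>"
  shows "nl_step V W \<epsilon> T \<nu> = nlaw \<nu> T"
proof -
  have s[measurable_cong]: "sets \<nu> = sets borel" and p: "prob_space \<nu>" using \<nu> by (auto simp: fin_second_moment_def)
  have "nl_kernel V W \<epsilon> T \<nu> = (\<lambda>x. distr std_gauss borel (nlQ \<nu> T x))"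
    unfolding nl_kernel_def qbarT_eq[OF \<nu>] by (auto intro!: distr_cong)
  then have "nl_step V W \<epsilon> T \<nu> = \<nu> \<bind> (\<lambda>x. distr std_gauss borel (nlQ \<nu> T x))"
    by (simp add: nl_step_def)
  also have "\<dots> = distr (\<nu> \<Otimes>\<^sub>M std_gauss) borel (case_prod (nlQ \<nu> T))"
    by (rule bind_distr_eq_distr_pair[OF p prob_space_std_gauss]) (use \<nu> in measurable)
  finally show ?thesis by (simp add: nlaw_def)
qed

lemma nlaw_second_moment:
  assumes \<nu>: "fin_second_moment \<nu>" and t: "t \<in> {0..T}"
  shows "fin_second_moment (nlaw \<nu> t)"
proof -
  interpret mean_field_init b g L l T "\<nu> \<Otimes>\<^sub>M std_gauss" by (rule mean_field_init_pair[OF \<nu>])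
  obtain p m where S: "mf_sol b g T (\<nu> \<Otimes>\<^sub>M std_gauss) (nlQ \<nu>) p m" using nlQ_sol[OF \<nu>] by blast
  obtain C where C: "0 \<le> C" "\<And>t x v. t \<in> {0..T} \<Longrightarrow> norm (nlQ \<nu> t x v) \<le> C * wt x v" using mf_sol_growth[OF S] by metis
  interpret \<nu>: prob_space \<nu> using \<nu> by (simp add: fin_second_moment_def)
  have s[measurable_cong]: "sets \<nu> = sets borel" using \<nu> by (simp add: fin_second_moment_def)
  have m[measurable]: "(\<lambda>w. nlQ \<nu> t (fst w) (snd w)) \<in> borel_measurable (\<nu> \<Otimes>\<^sub>M std_gauss)"
    by (rule mf_sol_measurable[OF S t])
  have d1: "distr (\<nu> \<Otimes>\<^sub>M std_gauss) \<nu> fst = \<nu>"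
    by (rule prob_space.distr_pair_fst[OF prob_space_std_gauss])
  have d2: "distr (\<nu> \<Otimes>\<^sub>M std_gauss) (std_gauss :: 'a measure) snd = std_gauss"
    using \<nu>.prob_space_axioms prob_space_std_gauss by (rule distr_pair_snd)
  have j1: "integrable (\<nu> \<Otimes>\<^sub>M (std_gauss :: 'a measure)) (\<lambda>w. (norm (fst w))\<^sup>2)"
    using integrable_distr[of fst "\<nu> \<Otimes>\<^sub>M std_gauss" \<nu> "\<lambda>x. (norm x)\<^sup>2"] \<nu> by (simp add: d1 fin_second_moment_def)
  have j2: "integrable (\<nu> \<Otimes>\<^sub>M (std_gauss :: 'a measure)) (\<lambda>w. (norm (snd w))\<^sup>2)"
    using integrable_distr[of snd "\<nu> \<Otimes>\<^sub>M std_gauss" "std_gauss :: 'a measure" "\<lambda>x. (norm x)\<^sup>2"] std_gauss_norm_square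
    by (simp add: d2)
  have i: "integrable (\<nu> \<Otimes>\<^sub>M std_gauss) (\<lambda>w. (norm (nlQ \<nu> t (fst w) (snd w)))\<^sup>2)"
  proof (rule Bochner_Integration.integrable_bound)
    show "integrable (\<nu> \<Otimes>\<^sub>M (std_gauss :: 'a measure)) (\<lambda>w. C\<^sup>2 * (3 * (mass\<^sup>2 + (norm (fst w))\<^sup>2 + (norm (snd w))\<^sup>2)))"
      by (intro integrable_mult_right Bochner_Integration.integrable_add P.integrable_const j1 j2)
    show "AE w in \<nu> \<Otimes>\<^sub>M std_gauss. norm ((norm (nlQ \<nu> t (fst w) (snd w)))\<^sup>2)
      \<le> norm (C\<^sup>2 * (3 * (mass\<^sup>2 + (norm (fst w))\<^sup>2 + (norm (snd w))\<^sup>2)))"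
    proof (rule AE_I2)
      fix w :: "'a \<times> 'a"
      have "(norm (nlQ \<nu> t (fst w) (snd w)))\<^sup>2 \<le> (C * wt (fst w) (snd w))\<^sup>2"
        by (intro power_mono C t) auto
      also have "\<dots> = C\<^sup>2 * (mass + norm (fst w) + norm (snd w))\<^sup>2" by (simp add: power_mult_distrib wt_def)
      also have "\<dots> \<le> C\<^sup>2 * (3 * (mass\<^sup>2 + (norm (fst w))\<^sup>2 + (norm (snd w))\<^sup>2))"
      proof (rule mult_left_mono)
        have "(x + y + z)\<^sup>2 \<le> 3 * (x\<^sup>2 + y\<^sup>2 + z\<^sup>2)" for x y z :: real
        proof -
          have "0 \<le> (x - y)\<^sup>2 + (y - z)\<^sup>2 + (x - z)\<^sup>2" by simp
          then show ?thesis by (simp add: power2_eq_square algebra_simps)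
        qed
        then show "(mass + norm (fst w) + norm (snd w))\<^sup>2 \<le> 3 * (mass\<^sup>2 + (norm (fst w))\<^sup>2 + (norm (snd w))\<^sup>2)" .
      qed simp
      finally show "norm ((norm (nlQ \<nu> t (fst w) (snd w)))\<^sup>2)
        \<le> norm (C\<^sup>2 * (3 * (mass\<^sup>2 + (norm (fst w))\<^sup>2 + (norm (snd w))\<^sup>2)))" by simp
    qed
  qed measurable
  show ?thesis unfolding fin_second_moment_def nlaw_def case_prod_beta'
    using i by (auto intro!: P.prob_space_distr m simp: integrable_distr_eq)
qed

lemma nl_step_iter_second_moment:
  assumes "fin_second_moment \<nu>"
  shows "fin_second_moment ((nl_step V W \<epsilon> T ^^ k) \<nu>)"
  using assms by (induction k) (auto simp: nl_step_eq intro!: nlaw_second_moment less_imp_le[OF T_pos])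

end

section \<open>The particle system\<close>

context hmc_setting begin

definition pmean :: "(nat \<Rightarrow> 'a) \<Rightarrow> nat \<Rightarrow> 'a" where
  "pmean x i = (1 / real N) *\<^sub>R (\<Sum>j<N. g (x i) (x j))"

lemma gradU_pmean: "i < N \<Longrightarrow> gradU V W \<epsilon> N x i = b (x i) + pmean x i"
  by (simp add: gradU_eq[OF V_diff W_diff W_sym] b_def pmean_def g_def scaleR_sum_right)

lemma part_sol_iff:
  "part_sol V W \<epsilon> T N x \<xi> q p \<longleftrightarrow> (\<forall>i<N. q 0 i = x i \<and> p 0 i = \<xi> i \<and>
        (\<forall>t\<in>{0..T}.
           ((\<lambda>s. q s i) has_vector_derivative p t i) (at t within {0..T}) \<and>
           ((\<lambda>s. p s i) has_vector_derivative - (b (q t i) + pmean (q t) i)) (at t within {0..T})))"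
  unfolding part_sol_def by (auto simp: gradU_pmean)

lemma average_le: "(\<And>j. j < N \<Longrightarrow> f j \<le> C) \<Longrightarrow> (1 / real N) * (\<Sum>j<N. f j) \<le> (C :: real)"
  using sum_bounded_above[of "{..<N}" f C] N_pos by (simp add: field_simps)

lemma pmean_lip:
  assumes i: "i < N"
  shows "norm (pmean x i - pmean y i) \<le> l * (norm (x i - y i) + (1 / real N) * (\<Sum>j<N. norm (x j - y j)))"
proof -
  have "pmean x i - pmean y i = (1 / real N) *\<^sub>R (\<Sum>j<N. g (x i) (x j) - g (y i) (y j))"
    by (simp add: pmean_def scaleR_diff_right sum_subtractf)
  also have "norm \<dots> = (1 / real N) * norm (\<Sum>j<N. g (x i) (x j) - g (y i) (y j))" by simp
  also have "\<dots> \<le> (1 / real N) * (\<Sum>j<N. l * (norm (x i - y i) + norm (x j - y j)))"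
    by (intro mult_left_mono order_trans[OF norm_sum] sum_mono g_Lip) auto
  also have "\<dots> = l * (norm (x i - y i) + (1 / real N) * (\<Sum>j<N. norm (x j - y j)))"
    using N_pos by (simp add: sum_distrib_left[symmetric] sum.distrib field_simps)
  finally show ?thesis .
qed

text \<open>The particle system is the mean-field dynamics whose initial law is the empirical
  measure of the \<open>N\<close> initial pairs: integrals over it are the averages in
  \<open>pmean\<close>. The Picard argument therefore covers it.\<close>

lemma part_sol_exists: "\<exists>q p. part_sol V W \<epsilon> T N x \<xi> q p"
proof -
  define U where "U = measure_pmf (pmf_of_set {..<N})"
  define F where "F i = (x i, \<xi> i)" for i
  define P where "P = distr U borel F"
  interpret U: prob_space U unfolding U_def by (rule measure_pmf.prob_space_axioms)
  have Fm[measurable]: "F \<in> measurable U borel" by (simp add: U_def)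
  have "0 \<in> {..<N}" using N_pos by simp
  then have ne: "{..<N} \<noteq> {}" "finite {..<N}" by auto
  have avg: "(\<integral>w. f w \<partial>P) = (1 / real N) *\<^sub>R (\<Sum>j<N. f (x j, \<xi> j))"
    if "f \<in> borel_measurable borel" for f :: "'a \<times> 'a \<Rightarrow> 'a"
  proof -
    have "measure_pmf.expectation (pmf_of_set {..<N}) h = (1 / real N) *\<^sub>R (\<Sum>j<N. h j)" for h :: "nat \<Rightarrow> 'a"
    proof -
      have "measure_pmf.expectation (pmf_of_set {..<N}) h = (\<Sum>j<N. pmf (pmf_of_set {..<N}) j *\<^sub>R h j)"
        by (rule integral_measure_pmf[OF ne(2)]) (simp add: set_pmf_of_set[OF ne])
      also have "\<dots> = (\<Sum>j<N. (1 / real N) *\<^sub>R h j)"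
        by (rule sum.cong) (simp_all add: pmf_of_set[OF ne])
      finally show ?thesis by (simp only: scaleR_sum_right)
    qed
    then show ?thesis unfolding P_def by (subst integral_distr[OF Fm that]) (simp add: U_def F_def)
  qed
  have Pi: "mean_field_init b g L l T P"
  proof (intro mean_field_init.intro mean_field_init_axioms.intro mf.mean_field_axioms)
    show "prob_space P" unfolding P_def by (rule U.prob_space_distr) measurable
    show "sets P = sets borel" by (simp add: P_def)
    show "integrable P norm" unfolding P_def
      by (subst integrable_distr_eq) (auto simp: U_def set_pmf_of_set[OF ne] intro!: integrable_measure_pmf_finite)
  qed
  interpret mean_field_init b g L l T P by (rule Pi)
  obtain Q p m where S: "mf_sol b g T P Q p m" using mf_sol_exists by blast
  have "part_sol V W \<epsilon> T N x \<xi> (\<lambda>t i. Q t (x i) (\<xi> i)) (\<lambda>t i. p t (x i) (\<xi> i))"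
    unfolding part_sol_iff
  proof (intro allI impI conjI ballI)
    fix i t assume i: "i < N" and t: "t \<in> {0..T}"
    show "((\<lambda>s. Q s (x i) (\<xi> i)) has_vector_derivative p t (x i) (\<xi> i)) (at t within {0..T})"
      by (rule mf_sol_deriv[OF S t])
    have [measurable]: "(\<lambda>w. Q t (fst w) (snd w)) \<in> borel_measurable borel"
      using mf_sol_measurable[OF S t] by (simp add: P_def)
    have "(\<integral>u. g (Q t (x i) (\<xi> i)) u \<partial>(m t)) = pmean (\<lambda>i. Q t (x i) (\<xi> i)) i"
      unfolding mf_sol_integral[OF S t] by (subst avg) (measurable, simp add: pmean_def)
    then show "((\<lambda>s. p s (x i) (\<xi> i)) has_vector_derivative
        - (b (Q t (x i) (\<xi> i)) + pmean (\<lambda>i. Q t (x i) (\<xi> i)) i)) (at t within {0..T})"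
      using mf_sol_deriv2[OF S t, of "x i" "\<xi> i"] by simp
  qed (auto simp: mf_sol_init[OF S])
  then show ?thesis by blast
qed

text \<open>The maximum is taken over times and particles at once. At a maximizing pair the average
  over the other particles is at most that maximum, so the Lipschitz constants add up to
  \<open>L + 2 * l\<close>, uniformly in \<open>N\<close>.\<close>

lemma part_sol_stable:
  assumes S: "part_sol V W \<epsilon> T N x \<xi> q p" and S': "part_sol V W \<epsilon> T N x' \<xi>' q' p'"
    and D: "\<And>i. i < N \<Longrightarrow> norm (x i - x' i) + T * norm (\<xi> i - \<xi>' i) \<le> D"
    and i: "i < N" and t: "t \<in> {0..T}"
  shows "norm (q t i - q' t i) \<le> 2 * D"
proof -
  note A = S[unfolded part_sol_iff, rule_format] and A' = S'[unfolded part_sol_iff, rule_format]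
  have zd: "((\<lambda>s. q s j - q' s j) has_vector_derivative p s j - p' s j) (at s within {0..T})"
    if "j < N" "s \<in> {0..T}" for j s
    using A[OF that(1)] A'[OF that(1)] that(2) by (intro derivative_intros) auto
  have vd: "((\<lambda>s. p s j - p' s j) has_vector_derivative
      - (b (q s j) + pmean (q s) j) - - (b (q' s j) + pmean (q' s) j)) (at s within {0..T})"
    if "j < N" "s \<in> {0..T}" for j s
    using A[OF that(1)] A'[OF that(1)] that(2) by (intro derivative_intros) auto
  have "\<exists>C. \<forall>s\<in>{0..T}. norm (q s j - q' s j) \<le> C \<and> (\<exists>s\<in>{0..T}. C = norm (q s j - q' s j))" if "j < N" for j
  proof -
    have "continuous_on {0..T} (\<lambda>s. norm (q s j - q' s j))"
      by (intro continuous_on_norm continuous_on_trajectory[OF zd[OF that]])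
    then obtain s0 where "s0 \<in> {0..T}" "\<And>s. s \<in> {0..T} \<Longrightarrow> norm (q s j - q' s j) \<le> norm (q s0 j - q' s0 j)"
      using continuous_attains_sup[of "{0..T}" "\<lambda>s. norm (q s j - q' s j)"] T_pos by auto
    then show ?thesis by (intro exI[of _ "norm (q s0 j - q' s0 j)"]) auto
  qed
  then obtain C where C: "\<And>j s. j < N \<Longrightarrow> s \<in> {0..T} \<Longrightarrow> norm (q s j - q' s j) \<le> C j"
    and C': "\<And>j. j < N \<Longrightarrow> \<exists>s\<in>{0..T}. C j = norm (q s j - q' s j)"
    using t by metis
  define M where "M = Max (C ` {..<N})"
  have M: "C j \<le> M" if "j < N" for j unfolding M_def by (rule Max_ge) (use that in auto)
  have "C 0 \<in> C ` {..<N}" using N_pos by auto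
  then have "M \<in> C ` {..<N}" unfolding M_def by (intro Max_in) auto
  then obtain k where k: "k < N" "M = C k" by auto
  then obtain s where s: "s \<in> {0..T}" "M = norm (q s k - q' s k)" using C'[of k] by auto
  have M0: "0 \<le> M" unfolding s(2) by simp
  have CM: "norm (q s j - q' s j) \<le> M" if "j < N" "s \<in> {0..T}" for j s using C[OF that] M[OF that(1)] by linarith
  have "norm ((q s k - q' s k) - (q 0 k - q' 0 k) - s *\<^sub>R (p 0 k - p' 0 k)) \<le> ((L + 2 * l) * M) * T\<^sup>2"
  proof (rule second_order_bound[OF zd[OF k(1)] vd[OF k(1)] s(1)])
    fix u assume u: "u \<in> {0..T}"
    have "norm (- (b (q u k) + pmean (q u) k) - - (b (q' u k) + pmean (q' u) k))
      = norm ((b (q u k) - b (q' u k)) + (pmean (q u) k - pmean (q' u) k))"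
      by (subst norm_minus_cancel[symmetric]) (simp add: algebra_simps)
    also have "\<dots> \<le> L * M + l * (M + M)"
    proof (intro norm_triangle_mono)
      show "norm (b (q u k) - b (q' u k)) \<le> L * M"
        using L_pos by (intro order_trans[OF drift.b_lip] mult_left_mono CM k u) auto
      show "norm (pmean (q u) k - pmean (q' u) k) \<le> l * (M + M)"
        by (intro order_trans[OF pmean_lip[OF k(1)]] mult_left_mono add_mono average_le CM k u l_nonneg)
    qed
    finally show "norm (- (b (q u k) + pmean (q u) k) - - (b (q' u k) + pmean (q' u) k)) \<le> (L + 2 * l) * M"
      by (simp add: algebra_simps)
  qed (use L_pos l_nonneg M0 in auto)
  also have "((L + 2 * l) * M) * T\<^sup>2 = ((L + 2 * l) * T\<^sup>2) * M" by simp
  also have "\<dots> \<le> 1/2 * M"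
  proof (rule mult_right_mono[OF _ M0])
    have "(L + 2 * l) * T\<^sup>2 \<le> (L + 3 * l) * T\<^sup>2" using l_nonneg by (intro mult_right_mono) auto
    then show "(L + 2 * l) * T\<^sup>2 \<le> 1/2" using mf.small by linarith
  qed
  finally have 1: "norm ((q s k - q' s k) - (x k - x' k) - s *\<^sub>R (\<xi> k - \<xi>' k)) \<le> 1/2 * M"
    using A[OF k(1)] A'[OF k(1)] by simp
  have "M \<le> norm ((q s k - q' s k) - (x k - x' k) - s *\<^sub>R (\<xi> k - \<xi>' k)) + norm (x k - x' k) + norm (s *\<^sub>R (\<xi> k - \<xi>' k))"
    unfolding s(2) by (smt (verit) norm_triangle_ineq diff_add_cancel)
  moreover have "norm (s *\<^sub>R (\<xi> k - \<xi>' k)) \<le> T * norm (\<xi> k - \<xi>' k)"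
    using s(1) by (auto intro!: mult_right_mono)
  ultimately have "M \<le> 2 * D" using D[OF k(1)] 1 by linarith
  then show ?thesis using CM[OF i t] by linarith
qed

lemma part_sol_unique:
  assumes S: "part_sol V W \<epsilon> T N x \<xi> q p" and S': "part_sol V W \<epsilon> T N x' \<xi>' q' p'"
    and eq: "\<And>i. i < N \<Longrightarrow> x i = x' i" "\<And>i. i < N \<Longrightarrow> \<xi> i = \<xi>' i" and i: "i < N" and t: "t \<in> {0..T}"
  shows "q t i = q' t i"
  using part_sol_stable[OF S S' _ i t, of 0] eq by simp

lemma qT_eq:
  assumes S: "part_sol V W \<epsilon> T N x \<xi> q p"
  shows "qT V W \<epsilon> T N x \<xi> = restrict (q T) {..<N}"
  unfolding qT_def
proof (rule the_equality)
  show "\<exists>q' p. part_sol V W \<epsilon> T N x \<xi> q' p \<and> restrict (q T) {..<N} = restrict (q' T) {..<N}" using S by blast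
  fix y assume "\<exists>q p. part_sol V W \<epsilon> T N x \<xi> q p \<and> y = restrict (q T) {..<N}"
  then show "y = restrict (q T) {..<N}"
  proof (elim exE conjE)
    fix q' p' assume S': "part_sol V W \<epsilon> T N x \<xi> q' p'" and y: "y = restrict (q' T) {..<N}"
    have "q' T i = q T i" if "i < N" for i
      by (rule part_sol_unique[OF S' S refl refl that]) (use T_pos in auto)
    then show "y = restrict (q T) {..<N}" unfolding y by (auto intro: restrict_ext)
  qed
qed

lemma qT_stable:
  assumes D: "\<And>i. i < N \<Longrightarrow> norm (x i - x' i) + T * norm (\<xi> i - \<xi>' i) \<le> D" and i: "i < N"
  shows "norm (qT V W \<epsilon> T N x \<xi> i - qT V W \<epsilon> T N x' \<xi>' i) \<le> 2 * D"
proof -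
  obtain q p where S: "part_sol V W \<epsilon> T N x \<xi> q p" using part_sol_exists by blast
  obtain q' p' where S': "part_sol V W \<epsilon> T N x' \<xi>' q' p'" using part_sol_exists by blast
  show ?thesis unfolding qT_eq[OF S] qT_eq[OF S'] using part_sol_stable[OF S S' D i, of T] i T_pos by simp
qed

lemma qT_component_continuous:
  assumes i: "i < N"
  shows "continuous_on UNIV (\<lambda>z :: (nat \<Rightarrow> 'a) \<times> (nat \<Rightarrow> 'a). qT V W \<epsilon> T N (fst z) (snd z) i)"
  unfolding continuous_on_sequentially
proof (intro ballI allI impI)
  fix y :: "(nat \<Rightarrow> 'a) \<times> (nat \<Rightarrow> 'a)" and u assume u: "(\<forall>n. u n \<in> UNIV) \<and> u \<longlonglongrightarrow> y"
  have c: "continuous_on UNIV (\<lambda>x :: nat \<Rightarrow> 'a. x j)" for j by (rule continuous_on_product_coordinates)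
  have u1: "(\<lambda>n. fst (u n) j) \<longlonglongrightarrow> fst y j" for j
    using continuous_on_tendsto_compose[OF c[of j] tendsto_fst[OF conjunct2[OF u]]] by simp
  have u2: "(\<lambda>n. snd (u n) j) \<longlonglongrightarrow> snd y j" for j
    using continuous_on_tendsto_compose[OF c[of j] tendsto_snd[OF conjunct2[OF u]]] by simp
  define D where "D n = (\<Sum>j<N. norm (fst (u n) j - fst y j) + T * norm (snd (u n) j - snd y j))" for n
  have D: "D \<longlonglongrightarrow> (\<Sum>j<N. 0 + T * 0)"
    unfolding D_def
    by (intro tendsto_sum tendsto_add tendsto_mult tendsto_const)
      (use u1 u2 in \<open>auto simp: tendsto_norm_zero_iff LIM_zero_iff\<close>)
  then have "(\<lambda>n. 2 * D n) \<longlonglongrightarrow> 2 * (\<Sum>j<N. 0 + T * 0)" by (intro tendsto_mult tendsto_const)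
  then have lim: "(\<lambda>n. 2 * D n) \<longlonglongrightarrow> 0" by simp
  have bd: "norm (qT V W \<epsilon> T N (fst (u n)) (snd (u n)) i - qT V W \<epsilon> T N (fst y) (snd y) i) \<le> 2 * D n" for n
  proof (rule qT_stable[OF _ i])
    fix j assume j: "j < N"
    show "norm (fst (u n) j - fst y j) + T * norm (snd (u n) j - snd y j) \<le> D n"
      unfolding D_def
      by (rule member_le_sum[of j "{..<N}" "\<lambda>j. norm (fst (u n) j - fst y j) + T * norm (snd (u n) j - snd y j)"])
        (use j T_pos in auto)
  qed
  have "(\<lambda>n. qT V W \<epsilon> T N (fst (u n)) (snd (u n)) i - qT V W \<epsilon> T N (fst y) (snd y) i) \<longlonglongrightarrow> 0"
    by (rule Lim_null_comparison[OF always_eventually lim], rule allI, rule bd)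
  then show "((\<lambda>z. qT V W \<epsilon> T N (fst z) (snd z) i) \<circ> u) \<longlonglongrightarrow> qT V W \<epsilon> T N (fst y) (snd y) i"
    by (simp add: comp_def LIM_zero_iff)
qed

text \<open>Points of the finite product are undefined off the index set. Extending by zero moves
  them to the product over all of \<open>nat\<close>, where the product sigma-algebra is the Borel
  one and continuity yields measurability.\<close>

definition zext :: "(nat \<Rightarrow> 'a) \<Rightarrow> nat \<Rightarrow> 'a" where "zext x i = (if i < N then x i else 0)"

lemma qT_zext: "qT V W \<epsilon> T N (zext x) (zext \<xi>) = qT V W \<epsilon> T N x \<xi>"
proof -
  obtain q p where S: "part_sol V W \<epsilon> T N x \<xi> q p" using part_sol_exists by blast
  obtain q' p' where S': "part_sol V W \<epsilon> T N (zext x) (zext \<xi>) q' p'" using part_sol_exists by blast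
  have "q' T i = q T i" if "i < N" for i
    by (rule part_sol_unique[OF S' S _ _ that]) (use T_pos in \<open>auto simp: zext_def\<close>)
  then show ?thesis unfolding qT_eq[OF S] qT_eq[OF S'] by (auto intro: restrict_ext)
qed

lemma sets_prodN: "sets \<nu> = sets borel \<Longrightarrow> sets (prodN N \<nu>) = sets (prodN N borel)"
  unfolding prodN_def by (rule sets_PiM_cong) auto

lemma qT_measurable:
  "(\<lambda>z. qT V W \<epsilon> T N (fst z) (snd z)) \<in> measurable (prodN N borel \<Otimes>\<^sub>M prodN N (borel :: 'a measure)) (prodN N borel)"
proof -
  have co: "(\<lambda>x. x i) \<in> measurable (prodN N borel) (borel :: 'a measure)" if "i < N" for i
    unfolding prodN_def using that by (intro measurable_component_singleton) auto
  have "zext \<in> measurable (prodN N borel) (\<Pi>\<^sub>M i\<in>UNIV. borel)"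
    unfolding zext_def[abs_def]
  proof (rule measurable_abs_UNIV)
    fix i show "(\<lambda>x. if i < N then x i else 0) \<in> borel_measurable (prodN N (borel :: 'a measure))"
      using co[of i] by (cases "i < N") auto
  qed
  then have z: "zext \<in> measurable (prodN N borel) borel"
    by (subst (asm) measurable_cong_sets[OF refl sets_PiM_equal_borel])
  have "(\<lambda>z. qT V W \<epsilon> T N (zext (fst z)) (zext (snd z)) i) \<in> measurable (prodN N borel \<Otimes>\<^sub>M prodN N borel) borel"
    if i: "i < N" for i
  proof -
    have "(\<lambda>z :: (nat \<Rightarrow> 'a) \<times> (nat \<Rightarrow> 'a). qT V W \<epsilon> T N (fst z) (snd z) i) \<in> borel_measurable (borel \<Otimes>\<^sub>M borel)"
      using borel_measurable_continuous_onI[OF qT_component_continuous[OF i]] by (simp add: borel_prod)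
    from measurable_compose[OF measurable_Pair[OF measurable_compose[OF measurable_fst z] measurable_compose[OF measurable_snd z]] this]
    show ?thesis by simp
  qed
  then have "(\<lambda>z. \<lambda>i\<in>{..<N}. qT V W \<epsilon> T N (fst z) (snd z) i)
      \<in> measurable (prodN N borel \<Otimes>\<^sub>M prodN N borel) (\<Pi>\<^sub>M i\<in>{..<N}. borel)"
    unfolding qT_zext by (intro measurable_restrict) auto
  moreover have "(\<lambda>i\<in>{..<N}. qT V W \<epsilon> T N x \<xi> i) = qT V W \<epsilon> T N x \<xi>" for x \<xi>
  proof -
    obtain q p where S: "part_sol V W \<epsilon> T N x \<xi> q p" using part_sol_exists by blast
    show ?thesis unfolding qT_eq[OF S] by (simp add: restrict_def fun_eq_iff)
  qed
  ultimately show ?thesis unfolding prodN_def by simp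
qed

lemma part_step_eq:
  assumes M: "prob_space M" and s: "sets M = sets (prodN N borel)"
  shows "part_step V W \<epsilon> T N M
    = distr (M \<Otimes>\<^sub>M prodN N std_gauss) (prodN N borel) (\<lambda>z. qT V W \<epsilon> T N (fst z) (snd z))"
proof -
  have m: "(\<lambda>z. qT V W \<epsilon> T N (fst z) (snd z)) \<in> measurable (M \<Otimes>\<^sub>M prodN N std_gauss) (prodN N borel)"
    using qT_measurable
    by (subst measurable_cong_sets[OF sets_pair_measure_cong[OF s sets_prodN[OF sets_std_gauss]] refl])
  show ?thesis unfolding part_step_def part_kernel_def[abs_def]
    using bind_distr_eq_distr_pair[OF M prob_space_prodN[OF prob_space_std_gauss], where f="qT V W \<epsilon> T N" and N="prodN N borel"] m
    by (simp add: case_prod_beta')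
qed

lemma part_step_iter:
  assumes M: "prob_space M" and s: "sets M = sets (prodN N borel)"
  shows "prob_space ((part_step V W \<epsilon> T N ^^ m) M)" "sets ((part_step V W \<epsilon> T N ^^ m) M) = sets (prodN N borel)"
proof -
  have "prob_space ((part_step V W \<epsilon> T N ^^ m) M) \<and> sets ((part_step V W \<epsilon> T N ^^ m) M) = sets (prodN N borel)"
  proof (induction m)
    case 0 then show ?case using M s by simp
  next
    case (Suc m)
    let ?M = "(part_step V W \<epsilon> T N ^^ m) M"
    interpret M: prob_space ?M using Suc by simp
    interpret G: prob_space "prodN N (std_gauss :: 'a measure)" by (rule prob_space_prodN[OF prob_space_std_gauss])
    interpret MG: pair_prob_space ?M "prodN N (std_gauss :: 'a measure)" ..
    have s': "sets ?M = sets (prodN N borel)" using Suc by simp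
    have m: "(\<lambda>z. qT V W \<epsilon> T N (fst z) (snd z)) \<in> measurable (?M \<Otimes>\<^sub>M prodN N std_gauss) (prodN N borel)"
      using qT_measurable
      by (subst measurable_cong_sets[OF sets_pair_measure_cong[OF s' sets_prodN[OF sets_std_gauss]] refl])
    show ?case using part_step_eq[OF M.prob_space_axioms s'] MG.P.prob_space_distr[OF m] by simp
  qed
  then show "prob_space ((part_step V W \<epsilon> T N ^^ m) M)" "sets ((part_step V W \<epsilon> T N ^^ m) M) = sets (prodN N borel)"
    by auto
qed

end

section \<open>Comparison with independent copies of the nonlinear dynamics\<close>

lemma (in mean_field_init) mf_sol_force_continuous:
  assumes S: "mf_sol b g T P Q p m"
  shows "continuous_on {0..T} (\<lambda>s. \<integral>w. g (Q s x v) (Q s (fst w) (snd w)) \<partial>P)"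
  unfolding continuous_on_sequentially
proof (intro ballI allI impI)
  fix t and u assume t: "t \<in> {0..T}" and u: "(\<forall>n. u n \<in> {0..T}) \<and> u \<longlonglongrightarrow> t"
  then have uT: "u n \<in> {0..T}" for n by blast
  obtain C where C: "0 \<le> C" "\<And>t x v. t \<in> {0..T} \<Longrightarrow> norm (Q t x v) \<le> C * wt x v" using mf_sol_growth[OF S] by metis
  have Qc: "(\<lambda>n. Q (u n) x v) \<longlonglongrightarrow> Q t x v" for x v
    using continuous_on_trajectory[OF mf_sol_deriv[OF S]] t u
    unfolding continuous_on_sequentially comp_def by blast
  have "(\<lambda>n. \<integral>w. g (Q (u n) x v) (Q (u n) (fst w) (snd w)) \<partial>P) \<longlonglongrightarrow> (\<integral>w. g (Q t x v) (Q t (fst w) (snd w)) \<partial>P)"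
  proof (rule integral_dominated_convergence[where
        w="\<lambda>w. norm (g 0 0) + l * (C * wt x v + C * wt (fst w) (snd w))"])
    show "integrable P (\<lambda>w. norm (g 0 0) + l * (C * wt x v + C * wt (fst w) (snd w)))" using wt_int by simp
    show "AE w in P. (\<lambda>n. g (Q (u n) x v) (Q (u n) (fst w) (snd w))) \<longlonglongrightarrow> g (Q t x v) (Q t (fst w) (snd w))"
    proof (rule AE_I2)
      fix w
      have "(\<lambda>n. (Q (u n) x v, Q (u n) (fst w) (snd w))) \<longlonglongrightarrow> (Q t x v, Q t (fst w) (snd w))"
        by (intro tendsto_Pair Qc)
      from continuous_on_tendsto_compose[OF g_cont[of UNIV] this]
      show "(\<lambda>n. g (Q (u n) x v) (Q (u n) (fst w) (snd w))) \<longlonglongrightarrow> g (Q t x v) (Q t (fst w) (snd w))" by simp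
    qed
    show "AE w in P. norm (g (Q (u n) x v) (Q (u n) (fst w) (snd w)))
        \<le> norm (g 0 0) + l * (C * wt x v + C * wt (fst w) (snd w))" for n
      by (intro AE_I2 order_trans[OF g_bound] add_left_mono mult_left_mono add_mono C uT l0)
    have [measurable]: "(\<lambda>w. Q s (fst w) (snd w)) \<in> borel_measurable P" if "s \<in> {0..T}" for s
      by (rule mf_sol_measurable[OF S that])
    show "(\<lambda>w. g (Q t x v) (Q t (fst w) (snd w))) \<in> borel_measurable P" using t by measurable
    show "(\<lambda>w. g (Q (u n) x v) (Q (u n) (fst w) (snd w))) \<in> borel_measurable P" for n using uT by measurable
  qed
  then show "((\<lambda>s. \<integral>w. g (Q s x v) (Q s (fst w) (snd w)) \<partial>P) \<circ> u) \<longlonglongrightarrow> (\<integral>w. g (Q t x v) (Q t (fst w) (snd w)) \<partial>P)"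
    by (simp add: comp_def)
qed

context hmc_setting begin

lemma pmean_continuous:
  assumes "\<And>j. j < N \<Longrightarrow> continuous_on S (\<lambda>s. x s j)" and i: "i < N"
  shows "continuous_on S (\<lambda>s. pmean (x s) i)"
proof -
  have gc: "continuous_on S (\<lambda>s. g (f s) (h s))" if "continuous_on S f" "continuous_on S h" for f h
    using continuous_on_compose2[OF mf.g_cont[of UNIV] continuous_on_Pair[OF that]] by simp
  show ?thesis unfolding pmean_def using assms by (intro continuous_intros gc) auto
qed

definition mfield :: "'a measure \<Rightarrow> real \<Rightarrow> 'a \<Rightarrow> 'a" where
  "mfield \<nu> s y = (\<integral>w. g y (nlQ \<nu> s (fst w) (snd w)) \<partial>(\<nu> \<Otimes>\<^sub>M std_gauss))"

text \<open>Both terms are evaluated along the nonlinear trajectories, which are independent across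
  particles; this makes it a fluctuation and not a stability quantity.\<close>

definition dev :: "'a measure \<Rightarrow> nat \<Rightarrow> (nat \<Rightarrow> 'a) \<Rightarrow> (nat \<Rightarrow> 'a) \<Rightarrow> real \<Rightarrow> real" where
  "dev \<nu> i Y \<eta> s = norm (pmean (\<lambda>j. nlQ \<nu> s (Y j) (\<eta> j)) i - mfield \<nu> s (nlQ \<nu> s (Y i) (\<eta> i)))"

definition dev_int :: "'a measure \<Rightarrow> nat \<Rightarrow> (nat \<Rightarrow> 'a) \<Rightarrow> (nat \<Rightarrow> 'a) \<Rightarrow> real" where
  "dev_int \<nu> i Y \<eta> = integral {0..T} (\<lambda>s. (T - s) * dev \<nu> i Y \<eta> s)"

lemma nlQ_trajectory_cont: "fin_second_moment \<nu> \<Longrightarrow> continuous_on S (\<lambda>s. nlQ \<nu> s x v)"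
  using continuous_on_compose2[OF nlQ_cont[of \<nu>], of S "\<lambda>s. (s, x, v)"] by (simp add: continuous_intros)

lemma dev_continuous:
  assumes \<nu>: "fin_second_moment \<nu>" and i: "i < N"
  shows "continuous_on {0..T} (dev \<nu> i Y \<eta>)"
proof -
  interpret mean_field_init b g L l T "\<nu> \<Otimes>\<^sub>M std_gauss" by (rule mean_field_init_pair[OF \<nu>])
  obtain p m where S: "mf_sol b g T (\<nu> \<Otimes>\<^sub>M std_gauss) (nlQ \<nu>) p m" using nlQ_sol[OF \<nu>] by blast
  have "continuous_on {0..T} (\<lambda>s. mfield \<nu> s (nlQ \<nu> s (Y i) (\<eta> i)))"
    unfolding mfield_def by (rule mf_sol_force_continuous[OF S])
  then show ?thesis unfolding dev_def
    by (intro continuous_on_norm continuous_on_diff pmean_continuous nlQ_trajectory_cont \<nu> i)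
qed

lemma dev_int_nonneg:
  assumes \<nu>: "fin_second_moment \<nu>" and i: "i < N" shows "0 \<le> dev_int \<nu> i Y \<eta>"
  unfolding dev_int_def
  by (intro integral_nonneg integrable_continuous_interval continuous_intros dev_continuous \<nu> i) (simp add: dev_def)

abbreviation kap :: real where "kap \<equiv> 3 * (l * T\<^sup>2)"

text \<open>The error \<open>E i\<close> of one particle involves the average of all trajectory
  distances, which in turn are bounded through the errors. This loop closes only after averaging
  over the particles, and this dictates the averaged distance in the claim.\<close>

lemma system_comparison:
  assumes \<nu>: "fin_second_moment \<nu>"
    and sync: "\<And>i. i < N \<Longrightarrow> Rt \<le> norm (X i - Y i) \<Longrightarrow> \<xi> i = \<eta> i"
  shows "(1 / real N) * (\<Sum>i<N. drift.cf (norm (qT V W \<epsilon> T N X \<xi> i - nlQ \<nu> T (Y i) (\<eta> i))))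
    \<le> (1 / real N) * (\<Sum>i<N. drift.goal (X i) (Y i) (\<xi> i - \<eta> i) + kap * drift.amp (X i) (Y i) (\<xi> i - \<eta> i))
      + 13/5 * ((1 / real N) * (\<Sum>i<N. dev_int \<nu> i Y \<eta>))"
proof -
  interpret mean_field_init b g L l T "\<nu> \<Otimes>\<^sub>M std_gauss" by (rule mean_field_init_pair[OF \<nu>])
  obtain pb m where S: "mf_sol b g T (\<nu> \<Otimes>\<^sub>M std_gauss) (nlQ \<nu>) pb m" using nlQ_sol[OF \<nu>] by blast
  obtain q p where Sp: "part_sol V W \<epsilon> T N X \<xi> q p" using part_sol_exists by blast
  note A = Sp[unfolded part_sol_iff, rule_format]
  define qb where "qb i s = nlQ \<nu> s (Y i) (\<eta> i)" for i s
  define pv where "pv i s = pb s (Y i) (\<eta> i)" for i s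
  define cb where "cb i s = mfield \<nu> s (qb i s)" for i s
  define sup where "sup i = (SUP s\<in>{0..T}. norm (q s i - qb i s))" for i
  define sbar where "sbar = (1 / real N) * (\<Sum>i<N. sup i)"
  \<comment> \<open>The difference of the two forces, split at the empirical mean field of the
    nonlinear copies: a Lipschitz part and the fluctuation.\<close>
  define \<beta> where "\<beta> i s = l * (sup i + sbar) + dev \<nu> i Y \<eta> s" for i s
  define E where "E i = integral {0..T} (\<lambda>s. (T - s) * \<beta> i s)" for i
  define M where "M i = drift.amp (X i) (Y i) (\<xi> i - \<eta> i)" for i
  have init: "qb i 0 = Y i" "pv i 0 = \<eta> i" for i by (simp_all add: qb_def pv_def mf_sol_init[OF S])
  have qd: "((\<lambda>s. q s i) has_vector_derivative p t i) (at t within {0..T})"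
    "((\<lambda>s. p s i) has_vector_derivative - (b (q t i) + pmean (q t) i)) (at t within {0..T})"
    if "i < N" "t \<in> {0..T}" for i t using A[OF that(1)] that(2) by auto
  have qbd: "(qb i has_vector_derivative pv i t) (at t within {0..T})"
    "(pv i has_vector_derivative - (b (qb i t) + cb i t)) (at t within {0..T})"
    if "t \<in> {0..T}" for i t
    using mf_sol_deriv[OF S that, of "Y i" "\<eta> i"] mf_sol_deriv2[OF S that, of "Y i" "\<eta> i"]
    unfolding qb_def[abs_def] pv_def[abs_def] cb_def mfield_def mf_sol_integral[OF S that] by auto
  have zc: "continuous_on {0..T} (\<lambda>s. norm (q s i - qb i s))" if "i < N" for i
    by (intro continuous_on_norm continuous_on_diff continuous_on_trajectory[OF qd(1)[OF that]] continuous_on_trajectory[OF qbd(1)])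
  have sup: "norm (q s i - qb i s) \<le> sup i" if "i < N" "s \<in> {0..T}" for i s
    unfolding sup_def
    by (rule cSUP_upper[OF that(2)]) (intro bounded_imp_bdd_above compact_imp_bounded compact_continuous_image zc that, simp)
  have cdiff: "norm (pmean (q s) i - cb i s) \<le> \<beta> i s" if i: "i < N" and s: "s \<in> {0..T}" for i s
  proof -
    have "norm (pmean (q s) i - cb i s) \<le> norm (pmean (q s) i - pmean (\<lambda>j. qb j s) i) + norm (pmean (\<lambda>j. qb j s) i - cb i s)"
      using norm_triangle_ineq[of "pmean (q s) i - pmean (\<lambda>j. qb j s) i" "pmean (\<lambda>j. qb j s) i - cb i s"] by simp
    also have "norm (pmean (\<lambda>j. qb j s) i - cb i s) = dev \<nu> i Y \<eta> s" by (simp add: dev_def qb_def cb_def)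
    also have "norm (pmean (q s) i - pmean (\<lambda>j. qb j s) i) \<le> l * (sup i + sbar)"
      unfolding sbar_def
      by (intro order_trans[OF pmean_lip[OF i]] mult_left_mono add_mono sum_mono sup i s l_nonneg) auto
    finally show ?thesis by (simp add: \<beta>_def)
  qed
  have \<beta>c: "continuous_on {0..T} (\<beta> i)" if "i < N" for i
    unfolding \<beta>_def by (intro continuous_intros dev_continuous[OF \<nu> that])
  have MM: "M i = drift.amp (q 0 i) (qb i 0) (p 0 i - pv i 0)" if "i < N" for i
    using A[OF that] by (simp add: M_def init)
  note sb = drift.sup_bound[OF qd(1) qd(2) qbd(1) qbd(2) cdiff \<beta>c MM E_def]
  note eb = drift.endpoint_cf_bound[OF qd(1) qd(2) qbd(1) qbd(2) cdiff \<beta>c MM E_def]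
  have sup_le: "sup i \<le> 40/37 * (M i + E i)" if i: "i < N" for i
    unfolding sup_def using T_pos sb[OF i _ i _ _ _ i _ i i]
    by (intro cSUP_least) (auto)
  have cf_le: "drift.cf (norm (qT V W \<epsilon> T N X \<xi> i - nlQ \<nu> T (Y i) (\<eta> i)))
      \<le> drift.goal (X i) (Y i) (\<xi> i - \<eta> i) + 5/2 * E i" if i: "i < N" for i
  proof -
    have "drift.cf (norm (q T i - qb i T)) \<le> drift.goal (q 0 i) (qb i 0) (p 0 i - pv i 0) + 5/2 * E i"
      by (rule eb[OF i _ i _ _ _ i _ i i]) (use A[OF i] sync[OF i] init in auto)
    moreover have "q 0 i = X i" "p 0 i = \<xi> i" using A[OF i] by auto
    moreover have "qT V W \<epsilon> T N X \<xi> i - nlQ \<nu> T (Y i) (\<eta> i) = q T i - qb i T"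
      using i by (simp add: qT_eq[OF Sp] qb_def)
    ultimately show ?thesis by (simp only: init)
  qed
  have E_eq: "E i = l * T\<^sup>2 / 2 * (sup i + sbar) + dev_int \<nu> i Y \<eta>" if i: "i < N" for i
  proof -
    have "((\<lambda>s. (T - s) * (l * (sup i + sbar)) + (T - s) * dev \<nu> i Y \<eta> s) has_integral
        (T\<^sup>2 / 2 * (l * (sup i + sbar)) + dev_int \<nu> i Y \<eta>)) {0..T}"
      unfolding dev_int_def
      by (intro has_integral_add has_integral_mult_left integral_linear_kernel integrable_integral
          integrable_continuous_interval continuous_intros dev_continuous \<nu> i) (use T_pos in auto)
    then show ?thesis unfolding E_def \<beta>_def distrib_left[of "T - _"] by (subst integral_unique) (auto simp: mult_ac)
  qed
  define av where "av f = (1 / real N) * (\<Sum>i<N. f i)" for f :: "nat \<Rightarrow> real"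
  have av_add: "av (\<lambda>i. f i + h i) = av f + av h" for f h by (simp add: av_def sum.distrib distrib_left)
  have av_mult: "av (\<lambda>i. c * f i) = c * av f" for f c
    unfolding av_def by (simp only: sum_distrib_left[symmetric] mult.left_commute)
  have av_const: "av (\<lambda>i. c) = c" for c using N_pos by (simp add: av_def)
  have av_mono: "av f \<le> av h" if "\<And>i. i < N \<Longrightarrow> f i \<le> h i" for f h
    unfolding av_def using that by (intro mult_left_mono sum_mono) auto
  have av_cong: "av f = av h" if "\<And>i. i < N \<Longrightarrow> f i = h i" for f h
    unfolding av_def using that by simp
  have "av E = av (\<lambda>i. l * T\<^sup>2 / 2 * (sup i + sbar) + dev_int \<nu> i Y \<eta>)" by (rule av_cong) (rule E_eq)
  also have "\<dots> = l * T\<^sup>2 / 2 * (av sup + sbar) + av (\<lambda>i. dev_int \<nu> i Y \<eta>)"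
    by (simp only: av_add av_mult av_const)
  also have "av sup = sbar" by (simp add: av_def sbar_def)
  finally have avE: "av E = l * T\<^sup>2 * sbar + av (\<lambda>i. dev_int \<nu> i Y \<eta>)" by simp
  have "sbar = av sup" by (simp add: av_def sbar_def)
  also have "\<dots> \<le> av (\<lambda>i. 40/37 * (M i + E i))" by (rule av_mono) (rule sup_le)
  also have "\<dots> = 40/37 * (av M + av E)" by (simp only: av_add av_mult)
  finally have sbar_le: "sbar \<le> 40/37 * (av M + av E)" .
  define d where "d = av (\<lambda>i. dev_int \<nu> i Y \<eta>)"
  have d0: "0 \<le> d" unfolding d_def av_def by (intro mult_nonneg_nonneg sum_nonneg dev_int_nonneg \<nu>) auto
  have M0: "0 \<le> av M" unfolding av_def M_def by (intro mult_nonneg_nonneg sum_nonneg drift.amp_nonneg) auto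
  have lT0: "0 \<le> l * T\<^sup>2" using l_nonneg by simp
  have s1: "av E \<le> l * T\<^sup>2 * (40/37 * (av M + av E)) + d"
    unfolding avE d_def[symmetric] using mult_left_mono[OF sbar_le lT0] by (simp add: avE d_def)
  have s2: "l * T\<^sup>2 * (40/37 * av E) \<le> 1/1000 * (40/37 * av E)"
  proof (rule mult_right_mono[OF l_small])
    have "0 \<le> sbar"
    proof -
      have "0 \<le> sup i" if "i < N" for i using sup[OF that, of 0] T_pos order_trans[OF norm_ge_zero] by fastforce
      then show ?thesis unfolding sbar_def by (intro mult_nonneg_nonneg sum_nonneg) auto
    qed
    then show "0 \<le> 40/37 * av E" unfolding avE d_def[symmetric] using lT0 d0 by simp
  qed
  have s3: "l * T\<^sup>2 * (40/37 * (av M + av E)) = 40/37 * (l * T\<^sup>2 * av M) + l * T\<^sup>2 * (40/37 * av E)"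
    by (simp add: algebra_simps)
  \<comment> \<open>The factor is the inverse of \<open>1 - (1/1000) * (40/37)\<close>, from
    absorbing the average of \<open>E\<close> on the left.\<close>
  have "e \<le> 37000/36960 * (40/37 * u + d)" if "e \<le> (40/37 * u + v) + d" "v \<le> 1/1000 * (40/37 * e)" for e u v d :: real
    using that by argo
  from this[OF s1[unfolded s3] s2] have "av E \<le> 37000/36960 * (40/37 * (l * T\<^sup>2 * av M) + d)" .
  \<comment> \<open>After multiplication by 5/2 the coefficients are about 2.71 and 2.503; rounding
    them up gives the 3 in \<open>kap\<close> and the 13/5.\<close>
  moreover have "5/2 * e \<le> 3 * u + 13/5 * d" if "e \<le> 37000/36960 * (40/37 * u + d)" "0 \<le> u" "0 \<le> d" for e u d :: real
    using that by argo
  moreover have "0 \<le> l * T\<^sup>2 * av M" using lT0 M0 by (rule mult_nonneg_nonneg)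
  ultimately have "5/2 * av E \<le> 3 * (l * T\<^sup>2 * av M) + 13/5 * d" using d0 by blast
  then have fin: "5/2 * av E \<le> kap * av M + 13/5 * d" by (simp only: mult.assoc)
  have "av (\<lambda>i. drift.cf (norm (qT V W \<epsilon> T N X \<xi> i - nlQ \<nu> T (Y i) (\<eta> i))))
    \<le> av (\<lambda>i. drift.goal (X i) (Y i) (\<xi> i - \<eta> i) + 5/2 * E i)"
    by (rule av_mono) (rule cf_le)
  also have "\<dots> = av (\<lambda>i. drift.goal (X i) (Y i) (\<xi> i - \<eta> i)) + 5/2 * av E" by (simp only: av_add av_mult)
  also have "\<dots> \<le> av (\<lambda>i. drift.goal (X i) (Y i) (\<xi> i - \<eta> i)) + (kap * av M + 13/5 * d)" using fin by simp
  also have "\<dots> = av (\<lambda>i. drift.goal (X i) (Y i) (\<xi> i - \<eta> i) + kap * M i) + 13/5 * d"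
    by (simp only: av_add av_mult)
  finally show ?thesis unfolding av_def d_def M_def .
qed

end

section \<open>One step of the coupled chains\<close>

text \<open>Although \<open>h\<close> depends on the whole coupled state \<open>z\<close>, its law
  for fixed \<open>z\<close> is always \<open>G\<close>. So the new velocity is independent of
  \<open>z\<close>, and each chain separately makes a genuine step.\<close>

lemma distr_noise:
  assumes \<Gamma>: "prob_space \<Gamma>" and \<Xi>: "prob_space \<Xi>" and G: "prob_space G"
    and \<pi>[measurable]: "\<pi> \<in> measurable \<Gamma> M" and d: "distr \<Gamma> M \<pi> = M"
    and h[measurable]: "case_prod h \<in> measurable (\<Gamma> \<Otimes>\<^sub>M \<Xi>) G"
    and hG: "\<And>z. z \<in> space \<Gamma> \<Longrightarrow> distr \<Xi> G (h z) = G"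
  shows "distr (\<Gamma> \<Otimes>\<^sub>M \<Xi>) (M \<Otimes>\<^sub>M G) (\<lambda>(z, w). (\<pi> z, h z w)) = M \<Otimes>\<^sub>M G"
proof (rule measure_eqI)
  interpret \<Gamma>: prob_space \<Gamma> by fact
  interpret \<Xi>: prob_space \<Xi> by fact
  interpret G: prob_space G by fact
  fix A assume "A \<in> sets (distr (\<Gamma> \<Otimes>\<^sub>M \<Xi>) (M \<Otimes>\<^sub>M G) (\<lambda>(z, w). (\<pi> z, h z w)))"
  then have A[measurable]: "A \<in> sets (M \<Otimes>\<^sub>M G)" by simp
  have m[measurable]: "(\<lambda>(z, w). (\<pi> z, h z w)) \<in> measurable (\<Gamma> \<Otimes>\<^sub>M \<Xi>) (M \<Otimes>\<^sub>M G)"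
    using h unfolding case_prod_beta' by measurable
  have "emeasure (distr (\<Gamma> \<Otimes>\<^sub>M \<Xi>) (M \<Otimes>\<^sub>M G) (\<lambda>(z, w). (\<pi> z, h z w))) A
    = (\<integral>\<^sup>+x. indicator A (case x of (z, w) \<Rightarrow> (\<pi> z, h z w)) \<partial>(\<Gamma> \<Otimes>\<^sub>M \<Xi>))"
    by (subst nn_integral_indicator[symmetric], simp, subst nn_integral_distr) auto
  also have "\<dots> = (\<integral>\<^sup>+z. \<integral>\<^sup>+w. indicator A (\<pi> z, h z w) \<partial>\<Xi> \<partial>\<Gamma>)"
    by (subst \<Xi>.nn_integral_fst[symmetric]) auto
  also have "\<dots> = (\<integral>\<^sup>+z. \<integral>\<^sup>+x. indicator A (\<pi> z, x) \<partial>G \<partial>\<Gamma>)"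
  proof (rule nn_integral_cong)
    fix z assume z: "z \<in> space \<Gamma>"
    have hz: "h z \<in> measurable \<Xi> G" using measurable_compose[OF measurable_Pair1'[OF z] h] by simp
    have pz: "\<pi> z \<in> space M" using measurable_space[OF \<pi> z] .
    have "(\<lambda>x. indicator A (\<pi> z, x) :: ennreal) \<in> borel_measurable (distr \<Xi> G (h z))"
      unfolding hG[OF z] using measurable_compose[OF measurable_Pair1'[OF pz], of "indicator A" G borel] by measurable
    from nn_integral_distr[OF hz this] have "(\<integral>\<^sup>+x. indicator A (\<pi> z, x) \<partial>distr \<Xi> G (h z)) = (\<integral>\<^sup>+w. indicator A (\<pi> z, h z w) \<partial>\<Xi>)" .
    then show "(\<integral>\<^sup>+w. indicator A (\<pi> z, h z w) \<partial>\<Xi>) = (\<integral>\<^sup>+x. indicator A (\<pi> z, x) \<partial>G)"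
      by (simp only: hG[OF z])
  qed
  also have "\<dots> = (\<integral>\<^sup>+y. \<integral>\<^sup>+x. indicator A (y, x) \<partial>G \<partial>M)"
  proof -
    have "(\<lambda>y. \<integral>\<^sup>+x. indicator A (y, x) \<partial>G) \<in> borel_measurable (distr \<Gamma> M \<pi>)" unfolding d by measurable
    from nn_integral_distr[OF \<pi> this] show ?thesis by (simp only: d)
  qed
  also have "\<dots> = emeasure (M \<Otimes>\<^sub>M G) A"
    by (subst nn_integral_indicator[symmetric], simp, subst G.nn_integral_fst[symmetric]) auto
  finally show "emeasure (distr (\<Gamma> \<Otimes>\<^sub>M \<Xi>) (M \<Otimes>\<^sub>M G) (\<lambda>(z, w). (\<pi> z, h z w))) A = emeasure (M \<Otimes>\<^sub>M G) A" .
qed simp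

context hmc_params begin

lemma vel_measurable[measurable (raw)]:
  assumes [measurable]: "f \<in> borel_measurable M" "h \<in> borel_measurable M" "k \<in> measurable M (std_gauss \<Otimes>\<^sub>M unif)"
  shows "(\<lambda>z. vel (f z) (h z) (k z) :: 'a::euclidean_space) \<in> borel_measurable M"
proof -
  have [measurable]: "(\<lambda>z. fst (k z)) \<in> borel_measurable M" "(\<lambda>z. snd (k z)) \<in> borel_measurable M"
    using measurable_compose[OF assms(3) measurable_fst] measurable_compose[OF assms(3) measurable_snd]
    by (auto simp: measurable_cong_sets[OF refl sets_std_gauss] measurable_cong_sets[OF refl sets_unif])
  have [measurable]: "(sgn :: 'a \<Rightarrow> 'a) \<in> borel_measurable borel"
    unfolding sgn_div_norm[abs_def] by measurable
  show ?thesis unfolding vel_def shift_or_reflect_def case_prod_beta' by measurable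
qed

lemma amp_measurable[measurable (raw)]:
  assumes [measurable]: "f \<in> borel_measurable M" "h \<in> borel_measurable M" "k \<in> borel_measurable M"
  shows "(\<lambda>z. amp (f z) (h z) (k z :: 'a::euclidean_space)) \<in> borel_measurable M"
  unfolding amp_def by measurable

lemma goal_measurable[measurable (raw)]:
  assumes [measurable]: "f \<in> borel_measurable M" "h \<in> borel_measurable M" "k \<in> borel_measurable M"
  shows "(\<lambda>z. goal (f z) (h z) (k z :: 'a::euclidean_space)) \<in> borel_measurable M"
  unfolding goal_def by measurable

lemma distr_vel: "distr (std_gauss \<Otimes>\<^sub>M unif) borel (vel x y) = (std_gauss :: 'a::euclidean_space measure)"
proof (cases "norm (x - y) < Rt")
  case True
  then have "vel x y = shift_or_reflect (gam *\<^sub>R (x - y))" by (simp add: vel_def fun_eq_iff)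
  then show ?thesis by (simp add: distr_shift_or_reflect)
next
  case False
  then have "vel x y = fst" by (simp add: vel_def fun_eq_iff)
  moreover have "distr (std_gauss \<Otimes>\<^sub>M unif) borel fst = distr (std_gauss \<Otimes>\<^sub>M unif) (std_gauss :: 'a measure) fst"
    by (rule distr_cong) auto
  ultimately show ?thesis using prob_space.distr_pair_fst[OF unif.prob_space_axioms] by simp
qed

lemma vel_sync: "Rt \<le> norm (x - y) \<Longrightarrow> vel x y w = fst w"
  by (simp add: vel_def)

end

context hmc_setting begin

lemma prob_space_noise: "prob_space (prodN N (std_gauss \<Otimes>\<^sub>M unif :: ('a \<times> real) measure))"
  by (intro prob_space_prodN prob_space_pair prob_space_std_gauss unif.prob_space_axioms)

lemma coord_measurable:
  assumes "sets M = sets (prodN N B)" "i < N" shows "(\<lambda>x. x i) \<in> measurable M B"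
  using assms by (subst measurable_cong_sets[OF assms(1) refl]) (auto simp: prodN_def intro!: measurable_component_singleton)

section \<open>Expected fluctuation along the nonlinear flow\<close>

lemma mfield_measurable:
  assumes \<nu>: "fin_second_moment \<nu>" and f: "f \<in> borel_measurable M" "h \<in> borel_measurable M"
  shows "(\<lambda>x. mfield \<nu> (f x) (h x)) \<in> borel_measurable M"
proof -
  have s[measurable_cong]: "sets \<nu> = sets borel" and p: "prob_space \<nu>" using \<nu> by (auto simp: fin_second_moment_def)
  interpret P: prob_space "\<nu> \<Otimes>\<^sub>M (std_gauss :: 'a measure)"
    by (intro prob_space_pair p prob_space_std_gauss)
  have "(\<lambda>z. mfield \<nu> (fst z) (snd z)) \<in> borel_measurable (borel \<Otimes>\<^sub>M borel)"
    unfolding mfield_def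
    by (rule P.borel_measurable_lebesgue_integral) (use \<nu> in \<open>measurable\<close>)
  from measurable_compose[OF measurable_Pair[OF f] this] show ?thesis by simp
qed

lemma mfield_nlaw:
  assumes \<nu>: "fin_second_moment \<nu>"
  shows "mfield \<nu> s y = (\<integral>u. g y u \<partial>(nlaw \<nu> s))"
proof -
  have s[measurable_cong]: "sets \<nu> = sets borel" using \<nu> by (auto simp: fin_second_moment_def)
  show ?thesis unfolding mfield_def nlaw_def
    by (subst integral_distr) (use \<nu> in \<open>auto simp: case_prod_beta'\<close>)
qed

lemma dev_measurable:
  assumes \<nu>: "fin_second_moment \<nu>" and i: "i < N"
  shows "(\<lambda>x. dev \<nu> i (fst (snd x)) (snd (snd x)) (fst x))
    \<in> borel_measurable (borel \<Otimes>\<^sub>M (prodN N \<nu> \<Otimes>\<^sub>M prodN N std_gauss))"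
proof -
  have s: "sets \<nu> = sets borel" using \<nu> by (auto simp: fin_second_moment_def)
  have c1[measurable]: "(\<lambda>x. fst (snd x) j) \<in> borel_measurable (borel \<Otimes>\<^sub>M (prodN N \<nu> \<Otimes>\<^sub>M prodN N (std_gauss :: 'a measure)))"
    if "j < N" for j
    using measurable_compose[OF measurable_compose[OF measurable_snd measurable_fst] coord_measurable[OF sets_prodN[OF s] that]] .
  have c2[measurable]: "(\<lambda>x. snd (snd x) j) \<in> borel_measurable (borel \<Otimes>\<^sub>M (prodN N \<nu> \<Otimes>\<^sub>M prodN N (std_gauss :: 'a measure)))"
    if "j < N" for j
    using measurable_compose[OF measurable_compose[OF measurable_snd measurable_snd] coord_measurable[OF sets_prodN[OF sets_std_gauss] that]] .
  have q: "(\<lambda>x. nlQ \<nu> (fst x) (fst (snd x) j) (snd (snd x) j))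
      \<in> borel_measurable (borel \<Otimes>\<^sub>M (prodN N \<nu> \<Otimes>\<^sub>M prodN N (std_gauss :: 'a measure)))" if "j < N" for j
    by (rule nlQ_measurable'[OF \<nu> measurable_fst c1[OF that] c2[OF that]])
  show ?thesis unfolding dev_def pmean_def
    by (intro borel_measurable_norm[THEN measurable_compose[rotated]] borel_measurable_diff borel_measurable_scaleR
        borel_measurable_const borel_measurable_sum mf.g_measurable' mfield_measurable[OF \<nu>] q measurable_fst i) auto
qed

text \<open>The Henstock-Kurzweil time integral is turned into a Lebesgue one, for which Tonelli
  exchanges time and expectation.\<close>

lemma dev_int_nn_integral:
  assumes \<nu>: "fin_second_moment \<nu>" and i: "i < N"
  shows "ennreal (dev_int \<nu> i Y \<eta>)
    = (\<integral>\<^sup>+s. indicator {0..T} s * ennreal ((T - s) * dev \<nu> i Y \<eta> s) \<partial>lborel)"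
proof -
  have "((\<lambda>s. (T - s) * dev \<nu> i Y \<eta> s) has_integral dev_int \<nu> i Y \<eta>) {0..T}"
    unfolding dev_int_def
    by (intro integrable_integral integrable_continuous_interval continuous_intros dev_continuous \<nu> i)
  then have "(\<integral>\<^sup>+s. ennreal (indicator {0..T} s * ((T - s) * dev \<nu> i Y \<eta> s)) \<partial>lborel) = ennreal (dev_int \<nu> i Y \<eta>)"
    by (intro nn_integral_has_integral_lebesgue) (auto simp: dev_def)
  moreover have "ennreal (indicator {0..T} s * ((T - s) * dev \<nu> i Y \<eta> s))
      = indicator {0..T} s * ennreal ((T - s) * dev \<nu> i Y \<eta> s)" for s
    by (auto simp: indicator_def)
  ultimately show ?thesis by simp
qed

text \<open>At a fixed time the copies are independent with law \<open>nlaw \<nu> s\<close>, and the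
  mean field is the integral against this same law, so the fluctuation bound applies.\<close>

lemma expected_dev:
  assumes \<nu>: "fin_second_moment \<nu>" and i: "i < N" and s: "s \<in> {0..T}"
    and B: "(\<integral>x. (norm x)\<^sup>2 \<partial>(nlaw \<nu> s)) \<le> B"
  shows "(\<integral>\<^sup>+x. ennreal (dev \<nu> i (fst x) (snd x) s) \<partial>(prodN N \<nu> \<Otimes>\<^sub>M prodN N std_gauss))
    \<le> ennreal (2 * l * sqrt B / sqrt (real N))"
proof -
  have sn[measurable_cong]: "sets \<nu> = sets borel" and p: "prob_space \<nu>" using \<nu> by (auto simp: fin_second_moment_def)
  have "fin_second_moment (nlaw \<nu> s)" by (rule nlaw_second_moment[OF \<nu> s])
  then have nsp: "prob_space (nlaw \<nu> s)" "sets (nlaw \<nu> s) = sets borel" "integrable (nlaw \<nu> s) (\<lambda>x. (norm x)\<^sup>2)"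
    by (auto simp: fin_second_moment_def)
  have f[measurable]: "(\<lambda>(x, v). nlQ \<nu> s x v) \<in> borel_measurable (\<nu> \<Otimes>\<^sub>M std_gauss)"
    unfolding case_prod_beta' using \<nu> by measurable
  have d: "distr (prodN N \<nu> \<Otimes>\<^sub>M prodN N std_gauss) (prodN N borel) (\<lambda>z. \<lambda>j\<in>{..<N}. nlQ \<nu> s (fst z j) (snd z j))
    = prodN N (nlaw \<nu> s)"
    using distr_PiM_pair[OF _ p prob_space_std_gauss f, of "{..<N}"] unfolding prodN_def nlaw_def by simp
  define h where "h u = norm ((1 / real N) *\<^sub>R (\<Sum>j<N. g (u i) (u j)) - (\<integral>w. g (u i) w \<partial>(nlaw \<nu> s)))" for u
  have dh: "dev \<nu> i Y \<eta> s = h (\<lambda>j\<in>{..<N}. nlQ \<nu> s (Y j) (\<eta> j))" for Y \<eta>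
    using i unfolding dev_def h_def pmean_def mfield_nlaw[OF \<nu>] by simp
  have cm: "(\<lambda>u. u j) \<in> borel_measurable (prodN N (borel :: 'a measure))" if "j < N" for j
    by (rule coord_measurable[OF refl that])
  have mfm: "(\<lambda>y. \<integral>w. g y w \<partial>(nlaw \<nu> s)) \<in> borel_measurable borel"
    unfolding mfield_nlaw[OF \<nu>, symmetric] by (rule mfield_measurable[OF \<nu>]) auto
  have hm: "h \<in> borel_measurable (prodN N borel)"
    unfolding h_def
    by (intro borel_measurable_norm[THEN measurable_compose[rotated]] borel_measurable_diff borel_measurable_scaleR
        borel_measurable_const borel_measurable_sum mf.g_measurable' cm i measurable_compose[OF cm[OF i] mfm]) auto
  have m: "(\<lambda>z. \<lambda>j\<in>{..<N}. nlQ \<nu> s (fst z j) (snd z j)) \<in> measurable (prodN N \<nu> \<Otimes>\<^sub>M prodN N std_gauss) (prodN N borel)"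
  proof -
    have "(\<lambda>z. nlQ \<nu> s (fst z j) (snd z j)) \<in> borel_measurable (prodN N \<nu> \<Otimes>\<^sub>M prodN N std_gauss)" if j: "j < N" for j
      by (rule nlQ_measurable'[OF \<nu> measurable_const])
        (simp, rule measurable_compose[OF measurable_fst coord_measurable[OF sets_prodN[OF sn] j]],
          rule measurable_compose[OF measurable_snd coord_measurable[OF sets_prodN[OF sets_std_gauss] j]])
    then show ?thesis unfolding prodN_def by (intro measurable_restrict) auto
  qed
  have "(\<integral>\<^sup>+x. ennreal (dev \<nu> i (fst x) (snd x) s) \<partial>(prodN N \<nu> \<Otimes>\<^sub>M prodN N std_gauss))
    = (\<integral>\<^sup>+u. ennreal (h u) \<partial>prodN N (nlaw \<nu> s))"
    unfolding d[symmetric] dh by (subst nn_integral_distr[OF m]) (use hm in auto)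
  also have "\<dots> \<le> ennreal (2 * l * sqrt (\<integral>x. (norm x)\<^sup>2 \<partial>(nlaw \<nu> s)) / sqrt (real N))"
    unfolding h_def by (rule mean_field_fluctuation[OF nsp _ l_nonneg mf.g_measurable i])
      (use g_Lip[of q u q u' for q u u'] in simp)
  also have "\<dots> \<le> ennreal (2 * l * sqrt B / sqrt (real N))"
    by (intro ennreal_leI divide_right_mono mult_left_mono) (use B l_nonneg in auto)
  finally show ?thesis .
qed

text \<open>The total weight \<open>T\<^sup>2 / 2\<close> of the kernel cancels the 2 in the
  fluctuation bound.\<close>

lemma expected_dev_int:
  assumes \<nu>: "fin_second_moment \<nu>" and i: "i < N"
    and B: "\<And>s. s \<in> {0..T} \<Longrightarrow> (\<integral>x. (norm x)\<^sup>2 \<partial>(nlaw \<nu> s)) \<le> B"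
  shows "(\<integral>\<^sup>+x. ennreal (dev_int \<nu> i (fst x) (snd x)) \<partial>(prodN N \<nu> \<Otimes>\<^sub>M prodN N std_gauss))
    \<le> ennreal (T\<^sup>2 * l * sqrt B / sqrt (real N))"
    "(\<lambda>x. ennreal (dev_int \<nu> i (fst x) (snd x))) \<in> borel_measurable (prodN N \<nu> \<Otimes>\<^sub>M prodN N std_gauss)"
proof -
  let ?P = "prodN N \<nu> \<Otimes>\<^sub>M prodN N (std_gauss :: 'a measure)"
  have p: "prob_space \<nu>" using \<nu> by (auto simp: fin_second_moment_def)
  interpret P: prob_space ?P by (intro prob_space_pair prob_space_prodN p prob_space_std_gauss)
  interpret LP: pair_sigma_finite lborel ?P ..
  define C where "C = 2 * l * sqrt B / sqrt (real N)"
  have B0: "0 \<le> B" using order_trans[OF _ B[of 0]] T_pos by (auto simp: integral_nonneg_AE)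
  have C0: "0 \<le> C" using B0 l_nonneg by (simp add: C_def)
  define F where "F s x = indicator {0..T} s * ennreal ((T - s) * dev \<nu> i (fst x) (snd x) s)" for s x
  have dm[measurable]: "(\<lambda>x. dev \<nu> i (fst (snd x)) (snd (snd x)) (fst x)) \<in> borel_measurable (lborel \<Otimes>\<^sub>M ?P)"
    using dev_measurable[OF \<nu> i] by simp
  have Fm[measurable]: "(\<lambda>(s, x). F s x) \<in> borel_measurable (lborel \<Otimes>\<^sub>M ?P)"
    unfolding F_def case_prod_beta' by measurable
  have eq: "ennreal (dev_int \<nu> i (fst x) (snd x)) = (\<integral>\<^sup>+s. F s x \<partial>lborel)" for x
    unfolding F_def by (rule dev_int_nn_integral[OF \<nu> i])
  have "(\<lambda>x. \<integral>\<^sup>+s. F s x \<partial>lborel) \<in> borel_measurable ?P"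
    using Fm by measurable
  then show "(\<lambda>x. ennreal (dev_int \<nu> i (fst x) (snd x))) \<in> borel_measurable ?P"
    by (subst measurable_cong[OF eq]) auto
  have "(\<integral>\<^sup>+x. ennreal (dev_int \<nu> i (fst x) (snd x)) \<partial>?P) = (\<integral>\<^sup>+x. \<integral>\<^sup>+s. F s x \<partial>lborel \<partial>?P)"
    by (rule nn_integral_cong) (rule eq)
  also have "\<dots> = (\<integral>\<^sup>+s. \<integral>\<^sup>+x. F s x \<partial>?P \<partial>lborel)"
    by (rule LP.Fubini') (use Fm in measurable)
  also have "\<dots> \<le> (\<integral>\<^sup>+s. ennreal (indicator {0..T} s * ((T - s) * C)) \<partial>lborel)"
  proof (rule nn_integral_mono)
    fix s :: real
    show "(\<integral>\<^sup>+x. F s x \<partial>?P) \<le> ennreal (indicator {0..T} s * ((T - s) * C))"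
    proof (cases "s \<in> {0..T}")
      case True
      have [measurable]: "(\<lambda>x. dev \<nu> i (fst x) (snd x) s) \<in> borel_measurable ?P"
        using measurable_compose[OF measurable_Pair1'[of s borel] dev_measurable[OF \<nu> i]] by simp
      have "(\<integral>\<^sup>+x. F s x \<partial>?P) = (\<integral>\<^sup>+x. ennreal (T - s) * ennreal (dev \<nu> i (fst x) (snd x) s) \<partial>?P)"
        using True by (simp add: F_def ennreal_mult dev_def)
      also have "\<dots> = ennreal (T - s) * (\<integral>\<^sup>+x. ennreal (dev \<nu> i (fst x) (snd x) s) \<partial>?P)"
        by (rule nn_integral_cmult) measurable
      also have "\<dots> \<le> ennreal (T - s) * ennreal C"
        unfolding C_def by (intro mult_left_mono expected_dev[OF \<nu> i True] B True) auto
      also have "\<dots> = ennreal (indicator {0..T} s * ((T - s) * C))" using True C0 by (simp add: ennreal_mult)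
      finally show ?thesis .
    qed (simp add: F_def)
  qed
  also have "\<dots> = ennreal (T\<^sup>2 / 2 * C)"
    by (intro nn_integral_has_integral_lebesgue has_integral_mult_left integral_linear_kernel)
      (use C0 T_pos in auto)
  finally show "(\<integral>\<^sup>+x. ennreal (dev_int \<nu> i (fst x) (snd x)) \<partial>?P) \<le> ennreal (T\<^sup>2 * l * sqrt B / sqrt (real N))"
    by (simp add: C_def mult.assoc)
qed

end

section \<open>Construction of the one-step coupling\<close>

lemma nn_integral_cmult_sum:
  fixes f :: "nat \<Rightarrow> 'b \<Rightarrow> ennreal"
  assumes "\<And>i. i < N \<Longrightarrow> f i \<in> borel_measurable M"
  shows "(\<integral>\<^sup>+x. c * (\<Sum>i<N. f i x) \<partial>M) = c * (\<Sum>i<N. \<integral>\<^sup>+x. f i x \<partial>M)"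
proof -
  have "(\<integral>\<^sup>+x. c * (\<Sum>i<N. f i x) \<partial>M) = c * (\<integral>\<^sup>+x. (\<Sum>i<N. f i x) \<partial>M)"
    by (rule nn_integral_cmult) (use assms in \<open>auto intro!: borel_measurable_sum\<close>)
  also have "(\<integral>\<^sup>+x. (\<Sum>i<N. f i x) \<partial>M) = (\<Sum>i<N. \<integral>\<^sup>+x. f i x \<partial>M)"
    by (rule nn_integral_sum) (auto intro: assms)
  finally show ?thesis .
qed

context hmc_setting begin

text \<open>Each particle has its own Gaussian and uniform variable: the nonlinear copy uses the
  Gaussian, the interacting particle the velocity made from both. The second marginal remains an
  exact product whatever the coupling \<open>\<Gamma>\<close> is, so the fluctuation bound is
  available again at the next step.\<close>

lemma one_step_coupling:
  assumes M: "prob_space M" "sets M = sets (prodN N (borel :: 'a measure))"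
    and \<nu>: "fin_second_moment \<nu>" and c: "coupling M (prodN N \<nu>) \<Gamma>"
    and B: "\<And>s. s \<in> {0..T} \<Longrightarrow> (\<integral>x. (norm x)\<^sup>2 \<partial>(nlaw \<nu> s)) \<le> B"
  defines "\<rho> \<equiv> \<lambda>x y :: nat \<Rightarrow> 'a. (1 / real N) * (\<Sum>i<N. drift.cf (norm (x i - y i)))"
  shows "\<exists>\<Gamma>'. coupling (part_step V W \<epsilon> T N M) (prodN N (nl_step V W \<epsilon> T \<nu>)) \<Gamma>' \<and>
    (\<integral>\<^sup>+z. ennreal (\<rho> (fst z) (snd z)) \<partial>\<Gamma>')
      \<le> ennreal (1 - drift.rate / 156) * (\<integral>\<^sup>+z. ennreal (\<rho> (fst z) (snd z)) \<partial>\<Gamma>)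
        + ennreal (13/5 * (T\<^sup>2 * l * sqrt B / sqrt (real N)))"
proof -
  have sn[measurable_cong]: "sets \<nu> = sets borel" and pn: "prob_space \<nu>" using \<nu> by (auto simp: fin_second_moment_def)
  let ?B = "prodN N (borel :: 'a measure)"
  let ?G = "prodN N (std_gauss :: 'a measure)"
  define \<Xi> where "\<Xi> = prodN N (std_gauss \<Otimes>\<^sub>M unif :: ('a \<times> real) measure)"
  interpret \<Xi>: prob_space \<Xi> unfolding \<Xi>_def by (rule prob_space_noise)
  interpret G: prob_space ?G by (rule prob_space_prodN[OF prob_space_std_gauss])
  interpret \<Gamma>: prob_space \<Gamma> using c by (simp add: coupling_def)
  define \<Theta> where "\<Theta> = \<Gamma> \<Otimes>\<^sub>M \<Xi>"
  interpret \<Theta>: prob_space \<Theta> unfolding \<Theta>_def by (intro prob_space_pair \<Gamma>.prob_space_axioms \<Xi>.prob_space_axioms)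
  have s\<nu>: "sets (prodN N \<nu>) = sets ?B" by (rule sets_prodN[OF sn])
  have sG: "sets ?G = sets ?B" by (rule sets_prodN[OF sets_std_gauss])
  have s\<Gamma>: "sets \<Gamma> = sets (M \<Otimes>\<^sub>M prodN N \<nu>)" using c by (simp add: coupling_def)
  have fstM: "fst \<in> measurable \<Gamma> M" and sndM: "snd \<in> measurable \<Gamma> (prodN N \<nu>)"
    by (auto simp: measurable_cong_sets[OF s\<Gamma> refl])
  have d1: "distr \<Gamma> M fst = M" and d2: "distr \<Gamma> (prodN N \<nu>) snd = prodN N \<nu>" using c by (auto simp: coupling_def)
  have X: "(\<lambda>z. fst (fst z) i) \<in> borel_measurable \<Theta>" and Y: "(\<lambda>z. snd (fst z) i) \<in> borel_measurable \<Theta>"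
    and w: "(\<lambda>z. snd z i) \<in> measurable \<Theta> (std_gauss \<Otimes>\<^sub>M unif :: ('a \<times> real) measure)" if i: "i < N" for i
    unfolding \<Theta>_def
    by (rule measurable_compose[OF measurable_compose[OF measurable_fst fstM] coord_measurable[OF M(2) i]],
        rule measurable_compose[OF measurable_compose[OF measurable_fst sndM] coord_measurable[OF s\<nu> i]],
        rule measurable_compose[OF measurable_snd coord_measurable[OF _ i]]) (simp add: \<Xi>_def)
  have w1: "(\<lambda>z. fst (snd z i)) \<in> borel_measurable \<Theta>" if i: "i < N" for i
    using measurable_compose[OF w[OF i] measurable_fst] by (simp add: measurable_cong_sets[OF refl sets_std_gauss])
  define xi where "xi z \<omega> = (\<lambda>i\<in>{..<N}. drift.vel (fst z i) (snd z i) (\<omega> i))" for z :: "(nat \<Rightarrow> 'a) \<times> (nat \<Rightarrow> 'a)" and \<omega>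
  define eta where "eta z \<omega> = (\<lambda>i\<in>{..<N}. fst (\<omega> i))" for z :: "(nat \<Rightarrow> 'a) \<times> (nat \<Rightarrow> 'a)" and \<omega> :: "nat \<Rightarrow> 'a \<times> real"
  have xim: "case_prod xi \<in> measurable (\<Gamma> \<Otimes>\<^sub>M \<Xi>) ?G"
    unfolding xi_def case_prod_beta' prodN_def \<Theta>_def[symmetric]
    by (intro measurable_restrict) (simp add: measurable_cong_sets[OF refl sets_std_gauss], intro drift.vel_measurable X Y w, auto)
  have etam: "case_prod eta \<in> measurable (\<Gamma> \<Otimes>\<^sub>M \<Xi>) ?G"
    unfolding eta_def case_prod_beta' prodN_def \<Theta>_def[symmetric]
    by (intro measurable_restrict) (simp add: measurable_cong_sets[OF refl sets_std_gauss] w1)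
  have gu: "prob_space (std_gauss \<Otimes>\<^sub>M unif :: ('a \<times> real) measure)"
    by (intro prob_space_pair prob_space_std_gauss unif.prob_space_axioms)
  \<comment> \<open>A push-forward depends on its target only through the sigma-algebra, so the
    Gaussian product may be replaced by the Borel product.\<close>
  have cG: "distr \<Xi> ?G f = distr \<Xi> ?B f" for f by (rule distr_cong) (auto simp: sG)
  have xiG: "distr \<Xi> ?G (xi z) = ?G" for z
    unfolding cG unfolding xi_def \<Xi>_def prodN_def
    by (rule distr_PiM_componentwise[OF _ gu _ drift.distr_vel prob_space_std_gauss]) auto
  have etaG: "distr \<Xi> ?G (eta z) = ?G" for z
  proof -
    have "distr (std_gauss \<Otimes>\<^sub>M unif) borel fst = (std_gauss :: 'a measure)"
    proof -
      have "distr (std_gauss \<Otimes>\<^sub>M unif) borel fst = distr (std_gauss \<Otimes>\<^sub>M unif) (std_gauss :: 'a measure) fst"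
        by (rule distr_cong) auto
      then show ?thesis using prob_space.distr_pair_fst[OF unif.prob_space_axioms] by simp
    qed
    then show ?thesis
      unfolding cG unfolding eta_def \<Xi>_def prodN_def
      by (intro distr_PiM_componentwise[OF _ gu _ _ prob_space_std_gauss])
        (auto simp: measurable_cong_sets[OF refl sets_std_gauss, symmetric])
  qed
  have law1: "distr \<Theta> (M \<Otimes>\<^sub>M ?G) (\<lambda>(z, \<omega>). (fst z, xi z \<omega>)) = M \<Otimes>\<^sub>M ?G"
    unfolding \<Theta>_def
    by (rule distr_noise[OF \<Gamma>.prob_space_axioms \<Xi>.prob_space_axioms G.prob_space_axioms fstM d1 xim xiG])
  have law2: "distr \<Theta> (prodN N \<nu> \<Otimes>\<^sub>M ?G) (\<lambda>(z, \<omega>). (snd z, eta z \<omega>)) = prodN N \<nu> \<Otimes>\<^sub>M ?G"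
    unfolding \<Theta>_def
    by (rule distr_noise[OF \<Gamma>.prob_space_axioms \<Xi>.prob_space_axioms G.prob_space_axioms sndM d2 etam etaG])
  have m1: "(\<lambda>(z, \<omega>). (fst z, xi z \<omega>)) \<in> measurable \<Theta> (M \<Otimes>\<^sub>M ?G)"
    unfolding case_prod_beta' \<Theta>_def using xim
    by (intro measurable_Pair measurable_compose[OF measurable_fst fstM]) (simp add: case_prod_beta')
  have m2: "(\<lambda>(z, \<omega>). (snd z, eta z \<omega>)) \<in> measurable \<Theta> (prodN N \<nu> \<Otimes>\<^sub>M ?G)"
    unfolding case_prod_beta' \<Theta>_def using etam
    by (intro measurable_Pair measurable_compose[OF measurable_fst sndM]) (simp add: case_prod_beta')
  define F1 where "F1 z = qT V W \<epsilon> T N (fst z) (snd z)" for z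
  define F2 where "F2 z = (\<lambda>i\<in>{..<N}. nlQ \<nu> T (fst z i) (snd z i))" for z
  have F1m: "F1 \<in> measurable (M \<Otimes>\<^sub>M ?G) ?B"
    unfolding F1_def[abs_def] using qT_measurable
    by (subst measurable_cong_sets[OF sets_pair_measure_cong[OF M(2) sG] refl])
  have F2m: "F2 \<in> measurable (prodN N \<nu> \<Otimes>\<^sub>M ?G) ?B"
  proof -
    have "(\<lambda>z. nlQ \<nu> T (fst z j) (snd z j)) \<in> borel_measurable (prodN N \<nu> \<Otimes>\<^sub>M ?G)" if j: "j < N" for j
      by (rule nlQ_measurable'[OF \<nu> measurable_const])
        (simp, rule measurable_compose[OF measurable_fst coord_measurable[OF s\<nu> j]],
          rule measurable_compose[OF measurable_snd coord_measurable[OF sG j]])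
    then show ?thesis unfolding prodN_def F2_def[abs_def] by (intro measurable_restrict) auto
  qed
  define \<Phi> where "\<Phi> = (\<lambda>(z, \<omega>). (F1 (fst z, xi z \<omega>), F2 (snd z, eta z \<omega>)))"
  have \<Phi>m: "\<Phi> \<in> measurable \<Theta> (?B \<Otimes>\<^sub>M ?B)"
    using measurable_Pair[OF measurable_compose[OF m1 F1m] measurable_compose[OF m2 F2m]]
    by (simp add: \<Phi>_def case_prod_beta')
  define \<Gamma>' where "\<Gamma>' = distr \<Theta> (?B \<Otimes>\<^sub>M ?B) \<Phi>"
  have ps: "part_step V W \<epsilon> T N M = distr (M \<Otimes>\<^sub>M ?G) ?B F1"
    unfolding F1_def[abs_def] by (rule part_step_eq[OF M])
  have ns: "prodN N (nl_step V W \<epsilon> T \<nu>) = distr (prodN N \<nu> \<Otimes>\<^sub>M ?G) ?B F2"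
  proof -
    have "(\<lambda>(x, v). nlQ \<nu> T x v) \<in> borel_measurable (\<nu> \<Otimes>\<^sub>M std_gauss)"
      unfolding case_prod_beta' using \<nu> by measurable
    from distr_PiM_pair[OF _ pn prob_space_std_gauss this, of "{..<N}"]
    show ?thesis unfolding prodN_def nl_step_eq[OF \<nu>] nlaw_def F2_def[abs_def] by simp
  qed
  have coup: "coupling (part_step V W \<epsilon> T N M) (prodN N (nl_step V W \<epsilon> T \<nu>)) \<Gamma>'"
    unfolding coupling_def
  proof (intro conjI)
    show "prob_space \<Gamma>'" unfolding \<Gamma>'_def by (rule \<Theta>.prob_space_distr[OF \<Phi>m])
    show "sets \<Gamma>' = sets (part_step V W \<epsilon> T N M \<Otimes>\<^sub>M prodN N (nl_step V W \<epsilon> T \<nu>))"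
      unfolding \<Gamma>'_def ps ns by (simp cong: sets_pair_measure_cong)
    have "distr \<Gamma>' (part_step V W \<epsilon> T N M) fst = distr \<Gamma>' ?B fst" by (rule distr_cong) (auto simp: ps)
    also have "\<dots> = distr \<Theta> ?B (F1 \<circ> (\<lambda>(z, \<omega>). (fst z, xi z \<omega>)))"
      unfolding \<Gamma>'_def by (subst distr_distr[OF measurable_fst \<Phi>m]) (auto simp: \<Phi>_def comp_def case_prod_beta')
    also have "\<dots> = distr (distr \<Theta> (M \<Otimes>\<^sub>M ?G) (\<lambda>(z, \<omega>). (fst z, xi z \<omega>))) ?B F1"
      by (rule distr_distr[OF F1m m1, symmetric])
    finally show "distr \<Gamma>' (part_step V W \<epsilon> T N M) fst = part_step V W \<epsilon> T N M" by (simp add: law1 ps)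
    have "distr \<Gamma>' (prodN N (nl_step V W \<epsilon> T \<nu>)) snd = distr \<Gamma>' ?B snd" by (rule distr_cong) (auto simp: ns)
    also have "\<dots> = distr \<Theta> ?B (F2 \<circ> (\<lambda>(z, \<omega>). (snd z, eta z \<omega>)))"
      unfolding \<Gamma>'_def by (subst distr_distr[OF measurable_snd \<Phi>m]) (auto simp: \<Phi>_def comp_def case_prod_beta')
    also have "\<dots> = distr (distr \<Theta> (prodN N \<nu> \<Otimes>\<^sub>M ?G) (\<lambda>(z, \<omega>). (snd z, eta z \<omega>))) ?B F2"
      by (rule distr_distr[OF F2m m2, symmetric])
    finally show "distr \<Gamma>' (prodN N (nl_step V W \<epsilon> T \<nu>)) snd = prodN N (nl_step V W \<epsilon> T \<nu>)" by (simp add: law2 ns)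
  qed
  define H where "H x y w = drift.goal x y (drift.vel x y w - fst w) + kap * drift.amp x y (drift.vel x y w - fst w)"
    for x y :: 'a and w
  have kap0: "0 \<le> kap" using l_nonneg by simp
  have H0: "0 \<le> H x y w" for x y w unfolding H_def
    by (rule add_nonneg_nonneg[OF drift.goal_nonneg mult_nonneg_nonneg[OF kap0 drift.amp_nonneg]])
  define a where "a i x = ennreal (dev_int \<nu> i (fst x) (snd x))" for i x
  have pt: "ennreal (\<rho> (fst (\<Phi> x)) (snd (\<Phi> x)))
    \<le> ennreal (1 / real N) * (\<Sum>i<N. ennreal (H (fst (fst x) i) (snd (fst x) i) (snd x i)))
      + ennreal (13/5 * (1 / real N)) * (\<Sum>i<N. a i (snd (fst x), eta (fst x) (snd x)))" for x
  proof -
    let ?X = "fst (fst x)" and ?Y = "snd (fst x)" and ?\<omega> = "snd x"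
    let ?xi = "xi (fst x) ?\<omega>" and ?eta = "eta (fst x) ?\<omega>"
    have "\<rho> (fst (\<Phi> x)) (snd (\<Phi> x)) = (1 / real N) * (\<Sum>i<N. drift.cf (norm (qT V W \<epsilon> T N ?X ?xi i - nlQ \<nu> T (?Y i) (?eta i))))"
      by (simp add: \<rho>_def \<Phi>_def F1_def F2_def case_prod_beta')
    also have "\<dots> \<le> (1 / real N) * (\<Sum>i<N. drift.goal (?X i) (?Y i) (?xi i - ?eta i) + kap * drift.amp (?X i) (?Y i) (?xi i - ?eta i))
      + 13/5 * ((1 / real N) * (\<Sum>i<N. dev_int \<nu> i ?Y ?eta))"
      by (rule system_comparison[OF \<nu>]) (simp add: xi_def eta_def drift.vel_sync)
    also have "\<dots> = (1 / real N) * (\<Sum>i<N. H (?X i) (?Y i) (?\<omega> i)) + (13/5 * (1 / real N)) * (\<Sum>i<N. dev_int \<nu> i ?Y ?eta)"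
      by (simp add: H_def xi_def eta_def)
    finally have "ennreal (\<rho> (fst (\<Phi> x)) (snd (\<Phi> x)))
      \<le> ennreal ((1 / real N) * (\<Sum>i<N. H (?X i) (?Y i) (?\<omega> i)) + (13/5 * (1 / real N)) * (\<Sum>i<N. dev_int \<nu> i ?Y ?eta))"
      by (rule ennreal_leI)
    also have "\<dots> = ennreal (1 / real N) * (\<Sum>i<N. ennreal (H (?X i) (?Y i) (?\<omega> i)))
        + ennreal (13/5 * (1 / real N)) * (\<Sum>i<N. ennreal (dev_int \<nu> i ?Y ?eta))"
    proof -
      have h: "(\<Sum>i<N. ennreal (H (?X i) (?Y i) (?\<omega> i))) = ennreal (\<Sum>i<N. H (?X i) (?Y i) (?\<omega> i))"
        by (rule sum_ennreal) (rule H0)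
      have d: "(\<Sum>i<N. ennreal (dev_int \<nu> i ?Y ?eta)) = ennreal (\<Sum>i<N. dev_int \<nu> i ?Y ?eta)"
        by (rule sum_ennreal) (simp add: dev_int_nonneg[OF \<nu>])
      have p: "ennreal (c * A + k * D) = ennreal c * ennreal A + ennreal k * ennreal D"
        if "0 \<le> c" "0 \<le> A" "0 \<le> k" "0 \<le> D" for c A k D :: real
        using that by (simp add: ennreal_plus ennreal_mult)
      show ?thesis unfolding h d
        by (rule p) (auto intro!: sum_nonneg H0 dev_int_nonneg[OF \<nu>])
    qed
    finally show ?thesis by (simp add: a_def)
  qed
  have Hm: "(\<lambda>x. ennreal (H (fst (fst x) i) (snd (fst x) i) (snd x i))) \<in> borel_measurable \<Theta>" if i: "i < N" for i
  proof -
    have v: "(\<lambda>x. drift.vel (fst (fst x) i) (snd (fst x) i) (snd x i) - fst (snd x i)) \<in> borel_measurable \<Theta>"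
      by (intro borel_measurable_diff drift.vel_measurable X Y w w1 i)
    show ?thesis unfolding H_def
      by (intro measurable_compose[OF _ measurable_ennreal] borel_measurable_add borel_measurable_times
          borel_measurable_const drift.goal_measurable drift.amp_measurable X Y i v)
  qed
  have am: "(\<lambda>x. a i (snd (fst x), eta (fst x) (snd x))) \<in> borel_measurable \<Theta>"
    and aI: "(\<integral>\<^sup>+x. a i (snd (fst x), eta (fst x) (snd x)) \<partial>\<Theta>) \<le> ennreal (T\<^sup>2 * l * sqrt B / sqrt (real N))" if i: "i < N" for i
  proof -
    have m: "a i \<in> borel_measurable (prodN N \<nu> \<Otimes>\<^sub>M ?G)"
      unfolding a_def by (rule expected_dev_int(2)[OF \<nu> i B])
    show "(\<lambda>x. a i (snd (fst x), eta (fst x) (snd x))) \<in> borel_measurable \<Theta>"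
      using measurable_compose[OF m2 m] by (simp add: case_prod_beta')
    have m': "a i \<in> borel_measurable (distr \<Theta> (prodN N \<nu> \<Otimes>\<^sub>M ?G) (\<lambda>(z, \<omega>). (snd z, eta z \<omega>)))" using m by (simp add: law2)
    have "(\<integral>\<^sup>+x. a i (snd (fst x), eta (fst x) (snd x)) \<partial>\<Theta>) = (\<integral>\<^sup>+x. a i x \<partial>(prodN N \<nu> \<Otimes>\<^sub>M ?G))"
      using nn_integral_distr[OF m2 m'] unfolding law2 by (simp add: case_prod_beta')
    also have "\<dots> \<le> ennreal (T\<^sup>2 * l * sqrt B / sqrt (real N))"
      unfolding a_def by (rule expected_dev_int(1)[OF \<nu> i B])
    finally show "(\<integral>\<^sup>+x. a i (snd (fst x), eta (fst x) (snd x)) \<partial>\<Theta>) \<le> ennreal (T\<^sup>2 * l * sqrt B / sqrt (real N))" .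
  qed
  have cfm: "(\<lambda>z. ennreal (drift.cf (norm (fst z i - snd z i)))) \<in> borel_measurable \<Gamma>" if i: "i < N" for i
    using measurable_compose[OF fstM coord_measurable[OF M(2) i]] measurable_compose[OF sndM coord_measurable[OF s\<nu> i]]
    by measurable
  \<comment> \<open>Given the current pair, the \<open>i\<close>-th term sees only the
    \<open>i\<close>-th noise coordinate, whose law is that of a single particle.\<close>
  have HI: "(\<integral>\<^sup>+x. ennreal (H (fst (fst x) i) (snd (fst x) i) (snd x i)) \<partial>\<Theta>)
      \<le> ennreal (1 - drift.rate / 156) * (\<integral>\<^sup>+z. ennreal (drift.cf (norm (fst z i - snd z i))) \<partial>\<Gamma>)" if i: "i < N" for i
  proof -
    have comp: "distr \<Xi> (std_gauss \<Otimes>\<^sub>M unif :: ('a \<times> real) measure) (\<lambda>\<omega>. \<omega> i) = std_gauss \<Otimes>\<^sub>M unif"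
      unfolding \<Xi>_def prodN_def by (rule distr_PiM_component) (use i gu in auto)
    have cm: "(\<lambda>\<omega>. \<omega> i) \<in> measurable \<Xi> (std_gauss \<Otimes>\<^sub>M unif :: ('a \<times> real) measure)"
      unfolding \<Xi>_def by (rule coord_measurable[OF refl i])
    have "(\<integral>\<^sup>+x. ennreal (H (fst (fst x) i) (snd (fst x) i) (snd x i)) \<partial>\<Theta>)
      = (\<integral>\<^sup>+z. \<integral>\<^sup>+\<omega>. ennreal (H (fst z i) (snd z i) (\<omega> i)) \<partial>\<Xi> \<partial>\<Gamma>)"
      using \<Xi>.nn_integral_fst[of "\<lambda>x. ennreal (H (fst (fst x) i) (snd (fst x) i) (snd x i))" \<Gamma>] Hm[OF i]
      unfolding \<Theta>_def by simp
    also have "\<dots> \<le> (\<integral>\<^sup>+z. ennreal (1 - drift.rate / 156) * ennreal (drift.cf (norm (fst z i - snd z i))) \<partial>\<Gamma>)"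
    proof (rule nn_integral_mono)
      fix z :: "(nat \<Rightarrow> 'a) \<times> (nat \<Rightarrow> 'a)"
      have hm: "(\<lambda>w. ennreal (H x y w)) \<in> borel_measurable (std_gauss \<Otimes>\<^sub>M unif)" for x y
      proof -
        have f: "(\<lambda>w. fst w :: 'a) \<in> borel_measurable (std_gauss \<Otimes>\<^sub>M unif)"
          using measurable_fst[of "std_gauss :: 'a measure" unif] by (simp add: measurable_cong_sets[OF refl sets_std_gauss])
        show ?thesis unfolding H_def
          by (intro measurable_compose[OF _ measurable_ennreal] borel_measurable_add borel_measurable_times
            borel_measurable_const drift.goal_measurable drift.amp_measurable borel_measurable_diff drift.vel_measurable
            measurable_ident_sets refl f)
      qed
      have "(\<integral>\<^sup>+\<omega>. ennreal (H (fst z i) (snd z i) (\<omega> i)) \<partial>\<Xi>) = (\<integral>\<^sup>+w. ennreal (H (fst z i) (snd z i) w) \<partial>(std_gauss \<Otimes>\<^sub>M unif))"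
        using nn_integral_distr[OF cm, of "\<lambda>w. ennreal (H (fst z i) (snd z i) w)"] hm by (simp add: comp)
      also have "\<dots> \<le> ennreal ((1 - drift.rate / 156) * drift.cf (norm (fst z i - snd z i)))"
        unfolding H_def by (rule drift.one_particle_contraction[OF kap0 l_bound])
      also have "\<dots> = ennreal (1 - drift.rate / 156) * ennreal (drift.cf (norm (fst z i - snd z i)))"
        using drift.rate_le by (intro ennreal_mult drift.cf_nonneg) auto
      finally show "(\<integral>\<^sup>+\<omega>. ennreal (H (fst z i) (snd z i) (\<omega> i)) \<partial>\<Xi>)
        \<le> ennreal (1 - drift.rate / 156) * ennreal (drift.cf (norm (fst z i - snd z i)))" .
    qed
    also have "\<dots> = ennreal (1 - drift.rate / 156) * (\<integral>\<^sup>+z. ennreal (drift.cf (norm (fst z i - snd z i))) \<partial>\<Gamma>)"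
      by (rule nn_integral_cmult[OF cfm[OF i]])
    finally show ?thesis .
  qed
  have \<rho>e: "ennreal (\<rho> x y) = ennreal (1 / real N) * (\<Sum>i<N. ennreal (drift.cf (norm (x i - y i))))" for x y
  proof -
    have h: "(\<Sum>i<N. ennreal (drift.cf (norm (x i - y i)))) = ennreal (\<Sum>i<N. drift.cf (norm (x i - y i)))"
      by (rule sum_ennreal) (simp add: drift.cf_nonneg)
    show ?thesis unfolding \<rho>_def h by (rule ennreal_mult) (auto intro!: sum_nonneg drift.cf_nonneg)
  qed
  have \<rho>\<Gamma>: "(\<integral>\<^sup>+z. ennreal (\<rho> (fst z) (snd z)) \<partial>\<Gamma>)
      = ennreal (1 / real N) * (\<Sum>i<N. \<integral>\<^sup>+z. ennreal (drift.cf (norm (fst z i - snd z i))) \<partial>\<Gamma>)"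
    unfolding \<rho>e by (rule nn_integral_cmult_sum[OF cfm])
  have \<rho>m: "(\<lambda>z. ennreal (\<rho> (fst z) (snd z))) \<in> borel_measurable (?B \<Otimes>\<^sub>M ?B)"
  proof -
    have "(\<lambda>z. fst z i) \<in> borel_measurable (?B \<Otimes>\<^sub>M ?B)" "(\<lambda>z. snd z i) \<in> borel_measurable (?B \<Otimes>\<^sub>M ?B)" if "i < N" for i
      using measurable_compose[OF measurable_fst coord_measurable[OF refl that]]
        measurable_compose[OF measurable_snd coord_measurable[OF refl that]] by auto
    then show ?thesis unfolding \<rho>_def by measurable
  qed
  have "(\<integral>\<^sup>+z. ennreal (\<rho> (fst z) (snd z)) \<partial>\<Gamma>') = (\<integral>\<^sup>+x. ennreal (\<rho> (fst (\<Phi> x)) (snd (\<Phi> x))) \<partial>\<Theta>)"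
    unfolding \<Gamma>'_def using \<rho>m by (subst nn_integral_distr[OF \<Phi>m]) auto
  also have "\<dots> \<le> (\<integral>\<^sup>+x. ennreal (1 / real N) * (\<Sum>i<N. ennreal (H (fst (fst x) i) (snd (fst x) i) (snd x i)))
      + ennreal (13/5 * (1 / real N)) * (\<Sum>i<N. a i (snd (fst x), eta (fst x) (snd x))) \<partial>\<Theta>)"
    by (intro nn_integral_mono pt)
  also have "\<dots> = (\<integral>\<^sup>+x. ennreal (1 / real N) * (\<Sum>i<N. ennreal (H (fst (fst x) i) (snd (fst x) i) (snd x i))) \<partial>\<Theta>)
      + (\<integral>\<^sup>+x. ennreal (13/5 * (1 / real N)) * (\<Sum>i<N. a i (snd (fst x), eta (fst x) (snd x))) \<partial>\<Theta>)"
    by (intro nn_integral_add borel_measurable_times_ennreal borel_measurable_sum borel_measurable_const Hm am) auto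
  also have "\<dots> = ennreal (1 / real N) * (\<Sum>i<N. \<integral>\<^sup>+x. ennreal (H (fst (fst x) i) (snd (fst x) i) (snd x i)) \<partial>\<Theta>)
      + ennreal (13/5 * (1 / real N)) * (\<Sum>i<N. \<integral>\<^sup>+x. a i (snd (fst x), eta (fst x) (snd x)) \<partial>\<Theta>)"
  proof (intro arg_cong2[where f="(+)"])
    show "(\<integral>\<^sup>+x. ennreal (1 / real N) * (\<Sum>i<N. ennreal (H (fst (fst x) i) (snd (fst x) i) (snd x i))) \<partial>\<Theta>)
      = ennreal (1 / real N) * (\<Sum>i<N. \<integral>\<^sup>+x. ennreal (H (fst (fst x) i) (snd (fst x) i) (snd x i)) \<partial>\<Theta>)"
      by (rule nn_integral_cmult_sum[OF Hm])
    show "(\<integral>\<^sup>+x. ennreal (13/5 * (1 / real N)) * (\<Sum>i<N. a i (snd (fst x), eta (fst x) (snd x))) \<partial>\<Theta>)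
      = ennreal (13/5 * (1 / real N)) * (\<Sum>i<N. \<integral>\<^sup>+x. a i (snd (fst x), eta (fst x) (snd x)) \<partial>\<Theta>)"
      by (rule nn_integral_cmult_sum[OF am])
  qed
  also have "\<dots> \<le> ennreal (1 / real N) * (\<Sum>i<N. ennreal (1 - drift.rate / 156) * (\<integral>\<^sup>+z. ennreal (drift.cf (norm (fst z i - snd z i))) \<partial>\<Gamma>))
      + ennreal (13/5 * (1 / real N)) * (\<Sum>i<N. ennreal (T\<^sup>2 * l * sqrt B / sqrt (real N)))"
    by (intro add_mono mult_left_mono sum_mono HI aI) auto
  also have "ennreal (1 / real N) * (\<Sum>i<N. ennreal (1 - drift.rate / 156) * (\<integral>\<^sup>+z. ennreal (drift.cf (norm (fst z i - snd z i))) \<partial>\<Gamma>))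
      = ennreal (1 - drift.rate / 156) * (\<integral>\<^sup>+z. ennreal (\<rho> (fst z) (snd z)) \<partial>\<Gamma>)"
    unfolding \<rho>\<Gamma> by (simp add: sum_distrib_left mult.left_commute)
  also have "ennreal (13/5 * (1 / real N)) * (\<Sum>i<N. ennreal (T\<^sup>2 * l * sqrt B / sqrt (real N)))
      = ennreal (13/5 * (T\<^sup>2 * l * sqrt B / sqrt (real N)))"
  proof -
    have "0 \<le> B" using order_trans[OF _ B[of 0]] T_pos by (auto simp: integral_nonneg_AE)
    then have d0: "0 \<le> T\<^sup>2 * l * sqrt B / sqrt (real N)" (is "0 \<le> ?d") using l_nonneg by simp
    have "(\<Sum>i<N. ennreal ?d) = ennreal (real N * ?d)"
      by (subst sum_ennreal) (use d0 in simp_all)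
    then have "ennreal (13/5 * (1 / real N)) * (\<Sum>i<N. ennreal ?d) = ennreal (13/5 * (1 / real N) * (real N * ?d))"
      by (simp only:) (rule ennreal_mult[symmetric], simp, rule mult_nonneg_nonneg[OF of_nat_0_le_iff d0])
    also have "13/5 * (1 / real N) * (real N * ?d) = 13/5 * ?d" using N_pos by simp
    finally show ?thesis .
  qed
  finally show ?thesis using coup by blast
qed

end

section \<open>Volume preservation and invariance\<close>

text \<open>The position is advanced with the already updated velocity. This makes the step two
  shears in succession, each a translation of one variable by a function of the other.\<close>

definition symp_euler :: "('a::euclidean_space \<Rightarrow> 'a) \<Rightarrow> real \<Rightarrow> 'a \<times> 'a \<Rightarrow> 'a \<times> 'a" where
  "symp_euler F h = (\<lambda>(x, v). (x + h *\<^sub>R (v - h *\<^sub>R F x), v - h *\<^sub>R F x))"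

lemma symp_euler_measurable[measurable]:
  assumes [measurable]: "F \<in> borel_measurable borel"
  shows "symp_euler F h \<in> measurable (borel \<Otimes>\<^sub>M borel) (borel \<Otimes>\<^sub>M borel)"
  unfolding symp_euler_def by measurable

lemma nn_integral_symp_euler:
  fixes F :: "'a::euclidean_space \<Rightarrow> 'a"
  assumes F[measurable]: "F \<in> borel_measurable borel" and G[measurable]: "G \<in> borel_measurable (borel \<Otimes>\<^sub>M borel)"
  shows "(\<integral>\<^sup>+z. G (symp_euler F h z) \<partial>(lborel \<Otimes>\<^sub>M lborel)) = (\<integral>\<^sup>+z. G z \<partial>(lborel \<Otimes>\<^sub>M lborel))"
proof -
  have "(\<integral>\<^sup>+z. G (symp_euler F h z) \<partial>(lborel \<Otimes>\<^sub>M lborel))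
      = (\<integral>\<^sup>+x. \<integral>\<^sup>+v. G (x + h *\<^sub>R (v - h *\<^sub>R F x), v - h *\<^sub>R F x) \<partial>lborel \<partial>lborel)"
    by (subst lborel.nn_integral_fst[symmetric]) (auto simp: symp_euler_def)
  also have "\<dots> = (\<integral>\<^sup>+x. \<integral>\<^sup>+v. G (x + h *\<^sub>R v, v) \<partial>lborel \<partial>lborel)"
  proof (rule nn_integral_cong)
    fix x
    show "(\<integral>\<^sup>+v. G (x + h *\<^sub>R (v - h *\<^sub>R F x), v - h *\<^sub>R F x) \<partial>lborel) = (\<integral>\<^sup>+v. G (x + h *\<^sub>R v, v) \<partial>lborel)"
      using nn_integral_lborel_translate[of "\<lambda>v. G (x + h *\<^sub>R v, v)" "- (h *\<^sub>R F x)"] by simp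
  qed
  also have "\<dots> = (\<integral>\<^sup>+v. \<integral>\<^sup>+x. G (x + h *\<^sub>R v, v) \<partial>lborel \<partial>lborel)"
    by (rule lborel_pair.Fubini') measurable
  also have "\<dots> = (\<integral>\<^sup>+v. \<integral>\<^sup>+x. G (x, v) \<partial>lborel \<partial>lborel)"
  proof (rule nn_integral_cong)
    fix v
    show "(\<integral>\<^sup>+x. G (x + h *\<^sub>R v, v) \<partial>lborel) = (\<integral>\<^sup>+x. G (x, v) \<partial>lborel)"
      using nn_integral_lborel_translate[of "\<lambda>x. G (x, v)" "h *\<^sub>R v"] by (simp add: add.commute)
  qed
  also have "\<dots> = (\<integral>\<^sup>+x. \<integral>\<^sup>+v. G (x, v) \<partial>lborel \<partial>lborel)"
    by (rule lborel_pair.Fubini') measurable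
  also have "\<dots> = (\<integral>\<^sup>+z. G z \<partial>(lborel \<Otimes>\<^sub>M lborel))"
    by (subst lborel.nn_integral_fst[symmetric]) auto
  finally show ?thesis .
qed

lemma symp_euler_pow_measurable:
  assumes F: "F \<in> borel_measurable borel"
  shows "(symp_euler F h ^^ n) \<in> measurable (borel \<Otimes>\<^sub>M borel) (borel \<Otimes>\<^sub>M borel)"
proof (induction n)
  case (Suc n)
  from measurable_comp[OF Suc symp_euler_measurable[OF F, of h]] show ?case by (simp add: comp_def)
qed (simp add: id_def)

lemma nn_integral_symp_euler_pow:
  fixes F :: "'a::euclidean_space \<Rightarrow> 'a"
  assumes F: "F \<in> borel_measurable borel" and G: "G \<in> borel_measurable (borel \<Otimes>\<^sub>M borel)"
  shows "(\<integral>\<^sup>+z. G ((symp_euler F h ^^ n) z) \<partial>(lborel \<Otimes>\<^sub>M lborel)) = (\<integral>\<^sup>+z. G z \<partial>(lborel \<Otimes>\<^sub>M lborel))"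
  using G
proof (induction n arbitrary: G)
  case (Suc n)
  have "(\<integral>\<^sup>+z. G ((symp_euler F h ^^ Suc n) z) \<partial>(lborel \<Otimes>\<^sub>M lborel))
    = (\<integral>\<^sup>+z. (\<lambda>z. G (symp_euler F h z)) ((symp_euler F h ^^ n) z) \<partial>(lborel \<Otimes>\<^sub>M lborel))" by simp
  also have "\<dots> = (\<integral>\<^sup>+z. G (symp_euler F h z) \<partial>(lborel \<Otimes>\<^sub>M lborel))"
    by (rule Suc.IH) (rule measurable_compose[OF symp_euler_measurable[OF F] Suc.prems])
  also have "\<dots> = (\<integral>\<^sup>+z. G z \<partial>(lborel \<Otimes>\<^sub>M lborel))" by (rule nn_integral_symp_euler[OF F Suc.prems])
  finally show ?case .
qed simp

lemma vector_increment_bound: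
  fixes f :: "real \<Rightarrow> 'a::euclidean_space"
  assumes f: "\<And>u. u \<in> {0..T} \<Longrightarrow> (f has_vector_derivative f' u) (at u within {0..T})"
    and s: "0 \<le> s" "s \<le> t" "t \<le> T"
    and bd: "\<And>u. u \<in> {s..t} \<Longrightarrow> norm (f' u - c) \<le> B" and B: "0 \<le> B"
  shows "norm (f t - f s - (t - s) *\<^sub>R c) \<le> B * (t - s)"
proof -
  have "((\<lambda>u. f' u - c) has_integral ((f t - t *\<^sub>R c) - (f s - s *\<^sub>R c))) {s..t}"
  proof (rule fundamental_theorem_of_calculus[OF s(2)])
    fix u assume u: "u \<in> {s..t}"
    have "(f has_vector_derivative f' u) (at u within {s..t})"
      by (rule has_vector_derivative_within_subset[OF f]) (use u s in auto)
    then show "((\<lambda>u. f u - u *\<^sub>R c) has_vector_derivative f' u - c) (at u within {s..t})"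
      by (auto intro!: derivative_eq_intros)
  qed
  then have "norm ((f t - t *\<^sub>R c) - (f s - s *\<^sub>R c)) \<le> B * measure lborel (cbox s t)"
    by (intro has_integral_bound[OF B]) (use bd in auto)
  then show ?thesis using s by (simp add: algebra_simps)
qed

text \<open>Local errors of order \<open>h\<^sup>2\<close> and stability \<open>1 + h * K1\<close>
  per step give a global error of order \<open>1 / n\<close> by a discrete Gronwall
  argument.\<close>

lemma symp_euler_converges:
  fixes F :: "'a::euclidean_space \<Rightarrow> 'a"
  assumes lip: "\<And>x y. norm (F x - F y) \<le> C * norm (x - y)" and C0: "0 \<le> C"
    and q: "\<And>u. u \<in> {0..T} \<Longrightarrow> (q has_vector_derivative p u) (at u within {0..T})"
    and p: "\<And>u. u \<in> {0..T} \<Longrightarrow> (p has_vector_derivative - F (q u)) (at u within {0..T})"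
    and t: "t \<in> {0..T}"
  shows "(\<lambda>n. (symp_euler F (t / real n) ^^ n) (q 0, p 0)) \<longlonglongrightarrow> (q t, p t)"
proof -
  have T0: "0 \<le> T" using t by simp
  have Fc: "continuous_on UNIV F"
    by (rule lipschitz_on_continuous_on[of C]) (use lip C0 in \<open>auto simp: lipschitz_on_def dist_norm\<close>)
  have qc: "continuous_on {0..T} q" and pc: "continuous_on {0..T} p"
    using continuous_on_trajectory[OF q] continuous_on_trajectory[OF p] by auto
  have "bounded (p ` {0..T})" "bounded ((\<lambda>u. F (q u)) ` {0..T})"
    by (rule compact_imp_bounded[OF compact_continuous_image[OF pc compact_Icc]],
        rule compact_imp_bounded[OF compact_continuous_image[OF continuous_on_compose2[OF Fc qc] compact_Icc]], simp)
  then obtain A B where A: "\<And>u. u \<in> {0..T} \<Longrightarrow> norm (p u) \<le> A" and B: "\<And>u. u \<in> {0..T} \<Longrightarrow> norm (F (q u)) \<le> B"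
    unfolding bounded_iff by (metis image_eqI)
  have A0: "0 \<le> A" and B0: "0 \<le> B" using A[OF t] B[OF t] order_trans[OF norm_ge_zero] by blast+
  define K1 where "K1 = 1 + (1 + T) * C"
  define K2 where "K2 = (1 + T) * (C * A) + 2 * B"
  have K10: "0 \<le> K1" and K20: "0 \<le> K2" using T0 C0 A0 B0 by (auto simp: K1_def K2_def)
  define err where "err z s = norm (fst z - q s) + norm (snd z - p s)" for z :: "'a \<times> 'a" and s
  \<comment> \<open>The starting point \<open>z\<close> is arbitrary, so the estimate combines
    propagation of the accumulated error with the local error of one step.\<close>
  have step: "err (symp_euler F h z) (s + h) \<le> (1 + h * K1) * err z s + K2 * h\<^sup>2"
    if s: "0 \<le> s" "0 \<le> h" "s + h \<le> T" for s h z
  proof -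
    obtain x v where z: "z = (x, v)" by (cases z)
    have hT: "h \<le> T" using s by simp
    have qi: "norm (q u - q s) \<le> A * h" if u: "u \<in> {s..s + h}" for u
    proof -
      have "norm (q u - q s - (u - s) *\<^sub>R 0) \<le> A * (u - s)"
        by (rule vector_increment_bound[OF q]) (use u s A A0 in auto)
      also have "\<dots> \<le> A * h" using u A0 by (intro mult_left_mono) auto
      finally show ?thesis by simp
    qed
    have pi: "norm (p (s + h) - p u) \<le> B * h" if u: "u \<in> {s..s + h}" for u
    proof -
      have "norm (p (s + h) - p u - (s + h - u) *\<^sub>R 0) \<le> B * (s + h - u)"
        by (rule vector_increment_bound[OF p]) (use u s B B0 in auto)
      also have "\<dots> \<le> B * h" using u B0 by (intro mult_left_mono) auto
      finally show ?thesis by simp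
    qed
    have p1: "norm (p (s + h) - p s - (s + h - s) *\<^sub>R (- F (q s))) \<le> (C * (A * h)) * (s + h - s)"
    proof (rule vector_increment_bound[OF p])
      fix u assume u: "u \<in> {s..s + h}"
      have "norm (- F (q u) - - F (q s)) = norm (F (q u) - F (q s))" by (simp add: norm_minus_commute)
      also have "\<dots> \<le> C * (A * h)" by (intro order_trans[OF lip] mult_left_mono qi u C0)
      finally show "norm (- F (q u) - - F (q s)) \<le> C * (A * h)" .
    qed (use s A0 C0 in auto)
    have q1: "norm (q (s + h) - q s - (s + h - s) *\<^sub>R p (s + h)) \<le> (B * h) * (s + h - s)"
      by (rule vector_increment_bound[OF q]) (use s B0 pi in \<open>auto simp: norm_minus_commute\<close>)
    define v' where "v' = v - h *\<^sub>R F x"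
    have ev: "norm (v' - p (s + h)) \<le> norm (v - p s) + h * (C * norm (x - q s)) + C * A * h\<^sup>2"
    proof -
      have "v' - p (s + h) = (v - p s) + h *\<^sub>R (F (q s) - F x) + - (p (s + h) - p s - (s + h - s) *\<^sub>R (- F (q s)))"
        by (simp add: v'_def algebra_simps)
      also have "norm \<dots> \<le> norm (v - p s) + h * (C * norm (x - q s)) + (C * (A * h)) * (s + h - s)"
      proof (intro norm_triangle_mono order_refl)
        have "norm (F (q s) - F x) \<le> C * norm (x - q s)" using lip[of "q s" x] by (simp add: norm_minus_commute)
        then show "norm (h *\<^sub>R (F (q s) - F x)) \<le> h * (C * norm (x - q s))" using s by (simp add: mult_left_mono)
        show "norm (- (p (s + h) - p s - (s + h - s) *\<^sub>R (- F (q s)))) \<le> (C * (A * h)) * (s + h - s)"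
          unfolding norm_minus_cancel by (rule p1)
      qed
      finally show ?thesis by (simp add: power2_eq_square mult_ac)
    qed
    have ex: "norm (x + h *\<^sub>R v' - q (s + h)) \<le> norm (x - q s) + h * norm (v' - p (s + h)) + B * h\<^sup>2"
    proof -
      have "x + h *\<^sub>R v' - q (s + h) = (x - q s) + h *\<^sub>R (v' - p (s + h)) + - (q (s + h) - q s - (s + h - s) *\<^sub>R p (s + h))"
        by (simp add: algebra_simps)
      also have "norm \<dots> \<le> norm (x - q s) + h * norm (v' - p (s + h)) + (B * h) * (s + h - s)"
        using s q1 unfolding norm_minus_cancel[of "q (s + h) - _ - _", symmetric]
        by (intro norm_triangle_mono order_refl) auto
      finally show ?thesis by (simp add: power2_eq_square mult_ac)
    qed
    have "err (symp_euler F h z) (s + h) = norm (x + h *\<^sub>R v' - q (s + h)) + norm (v' - p (s + h))"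
      by (simp add: err_def z symp_euler_def v'_def)
    also have "\<dots> \<le> norm (x - q s) + (1 + h) * norm (v' - p (s + h)) + B * h\<^sup>2" using ex by (simp add: algebra_simps)
    also have "\<dots> \<le> norm (x - q s) + (1 + h) * (norm (v - p s) + h * (C * norm (x - q s)) + C * A * h\<^sup>2) + B * h\<^sup>2"
      using s by (intro add_mono mult_left_mono ev order_refl) auto
    also have "\<dots> = norm (x - q s) + norm (v - p s) + h * norm (v - p s) + (1 + h) * (C * (h * norm (x - q s)))
        + (1 + h) * (C * A * h\<^sup>2) + B * h\<^sup>2"
      by (simp add: algebra_simps)
    also have "\<dots> \<le> norm (x - q s) + norm (v - p s) + h * (norm (x - q s) + norm (v - p s))
        + (1 + T) * (C * (h * (norm (x - q s) + norm (v - p s)))) + (1 + T) * (C * A * h\<^sup>2) + 2 * B * h\<^sup>2"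
    proof (intro add_mono order_refl)
      show "h * norm (v - p s) \<le> h * (norm (x - q s) + norm (v - p s))" using s by (intro mult_left_mono) auto
      show "(1 + h) * (C * (h * norm (x - q s))) \<le> (1 + T) * (C * (h * (norm (x - q s) + norm (v - p s))))"
        using s hT C0 by (intro mult_mono mult_nonneg_nonneg) auto
      show "(1 + h) * (C * A * h\<^sup>2) \<le> (1 + T) * (C * A * h\<^sup>2)" using hT C0 A0 by (intro mult_right_mono) auto
      show "B * h\<^sup>2 \<le> 2 * B * h\<^sup>2" using B0 by (intro mult_right_mono) auto
    qed
    also have "\<dots> = (1 + h * K1) * err z s + K2 * h\<^sup>2"
      by (simp add: err_def z K1_def K2_def algebra_simps)
    finally show ?thesis .
  qed
  have bound: "err ((symp_euler F (t / real n) ^^ n) (q 0, p 0)) t \<le> (K2 * t\<^sup>2 * exp (K1 * t)) * (1 / real n)"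
    if n: "0 < n" for n
  proof -
    define h where "h = t / real n"
    have h0: "0 \<le> h" and nh: "real n * h = t" using t n by (auto simp: h_def)
    \<comment> \<open>Each of the \<open>k\<close> local errors is charged the full amplification of
      \<open>k\<close> steps, which keeps the induction simple and is bounded by the exponential at
      the end.\<close>
    have "err ((symp_euler F h ^^ k) (q 0, p 0)) (real k * h) \<le> real k * h\<^sup>2 * K2 * (1 + h * K1) ^ k" if "k \<le> n" for k
      using that
    proof (induction k)
      case 0 then show ?case by (simp add: err_def)
    next
      case (Suc k)
      let ?z = "(symp_euler F h ^^ k) (q 0, p 0)"
      have "real (Suc k) * h \<le> real n * h" using Suc.prems h0 by (intro mult_right_mono) auto
      then have kh: "real k * h + h \<le> T" using nh t by (simp add: algebra_simps)
      have "err ((symp_euler F h ^^ Suc k) (q 0, p 0)) (real (Suc k) * h) = err (symp_euler F h ?z) (real k * h + h)"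
        by (simp add: algebra_simps)
      also have "\<dots> \<le> (1 + h * K1) * err ?z (real k * h) + K2 * h\<^sup>2"
        by (rule step) (use h0 kh in auto)
      also have "\<dots> \<le> (1 + h * K1) * (real k * h\<^sup>2 * K2 * (1 + h * K1) ^ k) + K2 * h\<^sup>2 * (1 + h * K1) ^ Suc k"
      proof (rule add_mono)
        show "(1 + h * K1) * err ?z (real k * h) \<le> (1 + h * K1) * (real k * h\<^sup>2 * K2 * (1 + h * K1) ^ k)"
          using Suc h0 K10 by (intro mult_left_mono) auto
        have "1 \<le> (1 + h * K1) ^ Suc k" using h0 K10 by (intro one_le_power) auto
        from mult_left_mono[OF this, of "K2 * h\<^sup>2"] show "K2 * h\<^sup>2 \<le> K2 * h\<^sup>2 * (1 + h * K1) ^ Suc k"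
          using K20 by simp
      qed
      also have "\<dots> = real (Suc k) * h\<^sup>2 * K2 * (1 + h * K1) ^ Suc k" by (simp add: algebra_simps)
      finally show ?case .
    qed
    from this[of n] have "err ((symp_euler F h ^^ n) (q 0, p 0)) t \<le> real n * h\<^sup>2 * K2 * (1 + h * K1) ^ n" by (simp add: nh)
    also have "\<dots> \<le> real n * h\<^sup>2 * K2 * exp (K1 * t)"
    proof (rule mult_left_mono)
      have "(1 + h * K1) ^ n \<le> exp (h * K1) ^ n" using h0 K10 by (intro power_mono exp_ge_add_one_self) auto
      also have "\<dots> = exp (K1 * t)" by (simp add: exp_of_nat_mult[symmetric] nh[symmetric] mult_ac)
      finally show "(1 + h * K1) ^ n \<le> exp (K1 * t)" .
    qed (use K20 in simp)
    also have "real n * h\<^sup>2 * K2 * exp (K1 * t) = (K2 * t\<^sup>2 * exp (K1 * t)) * (1 / real n)"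
      using n by (simp add: h_def power2_eq_square field_simps)
    finally show ?thesis by (simp add: h_def)
  qed
  show ?thesis
  proof (rule LIM_zero_cancel, rule Lim_null_comparison)
    show "\<forall>\<^sub>F n in sequentially. norm ((symp_euler F (t / real n) ^^ n) (q 0, p 0) - (q t, p t))
      \<le> (K2 * t\<^sup>2 * exp (K1 * t)) * (1 / real n)"
    proof (rule eventually_sequentiallyI[of 1])
      fix n :: nat assume "1 \<le> n"
      let ?z = "(symp_euler F (t / real n) ^^ n) (q 0, p 0)"
      have "norm (?z - (q t, p t)) \<le> norm (fst (?z - (q t, p t))) + norm (snd (?z - (q t, p t)))"
        unfolding norm_prod_def by (rule sqrt_sum_squares_le_sum) auto
      also have "\<dots> = err ?z t" by (simp add: err_def)
      also have "\<dots> \<le> (K2 * t\<^sup>2 * exp (K1 * t)) * (1 / real n)" using \<open>1 \<le> n\<close> by (intro bound) simp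
      finally show "norm (?z - (q t, p t)) \<le> (K2 * t\<^sup>2 * exp (K1 * t)) * (1 / real n)" .
    qed
    have "(\<lambda>n. (K2 * t\<^sup>2 * exp (K1 * t)) * (1 / real n)) \<longlonglongrightarrow> (K2 * t\<^sup>2 * exp (K1 * t)) * 0"
      by (intro tendsto_intros lim_1_over_n)
    then show "(\<lambda>n. (K2 * t\<^sup>2 * exp (K1 * t)) * (1 / real n)) \<longlonglongrightarrow> 0" by simp
  qed
qed

text \<open>Fatou gives one inequality, and only on open sets. Outer regularity extends it to Borel
  sets; equal total mass and complements reverse it.\<close>

lemma measure_eq_if_le_on_open:
  fixes M N :: "'a::polish_space measure"
  assumes M: "prob_space M" "sets M = sets borel" and N: "prob_space N" "sets N = sets borel"
    and le: "\<And>U. open U \<Longrightarrow> emeasure M U \<le> emeasure N U"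
  shows "M = N"
proof -
  interpret M: prob_space M by fact
  interpret N: prob_space N by fact
  have sp: "space M = UNIV" "space N = UNIV" using sets_eq_imp_space_eq[OF M(2)] sets_eq_imp_space_eq[OF N(2)] by simp_all
  have le_borel: "emeasure M B \<le> emeasure N B" if B: "B \<in> sets borel" for B
  proof -
    have "emeasure N B = (INF U \<in> {U. B \<subseteq> U \<and> open U}. emeasure N U)"
      by (rule outer_regular[OF N(2)]) (use B in auto)
    moreover have "emeasure M B \<le> (INF U \<in> {U. B \<subseteq> U \<and> open U}. emeasure N U)"
    proof (rule INF_greatest)
      fix U assume "U \<in> {U. B \<subseteq> U \<and> open U}"
      then have U: "B \<subseteq> U" "open U" by auto
      have "emeasure M B \<le> emeasure M U" by (rule emeasure_mono) (use U M(2) in auto)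
      also have "\<dots> \<le> emeasure N U" by (rule le[OF U(2)])
      finally show "emeasure M B \<le> emeasure N U" .
    qed
    ultimately show ?thesis by simp
  qed
  show ?thesis
  proof (rule measure_eqI)
    fix A assume "A \<in> sets M"
    then have A: "A \<in> sets borel" using M by simp
    have 1: "M.prob A \<le> N.prob A" using le_borel[OF A] by (simp add: M.emeasure_eq_measure N.emeasure_eq_measure)
    have "M.prob (space M - A) \<le> N.prob (space N - A)"
      using le_borel[of "- A"] A by (simp add: M.emeasure_eq_measure N.emeasure_eq_measure sp Compl_eq_Diff_UNIV[symmetric])
    then have "N.prob A \<le> M.prob A" using M.prob_compl[of A] N.prob_compl[of A] A M N by simp
    with 1 show "emeasure M A = emeasure N A" by (simp add: M.emeasure_eq_measure N.emeasure_eq_measure)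
  qed (use M N in simp)
qed

text \<open>Together with the next lemma this differentiates under the integral: the remainder bound
  depends on the integrand only through the Lipschitz constant of its gradient, so it survives
  integration over a parameter.\<close>

lemma first_order_remainder:
  fixes f :: "'a::euclidean_space \<Rightarrow> real"
  assumes f: "\<And>y. (f has_derivative (\<lambda>h. G y \<bullet> h)) (at y)"
    and lip: "\<And>y. norm (G y - G x) \<le> C * norm (y - x)" and C: "0 \<le> C"
  shows "\<bar>f y - f x - G x \<bullet> (y - x)\<bar> \<le> C * (norm (y - x))\<^sup>2"
proof -
  let ?\<phi> = "\<lambda>y. f y - G x \<bullet> y"
  have "norm (?\<phi> y - ?\<phi> x) \<le> (C * norm (y - x)) * norm (y - x)"
  proof (rule differentiable_bound[of "cball x (norm (y - x))" ?\<phi> "\<lambda>y h. G y \<bullet> h - G x \<bullet> h"])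
    fix w assume w: "w \<in> cball x (norm (y - x))"
    show "(?\<phi> has_derivative (\<lambda>h. G w \<bullet> h - G x \<bullet> h)) (at w within cball x (norm (y - x)))"
      by (rule has_derivative_at_withinI) (auto intro!: derivative_eq_intros f)
    show "onorm (\<lambda>h. G w \<bullet> h - G x \<bullet> h) \<le> C * norm (y - x)"
    proof (rule onorm_bound)
      fix h
      have "norm (G w \<bullet> h - G x \<bullet> h) = \<bar>(G w - G x) \<bullet> h\<bar>" by (simp add: inner_diff_left)
      also have "\<dots> \<le> norm (G w - G x) * norm h" by (rule Cauchy_Schwarz_ineq2)
      also have "\<dots> \<le> (C * norm (y - x)) * norm h"
        using w by (intro mult_right_mono order_trans[OF lip] mult_left_mono C) (auto simp: dist_norm norm_minus_commute)
      finally show "norm (G w \<bullet> h - G x \<bullet> h) \<le> C * norm (y - x) * norm h" .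
    qed (use C in simp)
  qed (auto simp: dist_norm norm_minus_commute)
  then show ?thesis by (simp add: inner_diff_right power2_eq_square algebra_simps)
qed

lemma has_derivative_of_quadratic_remainder:
  fixes f :: "'a::euclidean_space \<Rightarrow> real"
  assumes "\<And>y. \<bar>f y - f x - v \<bullet> (y - x)\<bar> \<le> C * (norm (y - x))\<^sup>2"
  shows "(f has_derivative (\<lambda>h. v \<bullet> h)) (at x)"
  unfolding has_derivative_iff_norm
proof (intro conjI bounded_linear_inner_right)
  show "((\<lambda>y. norm (f y - f x - v \<bullet> (y - x)) / norm (y - x)) \<longlongrightarrow> 0) (at x)"
  proof (rule Lim_null_comparison[where g="\<lambda>y. C * norm (y - x)", OF always_eventually])
    show "\<forall>y. norm (norm (f y - f x - v \<bullet> (y - x)) / norm (y - x)) \<le> C * norm (y - x)"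
    proof
      fix y
      show "norm (norm (f y - f x - v \<bullet> (y - x)) / norm (y - x)) \<le> C * norm (y - x)"
      proof (cases "y = x")
        case False
        then show ?thesis using assms[of y] by (simp add: divide_le_eq power2_eq_square mult.assoc)
      qed simp
    qed
    have "((\<lambda>y. C * norm (y - x)) \<longlongrightarrow> C * norm (x - x)) (at x)" by (intro tendsto_intros)
    then show "((\<lambda>y. C * norm (y - x)) \<longlongrightarrow> 0) (at x)" by simp
  qed
qed

section \<open>Potential, energy and invariance of the equilibrium\<close>

context hmc_setting begin

context
  fixes \<mu> :: "'a measure" and Z :: real
  assumes \<mu>: "fin_second_moment \<mu>" and Z: "0 < Z"
    and dens: "\<mu> = density lborel (\<lambda>x. ennreal (exp (- U_nu V W \<epsilon> \<mu> x) / Z))"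
begin

definition F :: "'a \<Rightarrow> 'a" where "F q = b q + (\<integral>u. g q u \<partial>\<mu>)"

lemma \<mu>_prob: "prob_space \<mu>" and \<mu>_sets: "sets \<mu> = sets borel" and \<mu>_int2: "integrable \<mu> (\<lambda>x. (norm x)\<^sup>2)"
  using \<mu> by (auto simp: fin_second_moment_def)

lemma \<mu>_int1: "integrable \<mu> norm"
proof -
  interpret prob_space \<mu> by (rule \<mu>_prob)
  note \<mu>_sets[measurable_cong]
  show ?thesis
  proof (rule Bochner_Integration.integrable_bound)
    show "integrable \<mu> (\<lambda>x. 1 + (norm x)\<^sup>2)" using \<mu>_int2 by simp
    show "AE x in \<mu>. norm (norm x) \<le> norm (1 + (norm x)\<^sup>2)"
    proof (rule AE_I2)
      fix x :: 'a
      have "0 \<le> (norm x - 1/2)\<^sup>2" by simp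
      then have "norm x \<le> 1 + (norm x)\<^sup>2" by (simp add: power2_eq_square algebra_simps)
      then show "norm (norm x) \<le> norm (1 + (norm x)\<^sup>2)" by simp
    qed
  qed measurable
qed

lemma F_lip: "norm (F x - F y) \<le> (L + l) * norm (x - y)"
proof -
  interpret prob_space \<mu> by (rule \<mu>_prob)
  have "norm (F x - F y) = norm ((b x - b y) + ((\<integral>u. g x u \<partial>\<mu>) - (\<integral>u. g y u \<partial>\<mu>)))"
    by (simp add: F_def algebra_simps)
  also have "\<dots> \<le> L * norm (x - y) + l * norm (x - y)"
    by (intro norm_triangle_mono drift.b_lip mf.g_integral_lip) (simp_all add: emeasure_space_1 \<mu>_sets)
  finally show ?thesis by (simp add: algebra_simps)
qed

lemma W_derivative: "((\<lambda>x. W x u) has_derivative (\<lambda>h. grad1 W x u \<bullet> h)) (at x)"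
  by (rule grad1_derivative[OF W_diff W_sym])

lemma W_continuous: "continuous_on UNIV (\<lambda>z. W (fst z) (snd z))"
  using W_diff by (intro differentiable_imp_continuous_on) (auto simp: differentiable_on_def intro: differentiable_at_withinI)

text \<open>A Lipschitz gradient makes \<open>W\<close> grow at most quadratically, which the finite
  second moment compensates. By symmetry the expansion can be made in the argument that is
  integrated.\<close>

lemma W_integrable: "integrable \<mu> (\<lambda>u. W x u)"
proof -
  interpret prob_space \<mu> by (rule \<mu>_prob)
  note \<mu>_sets[measurable_cong]
  have c: "continuous_on UNIV (\<lambda>u. W x u)"
    using continuous_on_compose2[OF W_continuous, of UNIV "\<lambda>u. (x, u)"] by (simp add: continuous_intros)
  have m[measurable]: "(\<lambda>u. W x u) \<in> borel_measurable borel" by (rule borel_measurable_continuous_onI[OF c])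
  show ?thesis
  proof (rule Bochner_Integration.integrable_bound)
    show "integrable \<mu> (\<lambda>u. \<bar>W 0 x\<bar> + norm (grad1 W 0 x) * norm u + Lt * (norm u)\<^sup>2)"
      using \<mu>_int1 \<mu>_int2 by simp
    show "AE u in \<mu>. norm (W x u) \<le> norm (\<bar>W 0 x\<bar> + norm (grad1 W 0 x) * norm u + Lt * (norm u)\<^sup>2)"
    proof (rule AE_I2)
      fix u
      have "\<bar>W u x - W 0 x - grad1 W 0 x \<bullet> (u - 0)\<bar> \<le> Lt * (norm (u - 0))\<^sup>2"
        by (rule first_order_remainder[OF W_derivative _ Lt_nn]) (use W_Lip[of _ x 0 x] in simp)
      moreover have "\<bar>grad1 W 0 x \<bullet> u\<bar> \<le> norm (grad1 W 0 x) * norm u" by (rule Cauchy_Schwarz_ineq2)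
      ultimately have "\<bar>W u x\<bar> \<le> \<bar>W 0 x\<bar> + norm (grad1 W 0 x) * norm u + Lt * (norm u)\<^sup>2" by simp
      then show "norm (W x u) \<le> norm (\<bar>W 0 x\<bar> + norm (grad1 W 0 x) * norm u + Lt * (norm u)\<^sup>2)"
        using W_sym[of x u] by simp
    qed
  qed measurable
qed

lemma grad1_integrable: "integrable \<mu> (\<lambda>u. grad1 W x u)"
proof -
  interpret prob_space \<mu> by (rule \<mu>_prob)
  note \<mu>_sets[measurable_cong]
  have c: "continuous_on UNIV (\<lambda>u. grad1 W x u)"
    by (rule lipschitz_on_continuous_on[of Lt]) (use W_Lip[of x _ x] Lt_nn in \<open>auto simp: lipschitz_on_def dist_norm\<close>)
  have m[measurable]: "(\<lambda>u. grad1 W x u) \<in> borel_measurable borel" by (rule borel_measurable_continuous_onI[OF c])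
  show ?thesis
  proof (rule Bochner_Integration.integrable_bound)
    show "integrable \<mu> (\<lambda>u. norm (grad1 W x 0) + Lt * norm u)" using \<mu>_int1 by simp
    show "AE u in \<mu>. norm (grad1 W x u) \<le> norm (norm (grad1 W x 0) + Lt * norm u)"
    proof (rule AE_I2)
      fix u
      have "norm (grad1 W x u) \<le> norm (grad1 W x 0) + norm (grad1 W x u - grad1 W x 0)" by (metis norm_triangle_sub)
      then show "norm (grad1 W x u) \<le> norm (norm (grad1 W x 0) + Lt * norm u)"
        using W_Lip[of x u x 0] by simp
    qed
  qed measurable
qed

definition U :: "'a \<Rightarrow> real" where "U = U_nu V W \<epsilon> \<mu>"

lemma U_derivative: "(U has_derivative (\<lambda>h. F x \<bullet> h)) (at x)"
proof -
  interpret prob_space \<mu> by (rule \<mu>_prob)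
  let ?w = "\<lambda>x. \<integral>u. W x u \<partial>\<mu>" and ?v = "\<integral>u. grad1 W x u \<partial>\<mu>"
  have w: "(?w has_derivative (\<lambda>h. ?v \<bullet> h)) (at x)"
  proof (rule has_derivative_of_quadratic_remainder)
    fix y
    have "?v \<bullet> (y - x) = (\<integral>u. grad1 W x u \<bullet> (y - x) \<partial>\<mu>)"
      by (rule integral_inner_left[symmetric]) (rule grad1_integrable)
    then have eq: "?w y - ?w x - ?v \<bullet> (y - x) = (\<integral>u. W y u - W x u - grad1 W x u \<bullet> (y - x) \<partial>\<mu>)"
      using W_integrable grad1_integrable by simp
    have "\<bar>?w y - ?w x - ?v \<bullet> (y - x)\<bar> \<le> (\<integral>u. \<bar>W y u - W x u - grad1 W x u \<bullet> (y - x)\<bar> \<partial>\<mu>)"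
      unfolding eq by (rule integral_abs_bound)
    also have "\<dots> \<le> (\<integral>u. Lt * (norm (y - x))\<^sup>2 \<partial>\<mu>)"
    proof (rule integral_mono)
      fix u
      show "\<bar>W y u - W x u - grad1 W x u \<bullet> (y - x)\<bar> \<le> Lt * (norm (y - x))\<^sup>2"
        by (rule first_order_remainder[OF W_derivative _ Lt_nn]) (use W_Lip[of _ u x u] in simp)
    qed (use W_integrable grad1_integrable in auto)
    finally show "\<bar>?w y - ?w x - ?v \<bullet> (y - x)\<bar> \<le> Lt * (norm (y - x))\<^sup>2" by (simp add: prob_space)
  qed
  have v: "(V has_derivative (\<lambda>h. b x \<bullet> h)) (at x)" unfolding b_def by (rule grad_has_derivative[OF V_diff])
  have "F x = b x + \<epsilon> *\<^sub>R ?v" unfolding F_def g_def by simp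
  then have "(\<lambda>h. F x \<bullet> h) = (\<lambda>h. b x \<bullet> h + \<epsilon> * (?v \<bullet> h))" by (simp add: inner_add_left)
  moreover have "U = (\<lambda>x. V x + \<epsilon> * ?w x)" by (simp add: U_def U_nu_def fun_eq_iff)
  ultimately show ?thesis by (simp only:) (intro has_derivative_add v has_derivative_mult_right w)
qed

lemma energy_conservation:
  assumes q: "\<And>u. u \<in> {0..T} \<Longrightarrow> (q has_vector_derivative p u) (at u within {0..T})"
    and p: "\<And>u. u \<in> {0..T} \<Longrightarrow> (p has_vector_derivative - F (q u)) (at u within {0..T})"
    and t: "t \<in> {0..T}"
  shows "U (q t) + (norm (p t))\<^sup>2 / 2 = U (q 0) + (norm (p 0))\<^sup>2 / 2"
proof -
  let ?E = "\<lambda>t. U (q t) + 1/2 * (p t \<bullet> p t)"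
  have "\<exists>c. \<forall>u\<in>{0..T}. ?E u = c"
  proof (rule has_derivative_zero_constant)
    fix u assume u: "u \<in> {0..T}"
    have q': "(q has_derivative (\<lambda>h. h *\<^sub>R p u)) (at u within {0..T})"
      using q[OF u] by (simp add: has_vector_derivative_def)
    have p': "(p has_derivative (\<lambda>h. h *\<^sub>R (- F (q u)))) (at u within {0..T})"
      using p[OF u] by (simp add: has_vector_derivative_def)
    have "((\<lambda>u. U (q u)) has_derivative (\<lambda>h. F (q u) \<bullet> (h *\<^sub>R p u))) (at u within {0..T})"
      using has_derivative_compose[OF q' U_derivative] .
    moreover have "((\<lambda>u. p u \<bullet> p u) has_derivative (\<lambda>h. p u \<bullet> (h *\<^sub>R (- F (q u))) + (h *\<^sub>R (- F (q u))) \<bullet> p u)) (at u within {0..T})"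
      by (rule has_derivative_inner[OF p' p'])
    ultimately have "(?E has_derivative (\<lambda>h. F (q u) \<bullet> (h *\<^sub>R p u) + 1/2 * (p u \<bullet> (h *\<^sub>R (- F (q u))) + (h *\<^sub>R (- F (q u))) \<bullet> p u))) (at u within {0..T})"
      by (intro has_derivative_add has_derivative_mult_right)
    then show "(?E has_derivative (\<lambda>h. 0)) (at u within {0..T})"
      by (simp add: inner_commute)
  qed simp
  moreover have "0 \<in> {0..T}" using t by simp
  ultimately have "?E t = ?E 0" using t by metis
  then show ?thesis by (simp add: power2_norm_eq_inner)
qed

definition phase_dens :: "'a \<times> 'a \<Rightarrow> real" where
  "phase_dens z = exp (- U (fst z)) / Z * gauss_dens (snd z)"

lemma phase_dens_continuous: "continuous_on UNIV phase_dens"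
proof -
  have "continuous_on UNIV U"
    by (rule has_derivative_continuous_on[of UNIV]) (rule has_derivative_at_withinI, rule U_derivative)
  then have "continuous_on UNIV (\<lambda>z :: 'a \<times> 'a. U (fst z))"
    by (rule continuous_on_compose2) (auto intro: continuous_intros)
  then show ?thesis unfolding phase_dens_def gauss_dens_def using Z by (intro continuous_intros) auto
qed

lemma phase_dens_measurable: "phase_dens \<in> borel_measurable (borel \<Otimes>\<^sub>M borel)"
  using borel_measurable_continuous_onI[OF phase_dens_continuous] by (simp add: borel_prod)

lemma phase_measure: "\<mu> \<Otimes>\<^sub>M std_gauss = density (lborel \<Otimes>\<^sub>M lborel) (\<lambda>z. ennreal (phase_dens z))"
proof -
  have Um[measurable]: "U \<in> borel_measurable borel"
    by (rule borel_measurable_continuous_onI, rule has_derivative_continuous_on[of UNIV])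
      (rule has_derivative_at_withinI, rule U_derivative)
  have \<mu>d: "\<mu> = density lborel (\<lambda>x. ennreal (exp (- U x) / Z))" using dens by (simp add: U_def)
  have "\<mu> \<Otimes>\<^sub>M std_gauss = density lborel (\<lambda>x. ennreal (exp (- U x) / Z)) \<Otimes>\<^sub>M density lborel (\<lambda>v::'a. ennreal (gauss_dens v))"
    by (rule arg_cong2[where f=pair_measure, OF \<mu>d std_gauss_density])
  also have "\<dots> = density (lborel \<Otimes>\<^sub>M lborel) (\<lambda>(x, v). ennreal (exp (- U x) / Z) * ennreal (gauss_dens v))"
  proof (rule pair_measure_density)
    show "sigma_finite_measure (density lborel (\<lambda>v::'a. ennreal (gauss_dens v)))"
      using prob_space_imp_sigma_finite[OF prob_space_std_gauss] by (simp add: std_gauss_density)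
  qed (auto intro: lborel.sigma_finite_measure_axioms)
  also have "\<dots> = density (lborel \<Otimes>\<^sub>M lborel) (\<lambda>z. ennreal (phase_dens z))"
    using Z by (intro arg_cong2[where f=density] refl)
      (auto simp: phase_dens_def ennreal_mult[symmetric] gauss_dens_nonneg)
  finally show ?thesis .
qed

text \<open>The flow depends on its own law, so invariance cannot be checked directly. With the law
  frozen at \<open>\<mu>\<close>, the flow is Hamiltonian with potential \<open>U\<close> and keeps
  the position law equal to \<open>\<mu>\<close>; therefore it solves the self-consistent equation,
  and uniqueness identifies it with the nonlinear flow.\<close>

lemma nl_step_invariant: "nl_step V W \<epsilon> T \<mu> = \<mu>"
proof -
  interpret \<mu>: prob_space \<mu> by (rule \<mu>_prob)
  have Fm: "F \<in> borel_measurable borel"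
  proof (rule borel_measurable_continuous_onI, rule lipschitz_on_continuous_on)
    show "(L + l)-lipschitz_on UNIV F"
      using F_lip L_pos l_nonneg by (auto simp: lipschitz_on_def dist_norm)
  qed
  have mfi: "mean_field_init b g L l T (\<mu> \<Otimes>\<^sub>M std_gauss)" by (rule mean_field_init_pair[OF \<mu>])
  have "mean_field F (\<lambda>_ _. 0) (L + l) 0 T"
  proof
    have "(L + l) * T\<^sup>2 \<le> (L + 3 * l) * T\<^sup>2" using l_nonneg by (intro mult_right_mono) auto
    then show "(L + l + 3 * 0) * T\<^sup>2 \<le> 1/2" using mf.small by simp
  qed (use F_lip L_pos l_nonneg T_pos in auto)
  then have fi: "mean_field_init F (\<lambda>_ _. 0) (L + l) 0 T (\<mu> \<Otimes>\<^sub>M std_gauss)"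
    using mfi by (simp add: mean_field_init_def)
  obtain Q p m where S: "mf_sol F (\<lambda>_ _. 0) T (\<mu> \<Otimes>\<^sub>M std_gauss) Q p m"
    and Qc: "continuous_on UNIV (\<lambda>z. Q (fst z) (fst (snd z)) (snd (snd z)))"
    using mean_field_init.mf_sol_exists[OF fi] by blast
  have init: "Q 0 x v = x" "p 0 x v = v" for x v using mean_field_init.mf_sol_init[OF fi S] by auto
  have Qd: "((\<lambda>s. Q s x v) has_vector_derivative p t x v) (at t within {0..T})"
    and pd: "((\<lambda>s. p s x v) has_vector_derivative - F (Q t x v)) (at t within {0..T})" if "t \<in> {0..T}" for t x v
    using mean_field_init.mf_sol_deriv[OF fi S that] mean_field_init.mf_sol_deriv2[OF fi S that] by auto
  \<comment> \<open>Every time in the interval is needed, not only the end, because the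
    self-consistent equation uses the law at all times.\<close>
  have law: "distr (\<mu> \<Otimes>\<^sub>M std_gauss) borel (\<lambda>(x, v). Q t x v) = \<mu>" if t: "t \<in> {0..T}" for t
  proof (rule measure_eq_if_le_on_open[OF _ _ \<mu>_prob \<mu>_sets])
    have Qm0: "(\<lambda>z. Q t (fst z) (snd z)) \<in> borel_measurable (borel \<Otimes>\<^sub>M borel)"
    proof -
      have "continuous_on UNIV (\<lambda>z :: 'a \<times> 'a. Q t (fst z) (snd z))"
        using continuous_on_compose2[OF Qc, of UNIV "\<lambda>z. (t, z)"] by (simp add: continuous_intros)
      from borel_measurable_continuous_onI[OF this] show ?thesis by (simp add: borel_prod)
    qed
    then have Qm: "(\<lambda>(x, v). Q t x v) \<in> borel_measurable (\<mu> \<Otimes>\<^sub>M std_gauss)"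
      unfolding case_prod_beta'
      by (subst measurable_cong_sets[OF sets_pair_measure_cong[OF \<mu>_sets sets_std_gauss] refl])
    show "prob_space (distr (\<mu> \<Otimes>\<^sub>M std_gauss) borel (\<lambda>(x, v). Q t x v))"
      by (rule prob_space.prob_space_distr[OF _ Qm]) (intro prob_space_pair \<mu>_prob prob_space_std_gauss)
    fix O' :: "'a set" assume O: "open O'"
    define \<psi> where "\<psi> z = indicator O' (fst z) * ennreal (phase_dens z)" for z :: "'a \<times> 'a"
    have Om: "(\<lambda>z :: 'a \<times> 'a. indicator O' (fst z) :: ennreal) \<in> borel_measurable (borel \<Otimes>\<^sub>M borel)"
      using measurable_compose[OF measurable_fst, of "indicator O'" borel borel "borel :: 'a measure"] borel_open[OF O] by measurable
    have \<psi>m: "\<psi> \<in> borel_measurable (borel \<Otimes>\<^sub>M borel)"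
      unfolding \<psi>_def by (intro borel_measurable_times_ennreal Om measurable_compose[OF phase_dens_measurable measurable_ennreal])
    have sL: "sets (lborel \<Otimes>\<^sub>M lborel) = sets (borel \<Otimes>\<^sub>M (borel :: 'a measure) :: ('a \<times> 'a) measure)"
      by (rule sets_pair_measure_cong) auto
    have sM: "measurable (lborel \<Otimes>\<^sub>M lborel) borel = measurable (borel \<Otimes>\<^sub>M (borel :: 'a measure) :: ('a \<times> 'a) measure) (borel :: ennreal measure)"
      by (rule measurable_cong_sets[OF sL refl])
    have pdm: "(\<lambda>z. ennreal (phase_dens z)) \<in> borel_measurable (lborel \<Otimes>\<^sub>M (lborel :: 'a measure))"
      unfolding sM by (rule measurable_compose[OF phase_dens_measurable measurable_ennreal])
    define S' where "S' n = symp_euler F (t / real n) ^^ n" for n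
    have S'm: "S' n \<in> measurable (borel \<Otimes>\<^sub>M borel) (borel \<Otimes>\<^sub>M borel)" for n
      unfolding S'_def by (rule symp_euler_pow_measurable[OF Fm])
    \<comment> \<open>The indicator of an open set is lower semicontinuous: if the limit lies in
      \<open>O'\<close>, the approximations do so eventually. Energy conservation identifies the
      limiting density with the initial one.\<close>
    have pt: "indicator O' (Q t (fst z) (snd z)) * ennreal (phase_dens z) \<le> liminf (\<lambda>n. \<psi> (S' n z))" for z
    proof (cases "Q t (fst z) (snd z) \<in> O'")
      case True
      obtain x v where z: "z = (x, v)" by (cases z)
      have lim: "(\<lambda>n. S' n z) \<longlonglongrightarrow> (Q t x v, p t x v)"
        using symp_euler_converges[OF F_lip _ Qd pd t, of x v] L_pos l_nonneg by (simp add: S'_def z init)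
      have "\<forall>\<^sub>F n in sequentially. fst (S' n z) \<in> O'"
        using topological_tendstoD[OF tendsto_fst[OF lim] O] True by (simp add: z)
      then have ev: "\<forall>\<^sub>F n in sequentially. \<psi> (S' n z) = ennreal (phase_dens (S' n z))"
        by eventually_elim (simp add: \<psi>_def)
      have "(\<lambda>n. phase_dens (S' n z)) \<longlonglongrightarrow> phase_dens (Q t x v, p t x v)"
        using continuous_on_tendsto_compose[OF phase_dens_continuous lim] by simp
      then have "(\<lambda>n. ennreal (phase_dens (S' n z))) \<longlonglongrightarrow> ennreal (phase_dens (Q t x v, p t x v))"
        by (rule tendsto_ennrealI)
      then have "(\<lambda>n. \<psi> (S' n z)) \<longlonglongrightarrow> ennreal (phase_dens (Q t x v, p t x v))"
        using ev by (simp add: tendsto_cong)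
      then have "liminf (\<lambda>n. \<psi> (S' n z)) = ennreal (phase_dens (Q t x v, p t x v))"
        by (intro lim_imp_Liminf) auto
      moreover have "phase_dens (Q t x v, p t x v) = phase_dens z"
      proof -
        have e: "phase_dens (y, w) = (2 * pi) powr (- real DIM('a) / 2) / Z * exp (- (U y + (norm w)\<^sup>2 / 2))" for y w
        proof -
          have "exp (- (U y + (norm w)\<^sup>2 / 2)) = exp (- U y) * exp (- (norm w)\<^sup>2 / 2)"
            by (simp add: exp_add[symmetric])
          then show ?thesis by (simp add: phase_dens_def gauss_dens_def)
        qed
        have "U (Q t x v) + (norm (p t x v))\<^sup>2 / 2 = U x + (norm v)\<^sup>2 / 2"
          using energy_conservation[OF Qd pd t, of x v] by (simp add: init)
        then show ?thesis unfolding z e by simp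
      qed
      ultimately show ?thesis using True by simp
    qed simp
    have "emeasure (distr (\<mu> \<Otimes>\<^sub>M std_gauss) borel (\<lambda>(x, v). Q t x v)) O'
      = (\<integral>\<^sup>+z. indicator O' (Q t (fst z) (snd z)) \<partial>(\<mu> \<Otimes>\<^sub>M std_gauss))"
      using borel_open[OF O] by (subst nn_integral_indicator[symmetric], simp, subst nn_integral_distr[OF Qm]) (auto simp: case_prod_beta')
    also have "\<dots> = (\<integral>\<^sup>+z. indicator O' (Q t (fst z) (snd z)) * ennreal (phase_dens z) \<partial>(lborel \<Otimes>\<^sub>M lborel))"
    proof -
      have "(\<lambda>z. indicator O' (Q t (fst z) (snd z)) :: ennreal) \<in> borel_measurable (lborel \<Otimes>\<^sub>M lborel)"
        unfolding sM using measurable_compose[OF Qm0, of "indicator O'" borel] borel_open[OF O] by measurable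
      from nn_integral_density[OF pdm this] show ?thesis
        unfolding phase_measure by (simp add: mult.commute)
    qed
    also have "\<dots> \<le> (\<integral>\<^sup>+z. liminf (\<lambda>n. \<psi> (S' n z)) \<partial>(lborel \<Otimes>\<^sub>M lborel))"
      by (rule nn_integral_mono) (rule pt)
    also have "\<dots> \<le> liminf (\<lambda>n. \<integral>\<^sup>+z. \<psi> (S' n z) \<partial>(lborel \<Otimes>\<^sub>M lborel))"
      by (rule nn_integral_liminf) (unfold sM, rule measurable_compose[OF S'm \<psi>m])
    also have "\<dots> = liminf (\<lambda>n::nat. \<integral>\<^sup>+z. \<psi> z \<partial>(lborel \<Otimes>\<^sub>M lborel))"
      unfolding S'_def by (simp only: nn_integral_symp_euler_pow[OF Fm \<psi>m])
    also have "\<dots> = (\<integral>\<^sup>+z. \<psi> z \<partial>(lborel \<Otimes>\<^sub>M lborel))" by (simp add: Liminf_const)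
    also have "\<dots> = (\<integral>\<^sup>+z. indicator O' (fst z) \<partial>(\<mu> \<Otimes>\<^sub>M (std_gauss :: 'a measure)))"
    proof -
      have "(\<lambda>z :: 'a \<times> 'a. indicator O' (fst z) :: ennreal) \<in> borel_measurable (lborel \<Otimes>\<^sub>M lborel)"
        unfolding sM by (rule Om)
      from nn_integral_density[OF pdm this] show ?thesis
        unfolding phase_measure \<psi>_def by (simp add: mult.commute)
    qed
    also have "\<dots> = emeasure (distr (\<mu> \<Otimes>\<^sub>M (std_gauss :: 'a measure)) \<mu> fst) O'"
      using borel_open[OF O] \<mu>_sets by (subst nn_integral_indicator[symmetric], simp, subst nn_integral_distr) auto
    also have "distr (\<mu> \<Otimes>\<^sub>M (std_gauss :: 'a measure)) \<mu> fst = \<mu>"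
      by (rule prob_space.distr_pair_fst[OF prob_space_std_gauss])
    finally show "emeasure (distr (\<mu> \<Otimes>\<^sub>M std_gauss) borel (\<lambda>(x, v). Q t x v)) O' \<le> emeasure \<mu> O'" .
  qed simp
  have S2: "mf_sol b g T (\<mu> \<Otimes>\<^sub>M std_gauss) Q p (\<lambda>_. \<mu>)"
    unfolding mf_sol_def
    using init Qd pd law by (auto simp: F_def)
  obtain p' m' where S3: "mf_sol b g T (\<mu> \<Otimes>\<^sub>M std_gauss) (nlQ \<mu>) p' m'" using nlQ_sol[OF \<mu>] by blast
  have T: "T \<in> {0..T}" using T_pos by simp
  have "m' T = \<mu>" using mean_field_init.mf_sol_law_unique[OF mfi S3 S2 T] .
  then show ?thesis
    using nl_step_eq[OF \<mu>] mean_field_init.mf_sol_law[OF mfi S3 T] by (simp add: nlaw_def)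
qed

end

end

section \<open>Couplings and Wasserstein distances\<close>

lemma INF_affine_ennreal:
  fixes f :: "'b \<Rightarrow> ennreal"
  assumes A: "\<And>x. x \<in> S \<Longrightarrow> a \<le> c * f x + k" and ne: "S \<noteq> {}" and c: "c \<noteq> \<top>"
  shows "a \<le> c * (INF x\<in>S. f x) + k"
proof -
  \<comment> \<open>An optimal coupling may not be at hand, so the bound is passed to the limit
    along a minimizing sequence; multiplication by a finite constant is continuous.\<close>
  obtain h :: "nat \<Rightarrow> ennreal" where h: "decseq h" "range h \<subseteq> f ` S" "(INF x\<in>S. f x) = (INF i. h i)"
    using ennreal_Inf_countable_INF[of "f ` S"] ne by auto
  have "h \<longlonglongrightarrow> (INF x\<in>S. f x)" unfolding h(3) by (rule LIMSEQ_INF[OF h(1)])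
  then have "(\<lambda>n. c * h n + k) \<longlonglongrightarrow> c * (INF x\<in>S. f x) + k"
    using c by (intro tendsto_add ennreal_tendsto_cmult tendsto_const) (auto simp: less_top)
  moreover have "a \<le> c * h n + k" for n
    using h(2) A by (metis image_iff range_subsetD)
  ultimately show ?thesis by (intro LIMSEQ_le_const) auto
qed

lemma coupling_swap:
  assumes c: "coupling M M' \<gamma>"
  shows "coupling M' M (distr \<gamma> (M' \<Otimes>\<^sub>M M) (\<lambda>z. (snd z, fst z)))"
proof -
  interpret \<gamma>: prob_space \<gamma> using c by (simp add: coupling_def)
  have s: "sets \<gamma> = sets (M \<Otimes>\<^sub>M M')" using c by (simp add: coupling_def)
  have m: "(\<lambda>z. (snd z, fst z)) \<in> measurable \<gamma> (M' \<Otimes>\<^sub>M M)"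
    by (subst measurable_cong_sets[OF s refl]) simp
  show ?thesis
    unfolding coupling_def
  proof (intro conjI)
    show "prob_space (distr \<gamma> (M' \<Otimes>\<^sub>M M) (\<lambda>z. (snd z, fst z)))" by (rule \<gamma>.prob_space_distr[OF m])
    show "distr (distr \<gamma> (M' \<Otimes>\<^sub>M M) (\<lambda>z. (snd z, fst z))) M' fst = M'"
      by (subst distr_distr[OF measurable_fst m]) (use c in \<open>simp add: comp_def coupling_def\<close>)
    show "distr (distr \<gamma> (M' \<Otimes>\<^sub>M M) (\<lambda>z. (snd z, fst z))) M snd = M"
      by (subst distr_distr[OF measurable_snd m]) (use c in \<open>simp add: comp_def coupling_def\<close>)
  qed simp
qed

text \<open>The equilibrium estimates list the two measures in the opposite order, so distances are
  exchanged on both sides of the inequality.\<close>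

lemma W1_le_swap:
  assumes sym: "\<And>x y. d x y = d y x" and m: "(\<lambda>z. ennreal (d (fst z) (snd z))) \<in> borel_measurable (M \<Otimes>\<^sub>M M')"
  shows "W1 d M M' \<le> W1 d M' M"
  unfolding W1_def
proof (rule INF_greatest)
  fix \<gamma> assume "\<gamma> \<in> {\<gamma>. coupling M' M \<gamma>}"
  then have c: "coupling M' M \<gamma>" by simp
  have s: "sets \<gamma> = sets (M' \<Otimes>\<^sub>M M)" using c by (simp add: coupling_def)
  have m': "(\<lambda>z. (snd z, fst z)) \<in> measurable \<gamma> (M \<Otimes>\<^sub>M M')"
    by (subst measurable_cong_sets[OF s refl]) simp
  have "(INF \<gamma>\<in>{\<gamma>. coupling M M' \<gamma>}. \<integral>\<^sup>+z. ennreal (d (fst z) (snd z)) \<partial>\<gamma>)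
    \<le> (\<integral>\<^sup>+z. ennreal (d (fst z) (snd z)) \<partial>distr \<gamma> (M \<Otimes>\<^sub>M M') (\<lambda>z. (snd z, fst z)))"
    by (rule INF_lower) (use coupling_swap[OF c] in simp)
  also have "\<dots> = (\<integral>\<^sup>+z. ennreal (d (snd z) (fst z)) \<partial>\<gamma>)"
    using m by (subst nn_integral_distr[OF m']) auto
  finally show "(INF \<gamma>\<in>{\<gamma>. coupling M M' \<gamma>}. \<integral>\<^sup>+z. ennreal (d (fst z) (snd z)) \<partial>\<gamma>)
    \<le> (\<integral>\<^sup>+z. ennreal (d (fst z) (snd z)) \<partial>\<gamma>)" by (simp add: sym[of "snd _"])
qed

lemma coupling_product: "prob_space M \<Longrightarrow> prob_space M' \<Longrightarrow> coupling M M' (M \<Otimes>\<^sub>M M')"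
  unfolding coupling_def by (auto intro: prob_space_pair distr_pair_snd prob_space.distr_pair_fst)

text \<open>Independent copies of one coupling: the starting point of the chain, with expected
  averaged cost equal to the cost of a single copy.\<close>

lemma coupling_prodN:
  assumes c: "coupling \<mu> \<nu> \<gamma>"
  shows "coupling (prodN N \<mu>) (prodN N \<nu>)
    (distr (prodN N \<gamma>) (prodN N \<mu> \<Otimes>\<^sub>M prodN N \<nu>) (\<lambda>u. (\<lambda>i\<in>{..<N}. fst (u i), \<lambda>i\<in>{..<N}. snd (u i))))"
    "(\<lambda>u. (\<lambda>i\<in>{..<N}. fst (u i), \<lambda>i\<in>{..<N}. snd (u i))) \<in> measurable (prodN N \<gamma>) (prodN N \<mu> \<Otimes>\<^sub>M prodN N \<nu>)"
proof -
  have g: "prob_space \<gamma>" and s: "sets \<gamma> = sets (\<mu> \<Otimes>\<^sub>M \<nu>)" and d1: "distr \<gamma> \<mu> fst = \<mu>" and d2: "distr \<gamma> \<nu> snd = \<nu>"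
    using c by (auto simp: coupling_def)
  interpret g: prob_space \<gamma> by fact
  have f: "fst \<in> measurable \<gamma> \<mu>" "snd \<in> measurable \<gamma> \<nu>" by (auto simp: measurable_cong_sets[OF s refl])
  have p: "prob_space \<mu>" "prob_space \<nu>" using g.prob_space_distr[OF f(1)] g.prob_space_distr[OF f(2)] d1 d2 by auto
  interpret G: prob_space "prodN N \<gamma>" by (rule prob_space_prodN[OF g])
  have m1: "(\<lambda>u. \<lambda>i\<in>{..<N}. fst (u i)) \<in> measurable (prodN N \<gamma>) (prodN N \<mu>)"
    and m2: "(\<lambda>u. \<lambda>i\<in>{..<N}. snd (u i)) \<in> measurable (prodN N \<gamma>) (prodN N \<nu>)"
    unfolding prodN_def by (intro measurable_restrict measurable_compose[OF measurable_component_singleton] f, simp)+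
  show m: "(\<lambda>u. (\<lambda>i\<in>{..<N}. fst (u i), \<lambda>i\<in>{..<N}. snd (u i))) \<in> measurable (prodN N \<gamma>) (prodN N \<mu> \<Otimes>\<^sub>M prodN N \<nu>)"
    by (rule measurable_Pair[OF m1 m2])
  show "coupling (prodN N \<mu>) (prodN N \<nu>)
    (distr (prodN N \<gamma>) (prodN N \<mu> \<Otimes>\<^sub>M prodN N \<nu>) (\<lambda>u. (\<lambda>i\<in>{..<N}. fst (u i), \<lambda>i\<in>{..<N}. snd (u i))))"
    unfolding coupling_def
  proof (intro conjI)
    show "prob_space (distr (prodN N \<gamma>) (prodN N \<mu> \<Otimes>\<^sub>M prodN N \<nu>) (\<lambda>u. (\<lambda>i\<in>{..<N}. fst (u i), \<lambda>i\<in>{..<N}. snd (u i))))"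
      by (rule G.prob_space_distr[OF m])
    have "distr (prodN N \<gamma>) (prodN N \<mu>) (\<lambda>u. \<lambda>i\<in>{..<N}. fst (u i)) = prodN N \<mu>"
      unfolding prodN_def by (rule distr_PiM_componentwise) (use g f d1 p in auto)
    then show "distr (distr (prodN N \<gamma>) (prodN N \<mu> \<Otimes>\<^sub>M prodN N \<nu>) (\<lambda>u. (\<lambda>i\<in>{..<N}. fst (u i), \<lambda>i\<in>{..<N}. snd (u i)))) (prodN N \<mu>) fst = prodN N \<mu>"
      by (subst distr_distr[OF measurable_fst m]) (simp add: comp_def)
    have "distr (prodN N \<gamma>) (prodN N \<nu>) (\<lambda>u. \<lambda>i\<in>{..<N}. snd (u i)) = prodN N \<nu>"
      unfolding prodN_def by (rule distr_PiM_componentwise) (use g f d2 p in auto)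
    then show "distr (distr (prodN N \<gamma>) (prodN N \<mu> \<Otimes>\<^sub>M prodN N \<nu>) (\<lambda>u. (\<lambda>i\<in>{..<N}. fst (u i), \<lambda>i\<in>{..<N}. snd (u i)))) (prodN N \<nu>) snd = prodN N \<nu>"
      by (subst distr_distr[OF measurable_snd m]) (simp add: comp_def)
  qed simp
qed

section \<open>Iteration of the coupling and the constants of the statement\<close>

context hmc_setting begin

definition c :: real where "c = (K * T\<^sup>2 / 156) * exp (- 5 * Rtilde L K R / (4 * T))"

lemma c_eq: "c = drift.rate / 156"
  unfolding c_def drift.rate_def unfolding Rt_def by simp

lemma c_bounds: "0 < c" "c \<le> 1"
  using drift.rate_pos drift.rate_le by (auto simp: c_eq)

lemma fdist_eq: "fdist L K R T = drift.cf"
  unfolding fdist_def[abs_def] R1_def drift.cf_def[abs_def] drift.slope_def[abs_def]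
  unfolding drift.cut_def unfolding Rt_def ..

definition A :: real where "A = exp (5 / 4 * (Rtilde L K R / T + 2))"

lemma A_pos: "0 < A" by (simp add: A_def)

text \<open>\<open>A\<close> equals \<open>exp (cut / T)\<close>, the inverse of the smallest slope
  of \<open>cf\<close>.\<close>

lemma le_A_cf: assumes "0 \<le> r" shows "r \<le> A * drift.cf r"
proof -
  have "exp (- drift.cut / T) = 1 / A"
    unfolding A_def inverse_eq_divide[symmetric] exp_minus[symmetric] drift.cut_def
    by (rule arg_cong[where f=exp]) (use T_pos in \<open>simp add: Rt_def field_simps\<close>)
  then have "1 / A * r \<le> drift.cf r" using drift.cf_ge[OF assms] by simp
  then show ?thesis using A_pos by (simp add: field_simps)
qed

lemma rhoN_eq: "rhoN L K R T N x y = (1 / real N) * (\<Sum>i<N. drift.cf (norm (x i - y i)))"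
  by (simp add: rhoN_def fdist_eq)

lemma ell1N_le: "ell1N N x y \<le> A * rhoN L K R T N x y"
proof -
  have "ell1N N x y \<le> (1 / real N) * (\<Sum>i<N. A * drift.cf (norm (x i - y i)))"
    unfolding ell1N_def by (intro mult_left_mono sum_mono le_A_cf) auto
  then show ?thesis by (simp add: rhoN_eq sum_distrib_left mult_ac)
qed

lemma rho_le_euclid: "rho L K R T x y \<le> euclid x y"
  unfolding rho_def euclid_def fdist_eq by (rule drift.cf_le) simp

lemma second_moment_le_B1:
  assumes \<nu>: "fin_second_moment \<nu>" and fin: "B1 V W \<epsilon> T \<nu> \<noteq> \<top>" and s: "s \<in> {0..T}"
  shows "(\<integral>x. (norm x)\<^sup>2 \<partial>(nlaw ((nl_step V W \<epsilon> T ^^ k) \<nu>) s)) \<le> enn2real (B1 V W \<epsilon> T \<nu>)"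
proof -
  let ?\<nu> = "(nl_step V W \<epsilon> T ^^ k) \<nu>"
  have f: "fin_second_moment ?\<nu>" by (rule nl_step_iter_second_moment[OF \<nu>])
  have i: "integrable (nlaw ?\<nu> s) (\<lambda>x. (norm x)\<^sup>2)"
    using nlaw_second_moment[OF f s] by (simp add: fin_second_moment_def)
  have "ennreal (\<integral>x. (norm x)\<^sup>2 \<partial>(nlaw ?\<nu> s)) = (\<integral>\<^sup>+y. ennreal ((norm y)\<^sup>2) \<partial>(nl_law V W \<epsilon> T ?\<nu> s))"
    unfolding nl_law_eq[OF f s] by (rule nn_integral_eq_integral[OF i, symmetric]) simp
  also have "\<dots> \<le> B1 V W \<epsilon> T \<nu>"
    unfolding B1_def by (rule SUP_upper2[where i=k], simp, rule SUP_upper) (rule s)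
  finally have "ennreal (\<integral>x. (norm x)\<^sup>2 \<partial>(nlaw ?\<nu> s)) \<le> ennreal (enn2real (B1 V W \<epsilon> T \<nu>))"
    using fin by (simp add: less_top)
  then show ?thesis by (subst (asm) ennreal_le_iff) auto
qed

text \<open>The estimate is kept for a coupling \<open>\<gamma>\<close> of the one-particle laws and
  a coupling \<open>\<Gamma>\<close> at each step; infima are taken only at the end. The finite
  \<open>B1\<close> bounds the second moments of all iterates at once, so the step error does not
  depend on \<open>m\<close>.\<close>

lemma chain_coupling:
  assumes \<mu>: "fin_second_moment \<mu>" and \<nu>: "fin_second_moment \<nu>" and fin: "B1 V W \<epsilon> T \<nu> \<noteq> \<top>"
    and g: "coupling \<mu> \<nu> \<gamma>"
  shows "\<exists>\<Gamma>. coupling ((part_step V W \<epsilon> T N ^^ m) (prodN N \<mu>)) (prodN N ((nl_step V W \<epsilon> T ^^ m) \<nu>)) \<Gamma> \<and>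
    (\<integral>\<^sup>+z. ennreal (rhoN L K R T N (fst z) (snd z)) \<partial>\<Gamma>)
      \<le> ennreal ((1 - c) ^ m) * (\<integral>\<^sup>+z. ennreal (rho L K R T (fst z) (snd z)) \<partial>\<gamma>)
        + ennreal (1 / c * (4 * T\<^sup>2 * \<epsilon> * Lt * sqrt (enn2real (B1 V W \<epsilon> T \<nu>))) * (1 / sqrt (real N)))"
proof (induction m)
  case 0
  have sg: "sets \<gamma> = sets (\<mu> \<Otimes>\<^sub>M \<nu>)" and pg: "prob_space \<gamma>" using g by (auto simp: coupling_def)
  have s: "sets \<mu> = sets borel" "sets \<nu> = sets borel" using \<mu> \<nu> by (auto simp: fin_second_moment_def)
  have sgb: "sets \<gamma> = sets (borel \<Otimes>\<^sub>M borel)" unfolding sg by (rule sets_pair_measure_cong[OF s])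
  let ?f = "\<lambda>u. (\<lambda>i\<in>{..<N}. fst (u i), \<lambda>i\<in>{..<N}. snd (u i)) :: (nat \<Rightarrow> 'a) \<times> (nat \<Rightarrow> 'a)"
  let ?\<Gamma> = "distr (prodN N \<gamma>) (prodN N \<mu> \<Otimes>\<^sub>M prodN N \<nu>) ?f"
  note cp = coupling_prodN[OF g, of N]
  have rm: "(\<lambda>z. ennreal (rho L K R T (fst z) (snd z))) \<in> borel_measurable \<gamma>"
    unfolding rho_def fdist_eq measurable_cong_sets[OF sgb refl] by measurable
  have rNm: "(\<lambda>z. ennreal (rhoN L K R T N (fst z) (snd z))) \<in> borel_measurable (prodN N \<mu> \<Otimes>\<^sub>M prodN N \<nu>)"
  proof -
    have "(\<lambda>z. fst z i) \<in> borel_measurable (prodN N \<mu> \<Otimes>\<^sub>M prodN N \<nu>)" "(\<lambda>z. snd z i) \<in> borel_measurable (prodN N \<mu> \<Otimes>\<^sub>M prodN N \<nu>)"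
      if "i < N" for i
      using measurable_compose[OF measurable_fst coord_measurable[OF sets_prodN[OF s(1)] that]]
        measurable_compose[OF measurable_snd coord_measurable[OF sets_prodN[OF s(2)] that]] by auto
    then show ?thesis unfolding rhoN_eq by measurable
  qed
  have comp: "distr (prodN N \<gamma>) \<gamma> (\<lambda>u. u i) = \<gamma>" and cm: "(\<lambda>u. u i) \<in> measurable (prodN N \<gamma>) \<gamma>" if "i < N" for i
    unfolding prodN_def using that pg by (auto intro!: distr_PiM_component measurable_component_singleton)
  have ci: "(\<integral>\<^sup>+u. ennreal (drift.cf (norm (fst (u i) - snd (u i)))) \<partial>prodN N \<gamma>) = (\<integral>\<^sup>+z. ennreal (rho L K R T (fst z) (snd z)) \<partial>\<gamma>)"
    if i: "i < N" for i
    using nn_integral_distr[OF cm[OF i], of "\<lambda>z. ennreal (rho L K R T (fst z) (snd z))"] rm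
    by (simp add: comp[OF i] rho_def fdist_eq)
  have "(\<integral>\<^sup>+z. ennreal (rhoN L K R T N (fst z) (snd z)) \<partial>?\<Gamma>)
    = (\<integral>\<^sup>+u. ennreal (rhoN L K R T N (fst (?f u)) (snd (?f u))) \<partial>prodN N \<gamma>)"
    using rNm by (subst nn_integral_distr[OF cp(2)]) auto
  also have "\<dots> = (\<integral>\<^sup>+u. ennreal (1 / real N) * (\<Sum>i<N. ennreal (drift.cf (norm (fst (u i) - snd (u i))))) \<partial>prodN N \<gamma>)"
  proof (rule nn_integral_cong)
    fix u :: "nat \<Rightarrow> 'a \<times> 'a"
    have h: "(\<Sum>i<N. ennreal (drift.cf (norm (fst (u i) - snd (u i))))) = ennreal (\<Sum>i<N. drift.cf (norm (fst (u i) - snd (u i))))"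
      by (rule sum_ennreal) (simp add: drift.cf_nonneg)
    show "ennreal (rhoN L K R T N (fst (?f u)) (snd (?f u))) = ennreal (1 / real N) * (\<Sum>i<N. ennreal (drift.cf (norm (fst (u i) - snd (u i)))))"
      unfolding h by (subst ennreal_mult[symmetric]) (auto intro!: sum_nonneg drift.cf_nonneg simp: rhoN_eq)
  qed
  also have "\<dots> = ennreal (1 / real N) * (\<Sum>i<N. \<integral>\<^sup>+u. ennreal (drift.cf (norm (fst (u i) - snd (u i)))) \<partial>prodN N \<gamma>)"
  proof (rule nn_integral_cmult_sum)
    fix i assume i: "i < N"
    show "(\<lambda>u. ennreal (drift.cf (norm (fst (u i) - snd (u i))))) \<in> borel_measurable (prodN N \<gamma>)"
      using measurable_compose[OF cm[OF i] rm] by (simp add: rho_def fdist_eq)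
  qed
  also have "\<dots> = (\<integral>\<^sup>+z. ennreal (rho L K R T (fst z) (snd z)) \<partial>\<gamma>)"
  proof -
    have "ennreal (1 / real N) * (of_nat N * a) = a" for a :: ennreal
    proof -
      have "ennreal (1 / real N) * of_nat N = ennreal (1 / real N * real N)"
        by (subst ennreal_mult) (auto simp: ennreal_of_nat_eq_real_of_nat)
      also have "\<dots> = 1" using N_pos by simp
      finally show ?thesis by (simp add: mult.assoc[symmetric])
    qed
    then show ?thesis by (simp add: ci)
  qed
  finally show ?case using cp(1) by (intro exI[of _ ?\<Gamma>]) simp
next
  case (Suc m)
  let ?M = "(part_step V W \<epsilon> T N ^^ m) (prodN N \<mu>)" and ?\<nu> = "(nl_step V W \<epsilon> T ^^ m) \<nu>"
  let ?B = "enn2real (B1 V W \<epsilon> T \<nu>)"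
  let ?I = "\<integral>\<^sup>+z. ennreal (rho L K R T (fst z) (snd z)) \<partial>\<gamma>"
  define e where "e = 4 * T\<^sup>2 * \<epsilon> * Lt * sqrt ?B * (1 / sqrt (real N))"
  have e0: "0 \<le> e" using eps_nn Lt_nn by (simp add: e_def)
  have ee: "1 / c * (4 * T\<^sup>2 * \<epsilon> * Lt * sqrt ?B) * (1 / sqrt (real N)) = e / c" by (simp add: e_def)
  obtain \<Gamma> where G: "coupling ?M (prodN N ?\<nu>) \<Gamma>"
    and GI: "(\<integral>\<^sup>+z. ennreal (rhoN L K R T N (fst z) (snd z)) \<partial>\<Gamma>) \<le> ennreal ((1 - c) ^ m) * ?I + ennreal (e / c)"
    using Suc unfolding ee by blast
  have pm: "prob_space (prodN N \<mu>)" "sets (prodN N \<mu>) = sets (prodN N borel)"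
  proof -
    have *: "prob_space \<mu>" "sets \<mu> = sets borel" using \<mu> by (auto simp: fin_second_moment_def)
    show "prob_space (prodN N \<mu>)" "sets (prodN N \<mu>) = sets (prodN N borel)"
      by (rule prob_space_prodN[OF *(1)], rule sets_prodN[OF *(2)])
  qed
  obtain \<Gamma>' where G': "coupling (part_step V W \<epsilon> T N ?M) (prodN N (nl_step V W \<epsilon> T ?\<nu>)) \<Gamma>'"
    and GI': "(\<integral>\<^sup>+z. ennreal (rhoN L K R T N (fst z) (snd z)) \<partial>\<Gamma>')
      \<le> ennreal (1 - c) * (\<integral>\<^sup>+z. ennreal (rhoN L K R T N (fst z) (snd z)) \<partial>\<Gamma>)
        + ennreal (13/5 * (T\<^sup>2 * l * sqrt ?B / sqrt (real N)))"
    using one_step_coupling[OF part_step_iter[OF pm] nl_step_iter_second_moment[OF \<nu>] G second_moment_le_B1[OF \<nu> fin]]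
    unfolding rhoN_eq c_eq by blast
  \<comment> \<open>The 13/5 from the comparison of the systems fits below the 4 in
    \<open>Bconst\<close>.\<close>
  have "ennreal (13/5 * (T\<^sup>2 * l * sqrt ?B / sqrt (real N))) \<le> ennreal e"
  proof (intro ennreal_leI)
    define d where "d = T\<^sup>2 * \<epsilon> * Lt * sqrt ?B / sqrt (real N)"
    have "0 \<le> d" using eps_nn Lt_nn by (simp add: d_def)
    moreover have "13/5 * (T\<^sup>2 * l * sqrt ?B / sqrt (real N)) = 13/5 * d" "e = 4 * d"
      by (simp_all add: d_def e_def l_def mult.assoc)
    ultimately show "13/5 * (T\<^sup>2 * l * sqrt ?B / sqrt (real N)) \<le> e" by linarith
  qed
  then have "(\<integral>\<^sup>+z. ennreal (rhoN L K R T N (fst z) (snd z)) \<partial>\<Gamma>')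
      \<le> ennreal (1 - c) * (ennreal ((1 - c) ^ m) * ?I + ennreal (e / c)) + ennreal e"
    by (intro order_trans[OF GI'] add_mono mult_left_mono GI) auto
  also have "\<dots> = ennreal ((1 - c) ^ Suc m) * ?I + (ennreal (1 - c) * ennreal (e / c) + ennreal e)"
    using c_bounds by (simp add: distrib_left ennreal_mult mult.assoc add.assoc)
  \<comment> \<open>The sum of the geometric series is the fixed point of the recursion, so it is
    already a bound at step 0 and reproduces itself.\<close>
  also have "ennreal (1 - c) * ennreal (e / c) + ennreal e = ennreal (e / c)"
  proof -
    have "ennreal (1 - c) * ennreal (e / c) + ennreal e = ennreal ((1 - c) * (e / c) + e)"
    proof -
      have n: "0 \<le> 1 - c" "0 \<le> e / c" using c_bounds e0 by auto
      then show ?thesis using e0 by (simp only: ennreal_mult[OF n] ennreal_plus[OF mult_nonneg_nonneg[OF n] e0])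
    qed
    also have "(1 - c) * (e / c) + e = e / c" using c_bounds by (simp add: field_simps)
    finally show ?thesis .
  qed
  finally show ?case unfolding ee using G' by (intro exI[of _ \<Gamma>']) simp
qed

lemma chain_bound_rho:
  assumes \<mu>: "fin_second_moment \<mu>" and \<nu>: "fin_second_moment \<nu>"
  shows "W1 (rhoN L K R T N) ((part_step V W \<epsilon> T N ^^ m) (prodN N \<mu>)) (prodN N ((nl_step V W \<epsilon> T ^^ m) \<nu>))
    \<le> ennreal (exp (- c * real m)) * W1 (rho L K R T) \<mu> \<nu> + ennreal (1 / c) * Bconst V W \<epsilon> T Lt \<nu> * ennreal (1 / sqrt (real N))"
proof (cases "B1 V W \<epsilon> T \<nu> = \<top>")
  case True
  \<comment> \<open>With infinite moments \<open>Bconst\<close> is \<open>\<top>\<close> by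
    definition, also for \<open>\<epsilon> = 0\<close>, and positive factors keep the right-hand
    side infinite.\<close>
  have "0 < 1 / c" "0 < 1 / sqrt (real N)" using c_bounds N_pos by auto
  then show ?thesis using True by (simp add: Bconst_def ennreal_mult_top ennreal_top_mult)
next
  case False
  have p: "prob_space \<mu>" "prob_space \<nu>" using \<mu> \<nu> by (auto simp: fin_second_moment_def)
  let ?e = "4 * T\<^sup>2 * \<epsilon> * Lt * sqrt (enn2real (B1 V W \<epsilon> T \<nu>))"
  have e0: "0 \<le> ?e" using eps_nn Lt_nn by simp
  have k: "ennreal (1 / c) * Bconst V W \<epsilon> T Lt \<nu> * ennreal (1 / sqrt (real N)) = ennreal (1 / c * ?e * (1 / sqrt (real N)))"
    using False c_bounds e0 by (simp add: Bconst_def ennreal_mult del: times_divide_eq_left times_divide_eq_right)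
  have pw: "(1 - c) ^ m \<le> exp (- c * real m)"
  proof -
    have "(1 - c) ^ m \<le> exp (- c) ^ m"
      using c_bounds exp_ge_add_one_self[of "- c"] by (intro power_mono) auto
    then show ?thesis by (simp add: exp_of_nat_mult[symmetric] mult.commute)
  qed
  show ?thesis unfolding k W1_def[of "rho L K R T"]
  proof (rule INF_affine_ennreal)
    show "{\<gamma>. coupling \<mu> \<nu> \<gamma>} \<noteq> {}" using coupling_product[OF p] by blast
    fix \<gamma> assume "\<gamma> \<in> {\<gamma>. coupling \<mu> \<nu> \<gamma>}"
    then have "coupling \<mu> \<nu> \<gamma>" by simp
    from chain_coupling[OF \<mu> \<nu> False this, of m] obtain \<Gamma>
      where G: "coupling ((part_step V W \<epsilon> T N ^^ m) (prodN N \<mu>)) (prodN N ((nl_step V W \<epsilon> T ^^ m) \<nu>)) \<Gamma>"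
      and GI: "(\<integral>\<^sup>+z. ennreal (rhoN L K R T N (fst z) (snd z)) \<partial>\<Gamma>)
      \<le> ennreal ((1 - c) ^ m) * (\<integral>\<^sup>+z. ennreal (rho L K R T (fst z) (snd z)) \<partial>\<gamma>) + ennreal (1 / c * ?e * (1 / sqrt (real N)))"
      by blast
    have "W1 (rhoN L K R T N) ((part_step V W \<epsilon> T N ^^ m) (prodN N \<mu>)) (prodN N ((nl_step V W \<epsilon> T ^^ m) \<nu>))
      \<le> (\<integral>\<^sup>+z. ennreal (rhoN L K R T N (fst z) (snd z)) \<partial>\<Gamma>)"
      unfolding W1_def by (rule INF_lower) (use G in simp)
    also note GI
    also have "ennreal ((1 - c) ^ m) * (\<integral>\<^sup>+z. ennreal (rho L K R T (fst z) (snd z)) \<partial>\<gamma>) + ennreal (1 / c * ?e * (1 / sqrt (real N)))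
      \<le> ennreal (exp (- c * real m)) * (\<integral>\<^sup>+z. ennreal (rho L K R T (fst z) (snd z)) \<partial>\<gamma>) + ennreal (1 / c * ?e * (1 / sqrt (real N)))"
      by (intro add_right_mono mult_right_mono ennreal_leI pw) auto
    finally show "W1 (rhoN L K R T N) ((part_step V W \<epsilon> T N ^^ m) (prodN N \<mu>)) (prodN N ((nl_step V W \<epsilon> T ^^ m) \<nu>))
      \<le> ennreal (exp (- c * real m)) * (\<integral>\<^sup>+z. ennreal (rho L K R T (fst z) (snd z)) \<partial>\<gamma>) + ennreal (1 / c * ?e * (1 / sqrt (real N)))" .
  qed simp
qed

lemma W1_mono:
  assumes "\<And>x y. d x y \<le> d' x y" shows "W1 d M M' \<le> W1 d' M M'"
  unfolding W1_def using assms by (intro INF_mono'[OF nn_integral_mono] ennreal_leI)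

lemma W1_cmult:
  assumes k: "0 \<le> k" and dd: "\<And>x y. d x y \<le> k * d' x y" and d0: "\<And>x y. 0 \<le> d' x y"
    and m: "(\<lambda>z. ennreal (d' (fst z) (snd z))) \<in> borel_measurable (M \<Otimes>\<^sub>M M')"
    and p: "prob_space M" "prob_space M'"
  shows "W1 d M M' \<le> ennreal k * W1 d' M M'"
proof -
  have "W1 d M M' \<le> ennreal k * W1 d' M M' + 0"
    unfolding W1_def[of d']
  proof (rule INF_affine_ennreal)
    show "{\<gamma>. coupling M M' \<gamma>} \<noteq> {}" using coupling_product[OF p] by blast
    fix \<gamma> assume "\<gamma> \<in> {\<gamma>. coupling M M' \<gamma>}"
    then have g: "coupling M M' \<gamma>" by simp
    have s: "sets \<gamma> = sets (M \<Otimes>\<^sub>M M')" using g by (simp add: coupling_def)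
    have "W1 d M M' \<le> (\<integral>\<^sup>+z. ennreal (d (fst z) (snd z)) \<partial>\<gamma>)"
      unfolding W1_def by (rule INF_lower) (use g in simp)
    also have "\<dots> \<le> (\<integral>\<^sup>+z. ennreal k * ennreal (d' (fst z) (snd z)) \<partial>\<gamma>)"
      by (intro nn_integral_mono) (simp add: ennreal_mult[symmetric] k d0 ennreal_leI dd)
    also have "\<dots> = ennreal k * (\<integral>\<^sup>+z. ennreal (d' (fst z) (snd z)) \<partial>\<gamma>)"
      by (rule nn_integral_cmult) (use m in \<open>simp add: measurable_cong_sets[OF s refl]\<close>)
    finally show "W1 d M M' \<le> ennreal k * (\<integral>\<^sup>+z. ennreal (d' (fst z) (snd z)) \<partial>\<gamma>) + 0" by simp
  qed simp
  then show ?thesis by simp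
qed

lemma rhoN_measurable:
  assumes s: "sets M = sets (prodN N (borel :: 'a measure))" "sets M' = sets (prodN N (borel :: 'a measure))"
  shows "(\<lambda>z. ennreal (rhoN L K R T N (fst z) (snd z))) \<in> borel_measurable (M \<Otimes>\<^sub>M M')"
    "(\<lambda>z. ennreal (ell1N N (fst z) (snd z))) \<in> borel_measurable (M \<Otimes>\<^sub>M M')"
proof -
  have "(\<lambda>z. fst z i) \<in> borel_measurable (M \<Otimes>\<^sub>M M')" "(\<lambda>z. snd z i) \<in> borel_measurable (M \<Otimes>\<^sub>M M')" if "i < N" for i
    using measurable_compose[OF measurable_fst coord_measurable[OF s(1) that]]
      measurable_compose[OF measurable_snd coord_measurable[OF s(2) that]] by auto
  note [measurable] = this
  show "(\<lambda>z. ennreal (rhoN L K R T N (fst z) (snd z))) \<in> borel_measurable (M \<Otimes>\<^sub>M M')"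
    unfolding rhoN_eq by measurable
  show "(\<lambda>z. ennreal (ell1N N (fst z) (snd z))) \<in> borel_measurable (M \<Otimes>\<^sub>M M')"
    unfolding ell1N_def by measurable
qed

lemma iter_facts:
  assumes \<mu>: "fin_second_moment \<mu>" and \<nu>: "fin_second_moment \<nu>"
  shows "prob_space ((part_step V W \<epsilon> T N ^^ m) (prodN N \<mu>))" "sets ((part_step V W \<epsilon> T N ^^ m) (prodN N \<mu>)) = sets (prodN N borel)"
    "prob_space (prodN N ((nl_step V W \<epsilon> T ^^ m) \<nu>))" "sets (prodN N ((nl_step V W \<epsilon> T ^^ m) \<nu>)) = sets (prodN N borel)"
proof -
  have pm: "prob_space (prodN N \<mu>)" "sets (prodN N \<mu>) = sets (prodN N borel)"
  proof -
    have *: "prob_space \<mu>" "sets \<mu> = sets borel" using \<mu> by (auto simp: fin_second_moment_def)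
    show "prob_space (prodN N \<mu>)" "sets (prodN N \<mu>) = sets (prodN N borel)"
      by (rule prob_space_prodN[OF *(1)], rule sets_prodN[OF *(2)])
  qed
  show "prob_space ((part_step V W \<epsilon> T N ^^ m) (prodN N \<mu>))" "sets ((part_step V W \<epsilon> T N ^^ m) (prodN N \<mu>)) = sets (prodN N borel)"
    by (rule part_step_iter[OF pm])+
  show "prob_space (prodN N ((nl_step V W \<epsilon> T ^^ m) \<nu>))" "sets (prodN N ((nl_step V W \<epsilon> T ^^ m) \<nu>)) = sets (prodN N borel)"
  proof -
    have *: "prob_space ((nl_step V W \<epsilon> T ^^ m) \<nu>)" "sets ((nl_step V W \<epsilon> T ^^ m) \<nu>) = sets borel"
      using nl_step_iter_second_moment[OF \<nu>, of m] by (auto simp: fin_second_moment_def)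
    show "prob_space (prodN N ((nl_step V W \<epsilon> T ^^ m) \<nu>))"
      "sets (prodN N ((nl_step V W \<epsilon> T ^^ m) \<nu>)) = sets (prodN N borel)"
      by (rule prob_space_prodN[OF *(1)], rule sets_prodN[OF *(2)])
  qed
qed

lemma chain_bound_ell1:
  assumes \<mu>: "fin_second_moment \<mu>" and \<nu>: "fin_second_moment \<nu>"
  shows "W1 (ell1N N) ((part_step V W \<epsilon> T N ^^ m) (prodN N \<mu>)) (prodN N ((nl_step V W \<epsilon> T ^^ m) \<nu>))
    \<le> ennreal A * ennreal (exp (- c * real m)) * W1 euclid \<mu> \<nu>
      + ennreal A * ennreal (1 / c) * Bconst V W \<epsilon> T Lt \<nu> * ennreal (1 / sqrt (real N))"
proof -
  note f = iter_facts[OF \<mu> \<nu>, of m]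
  have "W1 (ell1N N) ((part_step V W \<epsilon> T N ^^ m) (prodN N \<mu>)) (prodN N ((nl_step V W \<epsilon> T ^^ m) \<nu>))
    \<le> ennreal A * W1 (rhoN L K R T N) ((part_step V W \<epsilon> T N ^^ m) (prodN N \<mu>)) (prodN N ((nl_step V W \<epsilon> T ^^ m) \<nu>))"
    by (rule W1_cmult[OF less_imp_le[OF A_pos] ell1N_le _ rhoN_measurable(1)[OF f(2,4)] f(1,3)])
      (simp add: rhoN_eq sum_nonneg drift.cf_nonneg)
  also have "\<dots> \<le> ennreal A * (ennreal (exp (- c * real m)) * W1 euclid \<mu> \<nu>
      + ennreal (1 / c) * Bconst V W \<epsilon> T Lt \<nu> * ennreal (1 / sqrt (real N)))"
    by (intro mult_left_mono order_trans[OF chain_bound_rho[OF \<mu> \<nu>]] add_right_mono W1_mono rho_le_euclid) auto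
  finally show ?thesis by (simp add: distrib_left mult.assoc)
qed

lemma rhoN_sym: "rhoN L K R T N x y = rhoN L K R T N y x" and ell1N_sym: "ell1N N x y = ell1N N y x"
  and rho_sym: "rho L K R T u v = rho L K R T v u" and euclid_sym: "euclid u v = euclid v u"
  by (simp_all add: rhoN_def ell1N_def rho_def euclid_def norm_minus_commute)

end

theorem mainTheorem6:
  fixes V :: "'a::euclidean_space \<Rightarrow> real" and W :: "'a \<Rightarrow> 'a \<Rightarrow> real"
    and L K R Lt T \<epsilon> :: real and N :: nat and \<mu> \<mu>b :: "'a measure"
  assumes V_diff: "\<forall>x. V differentiable (at x)"
    and V_C1: "continuous_on UNIV (grad V)"
    and W_diff: "\<forall>z. (\<lambda>z. W (fst z) (snd z)) differentiable (at z)"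
    and W_C1: "continuous_on UNIV (grad (\<lambda>z. W (fst z) (snd z)))"
    and L_pos: "L > 0" and K_pos: "K > 0" and R_nn: "R \<ge> 0" and Lt_nn: "Lt \<ge> 0"
    and V0: "V 0 = 0" and V_nn: "\<forall>x. V x \<ge> 0"
    and V_Lip: "\<forall>x y. norm (grad V x - grad V y) \<le> L * norm (x - y)"
    and V_conv: "\<forall>x y. norm (x - y) \<ge> R \<longrightarrow>
        (x - y) \<bullet> (grad V x - grad V y) \<ge> K * (norm (x - y))\<^sup>2 + (1 / L) * (norm (grad V x - grad V y))\<^sup>2"
    and W_sym: "\<forall>x y. W x y = W y x"
    and W_Lip: "\<forall>x y x' y'. norm (grad1 W x y - grad1 W x' y') \<le> Lt * (norm (x - x') + norm (y - y'))"
    and T_pos: "T > 0" and eps_nn: "\<epsilon> \<ge> 0"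
    and N_pos: "N \<ge> 1"
    and mu: "fin_second_moment \<mu>" and mub: "fin_second_moment \<mu>b"
    and LT1: "L * T\<^sup>2 \<le> 3 / 5 * (1 / 4)"
    and LT2: "Rtilde L K R > 0 \<longrightarrow> L * T\<^sup>2 \<le> 3 / 5 * (3 / (1280 * L * (Rtilde L K R)\<^sup>2))"
    and eps_small: "\<epsilon> * Lt \<le> 5 / 64 * (K / sqrt (7 / 6 + 3 / (2 * K * T\<^sup>2)))
                                  * exp (- 5 * Rtilde L K R / (2 * T) - 5)"
  shows "(\<forall>m::nat.
      W1 (rhoN L K R T N) ((part_step V W \<epsilon> T N ^^ m) (prodN N \<mu>))
                          (prodN N ((nl_step V W \<epsilon> T ^^ m) \<mu>b))
        \<le> ennreal (exp (- ((K * T\<^sup>2 / 156) * exp (- 5 * Rtilde L K R / (4 * T))) * real m))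
             * W1 (rho L K R T) \<mu> \<mu>b
          + ennreal (1 / ((K * T\<^sup>2 / 156) * exp (- 5 * Rtilde L K R / (4 * T))))
             * Bconst V W \<epsilon> T Lt \<mu>b * ennreal (1 / sqrt (real N))
      \<and>
      W1 (ell1N N) ((part_step V W \<epsilon> T N ^^ m) (prodN N \<mu>))
                   (prodN N ((nl_step V W \<epsilon> T ^^ m) \<mu>b))
        \<le> ennreal (exp (5 / 4 * (Rtilde L K R / T + 2)))
             * ennreal (exp (- ((K * T\<^sup>2 / 156) * exp (- 5 * Rtilde L K R / (4 * T))) * real m))
             * W1 euclid \<mu> \<mu>b
          + ennreal (exp (5 / 4 * (Rtilde L K R / T + 2)))
             * ennreal (1 / ((K * T\<^sup>2 / 156) * exp (- 5 * Rtilde L K R / (4 * T))))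
             * Bconst V W \<epsilon> T Lt \<mu>b * ennreal (1 / sqrt (real N)))
    \<and>
    (\<forall>\<mu>s. fin_second_moment \<mu>s \<and>
       (\<exists>Z::real. 0 < Z \<and> \<mu>s = density lborel (\<lambda>x. ennreal (exp (- U_nu V W \<epsilon> \<mu>s x) / Z)))
     \<longrightarrow> (\<forall>m::nat.
      W1 (rhoN L K R T N) (prodN N \<mu>s) ((part_step V W \<epsilon> T N ^^ m) (prodN N \<mu>))
        \<le> ennreal (exp (- ((K * T\<^sup>2 / 156) * exp (- 5 * Rtilde L K R / (4 * T))) * real m))
             * W1 (rho L K R T) \<mu>s \<mu>
          + ennreal (1 / ((K * T\<^sup>2 / 156) * exp (- 5 * Rtilde L K R / (4 * T))))
             * Bconst V W \<epsilon> T Lt \<mu>s * ennreal (1 / sqrt (real N))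
      \<and>
      W1 (ell1N N) (prodN N \<mu>s) ((part_step V W \<epsilon> T N ^^ m) (prodN N \<mu>))
        \<le> ennreal (exp (5 / 4 * (Rtilde L K R / T + 2)))
             * ennreal (exp (- ((K * T\<^sup>2 / 156) * exp (- 5 * Rtilde L K R / (4 * T))) * real m))
             * W1 euclid \<mu>s \<mu>
          + ennreal (exp (5 / 4 * (Rtilde L K R / T + 2)))
             * ennreal (1 / ((K * T\<^sup>2 / 156) * exp (- 5 * Rtilde L K R / (4 * T))))
             * Bconst V W \<epsilon> T Lt \<mu>s * ennreal (1 / sqrt (real N))))"
proof -
  interpret hmc_setting V W L K R Lt T \<epsilon> N
    by (unfold_locales; (insert assms, blast))
  have ce: "K * T\<^sup>2 / 156 * exp (- 5 * Rtilde L K R / (4 * T)) = c" by (simp add: c_def)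
  have inv: "(nl_step V W \<epsilon> T ^^ m) \<mu>s = \<mu>s"
    if "fin_second_moment \<mu>s" "0 < Z" "\<mu>s = density lborel (\<lambda>x. ennreal (exp (- U_nu V W \<epsilon> \<mu>s x) / Z))" for \<mu>s Z m
    using nl_step_invariant[OF that] by (induction m) auto
  \<comment> \<open>The Wasserstein distance on the left is exchanged in one direction and the
    initial distance on the right in the other, so an inequality suffices for each.\<close>
  have swap: "W1 (rhoN L K R T N) (prodN N \<mu>s) ((part_step V W \<epsilon> T N ^^ m) (prodN N \<mu>))
        \<le> W1 (rhoN L K R T N) ((part_step V W \<epsilon> T N ^^ m) (prodN N \<mu>)) (prodN N \<mu>s)"
      "W1 (ell1N N) (prodN N \<mu>s) ((part_step V W \<epsilon> T N ^^ m) (prodN N \<mu>))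
        \<le> W1 (ell1N N) ((part_step V W \<epsilon> T N ^^ m) (prodN N \<mu>)) (prodN N \<mu>s)"
      "W1 (rho L K R T) \<mu> \<mu>s \<le> W1 (rho L K R T) \<mu>s \<mu>" "W1 euclid \<mu> \<mu>s \<le> W1 euclid \<mu>s \<mu>"
    if s: "fin_second_moment \<mu>s" for \<mu>s m
  proof -
    note f = iter_facts[OF mu s, of m] and f0 = iter_facts[OF mu s, of 0]
    show "W1 (rhoN L K R T N) (prodN N \<mu>s) ((part_step V W \<epsilon> T N ^^ m) (prodN N \<mu>))
        \<le> W1 (rhoN L K R T N) ((part_step V W \<epsilon> T N ^^ m) (prodN N \<mu>)) (prodN N \<mu>s)"
      by (rule W1_le_swap[OF rhoN_sym rhoN_measurable(1)]) (use f f0 in auto)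
    show "W1 (ell1N N) (prodN N \<mu>s) ((part_step V W \<epsilon> T N ^^ m) (prodN N \<mu>))
        \<le> W1 (ell1N N) ((part_step V W \<epsilon> T N ^^ m) (prodN N \<mu>)) (prodN N \<mu>s)"
      by (rule W1_le_swap[OF ell1N_sym rhoN_measurable(2)]) (use f f0 in auto)
    have [measurable_cong]: "sets \<mu> = sets borel" "sets \<mu>s = sets borel"
      using mu s by (auto simp: fin_second_moment_def)
    show "W1 (rho L K R T) \<mu> \<mu>s \<le> W1 (rho L K R T) \<mu>s \<mu>"
      by (rule W1_le_swap[OF rho_sym]) (unfold rho_def fdist_eq, measurable)
    show "W1 euclid \<mu> \<mu>s \<le> W1 euclid \<mu>s \<mu>"
      by (rule W1_le_swap[OF euclid_sym]) (unfold euclid_def, measurable)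
  qed
  show ?thesis
    unfolding ce
  proof (intro conjI allI impI)
    fix m :: nat
    show "W1 (rhoN L K R T N) ((part_step V W \<epsilon> T N ^^ m) (prodN N \<mu>)) (prodN N ((nl_step V W \<epsilon> T ^^ m) \<mu>b))
      \<le> ennreal (exp (- c * real m)) * W1 (rho L K R T) \<mu> \<mu>b
        + ennreal (1 / c) * Bconst V W \<epsilon> T Lt \<mu>b * ennreal (1 / sqrt (real N))"
      by (rule chain_bound_rho[OF mu mub])
    show "W1 (ell1N N) ((part_step V W \<epsilon> T N ^^ m) (prodN N \<mu>)) (prodN N ((nl_step V W \<epsilon> T ^^ m) \<mu>b))
      \<le> ennreal (exp (5 / 4 * (Rtilde L K R / T + 2))) * ennreal (exp (- c * real m)) * W1 euclid \<mu> \<mu>b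
        + ennreal (exp (5 / 4 * (Rtilde L K R / T + 2))) * ennreal (1 / c) * Bconst V W \<epsilon> T Lt \<mu>b * ennreal (1 / sqrt (real N))"
      using chain_bound_ell1[OF mu mub, of m] by (simp only: A_def)
  next
    fix \<mu>s and m :: nat
    assume "fin_second_moment \<mu>s \<and> (\<exists>Z::real. 0 < Z \<and> \<mu>s = density lborel (\<lambda>x. ennreal (exp (- U_nu V W \<epsilon> \<mu>s x) / Z)))"
    then obtain Z where s: "fin_second_moment \<mu>s" and Z: "0 < Z" "\<mu>s = density lborel (\<lambda>x. ennreal (exp (- U_nu V W \<epsilon> \<mu>s x) / Z))"
      by blast
    note i = inv[OF s Z, of m] and sw = swap(1)[OF s, of m] swap(2)[OF s, of m] swap(3)[OF s] swap(4)[OF s]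
    show "W1 (rhoN L K R T N) (prodN N \<mu>s) ((part_step V W \<epsilon> T N ^^ m) (prodN N \<mu>))
      \<le> ennreal (exp (- c * real m)) * W1 (rho L K R T) \<mu>s \<mu>
        + ennreal (1 / c) * Bconst V W \<epsilon> T Lt \<mu>s * ennreal (1 / sqrt (real N))"
      by (rule order_trans[OF sw(1)], rule order_trans[OF chain_bound_rho[OF mu s, of m, unfolded i]])
        (intro add_right_mono mult_left_mono sw(3), simp)
    show "W1 (ell1N N) (prodN N \<mu>s) ((part_step V W \<epsilon> T N ^^ m) (prodN N \<mu>))
      \<le> ennreal (exp (5 / 4 * (Rtilde L K R / T + 2))) * ennreal (exp (- c * real m)) * W1 euclid \<mu>s \<mu>
        + ennreal (exp (5 / 4 * (Rtilde L K R / T + 2))) * ennreal (1 / c) * Bconst V W \<epsilon> T Lt \<mu>s * ennreal (1 / sqrt (real N))"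
      by (rule order_trans[OF sw(2)], rule order_trans[OF chain_bound_ell1[OF mu s, of m, unfolded i A_def]])
        (intro add_right_mono mult_left_mono sw(4), simp)
  qed
qed

end
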